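(* Let $\mathbf{V}$ be either the category $\mathbf{sSet}$ of simplicial sets or the category $\mathbf{Top}_{\Delta}$ of $\Delta$-generated topological spaces. There exists a 2-monad $S$ on the 2-category $\mathbf{Cat}_{\mathbf{V}}$ such that the $S$-algebras are exactly the symmetric monoidal $\mathbf{V}$-enriched categories (without unit) and the morphisms of $S$-algebras are exactly the strict monoidal $\mathbf{V}$-enriched functors between them.
   Context: $\mathbf{Cat}_{\mathbf{V}}$ is the 2-category of small $\mathbf{V}$-enriched categories, $\mathbf{V}$-functors and $\mathbf{V}$-natural transformations, where $\mathbf{V}$ carries its cartesian product. For a 2-monad $(T,\mu,\eta)$, a $T$-algebra is an object $X$ with a map $h:TX\to X$ satisfying $h\circ Th=h\circ\mu_X$ and $h\circ\eta_X=\mathrm{id}_X$ strictly; a morphism of $T$-algebras from $(X,h)$ to $(Y,g)$ is a map $f:X\to Y$ with $f\circ h=g\circ Tf$. A monoidal $\mathbf{V}$-category without unit is a $\mathbf{V}$-category $\mathcal{C}$ with a $\mathbf{V}$-functor $\otimes:\mathcal{C}\times\mathcal{C}\to\mathcal{C}$ and a $\mathbf{V}$-natural isomorphism $\alpha:(a\otimes b)\otimes c\simeq a\otimes(b\otimes c)$ such that the two isomorphisms $((a\otimes b)\otimes c)\otimes d\simeq a\otimes(b\otimes(c\otimes d))$ built from $\alpha$ coincide (pentagon axiom). It is symmetric if it is equipped with a $\mathbf{V}$-natural isomorphism $\sigma:a\otimes b\to b\otimes a$ with $\sigma^2=\mathrm{id}$ such that the two composites $(a\otimes b)\otimes c\to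 a\otimes(b\otimes c)\to(b\otimes c)\otimes a\to b\otimes(c\otimes a)$ and $(a\otimes b)\otimes c\to(b\otimes a)\otimes c\to b\otimes(a\otimes c)\to b\otimes(c\otimes a)$ built from $\alpha$ and $\sigma$ coincide (hexagon axiom). A strict monoidal enriched functor between symmetric monoidal $\mathbf{V}$-categories means a $\mathbf{V}$-functor that strictly preserves all the structure: $\otimes$, $\alpha$ and $\sigma$. *)

theory Defs
  imports "HOL-Homology.Homology"
begin

section \<open>Small sets\<close>

text \<open>
  A small set is a set of elements of a type \<open>'u\<close> that belongs to the family \<open>Small\<close>.
  The locale asks for the closure properties that are used to build categories and their free
  symmetric monoidal categories. Every infinite type with all its subsets is an instance, and so
  are a Grothendieck universe with an infinite member (\<open>'u\<close> being its elements and \<open>Small\<close> its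
  members) and the sets of cardinality less than a given uncountable regular cardinal.
  \<open>upair\<close> is a coding of ordered pairs; it fixes the chosen binary products.
\<close>

record 'u univ =
  Small :: "'u set set"
  upair :: "'u \<Rightarrow> 'u \<Rightarrow> 'u"

locale universe =
  fixes U :: "'u univ"
  assumes infinite_small: "\<exists>A\<in>Small U. infinite A"
    and subset_small: "\<lbrakk>A \<in> Small U; B \<subseteq> A\<rbrakk> \<Longrightarrow> B \<in> Small U"
    and image_small: "A \<in> Small U \<Longrightarrow> f ` A \<in> Small U"
    and Union_small: "\<lbrakk>A \<in> Small U; \<And>a. a \<in> A \<Longrightarrow> F a \<in> Small U\<rbrakk> \<Longrightarrow> (\<Union>a\<in>A. F a) \<in> Small U"
    and upair_inject: "upair U x y = upair U x' y' \<longleftrightarrow> x = x' \<and> y = y'"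

definition unpair :: "'u univ \<Rightarrow> 'u \<Rightarrow> 'u \<times> 'u" where
  "unpair U z = (THE p. upair U (fst p) (snd p) = z)"

definition uprod :: "'u univ \<Rightarrow> 'u set \<Rightarrow> 'u set \<Rightarrow> 'u set" where
  "uprod U A B = {upair U a b | a b. a \<in> A \<and> b \<in> B}"


lemma ex_universe:
  assumes "infinite (UNIV :: 'u set)"
  shows "\<exists>U :: 'u univ. universe U \<and> Small U = UNIV"
proof -
  obtain f where f: "bij_betw f (UNIV \<times> UNIV :: ('u \<times> 'u) set) (UNIV :: 'u set)"
    using card_of_Times_same_infinite[OF assms] card_of_ordIso by blast
  then have "inj f" by (simp add: bij_betw_def)
  then have "universe \<lparr>Small = (UNIV :: 'u set set), upair = (\<lambda>x y. f (x, y))\<rparr>"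
    by unfold_locales (use assms in \<open>auto simp: inj_eq\<close>)
  then show ?thesis by force
qed

context universe
begin

lemma unpair [simp]: "unpair U (upair U x y) = (x, y)"
  unfolding unpair_def by (rule the_equality) (auto simp: upair_inject)

lemma upair_in_uprod [simp]: "upair U x y \<in> uprod U A B \<longleftrightarrow> x \<in> A \<and> y \<in> B"
  by (auto simp: uprod_def upair_inject)

lemma uprodE:
  assumes "z \<in> uprod U A B"
  obtains a b where "z = upair U a b" "a \<in> A" "b \<in> B"
  using assms by (auto simp: uprod_def)

lemma unpair_in [simp]:
  assumes "z \<in> uprod U A B"
  shows "upair U (fst (unpair U z)) (snd (unpair U z)) = z" "fst (unpair U z) \<in> A" "snd (unpair U z) \<in> B"
  using assms by (auto elim!: uprodE)

lemma uprod_small: "A \<in> Small U \<Longrightarrow> B \<in> Small U \<Longrightarrow> uprod U A B \<in> Small U"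
proof -
  assume "A \<in> Small U" "B \<in> Small U"
  then have "(\<Union>a\<in>A. upair U a ` B) \<in> Small U"
    by (intro Union_small image_small)
  also have "(\<Union>a\<in>A. upair U a ` B) = uprod U A B"
    by (auto simp: uprod_def)
  finally show ?thesis .
qed

lemma sing_small: "{x} \<in> Small U"
proof -
  obtain A where "A \<in> Small U" "infinite A" using infinite_small by blast
  then have "(\<lambda>_. x) ` A \<in> Small U" "A \<noteq> {}" using image_small by auto
  moreover have "(\<lambda>_. x) ` A = {x}" using \<open>A \<noteq> {}\<close> by auto
  ultimately show ?thesis by simp
qed

end


section \<open>Categories with chosen finite products\<close>

record ('v, 'a) cartcat =
  Obj :: "'v set"
  Arr :: "'a set"
  Dom :: "'a \<Rightarrow> 'v"
  Cod :: "'a \<Rightarrow> 'v"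
  Ide :: "'v \<Rightarrow> 'a"
  Comp :: "'a \<Rightarrow> 'a \<Rightarrow> 'a"  (infixr "\<cdot>\<index>" 75)
  Term :: 'v
  Prod :: "'v \<Rightarrow> 'v \<Rightarrow> 'v"
  Pr1 :: "'v \<Rightarrow> 'v \<Rightarrow> 'a"
  Pr2 :: "'v \<Rightarrow> 'v \<Rightarrow> 'a"
  Tuple :: "'a \<Rightarrow> 'a \<Rightarrow> 'a"

definition Hom :: "('v, 'a) cartcat \<Rightarrow> 'v \<Rightarrow> 'v \<Rightarrow> 'a set" where
  "Hom V X Y = {f \<in> Arr V. Dom V f = X \<and> Cod V f = Y}"

locale cartesian_category =
  fixes V :: "('v, 'a) cartcat" (structure)
  assumes Dom_Obj: "f \<in> Arr V \<Longrightarrow> Dom V f \<in> Obj V"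
    and Cod_Obj: "f \<in> Arr V \<Longrightarrow> Cod V f \<in> Obj V"
    and Ide_Hom: "X \<in> Obj V \<Longrightarrow> Ide V X \<in> Hom V X X"
    and Comp_Hom: "\<lbrakk>f \<in> Hom V X Y; g \<in> Hom V Y Z\<rbrakk> \<Longrightarrow> g \<cdot> f \<in> Hom V X Z"
    and Comp_Ide: "f \<in> Hom V X Y \<Longrightarrow> f \<cdot> Ide V X = f"
    and Ide_Comp: "f \<in> Hom V X Y \<Longrightarrow> Ide V Y \<cdot> f = f"
    and Comp_assoc: "\<lbrakk>f \<in> Hom V W X; g \<in> Hom V X Y; h \<in> Hom V Y Z\<rbrakk>
                      \<Longrightarrow> (h \<cdot> g) \<cdot> f = h \<cdot> (g \<cdot> f)"
    and Term_Obj: "Term V \<in> Obj V"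
    and Term_universal: "X \<in> Obj V \<Longrightarrow> \<exists>!f. f \<in> Hom V X (Term V)"
    and Prod_Obj: "\<lbrakk>X \<in> Obj V; Y \<in> Obj V\<rbrakk> \<Longrightarrow> Prod V X Y \<in> Obj V"
    and Pr1_Hom: "\<lbrakk>X \<in> Obj V; Y \<in> Obj V\<rbrakk> \<Longrightarrow> Pr1 V X Y \<in> Hom V (Prod V X Y) X"
    and Pr2_Hom: "\<lbrakk>X \<in> Obj V; Y \<in> Obj V\<rbrakk> \<Longrightarrow> Pr2 V X Y \<in> Hom V (Prod V X Y) Y"
    and Tuple_Hom: "\<lbrakk>f \<in> Hom V Z X; g \<in> Hom V Z Y\<rbrakk> \<Longrightarrow> Tuple V f g \<in> Hom V Z (Prod V X Y)"
    and Pr1_Tuple: "\<lbrakk>f \<in> Hom V Z X; g \<in> Hom V Z Y\<rbrakk> \<Longrightarrow> Pr1 V X Y \<cdot> Tuple V f g = f"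
    and Pr2_Tuple: "\<lbrakk>f \<in> Hom V Z X; g \<in> Hom V Z Y\<rbrakk> \<Longrightarrow> Pr2 V X Y \<cdot> Tuple V f g = g"
    and Tuple_unique: "\<lbrakk>X \<in> Obj V; Y \<in> Obj V; k \<in> Hom V Z (Prod V X Y)\<rbrakk>
                      \<Longrightarrow> Tuple V (Pr1 V X Y \<cdot> k) (Pr2 V X Y \<cdot> k) = k"

definition Bang :: "('v, 'a) cartcat \<Rightarrow> 'v \<Rightarrow> 'a" where
  "Bang V X = (THE f. f \<in> Hom V X (Term V))"

definition Times :: "('v, 'a) cartcat \<Rightarrow> 'a \<Rightarrow> 'a \<Rightarrow> 'a" where
  "Times V f g = Tuple V (f \<cdot>\<^bsub>V\<^esub> Pr1 V (Dom V f) (Dom V g)) (g \<cdot>\<^bsub>V\<^esub> Pr2 V (Dom V f) (Dom V g))"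

definition Assoc :: "('v, 'a) cartcat \<Rightarrow> 'v \<Rightarrow> 'v \<Rightarrow> 'v \<Rightarrow> 'a" where
  "Assoc V X Y Z =
     (let p = Pr1 V (Prod V X Y) Z
      in Tuple V (Pr1 V X Y \<cdot>\<^bsub>V\<^esub> p) (Tuple V (Pr2 V X Y \<cdot>\<^bsub>V\<^esub> p) (Pr2 V (Prod V X Y) Z)))"

definition Swap :: "('v, 'a) cartcat \<Rightarrow> 'v \<Rightarrow> 'v \<Rightarrow> 'a" where
  "Swap V X Y = Tuple V (Pr2 V X Y) (Pr1 V X Y)"


section \<open>Simplicial sets\<close>

definition Delta :: "nat \<Rightarrow> nat \<Rightarrow> (nat \<Rightarrow> nat) set" where
  "Delta m n = {\<theta> \<in> {..m} \<rightarrow>\<^sub>E {..n}. mono_on {..m} \<theta>}"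

text \<open>
  For \<open>\<theta> \<in> Delta m n\<close>, the function \<open>act X m n \<theta>\<close> maps \<open>n\<close>-simplices to \<open>m\<close>-simplices. All function
  fields below are required to take the value \<open>undefined\<close> outside their mathematical domain, so
  that equality of records is equality of the structures they represent.
\<close>

record 'u sset =
  simp :: "nat \<Rightarrow> 'u set"
  act :: "nat \<Rightarrow> nat \<Rightarrow> (nat \<Rightarrow> nat) \<Rightarrow> 'u \<Rightarrow> 'u"

definition simplicial_set :: "'u sset \<Rightarrow> bool" where
  "simplicial_set X \<longleftrightarrow>
     (\<forall>m n. \<forall>\<theta>\<in>Delta m n. act X m n \<theta> \<in> simp X n \<rightarrow>\<^sub>E simp X m) \<and>
     (\<forall>m n \<theta>. \<theta> \<notin> Delta m n \<longrightarrow> act X m n \<theta> = (\<lambda>_. undefined)) \<and>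
     (\<forall>n. \<forall>x\<in>simp X n. act X n n (\<lambda>i\<in>{..n}. i) x = x) \<and>
     (\<forall>m n p. \<forall>\<theta>\<in>Delta m n. \<forall>\<phi>\<in>Delta n p. \<forall>x\<in>simp X p.
        act X m p (compose {..m} \<phi> \<theta>) x = act X m n \<theta> (act X n p \<phi> x))"

record 'u smap =
  sdom :: "'u sset"
  scod :: "'u sset"
  sfun :: "nat \<Rightarrow> 'u \<Rightarrow> 'u"

definition simplicial_map :: "'u smap \<Rightarrow> bool" where
  "simplicial_map f \<longleftrightarrow>
     (\<forall>n. sfun f n \<in> simp (sdom f) n \<rightarrow>\<^sub>E simp (scod f) n) \<and>
     (\<forall>m n. \<forall>\<theta>\<in>Delta m n. \<forall>x\<in>simp (sdom f) n.
        sfun f m (act (sdom f) m n \<theta> x) = act (scod f) m n \<theta> (sfun f n x))"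

definition sset_term :: "'u sset" where
  "sset_term = \<lparr>simp = (\<lambda>_. {undefined}), act = (\<lambda>_ _ _ _. undefined)\<rparr>"

definition sset_prod :: "'u univ \<Rightarrow> 'u sset \<Rightarrow> 'u sset \<Rightarrow> 'u sset" where
  "sset_prod U X Y =
     \<lparr>simp = (\<lambda>n. uprod U (simp X n) (simp Y n)),
      act = (\<lambda>m n \<theta>. if \<theta> \<in> Delta m n
        then (\<lambda>z\<in>uprod U (simp X n) (simp Y n).
          upair U (act X m n \<theta> (fst (unpair U z))) (act Y m n \<theta> (snd (unpair U z))))
        else (\<lambda>_. undefined))\<rparr>"

definition sSet :: "'u univ \<Rightarrow> ('u sset, 'u smap) cartcat" where
  "sSet U =
     (let Ob = {X. simplicial_set X \<and> (\<forall>n. simp X n \<in> Small U)} in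
     \<lparr>Obj = Ob,
      Arr = {f. sdom f \<in> Ob \<and> scod f \<in> Ob \<and> simplicial_map f},
      Dom = sdom,
      Cod = scod,
      Ide = (\<lambda>X. \<lparr>sdom = X, scod = X, sfun = (\<lambda>n. \<lambda>x\<in>simp X n. x)\<rparr>),
      Comp = (\<lambda>g f. \<lparr>sdom = sdom f, scod = scod g,
                     sfun = (\<lambda>n. compose (simp (sdom f) n) (sfun g n) (sfun f n))\<rparr>),
      Term = sset_term,
      Prod = sset_prod U,
      Pr1 = (\<lambda>X Y. \<lparr>sdom = sset_prod U X Y, scod = X,
                    sfun = (\<lambda>n. \<lambda>z\<in>uprod U (simp X n) (simp Y n). fst (unpair U z))\<rparr>),
      Pr2 = (\<lambda>X Y. \<lparr>sdom = sset_prod U X Y, scod = Y,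
                    sfun = (\<lambda>n. \<lambda>z\<in>uprod U (simp X n) (simp Y n). snd (unpair U z))\<rparr>),
      Tuple = (\<lambda>f g. \<lparr>sdom = sdom f, scod = sset_prod U (scod f) (scod g),
                      sfun = (\<lambda>n. \<lambda>x\<in>simp (sdom f) n. upair U (sfun f n x) (sfun g n x))\<rparr>)\<rparr>)"


lemma Delta_comp: "\<theta> \<in> Delta m n \<Longrightarrow> \<phi> \<in> Delta n p \<Longrightarrow> compose {..m} \<phi> \<theta> \<in> Delta m p"
  unfolding Delta_def by (auto simp: compose_def mono_on_def PiE_iff extensional_def)

lemma Delta_id: "(\<lambda>i\<in>{..n}. i) \<in> Delta n n"
  unfolding Delta_def by (auto simp: mono_on_def)

lemma act_in: "\<lbrakk>simplicial_set X; \<theta> \<in> Delta m n; x \<in> simp X n\<rbrakk> \<Longrightarrow> act X m n \<theta> x \<in> simp X m"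
  unfolding simplicial_set_def by blast

lemma simplicial_set_sset_term: "simplicial_set sset_term"
  unfolding simplicial_set_def sset_term_def by (auto simp: PiE_iff extensional_def)

lemma sset_term_simps [simp]: "simp sset_term n = {undefined}" "act sset_term m n \<theta> x = undefined"
  by (auto simp: sset_term_def)

lemma simplicial_map_app: "\<lbrakk>simplicial_map f; x \<in> simp (sdom f) n\<rbrakk> \<Longrightarrow> sfun f n x \<in> simp (scod f) n"
  unfolding simplicial_map_def by blast

lemma simplicial_map_act:
  "\<lbrakk>simplicial_map f; x \<in> simp (sdom f) n; \<theta> \<in> Delta m n\<rbrakk>
    \<Longrightarrow> sfun f m (act (sdom f) m n \<theta> x) = act (scod f) m n \<theta> (sfun f n x)"
  unfolding simplicial_map_def by blast

lemma simplicial_map_restrictI: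
  assumes "\<And>n. sfun f n = restrict (h n) (simp (sdom f) n)" "simplicial_set (sdom f)"
    and "\<And>n x. x \<in> simp (sdom f) n \<Longrightarrow> h n x \<in> simp (scod f) n"
    and "\<And>m n \<theta> x. \<theta> \<in> Delta m n \<Longrightarrow> x \<in> simp (sdom f) n
           \<Longrightarrow> h m (act (sdom f) m n \<theta> x) = act (scod f) m n \<theta> (h n x)"
  shows "simplicial_map f"
  using assms unfolding simplicial_map_def by (auto simp: act_in)

lemma smap_eqI:
  assumes "sdom f = sdom g" "scod f = scod g" "simplicial_map f" "simplicial_map g"
    and "\<And>n x. x \<in> simp (sdom f) n \<Longrightarrow> sfun f n x = sfun g n x"
  shows "f = g"
proof -
  have "sfun f n = sfun g n" for n
    using assms unfolding simplicial_map_def by (metis PiE_ext)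
  then have "sfun f = sfun g" by blast
  with assms show ?thesis by (intro smap.equality) auto
qed

context universe
begin

lemma simplicial_set_sset_prod:
  assumes "simplicial_set X" and "simplicial_set Y"
  shows "simplicial_set (sset_prod U X Y)"
  using assms
  by (auto simp: simplicial_set_def sset_prod_def Delta_comp Delta_id PiE_iff elim!: uprodE)

lemma sset_prod_simps:
  "simp (sset_prod U X Y) n = uprod U (simp X n) (simp Y n)"
  "\<lbrakk>\<theta> \<in> Delta m n; x \<in> simp X n; y \<in> simp Y n\<rbrakk> \<Longrightarrow>
     act (sset_prod U X Y) m n \<theta> (upair U x y) = upair U (act X m n \<theta> x) (act Y m n \<theta> y)"
  by (auto simp: sset_prod_def)

lemma cartesian_category_sSet: "cartesian_category (sSet U)"
proof -
  have Obj: "X \<in> Obj (sSet U) \<longleftrightarrow> simplicial_set X \<and> (\<forall>n. simp X n \<in> Small U)" for X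
    by (simp add: sSet_def)
  have Hom: "f \<in> Hom (sSet U) X Y \<longleftrightarrow>
      sdom f = X \<and> scod f = Y \<and> X \<in> Obj (sSet U) \<and> Y \<in> Obj (sSet U) \<and> simplicial_map f" for f X Y
    by (auto simp: Hom_def sSet_def)
  have Ide: "Ide (sSet U) X = \<lparr>sdom = X, scod = X, sfun = (\<lambda>n. \<lambda>x\<in>simp X n. x)\<rparr>"
    and Comp: "Comp (sSet U) g f = \<lparr>sdom = sdom f, scod = scod g,
                 sfun = (\<lambda>n. \<lambda>x\<in>simp (sdom f) n. sfun g n (sfun f n x))\<rparr>"
    and Trm: "Term (sSet U) = sset_term"
    and Prd: "Prod (sSet U) X Y = sset_prod U X Y"
    and Pr1: "Pr1 (sSet U) X Y = \<lparr>sdom = sset_prod U X Y, scod = X,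
                 sfun = (\<lambda>n. \<lambda>z\<in>uprod U (simp X n) (simp Y n). fst (unpair U z))\<rparr>"
    and Pr2: "Pr2 (sSet U) X Y = \<lparr>sdom = sset_prod U X Y, scod = Y,
                 sfun = (\<lambda>n. \<lambda>z\<in>uprod U (simp X n) (simp Y n). snd (unpair U z))\<rparr>"
    and Tup: "Tuple (sSet U) f g = \<lparr>sdom = sdom f, scod = sset_prod U (scod f) (scod g),
                 sfun = (\<lambda>n. \<lambda>x\<in>simp (sdom f) n. upair U (sfun f n x) (sfun g n x))\<rparr>" for X Y f g
    by (simp_all add: sSet_def Let_def compose_def)
  have ide: "Ide (sSet U) X \<in> Hom (sSet U) X X" if "X \<in> Obj (sSet U)" for X
    unfolding Hom Ide using that
    by (auto simp: Obj intro!: simplicial_map_restrictI[where h = "\<lambda>n x. x"])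
  have comp: "Comp (sSet U) g f \<in> Hom (sSet U) X Z"
    if "f \<in> Hom (sSet U) X Y" "g \<in> Hom (sSet U) Y Z" for f g X Y Z
    unfolding Hom Comp using that simplicial_map_app[of f] simplicial_map_app[of g]
      simplicial_map_act[of f] simplicial_map_act[of g]
    by (auto simp: Obj Hom intro!: simplicial_map_restrictI[where h = "\<lambda>n x. sfun g n (sfun f n x)"])
  have prd: "Prod (sSet U) X Y \<in> Obj (sSet U)" if "X \<in> Obj (sSet U)" "Y \<in> Obj (sSet U)" for X Y
    using that simplicial_set_sset_prod uprod_small by (auto simp: Obj Prd sset_prod_simps)
  have pr1: "Pr1 (sSet U) X Y \<in> Hom (sSet U) (Prod (sSet U) X Y) X"
    if "X \<in> Obj (sSet U)" "Y \<in> Obj (sSet U)" for X Y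
    using that prd[OF that] unfolding Hom Pr1
    by (auto simp: Obj Prd sset_prod_simps act_in
        intro!: simplicial_map_restrictI[where h = "\<lambda>n z. fst (unpair U z)"] elim!: uprodE)
  have pr2: "Pr2 (sSet U) X Y \<in> Hom (sSet U) (Prod (sSet U) X Y) Y"
    if "X \<in> Obj (sSet U)" "Y \<in> Obj (sSet U)" for X Y
    using that prd[OF that] unfolding Hom Pr2
    by (auto simp: Obj Prd sset_prod_simps act_in
        intro!: simplicial_map_restrictI[where h = "\<lambda>n z. snd (unpair U z)"] elim!: uprodE)
  have tup: "Tuple (sSet U) f g \<in> Hom (sSet U) Z (Prod (sSet U) X Y)"
    if "f \<in> Hom (sSet U) Z X" "g \<in> Hom (sSet U) Z Y" for f g X Y Z
    using that prd[of X Y] simplicial_map_app[of f] simplicial_map_app[of g]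
      simplicial_map_act[of f] simplicial_map_act[of g] unfolding Hom Tup
    by (auto simp: Obj Prd sset_prod_simps
        intro!: simplicial_map_restrictI[where h = "\<lambda>n x. upair U (sfun f n x) (sfun g n x)"])
  have eqI: "f = g" if "f \<in> Hom (sSet U) X Y" "g \<in> Hom (sSet U) X Y"
    "\<And>n x. x \<in> simp X n \<Longrightarrow> sfun f n x = sfun g n x" for f g X Y
    using that unfolding Hom by (intro smap_eqI) auto
  have app: "sfun f n x \<in> simp Y n" if "f \<in> Hom (sSet U) X Y" "x \<in> simp X n" for f X Y n x
    using that simplicial_map_app[of f x n] unfolding Hom by auto
  have dom: "sdom f = X" "scod f = Y" "X \<in> Obj (sSet U)" "Y \<in> Obj (sSet U)"
    if "f \<in> Hom (sSet U) X Y" for f X Y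
    using that unfolding Hom by auto
  show ?thesis
  proof unfold_locales
    fix X assume X: "X \<in> Obj (sSet U)"
    let ?t = "\<lparr>sdom = X, scod = sset_term, sfun = \<lambda>n. \<lambda>x\<in>simp X n. undefined\<rparr>"
    have t: "?t \<in> Hom (sSet U) X (Term (sSet U))"
      using X simplicial_set_sset_term sing_small unfolding Hom Obj Trm
      by (auto intro!: simplicial_map_restrictI[where h = "\<lambda>n x. undefined"])
    have "f = ?t" if f: "f \<in> Hom (sSet U) X (Term (sSet U))" for f
      by (rule eqI[OF f t]) (use app[OF f] in \<open>auto simp: Trm\<close>)
    with t show "\<exists>!f. f \<in> Hom (sSet U) X (Term (sSet U))" by blast
  next
    fix f g X Y Z assume a: "f \<in> Hom (sSet U) Z X" "g \<in> Hom (sSet U) Z Y"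
    note d = dom[OF a(1)] dom[OF a(2)] 
    show "Comp (sSet U) (Pr1 (sSet U) X Y) (Tuple (sSet U) f g) = f"
      by (rule eqI[OF comp[OF tup[OF a] pr1] a(1)])
         (use d app[OF a(1)] app[OF a(2)] in \<open>auto simp: Comp Tup Pr1\<close>)
    show "Comp (sSet U) (Pr2 (sSet U) X Y) (Tuple (sSet U) f g) = g"
      by (rule eqI[OF comp[OF tup[OF a] pr2] a(2)])
         (use d app[OF a(1)] app[OF a(2)] in \<open>auto simp: Comp Tup Pr2\<close>)
  next
    fix X Y Z k assume a: "X \<in> Obj (sSet U)" "Y \<in> Obj (sSet U)" "k \<in> Hom (sSet U) Z (Prod (sSet U) X Y)"
    have k: "sfun k n x \<in> uprod U (simp X n) (simp Y n)" if "x \<in> simp Z n" for n x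
      using app[OF a(3) that] by (simp add: Prd sset_prod_simps)
    show "Tuple (sSet U) (Comp (sSet U) (Pr1 (sSet U) X Y) k) (Comp (sSet U) (Pr2 (sSet U) X Y) k) = k"
      by (rule eqI[OF tup[OF comp[OF a(3) pr1] comp[OF a(3) pr2]] a(3)])
         (use a(1,2) dom[OF a(3)] k unpair_in(1)[OF k] in \<open>auto simp: Comp Tup Pr1 Pr2\<close>)
  next
    fix f g h W X Y Z
    assume a: "f \<in> Hom (sSet U) W X" "g \<in> Hom (sSet U) X Y" "h \<in> Hom (sSet U) Y Z"
    show "Comp (sSet U) (Comp (sSet U) h g) f = Comp (sSet U) h (Comp (sSet U) g f)"
      by (rule eqI[OF comp[OF a(1) comp[OF a(2,3)]] comp[OF comp[OF a(1,2)] a(3)]])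
         (use app[OF a(1)] dom[OF a(1)] dom[OF a(2)] in \<open>auto simp: Comp\<close>)
  next
    fix f X Y assume a: "f \<in> Hom (sSet U) X Y"
    show "Comp (sSet U) f (Ide (sSet U) X) = f"
      by (rule eqI[OF comp[OF ide a] a]) (use dom[OF a] in \<open>auto simp: Comp Ide\<close>)
    show "Comp (sSet U) (Ide (sSet U) Y) f = f"
      by (rule eqI[OF comp[OF a ide] a]) (use dom[OF a] app[OF a] in \<open>auto simp: Comp Ide\<close>)
  next
    show "Term (sSet U) \<in> Obj (sSet U)"
      by (simp add: Trm Obj simplicial_set_sset_term sing_small)
  next
    fix f assume "f \<in> Arr (sSet U)"
    then show "Dom (sSet U) f \<in> Obj (sSet U)" "Cod (sSet U) f \<in> Obj (sSet U)"
      by (auto simp: sSet_def)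
  qed (fact ide comp prd pr1 pr2 tup)+
qed

end


section \<open>\<open>\<Delta>\<close>-generated spaces\<close>

abbreviation simplex_space :: "nat \<Rightarrow> (nat \<Rightarrow> real) topology" where
  "simplex_space p \<equiv> subtopology (powertop_real UNIV) (standard_simplex p)"

definition Delta_open :: "'x topology \<Rightarrow> 'x set \<Rightarrow> bool" where
  "Delta_open T W \<longleftrightarrow> W \<subseteq> topspace T \<and>
     (\<forall>p s. continuous_map (simplex_space p) T s \<longrightarrow>
        openin (simplex_space p) {t \<in> standard_simplex p. s t \<in> W})"

definition Delta_generated :: "'x topology \<Rightarrow> bool" where
  "Delta_generated T \<longleftrightarrow> (\<forall>W. Delta_open T W \<longrightarrow> openin T W)"

text \<open>The final topology with respect to the singular simplices of \<open>T\<close>.\<close>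

definition Delta_ification :: "'x topology \<Rightarrow> 'x topology" where
  "Delta_ification T = topology (Delta_open T)"

text \<open>
  The product in \<open>\<Delta>\<close>-generated spaces is the \<open>\<Delta>\<close>-ification of the usual product, transported
  here along the coding of pairs.
\<close>

definition Delta_prod :: "'u univ \<Rightarrow> 'u topology \<Rightarrow> 'u topology \<Rightarrow> 'u topology" where
  "Delta_prod U X Y =
     pullback_topology (uprod U (topspace X) (topspace Y)) (unpair U)
       (Delta_ification (prod_topology X Y))"

record 'u tmap =
  tdom :: "'u topology"
  tcod :: "'u topology"
  tfun :: "'u \<Rightarrow> 'u"

definition TopDelta :: "'u univ \<Rightarrow> ('u topology, 'u tmap) cartcat" where
  "TopDelta U =
     (let Ob = {X. Delta_generated X \<and> topspace X \<in> Small U} in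
     \<lparr>Obj = Ob,
      Arr = {f. tdom f \<in> Ob \<and> tcod f \<in> Ob \<and> continuous_map (tdom f) (tcod f) (tfun f) \<and>
                tfun f \<in> extensional (topspace (tdom f))},
      Dom = tdom,
      Cod = tcod,
      Ide = (\<lambda>X. \<lparr>tdom = X, tcod = X, tfun = (\<lambda>x\<in>topspace X. x)\<rparr>),
      Comp = (\<lambda>g f. \<lparr>tdom = tdom f, tcod = tcod g,
                     tfun = compose (topspace (tdom f)) (tfun g) (tfun f)\<rparr>),
      Term = discrete_topology {undefined},
      Prod = Delta_prod U,
      Pr1 = (\<lambda>X Y. \<lparr>tdom = Delta_prod U X Y, tcod = X,
                    tfun = (\<lambda>z\<in>uprod U (topspace X) (topspace Y). fst (unpair U z))\<rparr>),
      Pr2 = (\<lambda>X Y. \<lparr>tdom = Delta_prod U X Y, tcod = Y,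
                    tfun = (\<lambda>z\<in>uprod U (topspace X) (topspace Y). snd (unpair U z))\<rparr>),
      Tuple = (\<lambda>f g. \<lparr>tdom = tdom f, tcod = Delta_prod U (tcod f) (tcod g),
                      tfun = (\<lambda>x\<in>topspace (tdom f). upair U (tfun f x) (tfun g x))\<rparr>)\<rparr>)"


lemma istopology_Delta_open: "istopology (Delta_open T)"
proof -
  have 1: "Delta_open T (S \<inter> W)" if "Delta_open T S" "Delta_open T W" for S W
  proof -
    have "{t \<in> standard_simplex p. s t \<in> S \<inter> W} = {t \<in> standard_simplex p. s t \<in> S} \<inter> {t \<in> standard_simplex p. s t \<in> W}" for p and s :: "_ \<Rightarrow> 'a"
      by auto
    with that show ?thesis unfolding Delta_open_def by (auto intro: openin_Int)
  qed
  have 2: "Delta_open T (\<Union>K)" if "\<forall>W\<in>K. Delta_open T W" for K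
  proof -
    have "{t \<in> standard_simplex p. s t \<in> \<Union>K} = \<Union>((\<lambda>W. {t \<in> standard_simplex p. s t \<in> W}) ` K)" for p and s :: "_ \<Rightarrow> 'a"
      by auto
    with that show ?thesis unfolding Delta_open_def by (auto intro!: openin_Union)
  qed
  show ?thesis unfolding istopology_def using 1 2 by blast
qed

lemma openin_Delta_ification: "openin (Delta_ification T) W \<longleftrightarrow> Delta_open T W"
  by (simp add: Delta_ification_def istopology_Delta_open)

lemma openin_imp_Delta_open: "openin T W \<Longrightarrow> Delta_open T W"
  unfolding Delta_open_def
  by (auto dest: openin_subset dest!: openin_continuous_map_preimage simp del: openin_subtopology)

lemma topspace_Delta_ification [simp]: "topspace (Delta_ification T) = topspace T"
proof
  show "topspace (Delta_ification T) \<subseteq> topspace T"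
    using openin_topspace[of "Delta_ification T"] unfolding openin_Delta_ification Delta_open_def by blast
  show "topspace T \<subseteq> topspace (Delta_ification T)"
    by (rule openin_subset) (simp add: openin_Delta_ification openin_imp_Delta_open)
qed

lemma continuous_from_Delta: 
  assumes "Delta_generated X" "continuous_map X T f"
  shows "continuous_map X (Delta_ification T) f"
  unfolding continuous_map_def
proof (intro conjI allI impI)
  show "f \<in> topspace X \<rightarrow> topspace (Delta_ification T)" using assms(2) by (auto simp: continuous_map_def)
  fix W assume "openin (Delta_ification T) W"
  then have W: "Delta_open T W" by (simp add: openin_Delta_ification)
  have "Delta_open X {x \<in> topspace X. f x \<in> W}"
    unfolding Delta_open_def
  proof (intro conjI allI impI)
    fix p s assume s: "continuous_map (simplex_space p) X s"
    then have "continuous_map (simplex_space p) T (f \<circ> s)"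
      using assms(2) continuous_map_compose by blast
    then have "openin (simplex_space p) {t \<in> standard_simplex p. (f \<circ> s) t \<in> W}"
      using W unfolding Delta_open_def by blast
    moreover have "{t \<in> standard_simplex p. (f \<circ> s) t \<in> W} = {t \<in> standard_simplex p. s t \<in> {x \<in> topspace X. f x \<in> W}}"
      using s by (auto simp: continuous_map_def Pi_iff)
    ultimately show "openin (simplex_space p) {t \<in> standard_simplex p. s t \<in> {x \<in> topspace X. f x \<in> W}}" by simp
  qed auto
  then show "openin X {x \<in> topspace X. f x \<in> W}"
    using assms(1) by (simp add: Delta_generated_def)
qed

lemma continuous_Delta_simplex:
  "continuous_map (simplex_space p) (Delta_ification T) s \<longleftrightarrow> continuous_map (simplex_space p) T s"
proof
  assume "continuous_map (simplex_space p) T s"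
  then have s: "continuous_map (simplex_space p) T s" .
  then have "openin (simplex_space p) {t \<in> standard_simplex p. s t \<in> W}" if "Delta_open T W" for W
    using that unfolding Delta_open_def by blast
  with s show "continuous_map (simplex_space p) (Delta_ification T) s"
    unfolding continuous_map_def by (simp add: openin_Delta_ification)
next
  assume "continuous_map (simplex_space p) (Delta_ification T) s"
  then show "continuous_map (simplex_space p) T s"
    unfolding continuous_map_def
    by (simp add: openin_Delta_ification openin_imp_Delta_open)
qed

lemma Delta_generated_Delta_ification: "Delta_generated (Delta_ification T)"
  unfolding Delta_generated_def openin_Delta_ification
  by (auto simp: Delta_open_def continuous_Delta_simplex)

lemma continuous_Delta_ification_id: "continuous_map (Delta_ification T) T id"
proof -
  have "{x \<in> topspace T. x \<in> W} = W" if "openin T W" for W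
    using openin_subset[OF that] by auto
  then show ?thesis
    by (simp add: continuous_map_def openin_Delta_ification openin_imp_Delta_open)
qed


lemma Delta_generated_homeo:
  assumes "Delta_generated X" "homeomorphic_map X Y f"
  shows "Delta_generated Y"
proof -
  obtain g where fg: "homeomorphic_maps X Y f g" using assms(2) homeomorphic_map_maps by blast
  then have cf: "continuous_map X Y f" and cg: "continuous_map Y X g" by (auto simp: homeomorphic_maps_def)
  show ?thesis unfolding Delta_generated_def
  proof (intro allI impI)
    fix W assume "Delta_open Y W"
    then have "openin X {x \<in> topspace X. f x \<in> W}"
      using continuous_from_Delta[OF assms(1) cf] unfolding continuous_map_def by (simp add: openin_Delta_ification)
    then have "openin Y {y \<in> topspace Y. g y \<in> {x \<in> topspace X. f x \<in> W}}"
      using cg openin_continuous_map_preimage by blast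
    moreover have "{y \<in> topspace Y. g y \<in> {x \<in> topspace X. f x \<in> W}} = W"
      using fg \<open>Delta_open Y W\<close> unfolding homeomorphic_maps_def Delta_open_def continuous_map_def Pi_iff by auto
    ultimately show "openin Y W" by simp
  qed
qed

context universe begin

lemma topspace_Delta_prod: "topspace (Delta_prod U X Y) = uprod U (topspace X) (topspace Y)"
  unfolding Delta_prod_def topspace_pullback_topology by (auto elim!: uprodE)

lemma homeo_Delta_prod:
  "homeomorphic_maps (Delta_ification (prod_topology X Y)) (Delta_prod U X Y) (\<lambda>p. upair U (fst p) (snd p)) (unpair U)"
proof -
  have "continuous_map (Delta_ification (prod_topology X Y)) (Delta_prod U X Y) (\<lambda>p. upair U (fst p) (snd p))"
    unfolding continuous_map_def topspace_Delta_prod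
  proof (intro conjI allI impI)
    fix W assume "openin (Delta_prod U X Y) W"
    then obtain W' where W': "openin (Delta_ification (prod_topology X Y)) W'" "W = unpair U -` W' \<inter> uprod U (topspace X) (topspace Y)"
      by (auto simp: Delta_prod_def openin_pullback_topology)
    have "W' \<subseteq> topspace X \<times> topspace Y" using openin_subset[OF W'(1)] by simp
    then have "{x \<in> topspace (Delta_ification (prod_topology X Y)). upair U (fst x) (snd x) \<in> W} = W'"
      using W'(2) by auto
    then show "openin (Delta_ification (prod_topology X Y)) {x \<in> topspace (Delta_ification (prod_topology X Y)). upair U (fst x) (snd x) \<in> W}"
      using W'(1) by simp
  qed auto
  moreover have "continuous_map (Delta_prod U X Y) (Delta_ification (prod_topology X Y)) (unpair U)"
    unfolding continuous_map_def topspace_Delta_prod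
  proof (intro conjI allI impI)
    fix W assume W: "openin (Delta_ification (prod_topology X Y)) W"
    have "{x \<in> uprod U (topspace X) (topspace Y). unpair U x \<in> W} = unpair U -` W \<inter> uprod U (topspace X) (topspace Y)" by auto
    with W show "openin (Delta_prod U X Y) {x \<in> uprod U (topspace X) (topspace Y). unpair U x \<in> W}"
      unfolding Delta_prod_def openin_pullback_topology by metis
  qed (auto elim!: uprodE)
  ultimately show ?thesis unfolding homeomorphic_maps_def by (auto simp: topspace_Delta_prod)
qed

lemma Delta_prod_gen: "Delta_generated (Delta_prod U X Y)"
  using Delta_generated_homeo[OF Delta_generated_Delta_ification] homeo_Delta_prod homeomorphic_map_maps by blast

lemma cont_fst: "continuous_map (Delta_prod U X Y) X (\<lambda>z. fst (unpair U z))"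
  and cont_snd: "continuous_map (Delta_prod U X Y) Y (\<lambda>z. snd (unpair U z))"
proof -
  have "continuous_map (Delta_prod U X Y) (prod_topology X Y) (id \<circ> unpair U)"
    using homeo_Delta_prod continuous_Delta_ification_id unfolding homeomorphic_maps_def 
    by (metis continuous_map_compose)
  then show "continuous_map (Delta_prod U X Y) X (\<lambda>z. fst (unpair U z))" "continuous_map (Delta_prod U X Y) Y (\<lambda>z. snd (unpair U z))"
    by (auto simp: continuous_map_pairwise o_def)
qed

lemma cont_pair:
  assumes "Delta_generated Z" "continuous_map Z X f" "continuous_map Z Y g"
  shows "continuous_map Z (Delta_prod U X Y) (\<lambda>x. upair U (f x) (g x))"
proof -
  have "continuous_map Z (Delta_ification (prod_topology X Y)) (\<lambda>x. (f x, g x))"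
    using assms by (intro continuous_from_Delta) (auto simp: continuous_map_pairwise o_def)
  then have "continuous_map Z (Delta_prod U X Y) ((\<lambda>p. upair U (fst p) (snd p)) \<circ> (\<lambda>x. (f x, g x)))"
    using homeo_Delta_prod continuous_map_compose unfolding homeomorphic_maps_def by blast
  then show ?thesis by (simp add: o_def)
qed

lemma Delta_discrete: "Delta_generated (discrete_topology {a})"
  by (auto simp: Delta_generated_def Delta_open_def)

lemma cont_restrict: "continuous_map X Y (restrict f (topspace X)) \<longleftrightarrow> continuous_map X Y f"
  by (rule iffI; erule continuous_map_eq; simp)

end

context universe begin
lemma cartesian_category_TopDelta: "cartesian_category (TopDelta U)"
proof -
  have eqI: "f = g" if "tdom f = tdom g" "tcod f = tcod g" 
     "\<And>x. x \<in> topspace (tdom f) \<Longrightarrow> tfun f x = tfun g x" "tfun f \<in> extensional (topspace (tdom f))" 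
       "tfun g \<in> extensional (topspace (tdom f))"  for f g :: "'u tmap"
  proof -
    have "tfun f = tfun g"
      using that by (metis extensionalityI)
    with that show ?thesis by (metis (full_types) tmap.equality old.unit.exhaust)
  qed
  have fnc: "x \<in> topspace X \<Longrightarrow> f x \<in> topspace Y" if "continuous_map X Y f" for X Y :: "'u topology" and f x
    using that by (auto simp: continuous_map_def)
  note [simp] = topspace_Delta_prod uprod_small sing_small Delta_prod_gen Delta_discrete
  have Hom: "f \<in> Hom (TopDelta U) X Y \<longleftrightarrow> tdom f = X \<and> tcod f = Y \<and> Delta_generated X \<and> Delta_generated Y
    \<and> topspace X \<in> Small U \<and> topspace Y \<in> Small U \<and> continuous_map X Y (tfun f) \<and> tfun f \<in> extensional (topspace X)" for f X Y
    by (auto simp: Hom_def TopDelta_def)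
  have Obj: "X \<in> Obj (TopDelta U) \<longleftrightarrow> Delta_generated X \<and> topspace X \<in> Small U" for X
    by (auto simp: TopDelta_def)
  have Pr1: "Pr1 (TopDelta U) = (\<lambda>X Y. \<lparr>tdom = Delta_prod U X Y, tcod = X,
                    tfun = (\<lambda>z\<in>uprod U (topspace X) (topspace Y). fst (unpair U z))\<rparr>)"
    and Pr2: "Pr2 (TopDelta U) = (\<lambda>X Y. \<lparr>tdom = Delta_prod U X Y, tcod = Y,
                    tfun = (\<lambda>z\<in>uprod U (topspace X) (topspace Y). snd (unpair U z))\<rparr>)"
    and Tup: "Tuple (TopDelta U) = (\<lambda>f g. \<lparr>tdom = tdom f, tcod = Delta_prod U (tcod f) (tcod g),
                      tfun = (\<lambda>x\<in>topspace (tdom f). upair U (tfun f x) (tfun g x))\<rparr>)"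
    and Comp: "Comp (TopDelta U) = (\<lambda>g f. \<lparr>tdom = tdom f, tcod = tcod g,
                     tfun = compose (topspace (tdom f)) (tfun g) (tfun f)\<rparr>)"
    and Ide: "Ide (TopDelta U) = (\<lambda>X. \<lparr>tdom = X, tcod = X, tfun = (\<lambda>x\<in>topspace X. x)\<rparr>)"
    and Trm: "Term (TopDelta U) = discrete_topology {undefined}"
    and Prd: "Prod (TopDelta U) = Delta_prod U"
    and Dom: "Dom (TopDelta U) = tdom" and Cod: "Cod (TopDelta U) = tcod"
    by (auto simp: TopDelta_def Let_def)
  note d = Hom Obj Pr1 Pr2 Tup Comp Ide Trm Prd
  have cc: "continuous_map X Z (compose (topspace X) g f)" if "continuous_map X Y f" "continuous_map Y Z g" for X Y Z :: "'u topology" and f g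
  proof -
    have "compose (topspace X) g f = restrict (g \<circ> f) (topspace X)" by (auto simp: compose_def)
    then show ?thesis using cont_restrict that continuous_map_compose by metis
  qed
  have rp: "continuous_map (Delta_prod U X Y) Z (restrict f (uprod U (topspace X) (topspace Y))) \<longleftrightarrow> continuous_map (Delta_prod U X Y) Z f" for X Y Z f
    using cont_restrict[of "Delta_prod U X Y" Z f] by simp
  show ?thesis
  proof unfold_locales
    fix X :: "'u topology"
    assume "X \<in> Obj (TopDelta U)"
    then show "\<exists>!f. f \<in> Hom (TopDelta U) X (Term (TopDelta U))"
      apply (intro ex1I[of _ "\<lparr>tdom = X, tcod = discrete_topology {undefined}, tfun = \<lambda>x\<in>topspace X. undefined\<rparr>"])
      subgoal by (auto simp: d cont_restrict)
      subgoal for f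
        apply (rule eqI)
        by (auto simp: d continuous_map_def Pi_iff)
      done
  next
    fix f g :: "'u tmap" and X Y Z
    assume "f \<in> Hom (TopDelta U) Z X" "g \<in> Hom (TopDelta U) Z Y"
    then show "Comp (TopDelta U) (Pr1 (TopDelta U) X Y) (Tuple (TopDelta U) f g) = f"
      apply (intro eqI)
      by (auto simp: d compose_def fnc)
  next
    fix f g :: "'u tmap" and X Y Z
    assume "f \<in> Hom (TopDelta U) Z X" "g \<in> Hom (TopDelta U) Z Y"
    then show "Comp (TopDelta U) (Pr2 (TopDelta U) X Y) (Tuple (TopDelta U) f g) = g"
      apply (intro eqI)
      by (auto simp: d compose_def fnc)
  next
    fix f g :: "'u tmap" and X Y Z
    assume "f \<in> Hom (TopDelta U) Z X" "g \<in> Hom (TopDelta U) Z Y"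
    then show "Tuple (TopDelta U) f g \<in> Hom (TopDelta U) Z (Prod (TopDelta U) X Y)"
      by (auto simp: d cont_restrict cont_pair)
  next
    fix X Y Z k
    assume a: "X \<in> Obj (TopDelta U)" "Y \<in> Obj (TopDelta U)" "k \<in> Hom (TopDelta U) Z (Prod (TopDelta U) X Y)"
    then have *: "tfun k x \<in> uprod U (topspace X) (topspace Y)" if "x \<in> topspace Z" for x
      using that by (auto simp: d dest: fnc)
    with a show "Tuple (TopDelta U) (Comp (TopDelta U) (Pr1 (TopDelta U) X Y) k) (Comp (TopDelta U) (Pr2 (TopDelta U) X Y) k) = k"
      apply (intro eqI)
          by (auto simp: d compose_def intro: unpair_in(1)[OF *])
  next
    fix f g h :: "'u tmap" and W X Y Z
    assume "f \<in> Hom (TopDelta U) W X" "g \<in> Hom (TopDelta U) X Y" "h \<in> Hom (TopDelta U) Y Z"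
    then show "Comp (TopDelta U) (Comp (TopDelta U) h g) f = Comp (TopDelta U) h (Comp (TopDelta U) g f)"
      apply (intro eqI)
      by (auto simp: d compose_def fnc)
  next
    fix f :: "'u tmap" and X Y
    assume "f \<in> Hom (TopDelta U) X Y"
    then show "Comp (TopDelta U) f (Ide (TopDelta U) X) = f"
      apply (intro eqI)
      by (auto simp: d compose_def fnc)
  next
    fix f :: "'u tmap" and X Y
    assume "f \<in> Hom (TopDelta U) X Y"
    then show "Comp (TopDelta U) (Ide (TopDelta U) Y) f = f"
      apply (intro eqI)
      by (auto simp: d compose_def fnc)
  qed (auto simp: d cont_restrict rp cont_fst cont_snd intro: cc, auto simp: TopDelta_def)
qed
end


section \<open>Enriched categories\<close>

text \<open>\<open>cmp C a b c\<close> is the composition \<open>C(b,c) \<times> C(a,b) \<rightarrow> C(a,c)\<close>.\<close>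

record ('o, 'v, 'a) vcat =
  ob :: "'o set"
  hm :: "'o \<Rightarrow> 'o \<Rightarrow> 'v"
  cmp :: "'o \<Rightarrow> 'o \<Rightarrow> 'o \<Rightarrow> 'a"
  unt :: "'o \<Rightarrow> 'a"

definition vcategory :: "('v, 'a) cartcat \<Rightarrow> ('o, 'v, 'a) vcat \<Rightarrow> bool" where
  "vcategory V C \<longleftrightarrow>
     (\<forall>a\<in>ob C. \<forall>b\<in>ob C. hm C a b \<in> Obj V) \<and>
     (\<forall>a\<in>ob C. \<forall>b\<in>ob C. \<forall>c\<in>ob C.
        cmp C a b c \<in> Hom V (Prod V (hm C b c) (hm C a b)) (hm C a c)) \<and>
     (\<forall>a\<in>ob C. unt C a \<in> Hom V (Term V) (hm C a a)) \<and>
     (\<forall>a\<in>ob C. \<forall>b\<in>ob C. \<forall>c\<in>ob C. \<forall>d\<in>ob C.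
        cmp C a b d \<cdot>\<^bsub>V\<^esub> Times V (cmp C b c d) (Ide V (hm C a b)) =
        cmp C a c d \<cdot>\<^bsub>V\<^esub> Times V (Ide V (hm C c d)) (cmp C a b c)
                    \<cdot>\<^bsub>V\<^esub> Assoc V (hm C c d) (hm C b c) (hm C a b)) \<and>
     (\<forall>a\<in>ob C. \<forall>b\<in>ob C.
        cmp C a b b \<cdot>\<^bsub>V\<^esub> Times V (unt C b) (Ide V (hm C a b)) = Pr2 V (Term V) (hm C a b)) \<and>
     (\<forall>a\<in>ob C. \<forall>b\<in>ob C.
        cmp C a a b \<cdot>\<^bsub>V\<^esub> Times V (Ide V (hm C a b)) (unt C a) = Pr1 V (hm C a b) (Term V)) \<and>
     (\<forall>a b. \<not> (a \<in> ob C \<and> b \<in> ob C) \<longrightarrow> hm C a b = undefined) \<and>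
     (\<forall>a b c. \<not> (a \<in> ob C \<and> b \<in> ob C \<and> c \<in> ob C) \<longrightarrow> cmp C a b c = undefined) \<and>
     (\<forall>a. a \<notin> ob C \<longrightarrow> unt C a = undefined)"

record ('o, 'p, 'v, 'a) vfun =
  fsrc :: "('o, 'v, 'a) vcat"
  ftgt :: "('p, 'v, 'a) vcat"
  fob :: "'o \<Rightarrow> 'p"
  fhm :: "'o \<Rightarrow> 'o \<Rightarrow> 'a"

definition vfunctor :: "('v, 'a) cartcat \<Rightarrow> ('o, 'p, 'v, 'a) vfun \<Rightarrow> bool" where
  "vfunctor V F \<longleftrightarrow>
     (let C = fsrc F; D = ftgt F in
      vcategory V C \<and> vcategory V D \<and>
      fob F \<in> ob C \<rightarrow>\<^sub>E ob D \<and>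
      (\<forall>a\<in>ob C. \<forall>b\<in>ob C. fhm F a b \<in> Hom V (hm C a b) (hm D (fob F a) (fob F b))) \<and>
      (\<forall>a\<in>ob C. \<forall>b\<in>ob C. \<forall>c\<in>ob C.
         fhm F a c \<cdot>\<^bsub>V\<^esub> cmp C a b c =
         cmp D (fob F a) (fob F b) (fob F c) \<cdot>\<^bsub>V\<^esub> Times V (fhm F b c) (fhm F a b)) \<and>
      (\<forall>a\<in>ob C. fhm F a a \<cdot>\<^bsub>V\<^esub> unt C a = unt D (fob F a)) \<and>
      (\<forall>a b. \<not> (a \<in> ob C \<and> b \<in> ob C) \<longrightarrow> fhm F a b = undefined))"

definition vfun_id :: "('v, 'a) cartcat \<Rightarrow> ('o, 'v, 'a) vcat \<Rightarrow> ('o, 'o, 'v, 'a) vfun" where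
  "vfun_id V C =
     \<lparr>fsrc = C, ftgt = C, fob = (\<lambda>a\<in>ob C. a),
      fhm = (\<lambda>a b. if a \<in> ob C \<and> b \<in> ob C then Ide V (hm C a b) else undefined)\<rparr>"

definition vfun_comp ::
  "('v, 'a) cartcat \<Rightarrow> ('p, 'q, 'v, 'a) vfun \<Rightarrow> ('o, 'p, 'v, 'a) vfun \<Rightarrow> ('o, 'q, 'v, 'a) vfun" where
  "vfun_comp V G F =
     (let C = fsrc F in
      \<lparr>fsrc = C, ftgt = ftgt G, fob = compose (ob C) (fob G) (fob F),
       fhm = (\<lambda>a b. if a \<in> ob C \<and> b \<in> ob C
                    then fhm G (fob F a) (fob F b) \<cdot>\<^bsub>V\<^esub> fhm F a b else undefined)\<rparr>)"

record ('o, 'p, 'v, 'a) vnat =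
  nsrc :: "('o, 'p, 'v, 'a) vfun"
  ntgt :: "('o, 'p, 'v, 'a) vfun"
  ncomp :: "'o \<Rightarrow> 'a"

text \<open>
  \<open>ucomp V C a b c g f\<close> composes \<open>g : Z \<rightarrow> C(b,c)\<close> with \<open>f : Z \<rightarrow> C(a,b)\<close>. For \<open>Z\<close> the terminal
  object this is the composition of the underlying ordinary category of \<open>C\<close>.
\<close>

definition ucomp ::
  "('v, 'a) cartcat \<Rightarrow> ('o, 'v, 'a) vcat \<Rightarrow> 'o \<Rightarrow> 'o \<Rightarrow> 'o \<Rightarrow> 'a \<Rightarrow> 'a \<Rightarrow> 'a" where
  "ucomp V C a b c g f = cmp C a b c \<cdot>\<^bsub>V\<^esub> Tuple V g f"

definition vnatural :: "('v, 'a) cartcat \<Rightarrow> ('o, 'p, 'v, 'a) vnat \<Rightarrow> bool" where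
  "vnatural V t \<longleftrightarrow>
     (let F = nsrc t; G = ntgt t; C = fsrc F; D = ftgt F in
      vfunctor V F \<and> vfunctor V G \<and> fsrc G = C \<and> ftgt G = D \<and>
      (\<forall>a\<in>ob C. ncomp t a \<in> Hom V (Term V) (hm D (fob F a) (fob G a))) \<and>
      (\<forall>a\<in>ob C. \<forall>b\<in>ob C.
         ucomp V D (fob F a) (fob F b) (fob G b) (ncomp t b \<cdot>\<^bsub>V\<^esub> Bang V (hm C a b)) (fhm F a b) =
         ucomp V D (fob F a) (fob G a) (fob G b) (fhm G a b) (ncomp t a \<cdot>\<^bsub>V\<^esub> Bang V (hm C a b))) \<and>
      ncomp t \<in> extensional (ob C))"

definition vnat_id :: "('o, 'p, 'v, 'a) vfun \<Rightarrow> ('o, 'p, 'v, 'a) vnat" where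
  "vnat_id F = \<lparr>nsrc = F, ntgt = F, ncomp = (\<lambda>a\<in>ob (fsrc F). unt (ftgt F) (fob F a))\<rparr>"

definition vnat_vcomp ::
  "('v, 'a) cartcat \<Rightarrow> ('o, 'p, 'v, 'a) vnat \<Rightarrow> ('o, 'p, 'v, 'a) vnat \<Rightarrow> ('o, 'p, 'v, 'a) vnat" where
  "vnat_vcomp V s t =
     \<lparr>nsrc = nsrc t, ntgt = ntgt s,
      ncomp = (\<lambda>a\<in>ob (fsrc (nsrc t)).
        ucomp V (ftgt (nsrc t)) (fob (nsrc t) a) (fob (ntgt t) a) (fob (ntgt s) a)
          (ncomp s a) (ncomp t a))\<rparr>"

text \<open>
  For \<open>t : F \<Rightarrow> F'\<close> and \<open>s : G \<Rightarrow> G'\<close>, the component of the horizontal composite at \<open>a\<close> is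
  \<open>s\<close> at \<open>F' a\<close> after \<open>G\<close> applied to the component of \<open>t\<close> at \<open>a\<close>.
\<close>

definition vnat_hcomp ::
  "('v, 'a) cartcat \<Rightarrow> ('p, 'q, 'v, 'a) vnat \<Rightarrow> ('o, 'p, 'v, 'a) vnat \<Rightarrow> ('o, 'q, 'v, 'a) vnat" where
  "vnat_hcomp V s t =
     (let F = nsrc t; F' = ntgt t; G = nsrc s; G' = ntgt s in
      \<lparr>nsrc = vfun_comp V G F, ntgt = vfun_comp V G' F',
       ncomp = (\<lambda>a\<in>ob (fsrc F).
         ucomp V (ftgt G) (fob G (fob F a)) (fob G (fob F' a)) (fob G' (fob F' a))
           (ncomp s (fob F' a)) (fhm G (fob F a) (fob F' a) \<cdot>\<^bsub>V\<^esub> ncomp t a))\<rparr>)"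

definition vnat_iso :: "('v, 'a) cartcat \<Rightarrow> ('o, 'p, 'v, 'a) vnat \<Rightarrow> bool" where
  "vnat_iso V t \<longleftrightarrow> vnatural V t \<and>
     (\<exists>s. vnatural V s \<and> nsrc s = ntgt t \<and> ntgt s = nsrc t \<and>
        vnat_vcomp V s t = vnat_id (nsrc t) \<and> vnat_vcomp V t s = vnat_id (ntgt t))"


subsection \<open>Products of enriched categories\<close>

definition vcat_prod ::
  "('v, 'a) cartcat \<Rightarrow> ('o, 'v, 'a) vcat \<Rightarrow> ('p, 'v, 'a) vcat \<Rightarrow> ('o \<times> 'p, 'v, 'a) vcat" where
  "vcat_prod V C D =
     (let Ob = ob C \<times> ob D;
          H = (\<lambda>x y. Prod V (hm C (fst x) (fst y)) (hm D (snd x) (snd y))) in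
      \<lparr>ob = Ob,
       hm = (\<lambda>x y. if x \<in> Ob \<and> y \<in> Ob then H x y else undefined),
       cmp = (\<lambda>x y z. if x \<in> Ob \<and> y \<in> Ob \<and> z \<in> Ob then
         (let p = Pr1 V (H y z) (H x y); q = Pr2 V (H y z) (H x y) in
          Tuple V
            (ucomp V C (fst x) (fst y) (fst z)
               (Pr1 V (hm C (fst y) (fst z)) (hm D (snd y) (snd z)) \<cdot>\<^bsub>V\<^esub> p)
               (Pr1 V (hm C (fst x) (fst y)) (hm D (snd x) (snd y)) \<cdot>\<^bsub>V\<^esub> q))
            (ucomp V D (snd x) (snd y) (snd z)
               (Pr2 V (hm C (fst y) (fst z)) (hm D (snd y) (snd z)) \<cdot>\<^bsub>V\<^esub> p)
               (Pr2 V (hm C (fst x) (fst y)) (hm D (snd x) (snd y)) \<cdot>\<^bsub>V\<^esub> q)))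
         else undefined),
       unt = (\<lambda>x\<in>Ob. Tuple V (unt C (fst x)) (unt D (snd x)))\<rparr>)"

definition vfun_prod ::
  "('v, 'a) cartcat \<Rightarrow> ('o, 'p, 'v, 'a) vfun \<Rightarrow> ('q, 'r, 'v, 'a) vfun
     \<Rightarrow> ('o \<times> 'q, 'p \<times> 'r, 'v, 'a) vfun" where
  "vfun_prod V F G =
     (let Ob = ob (fsrc F) \<times> ob (fsrc G) in
      \<lparr>fsrc = vcat_prod V (fsrc F) (fsrc G), ftgt = vcat_prod V (ftgt F) (ftgt G),
       fob = (\<lambda>x\<in>Ob. (fob F (fst x), fob G (snd x))),
       fhm = (\<lambda>x y. if x \<in> Ob \<and> y \<in> Ob
                    then Times V (fhm F (fst x) (fst y)) (fhm G (snd x) (snd y)) else undefined)\<rparr>)"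

definition vfun_assoc ::
  "('v, 'a) cartcat \<Rightarrow> ('o, 'v, 'a) vcat \<Rightarrow> ('p, 'v, 'a) vcat \<Rightarrow> ('q, 'v, 'a) vcat
     \<Rightarrow> (('o \<times> 'p) \<times> 'q, 'o \<times> ('p \<times> 'q), 'v, 'a) vfun" where
  "vfun_assoc V C D E =
     (let Ob = (ob C \<times> ob D) \<times> ob E in
      \<lparr>fsrc = vcat_prod V (vcat_prod V C D) E, ftgt = vcat_prod V C (vcat_prod V D E),
       fob = (\<lambda>((a, b), c)\<in>Ob. (a, (b, c))),
       fhm = (\<lambda>x y. if x \<in> Ob \<and> y \<in> Ob
         then Assoc V (hm C (fst (fst x)) (fst (fst y))) (hm D (snd (fst x)) (snd (fst y)))
                (hm E (snd x) (snd y))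
         else undefined)\<rparr>)"

definition vfun_swap ::
  "('v, 'a) cartcat \<Rightarrow> ('o, 'v, 'a) vcat \<Rightarrow> ('p, 'v, 'a) vcat \<Rightarrow> ('o \<times> 'p, 'p \<times> 'o, 'v, 'a) vfun" where
  "vfun_swap V C D =
     (let Ob = ob C \<times> ob D in
      \<lparr>fsrc = vcat_prod V C D, ftgt = vcat_prod V D C,
       fob = (\<lambda>x\<in>Ob. (snd x, fst x)),
       fhm = (\<lambda>x y. if x \<in> Ob \<and> y \<in> Ob
         then Swap V (hm C (fst x) (fst y)) (hm D (snd x) (snd y)) else undefined)\<rparr>)"


section \<open>Symmetric monoidal enriched categories without unit\<close>

record ('o, 'v, 'a) symmon =
  tens :: "('o \<times> 'o, 'o, 'v, 'a) vfun"
  asc :: "(('o \<times> 'o) \<times> 'o, 'o, 'v, 'a) vnat"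
  symm :: "('o \<times> 'o, 'o, 'v, 'a) vnat"

definition tob :: "('o, 'v, 'a) symmon \<Rightarrow> 'o \<Rightarrow> 'o \<Rightarrow> 'o" where
  "tob M a b = fob (tens M) (a, b)"

text \<open>The tensor product of \<open>f : 1 \<rightarrow> C(a,a')\<close> and \<open>g : 1 \<rightarrow> C(b,b')\<close>.\<close>

definition tarr ::
  "('v, 'a) cartcat \<Rightarrow> ('o, 'v, 'a) symmon \<Rightarrow> 'o \<Rightarrow> 'o \<Rightarrow> 'o \<Rightarrow> 'o \<Rightarrow> 'a \<Rightarrow> 'a \<Rightarrow> 'a" where
  "tarr V M a a' b b' f g = fhm (tens M) (a, b) (a', b') \<cdot>\<^bsub>V\<^esub> Tuple V f g"

definition monoidal :: "('v, 'a) cartcat \<Rightarrow> ('o, 'v, 'a) vcat \<Rightarrow> ('o, 'v, 'a) symmon \<Rightarrow> bool" where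
  "monoidal V C M \<longleftrightarrow>
     (let T = tob M; \<alpha> = (\<lambda>a b c. ncomp (asc M) ((a, b), c)) in
      vfunctor V (tens M) \<and> fsrc (tens M) = vcat_prod V C C \<and> ftgt (tens M) = C \<and>
      vnat_iso V (asc M) \<and>
      nsrc (asc M) = vfun_comp V (tens M) (vfun_prod V (tens M) (vfun_id V C)) \<and>
      ntgt (asc M) = vfun_comp V (tens M)
        (vfun_comp V (vfun_prod V (vfun_id V C) (tens M)) (vfun_assoc V C C C)) \<and>
      (\<forall>a\<in>ob C. \<forall>b\<in>ob C. \<forall>c\<in>ob C. \<forall>d\<in>ob C.
         ucomp V C (T (T (T a b) c) d) (T (T a b) (T c d)) (T a (T b (T c d)))
           (\<alpha> a b (T c d)) (\<alpha> (T a b) c d) =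
         ucomp V C (T (T (T a b) c) d) (T a (T (T b c) d)) (T a (T b (T c d)))
           (tarr V M a a (T (T b c) d) (T b (T c d)) (unt C a) (\<alpha> b c d))
           (ucomp V C (T (T (T a b) c) d) (T (T a (T b c)) d) (T a (T (T b c) d))
             (\<alpha> a (T b c) d)
             (tarr V M (T (T a b) c) (T a (T b c)) d d (\<alpha> a b c) (unt C d)))))"

definition symmetric_monoidal ::
  "('v, 'a) cartcat \<Rightarrow> ('o, 'v, 'a) vcat \<Rightarrow> ('o, 'v, 'a) symmon \<Rightarrow> bool" where
  "symmetric_monoidal V C M \<longleftrightarrow>
     (let T = tob M; \<alpha> = (\<lambda>a b c. ncomp (asc M) ((a, b), c)); \<sigma> = (\<lambda>a b. ncomp (symm M) (a, b)) in
      monoidal V C M \<and>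
      vnat_iso V (symm M) \<and>
      nsrc (symm M) = tens M \<and>
      ntgt (symm M) = vfun_comp V (tens M) (vfun_swap V C C) \<and>
      (\<forall>a\<in>ob C. \<forall>b\<in>ob C.
         ucomp V C (T a b) (T b a) (T a b) (\<sigma> b a) (\<sigma> a b) = unt C (T a b)) \<and>
      (\<forall>a\<in>ob C. \<forall>b\<in>ob C. \<forall>c\<in>ob C.
         ucomp V C (T (T a b) c) (T (T b c) a) (T b (T c a))
           (\<alpha> b c a)
           (ucomp V C (T (T a b) c) (T a (T b c)) (T (T b c) a) (\<sigma> a (T b c)) (\<alpha> a b c)) =
         ucomp V C (T (T a b) c) (T b (T a c)) (T b (T c a))
           (tarr V M b b (T a c) (T c a) (unt C b) (\<sigma> a c))
           (ucomp V C (T (T a b) c) (T (T b a) c) (T b (T a c))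
             (\<alpha> b a c)
             (tarr V M (T a b) (T b a) c c (\<sigma> a b) (unt C c)))))"

definition strict_monoidal ::
  "('v, 'a) cartcat \<Rightarrow> ('o, 'v, 'a) vcat \<Rightarrow> ('o, 'v, 'a) symmon
     \<Rightarrow> ('p, 'v, 'a) vcat \<Rightarrow> ('p, 'v, 'a) symmon \<Rightarrow> ('o, 'p, 'v, 'a) vfun \<Rightarrow> bool" where
  "strict_monoidal V C M D N F \<longleftrightarrow>
     vfunctor V F \<and> fsrc F = C \<and> ftgt F = D \<and>
     vfun_comp V F (tens M) = vfun_comp V (tens N) (vfun_prod V F F) \<and>
     (\<forall>a\<in>ob C. \<forall>b\<in>ob C. \<forall>c\<in>ob C.
        fhm F (tob M (tob M a b) c) (tob M a (tob M b c)) \<cdot>\<^bsub>V\<^esub> ncomp (asc M) ((a, b), c) =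
        ncomp (asc N) ((fob F a, fob F b), fob F c)) \<and>
     (\<forall>a\<in>ob C. \<forall>b\<in>ob C.
        fhm F (tob M a b) (tob M b a) \<cdot>\<^bsub>V\<^esub> ncomp (symm M) (a, b) =
        ncomp (symm N) (fob F a, fob F b))"


section \<open>2-categories and 2-monads\<close>

text \<open>\<open>\<star>\<close> composes 1-cells, \<open>\<diamondop>\<close> is vertical and \<open>\<bowtie>\<close> horizontal composition of 2-cells.\<close>

record ('c, 'f, 't) twocat =
  cell0 :: "'c set"
  cell1 :: "'f set"
  cell2 :: "'t set"
  src1 :: "'f \<Rightarrow> 'c"
  tgt1 :: "'f \<Rightarrow> 'c"
  src2 :: "'t \<Rightarrow> 'f"
  tgt2 :: "'t \<Rightarrow> 'f"
  id1 :: "'c \<Rightarrow> 'f"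
  comp1 :: "'f \<Rightarrow> 'f \<Rightarrow> 'f"  (infixr "\<star>\<index>" 75)
  id2 :: "'f \<Rightarrow> 't"
  vcomp :: "'t \<Rightarrow> 't \<Rightarrow> 't"  (infixr "\<diamondop>\<index>" 75)
  hcomp :: "'t \<Rightarrow> 't \<Rightarrow> 't"  (infixr "\<bowtie>\<index>" 75)

definition one_cells :: "('c, 'f, 't) twocat \<Rightarrow> 'c \<Rightarrow> 'c \<Rightarrow> 'f set" where
  "one_cells K X Y = {f \<in> cell1 K. src1 K f = X \<and> tgt1 K f = Y}"

definition two_cells :: "('c, 'f, 't) twocat \<Rightarrow> 'f \<Rightarrow> 'f \<Rightarrow> 't set" where
  "two_cells K f g = {s \<in> cell2 K. src2 K s = f \<and> tgt2 K s = g}"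

locale two_category =
  fixes K :: "('c, 'f, 't) twocat" (structure)
  assumes one_cell: "f \<in> cell1 K \<Longrightarrow> src1 K f \<in> cell0 K \<and> tgt1 K f \<in> cell0 K"
    and two_cell: "s \<in> cell2 K \<Longrightarrow> src2 K s \<in> cell1 K \<and> tgt2 K s \<in> cell1 K \<and>
          src1 K (src2 K s) = src1 K (tgt2 K s) \<and> tgt1 K (src2 K s) = tgt1 K (tgt2 K s)"
    and id1_cell: "X \<in> cell0 K \<Longrightarrow> id1 K X \<in> one_cells K X X"
    and comp1_cell: "\<lbrakk>f \<in> one_cells K X Y; g \<in> one_cells K Y Z\<rbrakk> \<Longrightarrow> g \<star> f \<in> one_cells K X Z"
    and comp1_id1: "f \<in> one_cells K X Y \<Longrightarrow> f \<star> id1 K X = f"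
    and id1_comp1: "f \<in> one_cells K X Y \<Longrightarrow> id1 K Y \<star> f = f"
    and comp1_assoc: "\<lbrakk>f \<in> one_cells K W X; g \<in> one_cells K X Y; h \<in> one_cells K Y Z\<rbrakk>
          \<Longrightarrow> (h \<star> g) \<star> f = h \<star> (g \<star> f)"
    and id2_cell: "f \<in> cell1 K \<Longrightarrow> id2 K f \<in> two_cells K f f"
    and vcomp_cell: "\<lbrakk>s \<in> two_cells K f g; t \<in> two_cells K g h\<rbrakk> \<Longrightarrow> t \<diamondop> s \<in> two_cells K f h"
    and vcomp_id2: "s \<in> two_cells K f g \<Longrightarrow> s \<diamondop> id2 K f = s"
    and id2_vcomp: "s \<in> two_cells K f g \<Longrightarrow> id2 K g \<diamondop> s = s"
    and vcomp_assoc: "\<lbrakk>s \<in> two_cells K f g; t \<in> two_cells K g h; u \<in> two_cells K h k\<rbrakk>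
          \<Longrightarrow> (u \<diamondop> t) \<diamondop> s = u \<diamondop> (t \<diamondop> s)"
    and hcomp_cell: "\<lbrakk>s \<in> two_cells K f f'; t \<in> two_cells K g g'; tgt1 K f = src1 K g\<rbrakk>
          \<Longrightarrow> t \<bowtie> s \<in> two_cells K (g \<star> f) (g' \<star> f')"
    and hcomp_id2: "\<lbrakk>f \<in> one_cells K X Y; g \<in> one_cells K Y Z\<rbrakk>
          \<Longrightarrow> id2 K g \<bowtie> id2 K f = id2 K (g \<star> f)"
    and interchange: "\<lbrakk>s \<in> two_cells K f f'; s' \<in> two_cells K f' f'';
           t \<in> two_cells K g g'; t' \<in> two_cells K g' g''; tgt1 K f = src1 K g\<rbrakk>
          \<Longrightarrow> (t' \<diamondop> t) \<bowtie> (s' \<diamondop> s) = (t' \<bowtie> s') \<diamondop> (t \<bowtie> s)"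
    and hcomp_id1: "\<lbrakk>f \<in> one_cells K X Y; s \<in> two_cells K f g\<rbrakk> \<Longrightarrow> s \<bowtie> id2 K (id1 K X) = s"
    and id1_hcomp: "\<lbrakk>f \<in> one_cells K X Y; s \<in> two_cells K f g\<rbrakk> \<Longrightarrow> id2 K (id1 K Y) \<bowtie> s = s"
    and hcomp_assoc: "\<lbrakk>s \<in> two_cells K f f'; t \<in> two_cells K g g'; u \<in> two_cells K h h';
           tgt1 K f = src1 K g; tgt1 K g = src1 K h\<rbrakk>
          \<Longrightarrow> (u \<bowtie> t) \<bowtie> s = u \<bowtie> (t \<bowtie> s)"

record ('c, 'f, 't) monad_data =
  T0 :: "'c \<Rightarrow> 'c"
  T1 :: "'f \<Rightarrow> 'f"
  T2 :: "'t \<Rightarrow> 't"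
  mu :: "'c \<Rightarrow> 'f"
  eta :: "'c \<Rightarrow> 'f"

locale two_monad = two_category K
  for K :: "('c, 'f, 't) twocat" (structure) +
  fixes S :: "('c, 'f, 't) monad_data"
  assumes T0_cell: "X \<in> cell0 K \<Longrightarrow> T0 S X \<in> cell0 K"
    and T1_cell: "f \<in> one_cells K X Y \<Longrightarrow> T1 S f \<in> one_cells K (T0 S X) (T0 S Y)"
    and T2_cell: "s \<in> two_cells K f g \<Longrightarrow> T2 S s \<in> two_cells K (T1 S f) (T1 S g)"
    and T1_id1: "X \<in> cell0 K \<Longrightarrow> T1 S (id1 K X) = id1 K (T0 S X)"
    and T1_comp1: "\<lbrakk>f \<in> one_cells K X Y; g \<in> one_cells K Y Z\<rbrakk>
          \<Longrightarrow> T1 S (g \<star> f) = T1 S g \<star> T1 S f"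
    and T2_id2: "f \<in> cell1 K \<Longrightarrow> T2 S (id2 K f) = id2 K (T1 S f)"
    and T2_vcomp: "\<lbrakk>s \<in> two_cells K f g; t \<in> two_cells K g h\<rbrakk>
          \<Longrightarrow> T2 S (t \<diamondop> s) = T2 S t \<diamondop> T2 S s"
    and T2_hcomp: "\<lbrakk>s \<in> two_cells K f f'; t \<in> two_cells K g g'; tgt1 K f = src1 K g\<rbrakk>
          \<Longrightarrow> T2 S (t \<bowtie> s) = T2 S t \<bowtie> T2 S s"
    and mu_cell: "X \<in> cell0 K \<Longrightarrow> mu S X \<in> one_cells K (T0 S (T0 S X)) (T0 S X)"
    and eta_cell: "X \<in> cell0 K \<Longrightarrow> eta S X \<in> one_cells K X (T0 S X)"
    and mu_natural: "f \<in> one_cells K X Y \<Longrightarrow> mu S Y \<star> T1 S (T1 S f) = T1 S f \<star> mu S X"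
    and eta_natural: "f \<in> one_cells K X Y \<Longrightarrow> eta S Y \<star> f = T1 S f \<star> eta S X"
    and mu_natural2: "\<lbrakk>f \<in> one_cells K X Y; s \<in> two_cells K f g\<rbrakk>
          \<Longrightarrow> id2 K (mu S Y) \<bowtie> T2 S (T2 S s) = T2 S s \<bowtie> id2 K (mu S X)"
    and eta_natural2: "\<lbrakk>f \<in> one_cells K X Y; s \<in> two_cells K f g\<rbrakk>
          \<Longrightarrow> id2 K (eta S Y) \<bowtie> s = T2 S s \<bowtie> id2 K (eta S X)"
    and mu_assoc: "X \<in> cell0 K \<Longrightarrow> mu S X \<star> T1 S (mu S X) = mu S X \<star> mu S (T0 S X)"
    and mu_eta_T: "X \<in> cell0 K \<Longrightarrow> mu S X \<star> eta S (T0 S X) = id1 K (T0 S X)"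
    and mu_T_eta: "X \<in> cell0 K \<Longrightarrow> mu S X \<star> T1 S (eta S X) = id1 K (T0 S X)"

definition monad_algebra ::
  "('c, 'f, 't) twocat \<Rightarrow> ('c, 'f, 't) monad_data \<Rightarrow> 'c \<Rightarrow> 'f \<Rightarrow> bool" where
  "monad_algebra K S X h \<longleftrightarrow> X \<in> cell0 K \<and> h \<in> one_cells K (T0 S X) X \<and>
     h \<star>\<^bsub>K\<^esub> T1 S h = h \<star>\<^bsub>K\<^esub> mu S X \<and> h \<star>\<^bsub>K\<^esub> eta S X = id1 K X"

definition monad_algebra_morphism ::
  "('c, 'f, 't) twocat \<Rightarrow> ('c, 'f, 't) monad_data \<Rightarrow> 'c \<Rightarrow> 'f \<Rightarrow> 'c \<Rightarrow> 'f \<Rightarrow> 'f \<Rightarrow> bool" where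
  "monad_algebra_morphism K S X h Y g f \<longleftrightarrow>
     monad_algebra K S X h \<and> monad_algebra K S Y g \<and> f \<in> one_cells K X Y \<and>
     f \<star>\<^bsub>K\<^esub> h = g \<star>\<^bsub>K\<^esub> T1 S f"

definition VCat ::
  "'u univ \<Rightarrow> ('v, 'a) cartcat
     \<Rightarrow> (('u, 'v, 'a) vcat, ('u, 'u, 'v, 'a) vfun, ('u, 'u, 'v, 'a) vnat) twocat" where
  "VCat U V =
     (let small = (\<lambda>C. ob C \<in> Small U) in
     \<lparr>cell0 = {C. vcategory V C \<and> small C},
      cell1 = {F. vfunctor V F \<and> small (fsrc F) \<and> small (ftgt F)},
      cell2 = {t. vnatural V t \<and> small (fsrc (nsrc t)) \<and> small (ftgt (nsrc t))},
      src1 = fsrc, tgt1 = ftgt, src2 = nsrc, tgt2 = ntgt,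
      id1 = vfun_id V, comp1 = vfun_comp V,
      id2 = vnat_id, vcomp = vnat_vcomp V, hcomp = vnat_hcomp V\<rparr>)"

text \<open>
  The category of strict \<open>S\<close>-algebras is isomorphic, over the category of small \<open>V\<close>-categories
  and \<open>V\<close>-functors, to the category of small symmetric monoidal \<open>V\<close>-categories without unit and
  strict monoidal \<open>V\<close>-functors: algebra structures on each \<open>C\<close> correspond bijectively to symmetric
  monoidal structures on \<open>C\<close>, and under this correspondence the same \<open>V\<close>-functors are morphisms.
\<close>

definition algebras_are_symmetric_monoidal ::
  "'u univ \<Rightarrow> ('v, 'a) cartcat
     \<Rightarrow> (('u, 'v, 'a) vcat, ('u, 'u, 'v, 'a) vfun, ('u, 'u, 'v, 'a) vnat) monad_data \<Rightarrow> bool" where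
  "algebras_are_symmetric_monoidal U V S \<longleftrightarrow>
     (\<exists>\<Phi>. (\<forall>C\<in>cell0 (VCat U V).
              bij_betw (\<Phi> C) {h. monad_algebra (VCat U V) S C h} {M. symmetric_monoidal V C M}) \<and>
          (\<forall>C\<in>cell0 (VCat U V). \<forall>D\<in>cell0 (VCat U V). \<forall>h k F.
              monad_algebra (VCat U V) S C h \<longrightarrow> monad_algebra (VCat U V) S D k \<longrightarrow>
              (monad_algebra_morphism (VCat U V) S C h D k F \<longleftrightarrow>
               strict_monoidal V C (\<Phi> C h) D (\<Phi> D k) F)))"

end

theory Submission
 imports Defs
begin

text \<open>
 Both categories \<open>V\<close> have small coproducts that commute with products, and this is all that is used
 of them. The monad \<open>S\<close> sends \<open>C\<close> to the free symmetric monoidal \<open>V\<close>-category on \<open>C\<close>: its objects are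
 binary trees of objects of \<open>C\<close>, and the hom object from \<open>s\<close> to \<open>t\<close> is the coproduct, over the formal
 coherence isomorphisms \<open>e\<close> that move the leaves of \<open>s\<close> below those of \<open>t\<close>, of the products of the hom
 objects of \<open>C\<close> between corresponding leaves. Formal isomorphisms are taken modulo the axioms of symmetric
 monoidal categories, so that no coherence theorem is needed. The universal property of \<open>S C\<close>, with its
 uniqueness clause for functors and for monoidal transformations, gives the monad laws. An algebra structure
 on \<open>C\<close> is the same as the symmetric monoidal structure that it transports from \<open>S C\<close> to \<open>C\<close>.

 Since \<open>V\<close> need not be cartesian closed, equations between arrows of \<open>V\<close> are verified on generalised
 elements \<open>Z \<rightarrow> X\<close>, and often only on the elements of a family on which maps out of \<open>X\<close> are determined.
\<close>

section \<open>Generalised elements\<close>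

text \<open>Algebra laws are strict, so functors out of \<open>Fr C\<close> must be shown equal and
  not merely isomorphic. Unreduced trees make this possible: nothing is identified on objects, and a
  strict functor is determined there by recursion. The difficulty lies in composition, an arrow out
  of a product of two coproducts. Without exponentials it cannot be curried, so coproducts are
  required to be stable under multiplication by a parameter object, and this is used for one factor
  at a time. The composition rule itself comes from naturality, which moves every formal isomorphism
  in front of the arrows of \<open>C\<close>; an element of a single summand is thus one isomorphism
  followed by a tensor product of arrows. Formal isomorphisms are untyped terms, hence countably
  many whatever \<open>C\<close> is, and chosen representatives of their classes index the summands.
  The axioms of the transported structure on \<open>C\<close> are never checked in \<open>C\<close>
  itself: the unit is a section of the structure map, so every diagram in \<open>C\<close> is the
  image of one in the free category.\<close>

context cartesian_category
begin

section \<open>The calculus of tuples in a cartesian category\<close>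

lemma Hom_iff: "f \<in> Hom V X Y \<longleftrightarrow> f \<in> Arr V \<and> Dom V f = X \<and> Cod V f = Y"
 by (simp add: Hom_def)

lemma HomD:
 assumes "f \<in> Hom V X Y"
 shows "f \<in> Arr V" "Dom V f = X" "Cod V f = Y" "X \<in> Obj V" "Y \<in> Obj V"
 using assms Dom_Obj Cod_Obj by (auto simp: Hom_def)

lemma Comp_Arr [simp]:
 assumes "f \<in> Arr V" "g \<in> Arr V" "Dom V g = Cod V f"
 shows "g \<cdot> f \<in> Arr V" "Dom V (g \<cdot> f) = Dom V f" "Cod V (g \<cdot> f) = Cod V g"
 using Comp_Hom[of f "Dom V f" "Cod V f" g "Cod V g"] assms by (auto simp: Hom_def)

lemma Comp_assoc' [simp]:
 assumes "f \<in> Arr V" "g \<in> Arr V" "h \<in> Arr V" "Dom V g = Cod V f" "Dom V h = Cod V g"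
 shows "(h \<cdot> g) \<cdot> f = h \<cdot> g \<cdot> f"
 by (rule Comp_assoc) (use assms in \<open>auto simp: Hom_def\<close>)

lemma Ide_Arr [simp]:
 assumes "X \<in> Obj V"
 shows "Ide V X \<in> Arr V" "Dom V (Ide V X) = X" "Cod V (Ide V X) = X"
 using Ide_Hom[OF assms] by (auto simp: Hom_def)

lemma Comp_Ide' [simp]: "f \<in> Arr V ==> Dom V f = X ==> f \<cdot> Ide V X = f"
 using Comp_Ide by (auto simp: Hom_def)

lemma Ide_Comp' [simp]: "f \<in> Arr V ==> Cod V f = X ==> Ide V X \<cdot> f = f"
 using Ide_Comp by (auto simp: Hom_def)

lemma Pr_Arr [simp]:
 assumes "X \<in> Obj V" "Y \<in> Obj V"
 shows "Pr1 V X Y \<in> Arr V" "Dom V (Pr1 V X Y) = Prod V X Y" "Cod V (Pr1 V X Y) = X"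
  "Pr2 V X Y \<in> Arr V" "Dom V (Pr2 V X Y) = Prod V X Y" "Cod V (Pr2 V X Y) = Y"
 using Pr1_Hom[OF assms] Pr2_Hom[OF assms] by (auto simp: Hom_def)

lemma Obj_simps [simp]:
 "Term V \<in> Obj V" "X \<in> Obj V ==> Y \<in> Obj V ==> Prod V X Y \<in> Obj V"
 "f \<in> Arr V ==> Dom V f \<in> Obj V" "f \<in> Arr V ==> Cod V f \<in> Obj V"
 by (simp_all add: Term_Obj Prod_Obj Dom_Obj Cod_Obj)

lemma Tuple_Arr [simp]:
 assumes "f \<in> Arr V" "g \<in> Arr V" "Dom V f = Dom V g"
 shows "Tuple V f g \<in> Arr V" "Dom V (Tuple V f g) = Dom V g"
  "Cod V (Tuple V f g) = Prod V (Cod V f) (Cod V g)"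
 using Tuple_Hom[of f "Dom V f" "Cod V f" g "Cod V g"] assms by (auto simp: Hom_def)

lemma Pr_Tuple [simp]:
 assumes "f \<in> Arr V" "g \<in> Arr V" "Dom V f = Dom V g" "Cod V f = X" "Cod V g = Y"
 shows "Pr1 V X Y \<cdot> Tuple V f g = f" "Pr2 V X Y \<cdot> Tuple V f g = g"
 using Pr1_Tuple[of f "Dom V f" X g Y] Pr2_Tuple[of f "Dom V f" X g Y] assms
 by (auto simp: Hom_def)

lemma Tuple_eta:
 assumes "k \<in> Arr V" "Cod V k = Prod V X Y" "X \<in> Obj V" "Y \<in> Obj V"
 shows "Tuple V (Pr1 V X Y \<cdot> k) (Pr2 V X Y \<cdot> k) = k"
 using Tuple_unique[of X Y k "Dom V k"] assms by (auto simp: Hom_def)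

lemma Tuple_inject:
 assumes "Tuple V f g = Tuple V f' g'" "f \<in> Arr V" "g \<in> Arr V" "Dom V f = Dom V g"
  "f' \<in> Arr V" "g' \<in> Arr V" "Dom V f' = Dom V g'" "Cod V f = Cod V f'" "Cod V g = Cod V g'"
 shows "f = f'" "g = g'"
proof -
 have "f = Pr1 V (Cod V f) (Cod V g) \<cdot> Tuple V f g" "g = Pr2 V (Cod V f) (Cod V g) \<cdot> Tuple V f g"
  using assms(2-4) by simp_all
 moreover have "f' = Pr1 V (Cod V f) (Cod V g) \<cdot> Tuple V f' g'" "g' = Pr2 V (Cod V f) (Cod V g) \<cdot> Tuple V f' g'"
  using assms(5-9) by simp_all
 ultimately show "f = f'" "g = g'" using assms(1) by simp_all
qed

lemma Tuple_Pr [simp]: "X \<in> Obj V ==> Y \<in> Obj V ==> Tuple V (Pr1 V X Y) (Pr2 V X Y) = Ide V (Prod V X Y)"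
 using Tuple_eta[of "Ide V (Prod V X Y)" X Y] by simp

lemma Tuple_Comp [simp]:
 assumes "f \<in> Arr V" "g \<in> Arr V" "Dom V f = Dom V g" "k \<in> Arr V" "Cod V k = Dom V g"
 shows "Tuple V f g \<cdot> k = Tuple V (f \<cdot> k) (g \<cdot> k)"
proof -
 have "Pr1 V (Cod V f) (Cod V g) \<cdot> Tuple V f g \<cdot> k = f \<cdot> k"
  "Pr2 V (Cod V f) (Cod V g) \<cdot> Tuple V f g \<cdot> k = g \<cdot> k"
  using assms by (simp_all flip: Comp_assoc')
 then show ?thesis
  using Tuple_eta[of "Tuple V f g \<cdot> k" "Cod V f" "Cod V g"] assms by simp
qed

lemma Tuple_cases:
 assumes "k \<in> Arr V" "Cod V k = Prod V X Y" "X \<in> Obj V" "Y \<in> Obj V"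
 obtains x y where "k = Tuple V x y" "x \<in> Arr V" "y \<in> Arr V" "Dom V x = Dom V k" "Dom V y = Dom V k"
  "Cod V x = X" "Cod V y = Y"
 by (rule that[of "Pr1 V X Y \<cdot> k" "Pr2 V X Y \<cdot> k"]) (use assms in \<open>simp_all add: Tuple_eta\<close>)

lemma Bang_Hom: "X \<in> Obj V ==> Bang V X \<in> Hom V X (Term V)"
 unfolding Bang_def by (rule theI') (rule Term_universal)

lemma Bang_Arr [simp]:
 assumes "X \<in> Obj V"
 shows "Bang V X \<in> Arr V" "Dom V (Bang V X) = X" "Cod V (Bang V X) = Term V"
 using Bang_Hom[OF assms] by (auto simp: Hom_def)

lemma Bang_unique: "f \<in> Arr V ==> Cod V f = Term V ==> f = Bang V (Dom V f)"
 using Term_universal[of "Dom V f"] Bang_Hom[of "Dom V f"] by (auto simp: Hom_def)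

lemma Bang_Comp [simp]: "f \<in> Arr V ==> Cod V f = X ==> Bang V X \<cdot> f = Bang V (Dom V f)"
 using Bang_unique[of "Bang V X \<cdot> f"] by auto

lemma Bang_Term [simp]: "Bang V (Term V) = Ide V (Term V)"
 using Bang_unique[of "Ide V (Term V)"] by simp

lemma Times_Arr [simp]:
 assumes "f \<in> Arr V" "g \<in> Arr V"
 shows "Times V f g \<in> Arr V" "Dom V (Times V f g) = Prod V (Dom V f) (Dom V g)"
  "Cod V (Times V f g) = Prod V (Cod V f) (Cod V g)"
 using assms by (simp_all add: Times_def)

lemma Times_Tuple [simp]:
 assumes "f \<in> Arr V" "g \<in> Arr V" "x \<in> Arr V" "y \<in> Arr V" "Dom V x = Dom V y"
  "Cod V x = Dom V f" "Cod V y = Dom V g"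
 shows "Times V f g \<cdot> Tuple V x y = Tuple V (f \<cdot> x) (g \<cdot> y)"
 using assms by (simp add: Times_def)

lemma Assoc_Arr [simp]:
 assumes "X \<in> Obj V" "Y \<in> Obj V" "Z \<in> Obj V"
 shows "Assoc V X Y Z \<in> Arr V" "Dom V (Assoc V X Y Z) = Prod V (Prod V X Y) Z"
  "Cod V (Assoc V X Y Z) = Prod V X (Prod V Y Z)"
 using assms by (simp_all add: Assoc_def Let_def)

lemma Assoc_Tuple [simp]:
 assumes "x \<in> Arr V" "y \<in> Arr V" "z \<in> Arr V" "Dom V x = Dom V z" "Dom V y = Dom V z"
  "Cod V x = X" "Cod V y = Y" "Cod V z = Z"
 shows "Assoc V X Y Z \<cdot> Tuple V (Tuple V x y) z = Tuple V x (Tuple V y z)"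
proof -
 have "X \<in> Obj V" "Y \<in> Obj V" "Z \<in> Obj V" using assms by auto
 with assms show ?thesis by (simp add: Assoc_def Let_def)
qed

lemma Swap_Arr [simp]:
 assumes "X \<in> Obj V" "Y \<in> Obj V"
 shows "Swap V X Y \<in> Arr V" "Dom V (Swap V X Y) = Prod V X Y" "Cod V (Swap V X Y) = Prod V Y X"
 using assms by (simp_all add: Swap_def)

lemma Swap_Tuple [simp]:
 assumes "x \<in> Arr V" "y \<in> Arr V" "Dom V x = Dom V y" "Cod V x = X" "Cod V y = Y"
 shows "Swap V X Y \<cdot> Tuple V x y = Tuple V y x"
proof -
 have "X \<in> Obj V" "Y \<in> Obj V" using assms by auto
 with assms show ?thesis by (simp add: Swap_def)
qed

section \<open>Dense families of elements\<close>

text \<open>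
 A sieve-like family of generalised elements of \<open>X\<close> is dense if it suffices to test equality of
 maps out of \<open>X\<close> on it. The parameter object \<open>W\<close> makes density stable under products even though
 \<open>V\<close> is not assumed to be cartesian closed.
\<close>

definition dense :: "'v => 'a set => bool" where
 "dense X A \<longleftrightarrow> X \<in> Obj V \<and> (\<forall>x\<in>A. x \<in> Arr V \<and> Cod V x = X) \<and>
   (\<forall>x\<in>A. \<forall>k\<in>Arr V. Cod V k = Dom V x --> x \<cdot> k \<in> A) \<and>
   (\<forall>W\<in>Obj V. \<forall>f\<in>Arr V. \<forall>g\<in>Arr V.
    Dom V f = Prod V X W --> Dom V g = Prod V X W --> Cod V f = Cod V g -->
    (\<forall>x\<in>A. \<forall>w\<in>Arr V. Dom V w = Dom V x --> Cod V w = W --> f \<cdot> Tuple V x w = g \<cdot> Tuple V x w)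
    --> f = g)"

lemma denseD:
 assumes "dense X A"
 shows "X \<in> Obj V" "x \<in> A ==> x \<in> Arr V" "x \<in> A ==> Cod V x = X"
  "x \<in> A ==> k \<in> Arr V ==> Cod V k = Dom V x ==> x \<cdot> k \<in> A"
 using assms unfolding dense_def by auto

lemma dense_eq2:
 assumes "dense X A" "f \<in> Hom V (Prod V X W) Y" "g \<in> Hom V (Prod V X W) Y" "W \<in> Obj V"
  and "\<And>x w. x \<in> A ==> w \<in> Arr V ==> Dom V w = Dom V x ==> Cod V w = W
      ==> f \<cdot> Tuple V x w = g \<cdot> Tuple V x w"
 shows "f = g"
 using assms unfolding dense_def Hom_iff by metis

text \<open>The case of a trivial parameter: \<open>W\<close> is the terminal object, and pairing
  the identity with the unique map removes it again.\<close>

lemma dense_eq: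
 assumes A: "dense X A" and f: "f \<in> Hom V X Y" and g: "g \<in> Hom V X Y"
  and eq: "\<And>x. x \<in> A ==> f \<cdot> x = g \<cdot> x"
 shows "f = g"
proof -
 note X = denseD(1)[OF A] and d = denseD(2,3)[OF A]
 have "f \<cdot> Pr1 V X (Term V) = g \<cdot> Pr1 V X (Term V)"
  by (rule dense_eq2[OF A, where W = "Term V" and Y = Y]) (use X f g d eq in \<open>simp_all add: Hom_iff\<close>)
 then have "(f \<cdot> Pr1 V X (Term V)) \<cdot> Tuple V (Ide V X) (Bang V X)
       = (g \<cdot> Pr1 V X (Term V)) \<cdot> Tuple V (Ide V X) (Bang V X)" by simp
 with X f g show ?thesis by (simp add: Hom_iff)
qed

text \<open>The generic element is the first projection of \<open>Prod V X W\<close>, paired with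
  the second projection; this pair is the identity, so testing on it alone suffices.\<close>

lemma dense_all: "X \<in> Obj V ==> dense X {x \<in> Arr V. Cod V x = X}"
 unfolding dense_def
proof (safe; (simp; fail)?)
 fix W f g assume a: "X \<in> Obj V" "W \<in> Obj V" "f \<in> Arr V" "g \<in> Arr V" "Dom V f = Prod V X W" "Dom V g = Prod V X W"
  "\<forall>x\<in>{x \<in> Arr V. Cod V x = X}. \<forall>w\<in>Arr V. Dom V w = Dom V x --> Cod V w = W --> f \<cdot> Tuple V x w = g \<cdot> Tuple V x w"
 from a(7)[rule_format, of "Pr1 V X W" "Pr2 V X W"] a show "f = g" by simp
qed

definition tuples :: "'a set => 'a set => 'a set" where
 "tuples A B = {Tuple V x y | x y. x \<in> A \<and> y \<in> B \<and> Dom V x = Dom V y}"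

text \<open>Density is used in one variable at a time: everything else, including the stage at which
  the other variable lives, is packed into the parameter object. This is what the parameter in
  \<open>dense\<close> is for.\<close>

lemma dense_tuples:
 assumes A: "dense X A" and B: "dense Y B"
 shows "dense (Prod V X Y) (tuples A B)"
 unfolding dense_def
proof (intro conjI ballI impI allI)
 note a = denseD[OF A] and b = denseD[OF B]
 show "Prod V X Y \<in> Obj V" using a b by simp
 fix p assume "p \<in> tuples A B"
 then obtain x y where p: "p = Tuple V x y" "x \<in> A" "y \<in> B" "Dom V x = Dom V y"
  by (auto simp: tuples_def)
 then show "p \<in> Arr V" "Cod V p = Prod V X Y" using a b by simp_all
 fix k assume "k \<in> Arr V" "Cod V k = Dom V p"
 then have "p \<cdot> k = Tuple V (x \<cdot> k) (y \<cdot> k)" "x \<cdot> k \<in> A" "y \<cdot> k \<in> B" "Dom V (x \<cdot> k) = Dom V (y \<cdot> k)"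
  using p a(2-4) b(2-4) by simp_all
 then show "p \<cdot> k \<in> tuples A B" unfolding tuples_def by blast
next
 note a = denseD[OF A] and b = denseD[OF B]
 fix W f g assume W: "W \<in> Obj V" and f: "f \<in> Arr V" "Dom V f = Prod V (Prod V X Y) W"
  and g: "g \<in> Arr V" "Dom V g = Prod V (Prod V X Y) W" and fg: "Cod V f = Cod V g"
  and eq: "\<forall>x\<in>tuples A B. \<forall>w\<in>Arr V. Dom V w = Dom V x --> Cod V w = W -->
   f \<cdot> Tuple V x w = g \<cdot> Tuple V x w"
 have eq': "f \<cdot> Tuple V (Tuple V x y) w = g \<cdot> Tuple V (Tuple V x y) w"
  if "x \<in> A" "y \<in> B" "w \<in> Arr V" "Dom V x = Dom V y" "Dom V w = Dom V y" "Cod V w = W" for x y w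
  using that a(2,3) b(2,3) by (intro eq[rule_format]) (simp_all add: tuples_def, blast)
 have 1: "f \<cdot> Tuple V (Tuple V x y) w = g \<cdot> Tuple V (Tuple V x y) w"
  if x: "x \<in> A" and yw: "y \<in> Arr V" "w \<in> Arr V" "Dom V x = Dom V y" "Dom V w = Dom V y" "Cod V y = Y" "Cod V w = W" for x y w
 proof -
  \<comment> \<open>The fixed element \<open>x\<close> lives over its own stage, so that stage is
    adjoined to the parameter: \<open>?r\<close> sends (y, (w, z)) to ((x z, y), w). Closure of
    \<open>A\<close> under change of stage makes x z admissible.\<close>
  let ?Z = "Dom V x" let ?q = "Pr2 V Y (Prod V W (Dom V x))"
  have o: "?Z \<in> Obj V" "Prod V W ?Z \<in> Obj V" using a x W by simp_all
  let ?r = "Tuple V (Tuple V (x \<cdot> Pr2 V W ?Z \<cdot> ?q) (Pr1 V Y (Prod V W ?Z))) (Pr1 V W ?Z \<cdot> ?q)"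
  note r = a(1) b(1) W o x a(2)[OF x] a(3)[OF x] f g fg
  have "f \<cdot> ?r = g \<cdot> ?r"
  proof (rule dense_eq2[OF B _ _ o(2)])
   show "f \<cdot> ?r \<in> Hom V (Prod V Y (Prod V W ?Z)) (Cod V g)" "g \<cdot> ?r \<in> Hom V (Prod V Y (Prod V W ?Z)) (Cod V g)"
    using r by (simp_all add: Hom_iff)
   fix v u assume v: "v \<in> B" and u: "u \<in> Arr V" "Dom V u = Dom V v" "Cod V u = Prod V W ?Z"
   from u obtain w z where u': "u = Tuple V w z" "w \<in> Arr V" "z \<in> Arr V" "Dom V w = Dom V v" "Dom V z = Dom V v"
    "Cod V w = W" "Cod V z = ?Z" using Tuple_cases[of u W ?Z] W o(1) by metis
   have "f \<cdot> Tuple V (Tuple V (x \<cdot> z) v) w = g \<cdot> Tuple V (Tuple V (x \<cdot> z) v) w"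
    by (rule eq') (use u' v x a in simp_all)
   then show "(f \<cdot> ?r) \<cdot> Tuple V v u = (g \<cdot> ?r) \<cdot> Tuple V v u"
    using r u' v b by simp
  qed
  \<comment> \<open>Evaluating at the identity of \<open>?Z\<close> recovers \<open>x\<close>
    itself.\<close>
  then have "(f \<cdot> ?r) \<cdot> Tuple V y (Tuple V w (Ide V ?Z)) = (g \<cdot> ?r) \<cdot> Tuple V y (Tuple V w (Ide V ?Z))"
   by simp
  then show ?thesis using yw r by simp
 qed
 \<comment> \<open>Here \<open>?r\<close> is the inverse of the associativity isomorphism; it brings
   the triple product into the form in which density of \<open>A\<close> applies, with
   \<open>?P\<close> as parameter.\<close>
 let ?P = "Prod V Y W" let ?q = "Pr2 V X ?P"
 let ?r = "Tuple V (Tuple V (Pr1 V X ?P) (Pr1 V Y W \<cdot> ?q)) (Pr2 V Y W \<cdot> ?q)"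
 note r = a(1) b(1) W f g fg
 have P: "?P \<in> Obj V" using r by simp
 have "f \<cdot> ?r = g \<cdot> ?r"
 proof (rule dense_eq2[OF A _ _ P])
  show "f \<cdot> ?r \<in> Hom V (Prod V X ?P) (Cod V g)" "g \<cdot> ?r \<in> Hom V (Prod V X ?P) (Cod V g)"
   using r P by (simp_all add: Hom_iff)
  fix v u assume v: "v \<in> A" and u: "u \<in> Arr V" "Dom V u = Dom V v" "Cod V u = ?P"
  from u obtain y w where u': "u = Tuple V y w" "w \<in> Arr V" "y \<in> Arr V" "Dom V w = Dom V v" "Dom V y = Dom V v"
   "Cod V w = W" "Cod V y = Y" using Tuple_cases[of u Y W] W b(1) by metis
  have "f \<cdot> Tuple V (Tuple V v y) w = g \<cdot> Tuple V (Tuple V v y) w"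
   by (rule 1) (use u' v a in simp_all)
  then show "(f \<cdot> ?r) \<cdot> Tuple V v u = (g \<cdot> ?r) \<cdot> Tuple V v u"
   using r P u' v a by simp
 qed
 then have "(f \<cdot> ?r) \<cdot> Assoc V X Y W = (g \<cdot> ?r) \<cdot> Assoc V X Y W" by simp
 moreover have "?r \<cdot> Assoc V X Y W = Ide V (Prod V (Prod V X Y) W)"
  using r P by (simp add: Assoc_def Let_def Tuple_eta)
 ultimately show "f = g" using r P by simp
qed

end

section \<open>Enriched categories in terms of generalised elements\<close>

lemma vfun_eqI:
 assumes "fsrc F = fsrc G" "ftgt F = ftgt G" "\<And>a. fob F a = fob G a" "\<And>a b. fhm F a b = fhm G a b"
 shows "F = (G :: ('o, 'p, 'v, 'a) vfun)"
 using assms by (intro vfun.equality) (auto simp: fun_eq_iff)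

lemma vnat_eqI:
 assumes "nsrc s = nsrc t" "ntgt s = ntgt t" "\<And>a. ncomp s a = ncomp t a"
 shows "s = (t :: ('o, 'p, 'v, 'a) vnat)"
 using assms by (intro vnat.equality) (auto simp: fun_eq_iff)

context cartesian_category
begin

text \<open>Morphisms from \<open>a\<close> to \<open>b\<close> at stage \<open>Z\<close>. For each
  \<open>Z\<close> they form an ordinary category under \<open>ucomp\<close> and \<open>uid\<close>,
  so that diagrams in an enriched category can be chased as ordinary ones.\<close>

abbreviation El :: "('o, 'v, 'a) vcat => 'v => 'o => 'o => 'a set" where
 "El C Z a b \<equiv> Hom V Z (hm C a b)"

definition uid :: "('o, 'v, 'a) vcat => 'v => 'o => 'a" where
 "uid C Z a = unt C a \<cdot> Bang V Z"

lemma vcatD: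
 assumes "vcategory V C"
 shows "a \<in> ob C ==> b \<in> ob C ==> hm C a b \<in> Obj V"
  "[|a \<in> ob C; b \<in> ob C; c \<in> ob C|] ==> cmp C a b c \<in> El C (Prod V (hm C b c) (hm C a b)) a c"
  "a \<in> ob C ==> unt C a \<in> El C (Term V) a a"
  "\<not> (a \<in> ob C \<and> b \<in> ob C) ==> hm C a b = undefined"
  "\<not> (a \<in> ob C \<and> b \<in> ob C \<and> c \<in> ob C) ==> cmp C a b c = undefined"
  "a \<notin> ob C ==> unt C a = undefined"
 using assms unfolding vcategory_def by blast+

lemma hm_Obj [simp]: "vcategory V C ==> a \<in> ob C ==> b \<in> ob C ==> hm C a b \<in> Obj V"
 by (rule vcatD)

lemma unt_Hom [simp]: "vcategory V C ==> a \<in> ob C ==> unt C a \<in> El C (Term V) a a"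
 by (rule vcatD)

lemma uid_Hom [simp]: "vcategory V C ==> a \<in> ob C ==> Z \<in> Obj V ==> uid C Z a \<in> El C Z a a"
 unfolding uid_def by (rule Comp_Hom[OF Bang_Hom vcatD(3)])

lemma uid_Term [simp]: "vcategory V C ==> a \<in> ob C ==> uid C (Term V) a = unt C a"
 using vcatD(3)[of C a] by (simp add: uid_def Hom_iff)

lemma uid_Comp [simp]:
 assumes "vcategory V C" "a \<in> ob C" "k \<in> Hom V Z' Z"
 shows "uid C Z a \<cdot> k = uid C Z' a"
 using vcatD(3)[OF assms(1,2)] HomD[OF assms(3)] by (simp add: uid_def Hom_iff)

lemma ucomp_Hom [simp]:
 assumes "vcategory V C" "a \<in> ob C" "b \<in> ob C" "c \<in> ob C"
  "g \<in> El C Z b c" "f \<in> El C Z a b"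
 shows "ucomp V C a b c g f \<in> El C Z a c"
 using vcatD(2)[of C a b c] assms by (auto simp: ucomp_def Hom_iff)

lemma ucomp_Comp [simp]:
 assumes "vcategory V C" "a \<in> ob C" "b \<in> ob C" "c \<in> ob C"
  "g \<in> El C Z b c" "f \<in> El C Z a b" "k \<in> Hom V Z' Z"
 shows "ucomp V C a b c g f \<cdot> k = ucomp V C a b c (g \<cdot> k) (f \<cdot> k)"
 using vcatD(2)[of C a b c] assms by (auto simp: ucomp_def Hom_iff)

text \<open>The associativity axiom equates two arrows out of a triple product; both are evaluated
  at the element ((\<open>h\<close>, \<open>g\<close>), \<open>f\<close>).\<close>

lemma ucomp_assoc:
 assumes C: "vcategory V C" and o: "a \<in> ob C" "b \<in> ob C" "c \<in> ob C" "d \<in> ob C"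
  and h: "h \<in> El C Z c d" "g \<in> El C Z b c" "f \<in> El C Z a b"
 shows "ucomp V C a b d (ucomp V C b c d h g) f = ucomp V C a c d h (ucomp V C a b c g f)"
proof -
 have "cmp C a b d \<cdot> Times V (cmp C b c d) (Ide V (hm C a b)) =
    cmp C a c d \<cdot> Times V (Ide V (hm C c d)) (cmp C a b c)
          \<cdot> Assoc V (hm C c d) (hm C b c) (hm C a b)"
  using C o unfolding vcategory_def by blast
 then have "(cmp C a b d \<cdot> Times V (cmp C b c d) (Ide V (hm C a b))) \<cdot> Tuple V (Tuple V h g) f =
    (cmp C a c d \<cdot> Times V (Ide V (hm C c d)) (cmp C a b c)
          \<cdot> Assoc V (hm C c d) (hm C b c) (hm C a b)) \<cdot> Tuple V (Tuple V h g) f" by simp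
 moreover note vcatD(2)[OF C] vcatD(1)[OF C] o h HomD(4)[OF h(1)]
 ultimately show ?thesis by (simp add: ucomp_def Hom_iff)
qed

lemma ucomp_uid [simp]:
 assumes C: "vcategory V C" and o: "a \<in> ob C" "b \<in> ob C" and f: "f \<in> El C Z a b"
 shows "ucomp V C a b b (uid C Z b) f = f" "ucomp V C a a b f (uid C Z a) = f"
proof -
 have "cmp C a b b \<cdot> Times V (unt C b) (Ide V (hm C a b)) = Pr2 V (Term V) (hm C a b)"
  "cmp C a a b \<cdot> Times V (Ide V (hm C a b)) (unt C a) = Pr1 V (hm C a b) (Term V)"
  using C o unfolding vcategory_def by blast+
 then have "(cmp C a b b \<cdot> Times V (unt C b) (Ide V (hm C a b))) \<cdot> Tuple V (Bang V Z) f
       = Pr2 V (Term V) (hm C a b) \<cdot> Tuple V (Bang V Z) f"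
  "(cmp C a a b \<cdot> Times V (Ide V (hm C a b)) (unt C a)) \<cdot> Tuple V f (Bang V Z)
       = Pr1 V (hm C a b) (Term V) \<cdot> Tuple V f (Bang V Z)"
  by simp_all
 moreover note vcatD(2)[OF C] vcatD(1)[OF C] vcatD(3)[OF C] o f HomD(4)[OF f]
 ultimately show "ucomp V C a b b (uid C Z b) f = f" "ucomp V C a a b f (uid C Z a) = f"
  by (simp_all add: ucomp_def uid_def Hom_iff)
qed

lemma ucomp_unt [simp]:
 assumes "vcategory V C" "a \<in> ob C" "b \<in> ob C" "f \<in> El C (Term V) a b"
 shows "ucomp V C a b b (unt C b) f = f" "ucomp V C a a b f (unt C a) = f"
 using ucomp_uid[OF assms] assms by simp_all

text \<open>For an arbitrary category all elements serve as such a family; for the free category it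
  will consist of the elements that come from single summands.\<close>

definition dfam :: "('o, 'v, 'a) vcat => ('o => 'o => 'a set) => bool" where
 "dfam C A \<longleftrightarrow> (\<forall>a\<in>ob C. \<forall>b\<in>ob C. dense (hm C a b) (A a b))"

definition elements :: "('o, 'v, 'a) vcat => 'o => 'o => 'a set" where
 "elements C a b = {x \<in> Arr V. Cod V x = hm C a b}"

lemma dfam_elements: "vcategory V C ==> dfam C (elements C)"
 by (simp add: dfam_def elements_def dense_all)

lemma dfam_Hom:
 "dfam C A ==> a \<in> ob C ==> b \<in> ob C ==> f \<in> A a b ==> Dom V f = Z ==> f \<in> El C Z a b"
 by (auto simp: dfam_def Hom_iff dest: denseD)

text \<open>Converse of the evaluation lemmas: an axiom is an equation between arrows out of a
  product of hom objects, and tuples of dense elements are dense there by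
  \<open>dense_tuples\<close>.\<close>

lemma vcategoryI:
 assumes A: "dfam C A"
  and cmp: "\<And>a b c. [|a \<in> ob C; b \<in> ob C; c \<in> ob C|]
   ==> cmp C a b c \<in> El C (Prod V (hm C b c) (hm C a b)) a c"
  and unt: "\<And>a. a \<in> ob C ==> unt C a \<in> El C (Term V) a a"
  and assoc: "\<And>a b c d f g h Z. [|a \<in> ob C; b \<in> ob C; c \<in> ob C; d \<in> ob C;
   h \<in> A c d; g \<in> A b c; f \<in> A a b; Dom V h = Z; Dom V g = Z; Dom V f = Z|]
   ==> ucomp V C a b d (ucomp V C b c d h g) f = ucomp V C a c d h (ucomp V C a b c g f)"
  and unl: "\<And>a b f Z. [|a \<in> ob C; b \<in> ob C; f \<in> A a b; Dom V f = Z|]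
   ==> ucomp V C a b b (uid C Z b) f = f"
  and unr: "\<And>a b f Z. [|a \<in> ob C; b \<in> ob C; f \<in> A a b; Dom V f = Z|]
   ==> ucomp V C a a b f (uid C Z a) = f"
  and und: "\<And>a b. \<not> (a \<in> ob C \<and> b \<in> ob C) ==> hm C a b = undefined"
   "\<And>a b c. \<not> (a \<in> ob C \<and> b \<in> ob C \<and> c \<in> ob C) ==> cmp C a b c = undefined"
   "\<And>a. a \<notin> ob C ==> unt C a = undefined"
 shows "vcategory V C"
 unfolding vcategory_def
proof (intro conjI ballI allI impI)
 have D: "dense (hm C a b) (A a b)" if "a \<in> ob C" "b \<in> ob C" for a b
  using A that by (simp add: dfam_def)
 note hm = denseD(1)[OF D]
 have cmp': "cmp C a b c \<in> Arr V \<and> Dom V (cmp C a b c) = Prod V (hm C b c) (hm C a b) \<and>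
  Cod V (cmp C a b c) = hm C a c" if "a \<in> ob C" "b \<in> ob C" "c \<in> ob C" for a b c
  using cmp[OF that] by (simp add: Hom_iff)
 have unt': "unt C a \<in> Arr V \<and> Dom V (unt C a) = Term V \<and> Cod V (unt C a) = hm C a a" if "a \<in> ob C" for a
  using unt[OF that] by (simp add: Hom_iff)
 have el: "f \<in> Arr V \<and> Cod V f = hm C a b" if "a \<in> ob C" "b \<in> ob C" "f \<in> A a b" for a b f
  using denseD(2,3)[OF D] that by blast
 fix a b assume ab: "a \<in> ob C" "b \<in> ob C"
 show "hm C a b \<in> Obj V" using hm ab .
 show "cmp C a b b \<cdot> Times V (unt C b) (Ide V (hm C a b)) = Pr2 V (Term V) (hm C a b)"
 proof (rule dense_eq[OF dense_tuples[OF dense_all[OF Term_Obj] D[OF ab]]])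
  fix x assume "x \<in> tuples {x \<in> Arr V. Cod V x = Term V} (A a b)"
  then obtain t f where x: "x = Tuple V t f" "f \<in> A a b" "t \<in> Arr V" "Cod V t = Term V" "Dom V t = Dom V f"
   by (auto simp: tuples_def)
  with Bang_unique[of t] have "t = Bang V (Dom V f)" by simp
  with x show "(cmp C a b b \<cdot> Times V (unt C b) (Ide V (hm C a b))) \<cdot> x = Pr2 V (Term V) (hm C a b) \<cdot> x"
   using ab cmp' unt' hm el[OF ab] unl[OF ab] by (simp add: ucomp_def uid_def)
 qed (use ab cmp' unt' hm in \<open>simp_all add: Hom_iff\<close>)
 show "cmp C a a b \<cdot> Times V (Ide V (hm C a b)) (unt C a) = Pr1 V (hm C a b) (Term V)"
 proof (rule dense_eq[OF dense_tuples[OF D[OF ab] dense_all[OF Term_Obj]]])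
  fix x assume "x \<in> tuples (A a b) {x \<in> Arr V. Cod V x = Term V}"
  then obtain t f where x: "x = Tuple V f t" "f \<in> A a b" "t \<in> Arr V" "Cod V t = Term V" "Dom V t = Dom V f"
   by (auto simp: tuples_def)
  with Bang_unique[of t] have "t = Bang V (Dom V f)" by simp
  with x show "(cmp C a a b \<cdot> Times V (Ide V (hm C a b)) (unt C a)) \<cdot> x = Pr1 V (hm C a b) (Term V) \<cdot> x"
   using ab cmp' unt' hm el[OF ab] unr[OF ab] by (simp add: ucomp_def uid_def)
 qed (use ab cmp' unt' hm in \<open>simp_all add: Hom_iff\<close>)
 fix c assume c: "c \<in> ob C"
 fix d assume d: "d \<in> ob C"
 show "cmp C a b d \<cdot> Times V (cmp C b c d) (Ide V (hm C a b)) =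
    cmp C a c d \<cdot> Times V (Ide V (hm C c d)) (cmp C a b c)
          \<cdot> Assoc V (hm C c d) (hm C b c) (hm C a b)"
 proof (rule dense_eq[OF dense_tuples[OF dense_tuples[OF D[OF c d] D[OF ab(2) c]] D[OF ab]]])
  fix x assume "x \<in> tuples (tuples (A c d) (A b c)) (A a b)"
  then obtain h g f where x: "x = Tuple V (Tuple V h g) f" "h \<in> A c d" "g \<in> A b c" "f \<in> A a b"
   "Dom V h = Dom V g" "Dom V (Tuple V h g) = Dom V f"
   by (auto simp: tuples_def)
  then have "Dom V g = Dom V f" using ab c d el by simp
  with x show "(cmp C a b d \<cdot> Times V (cmp C b c d) (Ide V (hm C a b))) \<cdot> x =
    (cmp C a c d \<cdot> Times V (Ide V (hm C c d)) (cmp C a b c)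
          \<cdot> Assoc V (hm C c d) (hm C b c) (hm C a b)) \<cdot> x"
   using ab c d cmp' hm el assoc[of a b c d h g f "Dom V f"] by (simp add: ucomp_def)
 qed (use ab c d cmp' hm in \<open>simp_all add: Hom_iff\<close>)
qed (simp_all add: cmp unt und)

section \<open>Enriched functors on elements\<close>

lemma vfunD:
 assumes "vfunctor V F"
 shows "vcategory V (fsrc F)" "vcategory V (ftgt F)"
  "a \<in> ob (fsrc F) ==> fob F a \<in> ob (ftgt F)"
  "a \<in> ob (fsrc F) ==> b \<in> ob (fsrc F) ==>
   fhm F a b \<in> El (ftgt F) (hm (fsrc F) a b) (fob F a) (fob F b)"
  "a \<notin> ob (fsrc F) ==> fob F a = undefined"
  "\<not> (a \<in> ob (fsrc F) \<and> b \<in> ob (fsrc F)) ==> fhm F a b = undefined"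
 using assms unfolding vfunctor_def Let_def PiE_iff extensional_def by blast+

lemma vfun_fob [simp]: "vfunctor V F ==> fsrc F = C ==> ftgt F = D ==> a \<in> ob C ==> fob F a \<in> ob D"
 using vfunD(3)[of F a] by simp

lemma vfun_app [simp]:
 assumes "vfunctor V F" "fsrc F = C" "ftgt F = D" "a \<in> ob C" "b \<in> ob C" "f \<in> El C Z a b"
 shows "fhm F a b \<cdot> f \<in> El D Z (fob F a) (fob F b)"
 using vfunD(4)[of F a b] assms by (simp add: Hom_iff)

lemma vfun_app_Comp [simp]:
 assumes "vfunctor V F" "fsrc F = C" "a \<in> ob C" "b \<in> ob C" "f \<in> El C Z a b"
  "k \<in> Hom V Z' Z"
 shows "(fhm F a b \<cdot> f) \<cdot> k = fhm F a b \<cdot> f \<cdot> k"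
 using vfunD(4)[of F a b] assms by (simp add: Hom_iff)

lemma vfun_ucomp [simp]:
 assumes F: "vfunctor V F" "fsrc F = C" "ftgt F = D" and o: "a \<in> ob C" "b \<in> ob C" "c \<in> ob C"
  and g: "g \<in> El C Z b c" "f \<in> El C Z a b"
 shows "fhm F a c \<cdot> ucomp V C a b c g f =
  ucomp V D (fob F a) (fob F b) (fob F c) (fhm F b c \<cdot> g) (fhm F a b \<cdot> f)"
proof -
 have "fhm F a c \<cdot> cmp C a b c =
     cmp D (fob F a) (fob F b) (fob F c) \<cdot> Times V (fhm F b c) (fhm F a b)"
  using F o unfolding vfunctor_def Let_def by simp
 then have "(fhm F a c \<cdot> cmp C a b c) \<cdot> Tuple V g f =
     (cmp D (fob F a) (fob F b) (fob F c) \<cdot> Times V (fhm F b c) (fhm F a b)) \<cdot> Tuple V g f" by simp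
 moreover have "vcategory V C" "vcategory V D" using vfunD(1,2)[OF F(1)] F by simp_all
 moreover note vcatD(1,2)[OF this(1)] vcatD(1,2)[OF this(2)] vfunD(3,4)[OF F(1)]
 ultimately show ?thesis using F o g by (simp add: Hom_iff ucomp_def)
qed

lemma vfun_unt [simp]:
 assumes "vfunctor V F" "fsrc F = C" "ftgt F = D" "a \<in> ob C"
 shows "fhm F a a \<cdot> unt C a = unt D (fob F a)"
 using assms unfolding vfunctor_def Let_def by simp

lemma vfun_uid [simp]:
 assumes F: "vfunctor V F" "fsrc F = C" "ftgt F = D" and o: "a \<in> ob C" and Z: "Z \<in> Obj V"
 shows "fhm F a a \<cdot> uid C Z a = uid D Z (fob F a)"
proof -
 have C: "vcategory V C" using vfunD(1)[OF F(1)] F by simp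
 have "fhm F a a \<cdot> uid C Z a = (fhm F a a \<cdot> unt C a) \<cdot> Bang V Z"
  unfolding uid_def using vcatD(3)[OF C o] vfunD(4)[OF F(1), of a a] F o Z by (simp add: Hom_iff del: vfun_unt)
 also have "\<dots> = uid D Z (fob F a)" using vfun_unt[OF F o] by (simp add: uid_def)
 finally show ?thesis .
qed

text \<open>Preservation of composition is an equation between arrows out of a product of two hom
  objects, hence may be tested on pairs of dense elements.\<close>

lemma vfunctorI:
 assumes C: "vcategory V (fsrc F)" "vcategory V (ftgt F)" and A: "dfam (fsrc F) A"
  and fob: "\<And>a. a \<in> ob (fsrc F) ==> fob F a \<in> ob (ftgt F)"
  and fhm: "\<And>a b. [|a \<in> ob (fsrc F); b \<in> ob (fsrc F)|]
   ==> fhm F a b \<in> El (ftgt F) (hm (fsrc F) a b) (fob F a) (fob F b)"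
  and comp: "\<And>a b c f g Z. [|a \<in> ob (fsrc F); b \<in> ob (fsrc F); c \<in> ob (fsrc F);
   g \<in> A b c; f \<in> A a b; Dom V g = Z; Dom V f = Z|]
   ==> fhm F a c \<cdot> ucomp V (fsrc F) a b c g f =
    ucomp V (ftgt F) (fob F a) (fob F b) (fob F c) (fhm F b c \<cdot> g) (fhm F a b \<cdot> f)"
  and unt: "\<And>a. a \<in> ob (fsrc F) ==> fhm F a a \<cdot> unt (fsrc F) a = unt (ftgt F) (fob F a)"
  and und: "\<And>a. a \<notin> ob (fsrc F) ==> fob F a = undefined"
   "\<And>a b. \<not> (a \<in> ob (fsrc F) \<and> b \<in> ob (fsrc F)) ==> fhm F a b = undefined"
 shows "vfunctor V F"
proof -
 have D: "dense (hm (fsrc F) a b) (A a b)" if "a \<in> ob (fsrc F)" "b \<in> ob (fsrc F)" for a b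
  using A that by (simp add: dfam_def)
 note d = denseD[OF D]
 have "fhm F a c \<cdot> cmp (fsrc F) a b c =
     cmp (ftgt F) (fob F a) (fob F b) (fob F c) \<cdot> Times V (fhm F b c) (fhm F a b)"
  if o: "a \<in> ob (fsrc F)" "b \<in> ob (fsrc F)" "c \<in> ob (fsrc F)" for a b c
 proof (rule dense_eq[OF dense_tuples[OF D[OF o(2,3)] D[OF o(1,2)]]])
  note t = fob[OF o(1)] fob[OF o(2)] fob[OF o(3)] fhm[OF o(2,3)] fhm[OF o(1,2)] fhm[OF o(1,3)]
   vcatD(1,2)[OF C(1)] vcatD(1,2)[OF C(2)] o
  show "fhm F a c \<cdot> cmp (fsrc F) a b c \<in> El (ftgt F) (Prod V (hm (fsrc F) b c) (hm (fsrc F) a b)) (fob F a) (fob F c)"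
   "cmp (ftgt F) (fob F a) (fob F b) (fob F c) \<cdot> Times V (fhm F b c) (fhm F a b)
    \<in> El (ftgt F) (Prod V (hm (fsrc F) b c) (hm (fsrc F) a b)) (fob F a) (fob F c)"
   using t by (simp_all add: Hom_iff)
  fix x assume "x \<in> tuples (A b c) (A a b)"
  then obtain g f where x: "x = Tuple V g f" "g \<in> A b c" "f \<in> A a b" "Dom V g = Dom V f"
   by (auto simp: tuples_def)
  moreover have "g \<in> Arr V" "f \<in> Arr V" "Cod V g = hm (fsrc F) b c" "Cod V f = hm (fsrc F) a b"
   using d(2,3)[OF o(2,3) x(2)] d(2,3)[OF o(1,2) x(3)] by simp_all
  ultimately show "(fhm F a c \<cdot> cmp (fsrc F) a b c) \<cdot> x =
     (cmp (ftgt F) (fob F a) (fob F b) (fob F c) \<cdot> Times V (fhm F b c) (fhm F a b)) \<cdot> x"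
   using comp[OF o x(2,3,4) refl] t by (simp add: Hom_iff ucomp_def)
 qed
 then show ?thesis
  unfolding vfunctor_def Let_def PiE_iff extensional_def
  using C fob fhm unt und by blast
qed

text \<open>Functors are \<open>undefined\<close> off their domains, so records are equal as soon as
  they agree inside; there the arrows on hom objects are compared on dense elements.\<close>

lemma vfunctor_eqI:
 assumes "vfunctor V F" "vfunctor V G" "fsrc F = fsrc G" "ftgt F = ftgt G" "dfam (fsrc G) A"
  and ob: "\<And>a. a \<in> ob (fsrc G) ==> fob F a = fob G a"
  and hm: "\<And>a b f Z. a \<in> ob (fsrc G) ==> b \<in> ob (fsrc G) ==> f \<in> A a b ==> f \<in> El (fsrc G) Z a b
   ==> fhm F a b \<cdot> f = fhm G a b \<cdot> f"
 shows "F = G"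
proof (rule vfun_eqI)
 show ob': "fob F a = fob G a" for a
  using assms vfunD(5)[of F a] vfunD(5)[of G a] by (cases "a \<in> ob (fsrc G)") simp_all
 show "fhm F a b = fhm G a b" for a b
 proof (cases "a \<in> ob (fsrc G) \<and> b \<in> ob (fsrc G)")
  case True
  then have "dense (hm (fsrc G) a b) (A a b)" using assms by (simp add: dfam_def)
  moreover have "fhm F a b \<in> El (ftgt G) (hm (fsrc G) a b) (fob G a) (fob G b)"
   "fhm G a b \<in> El (ftgt G) (hm (fsrc G) a b) (fob G a) (fob G b)"
   using vfunD(4)[OF assms(1), of a b] vfunD(4)[OF assms(2), of a b] True assms(3,4) ob' by simp_all
  ultimately show ?thesis
   by (rule dense_eq) (rule hm[OF _ _ _ dfam_Hom[OF assms(5) _ _ _ refl]]; use True in simp)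
 next
  case False
  then show ?thesis using vfunD(6)[OF assms(1), of a b] vfunD(6)[OF assms(2), of a b] assms(3) by simp
 qed
qed (use assms(3,4) in auto)

section \<open>Enriched natural transformations on elements\<close>

lemma natD:
 assumes "vnatural V t"
 shows "vfunctor V (nsrc t)" "vfunctor V (ntgt t)" "fsrc (ntgt t) = fsrc (nsrc t)" "ftgt (ntgt t) = ftgt (nsrc t)"
  "a \<in> ob (fsrc (nsrc t)) ==> ncomp t a \<in> El (ftgt (nsrc t)) (Term V) (fob (nsrc t) a) (fob (ntgt t) a)"
  "a \<notin> ob (fsrc (nsrc t)) ==> ncomp t a = undefined"
 using assms unfolding vnatural_def Let_def extensional_def by blast+

lemma ncomp_Hom [simp]:
 assumes "vnatural V t" "nsrc t = F" "ntgt t = G" "fsrc F = C" "ftgt F = D" "a \<in> ob C"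
 shows "ncomp t a \<in> El D (Term V) (fob F a) (fob G a)"
 using natD(5)[of t a] assms by simp

text \<open>Composing with the map from \<open>Z\<close> to the terminal object turns a morphism of
  the underlying category into a constant morphism at stage \<open>Z\<close>.\<close>

lemma stage_Hom [simp]:
 "f \<in> Hom V (Term V) X ==> Z \<in> Obj V ==> f \<cdot> Bang V Z \<in> Hom V Z X"
 by (simp add: Hom_iff)

lemma stage_Comp [simp]:
 "f \<in> Hom V (Term V) X ==> k \<in> Hom V Z' Z ==> (f \<cdot> Bang V Z) \<cdot> k = f \<cdot> Bang V Z'"
 by (auto simp: Hom_iff)

lemma stage_Term [simp]: "f \<in> Hom V (Term V) X ==> f \<cdot> Ide V (Term V) = f"
 by (simp add: Hom_iff)

text \<open>\<open>vnatural\<close> states the square at the universal element, the identity of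
  \<open>hm C a b\<close>; composing with \<open>f\<close> gives the square at
  \<open>f\<close>.\<close>

lemma nat_sq:
 assumes t: "vnatural V t" "nsrc t = F" "ntgt t = G" "fsrc F = C" "ftgt F = D"
  and o: "a \<in> ob C" "b \<in> ob C" and f: "f \<in> El C Z a b"
 shows "ucomp V D (fob F a) (fob F b) (fob G b) (ncomp t b \<cdot> Bang V Z) (fhm F a b \<cdot> f) =
     ucomp V D (fob F a) (fob G a) (fob G b) (fhm G a b \<cdot> f) (ncomp t a \<cdot> Bang V Z)"
proof -
 have F: "vfunctor V F" "vfunctor V G" "fsrc G = C" "ftgt G = D" using natD(1-4)[OF t(1)] t by simp_all
 have cd: "vcategory V C" "vcategory V D" using vfunD(1,2)[OF F(1)] t by simp_all
 have "ucomp V D (fob F a) (fob F b) (fob G b) (ncomp t b \<cdot> Bang V (hm C a b)) (fhm F a b) =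
     ucomp V D (fob F a) (fob G a) (fob G b) (fhm G a b) (ncomp t a \<cdot> Bang V (hm C a b))"
  using t o unfolding vnatural_def Let_def by simp
 then have "ucomp V D (fob F a) (fob F b) (fob G b) (ncomp t b \<cdot> Bang V (hm C a b)) (fhm F a b) \<cdot> f =
     ucomp V D (fob F a) (fob G a) (fob G b) (fhm G a b) (ncomp t a \<cdot> Bang V (hm C a b)) \<cdot> f" by simp
 moreover have "fhm F a b \<in> El D (hm C a b) (fob F a) (fob F b)"
   "fhm G a b \<in> El D (hm C a b) (fob G a) (fob G b)"
  using vfunD(4)[OF F(1), of a b] vfunD(4)[OF F(2), of a b] F t o by simp_all
 moreover note ncomp_Hom[OF t o(1)] ncomp_Hom[OF t o(2)] hm_Obj[OF cd(1) o]
 ultimately show ?thesis using t o F f cd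
  by (simp add: ucomp_Comp[OF _ _ _ _ _ _ f] stage_Comp[OF _ f] del: ucomp_Comp stage_Comp)
qed

lemma nat_sq_Term:
 assumes t: "vnatural V t" "nsrc t = F" "ntgt t = G" "fsrc F = C" "ftgt F = D"
  and o: "a \<in> ob C" "b \<in> ob C" and f: "f \<in> El C (Term V) a b"
 shows "ucomp V D (fob F a) (fob F b) (fob G b) (ncomp t b) (fhm F a b \<cdot> f) =
     ucomp V D (fob F a) (fob G a) (fob G b) (fhm G a b \<cdot> f) (ncomp t a)"
proof -
 have "ncomp t a \<in> El D (Term V) (fob F a) (fob G a)" "ncomp t b \<in> El D (Term V) (fob F b) (fob G b)"
  using ncomp_Hom[OF t o(1)] ncomp_Hom[OF t o(2)] by simp_all
 with nat_sq[OF assms] show ?thesis by (simp add: Hom_iff)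
qed

text \<open>For fixed \<open>a\<close> and \<open>b\<close>, naturality equates two arrows out of
  \<open>hm C a b\<close>, so a dense family detects it.\<close>

lemma vnaturalI:
 assumes F: "vfunctor V F" "vfunctor V G" "fsrc F = C" "ftgt F = D" "fsrc G = C" "ftgt G = D"
  and t: "nsrc t = F" "ntgt t = G" and A: "dfam C A"
  and ty: "\<And>a. a \<in> ob C ==> ncomp t a \<in> El D (Term V) (fob F a) (fob G a)"
  and sq: "\<And>a b f Z. a \<in> ob C ==> b \<in> ob C ==> f \<in> A a b ==> Dom V f = Z ==>
   ucomp V D (fob F a) (fob F b) (fob G b) (ncomp t b \<cdot> Bang V Z) (fhm F a b \<cdot> f) =
     ucomp V D (fob F a) (fob G a) (fob G b) (fhm G a b \<cdot> f) (ncomp t a \<cdot> Bang V Z)"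
  and und: "\<And>a. a \<notin> ob C ==> ncomp t a = undefined"
 shows "vnatural V t"
proof -
 have cd: "vcategory V C" "vcategory V D" using vfunD(1,2)[OF F(1)] F by simp_all
 have "ucomp V D (fob F a) (fob F b) (fob G b) (ncomp t b \<cdot> Bang V (hm C a b)) (fhm F a b) =
     ucomp V D (fob F a) (fob G a) (fob G b) (fhm G a b) (ncomp t a \<cdot> Bang V (hm C a b))"
  if o: "a \<in> ob C" "b \<in> ob C" for a b
 proof (rule dense_eq)
  let ?X = "hm C a b"
  note ty' = ty[OF o(1)] ty[OF o(2)]
  have o': "?X \<in> Obj V" using o cd by simp
  have h: "fhm F a b \<in> El D (hm C a b) (fob F a) (fob F b)"
   "fhm G a b \<in> El D (hm C a b) (fob G a) (fob G b)"
   using vfunD(4)[OF F(1), of a b] vfunD(4)[OF F(2), of a b] F o by simp_all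
  show "dense (hm C a b) (A a b)" using A o by (simp add: dfam_def)
  show "ucomp V D (fob F a) (fob F b) (fob G b) (ncomp t b \<cdot> Bang V (hm C a b)) (fhm F a b) \<in> El D ?X (fob F a) (fob G b)"
   by (rule ucomp_Hom[OF cd(2)]) (use F o h ty' o' in simp_all)
  show "ucomp V D (fob F a) (fob G a) (fob G b) (fhm G a b) (ncomp t a \<cdot> Bang V (hm C a b)) \<in> El D ?X (fob F a) (fob G b)"
   by (rule ucomp_Hom[OF cd(2)]) (use F o h ty' o' in simp_all)
  fix f assume f: "f \<in> A a b"
  have f': "f \<in> Hom V (Dom V f) ?X" using dfam_Hom[OF A o f] by simp
  have "ucomp V D (fob F a) (fob F b) (fob G b) (ncomp t b \<cdot> Bang V (hm C a b)) (fhm F a b) \<cdot> f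
   = ucomp V D (fob F a) (fob F b) (fob G b) ((ncomp t b \<cdot> Bang V (hm C a b)) \<cdot> f) (fhm F a b \<cdot> f)"
   by (rule ucomp_Comp[OF cd(2) _ _ _ _ _ f']) (use F o h ty' o' in simp_all)
  also have "\<dots> = ucomp V D (fob F a) (fob G a) (fob G b) (fhm G a b \<cdot> f) ((ncomp t a \<cdot> Bang V (hm C a b)) \<cdot> f)"
   using stage_Comp[OF ty'(1) f'] stage_Comp[OF ty'(2) f'] sq[OF o f refl] by simp
  also have "\<dots> = ucomp V D (fob F a) (fob G a) (fob G b) (fhm G a b) (ncomp t a \<cdot> Bang V (hm C a b)) \<cdot> f"
   by (rule ucomp_Comp[OF cd(2) _ _ _ _ _ f', symmetric]) (use F o h ty' o' in simp_all)
  finally show "ucomp V D (fob F a) (fob F b) (fob G b) (ncomp t b \<cdot> Bang V (hm C a b)) (fhm F a b) \<cdot> f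
   = ucomp V D (fob F a) (fob G a) (fob G b) (fhm G a b) (ncomp t a \<cdot> Bang V (hm C a b)) \<cdot> f" .
 qed
 then show ?thesis unfolding vnatural_def Let_def extensional_def using F t ty und by simp
qed

lemma vnatural_eqI:
 assumes "vnatural V s" "vnatural V t" "nsrc s = nsrc t" "ntgt s = ntgt t"
  "\<And>a. a \<in> ob (fsrc (nsrc t)) ==> ncomp s a = ncomp t a"
 shows "s = t"
proof (rule vnat_eqI)
 show "ncomp s a = ncomp t a" for a
  using assms natD(6)[of s a] natD(6)[of t a] by (cases "a \<in> ob (fsrc (nsrc t))") auto
qed (use assms in auto)

end

section \<open>The 2-category of enriched categories\<close>

context cartesian_category
begin

abbreviation oo :: "('p, 'q, 'v, 'a) vfun => ('o, 'p, 'v, 'a) vfun => ('o, 'q, 'v, 'a) vfun"  (infixr "oo" 75) where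
 "G oo F \<equiv> vfun_comp V G F"

declare Bang_Hom [simp]

section \<open>Identity and composite functors\<close>

lemma vfun_id_simps [simp]:
 "fsrc (vfun_id V C) = C" "ftgt (vfun_id V C) = C" "a \<in> ob C ==> fob (vfun_id V C) a = a"
 "a \<in> ob C ==> b \<in> ob C ==> fhm (vfun_id V C) a b = Ide V (hm C a b)"
 by (simp_all add: vfun_id_def)

lemma Ide_app [simp]: "f \<in> Hom V Z X ==> Ide V X \<cdot> f = f"
 by (simp add: Ide_Comp)

lemma vfunctor_id [simp]:
 assumes C: "vcategory V C"
 shows "vfunctor V (vfun_id V C)"
proof (rule vfunctorI[where A = "elements C"])
 fix a assume "a \<in> ob (fsrc (vfun_id V C))"
 then have a: "a \<in> ob C" by simp
 show "fhm (vfun_id V C) a a \<cdot> unt (fsrc (vfun_id V C)) a = unt (ftgt (vfun_id V C)) (fob (vfun_id V C) a)"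
  using a unt_Hom[OF C a] by simp
 fix b assume "b \<in> ob (fsrc (vfun_id V C))"
 then have b: "b \<in> ob C" by simp
 show "fhm (vfun_id V C) a b \<in> El (ftgt (vfun_id V C)) (hm (fsrc (vfun_id V C)) a b) (fob (vfun_id V C) a) (fob (vfun_id V C) b)"
  using a b C by (simp add: Ide_Hom)
 fix c f g Z assume "c \<in> ob (fsrc (vfun_id V C))" "g \<in> elements C b c" "f \<in> elements C a b" "Dom V g = Z" "Dom V f = Z"
 then have c: "c \<in> ob C" and f: "f \<in> El C Z a b" "g \<in> El C Z b c"
  by (simp_all add: elements_def Hom_iff)
 have "ucomp V C a b c g f \<in> El C Z a c" using C a b c f by simp
 then show "fhm (vfun_id V C) a c \<cdot> ucomp V (fsrc (vfun_id V C)) a b c g f =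
    ucomp V (ftgt (vfun_id V C)) (fob (vfun_id V C) a) (fob (vfun_id V C) b) (fob (vfun_id V C) c)
    (fhm (vfun_id V C) b c \<cdot> g) (fhm (vfun_id V C) a b \<cdot> f)"
  using a b c f by simp
qed (use C in \<open>auto simp: dfam_elements vfun_id_def\<close>)

lemma vfun_comp_simps [simp]:
 "fsrc (G oo F) = fsrc F" "ftgt (G oo F) = ftgt G"
 "a \<in> ob (fsrc F) ==> fob (G oo F) a = fob G (fob F a)"
 by (simp_all add: vfun_comp_def Let_def compose_def)

lemma vfun_comp_fhm:
 "a \<in> ob (fsrc F) ==> b \<in> ob (fsrc F) ==>
  fhm (G oo F) a b = fhm G (fob F a) (fob F b) \<cdot> fhm F a b"
 by (simp add: vfun_comp_def Let_def)

lemma vfun_comp_app [simp]: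
 assumes F: "vfunctor V F" "fsrc F = C" and G: "vfunctor V G" "fsrc G = ftgt F"
  and o: "a \<in> ob C" "b \<in> ob C" and f: "f \<in> El C Z a b"
 shows "fhm (G oo F) a b \<cdot> f = fhm G (fob F a) (fob F b) \<cdot> fhm F a b \<cdot> f"
proof -
 have "fhm F a b \<in> El (ftgt F) (hm C a b) (fob F a) (fob F b)"
  using vfunD(4)[OF F(1), of a b] o F by simp
 moreover have "fhm G (fob F a) (fob F b) \<in> El (ftgt G) (hm (ftgt F) (fob F a) (fob F b)) (fob G (fob F a)) (fob G (fob F b))"
  using vfunD(4)[OF G(1), of "fob F a" "fob F b"] o F G by simp
 ultimately show ?thesis using o F f by (simp add: vfun_comp_fhm Hom_iff)
qed

lemma vfunctor_comp [simp]:
 assumes F: "vfunctor V F" and G: "vfunctor V G" "fsrc G = ftgt F"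
 shows "vfunctor V (G oo F)"
proof (rule vfunctorI[where A = "elements (fsrc F)"])
 note C = vfunD(1,2)[OF F] vfunD(2)[OF G(1)]
 show "vcategory V (fsrc (G oo F))" "vcategory V (ftgt (G oo F))"
  "dfam (fsrc (G oo F)) (elements (fsrc F))"
  using C by (simp_all add: dfam_elements)
 fix a assume "a \<in> ob (fsrc (G oo F))"
 then have a: "a \<in> ob (fsrc F)" by simp
 show "fob (G oo F) a \<in> ob (ftgt (G oo F))"
  using a F G by simp
 have u: "unt (fsrc F) a \<in> El (fsrc F) (Term V) a a" using a C by simp
 then show "fhm (G oo F) a a \<cdot> unt (fsrc (G oo F)) a = unt (ftgt (G oo F)) (fob (G oo F) a)"
  using a F G by simp
 fix b assume "b \<in> ob (fsrc (G oo F))"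
 then have b: "b \<in> ob (fsrc F)" by simp
 show "fhm (G oo F) a b
  \<in> El (ftgt (G oo F)) (hm (fsrc (G oo F)) a b) (fob (G oo F) a) (fob (G oo F) b)"
  using vfun_app[OF G(1,2) refl _ _ vfunD(4)[OF F a b]] F a b by (simp add: vfun_comp_fhm)
 fix c f g Z assume "c \<in> ob (fsrc (G oo F))" "g \<in> elements (fsrc F) b c" "f \<in> elements (fsrc F) a b"
  "Dom V g = Z" "Dom V f = Z"
 then have c: "c \<in> ob (fsrc F)" and f: "f \<in> El (fsrc F) Z a b" "g \<in> El (fsrc F) Z b c"
  by (auto simp: elements_def Hom_iff)
 have "ucomp V (fsrc F) a b c g f \<in> El (fsrc F) Z a c" using C a b c f by simp
 then show "fhm (G oo F) a c \<cdot> ucomp V (fsrc (G oo F)) a b c g f =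
    ucomp V (ftgt (G oo F)) (fob (G oo F) a) (fob (G oo F) b)
    (fob (G oo F) c) (fhm (G oo F) b c \<cdot> g) (fhm (G oo F) a b \<cdot> f)"
  using a b c f F G C by (simp add: vfun_ucomp[where Z = Z] vfun_comp_app[where Z = Z])
qed (auto simp: vfun_comp_def Let_def compose_def)

lemma vfunctor_eqI':
 assumes "vfunctor V F" "vfunctor V G" "fsrc F = C" "fsrc G = C" "ftgt F = ftgt G"
  and ob: "\<And>a. a \<in> ob C ==> fob F a = fob G a"
  and hm: "\<And>a b f Z. a \<in> ob C ==> b \<in> ob C ==> f \<in> El C Z a b
   ==> fhm F a b \<cdot> f = fhm G a b \<cdot> f"
 shows "F = G"
 by (rule vfunctor_eqI[OF assms(1,2), where A = "elements C"])
  (use assms vfunD(1)[OF assms(1)] in \<open>auto simp: dfam_elements\<close>)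

lemma vfun_comp_assoc:
 assumes "vfunctor V F" "vfunctor V G" "vfunctor V H" "fsrc G = ftgt F" "fsrc H = ftgt G"
 shows "(H oo G) oo F = H oo (G oo F)"
proof (rule vfunctor_eqI'[where C = "fsrc F"])
 fix a b f Z assume "a \<in> ob (fsrc F)" "b \<in> ob (fsrc F)" "f \<in> El (fsrc F) Z a b"
 then show "fhm ((H oo G) oo F) a b \<cdot> f = fhm (H oo (G oo F)) a b \<cdot> f"
  using assms by (simp add: vfun_comp_app[where Z = Z] vfun_app[where Z = Z])
qed (use assms in simp_all)

lemma vfun_comp_id [simp]:
 assumes F: "vfunctor V F" "fsrc F = C"
 shows "F oo vfun_id V C = F"
proof (rule vfunctor_eqI'[where C = C])
 have C: "vcategory V C" using vfunD[OF F(1)] F by simp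
 show "vfunctor V (F oo vfun_id V C)" using C F by simp
 fix a b f Z assume "a \<in> ob C" "b \<in> ob C" "f \<in> El C Z a b"
 then show "fhm (F oo vfun_id V C) a b \<cdot> f = fhm F a b \<cdot> f"
  using F C by (simp add: vfun_comp_app[where Z = Z])
qed (use assms in simp_all)

lemma vfun_id_comp [simp]:
 assumes F: "vfunctor V F" "ftgt F = D"
 shows "vfun_id V D oo F = F"
proof (rule vfunctor_eqI'[where C = "fsrc F"])
 have C: "vcategory V D" using vfunD[OF F(1)] F by simp
 show "vfunctor V (vfun_id V D oo F)" using C F by simp
 fix a b f Z assume "a \<in> ob (fsrc F)" "b \<in> ob (fsrc F)" "f \<in> El (fsrc F) Z a b"
 then show "fhm (vfun_id V D oo F) a b \<cdot> f = fhm F a b \<cdot> f"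
  using F C Ide_app[OF vfun_app[OF F(1) refl F(2), of a b f Z]] by (simp add: vfun_comp_app[where Z = Z])
qed (use assms in simp_all)

section \<open>Vertical and horizontal composition of transformations\<close>

lemma vnat_simps [simp]:
 "nsrc (vnat_id F) = F" "ntgt (vnat_id F) = F" "a \<in> ob (fsrc F) ==> ncomp (vnat_id F) a = unt (ftgt F) (fob F a)"
 "nsrc (vnat_vcomp V s t) = nsrc t" "ntgt (vnat_vcomp V s t) = ntgt s"
 "a \<in> ob (fsrc (nsrc t)) ==> ncomp (vnat_vcomp V s t) a =
   ucomp V (ftgt (nsrc t)) (fob (nsrc t) a) (fob (ntgt t) a) (fob (ntgt s) a) (ncomp s a) (ncomp t a)"
 "nsrc (vnat_hcomp V u v) = nsrc u oo nsrc v"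
 "ntgt (vnat_hcomp V u v) = ntgt u oo ntgt v"
 by (simp_all add: vnat_id_def vnat_vcomp_def vnat_hcomp_def Let_def)

lemma vnat_hcomp_ncomp:
 "nsrc t = F ==> nsrc s = G ==> ntgt t = F' ==> ntgt s = G' ==> a \<in> ob (fsrc F) ==> ncomp (vnat_hcomp V s t) a =
   ucomp V (ftgt G) (fob G (fob F a)) (fob G (fob F' a)) (fob G' (fob F' a))
      (ncomp s (fob F' a)) (fhm G (fob F a) (fob F' a) \<cdot> ncomp t a)"
 by (simp add: vnat_hcomp_def Let_def)

lemma stage_ucomp [simp]:
 assumes "vcategory V C" "a \<in> ob C" "b \<in> ob C" "c \<in> ob C"
  "g \<in> El C (Term V) b c" "f \<in> El C (Term V) a b" "Z \<in> Obj V"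
 shows "ucomp V C a b c g f \<cdot> Bang V Z = ucomp V C a b c (g \<cdot> Bang V Z) (f \<cdot> Bang V Z)"
 by (rule ucomp_Comp[OF assms(1-6) Bang_Hom[OF assms(7)]])

text \<open>Two squares in the category of morphisms at stage \<open>Z\<close>, glued along
  \<open>f'\<close>.\<close>

lemma paste_vertical:
 assumes D: "vcategory V D" and o: "a \<in> ob D" "a' \<in> ob D" "a'' \<in> ob D" "b \<in> ob D" "b' \<in> ob D" "b'' \<in> ob D"
  and ty: "f \<in> El D Z a b" "f' \<in> El D Z a' b'" "f'' \<in> El D Z a'' b''"
   "u \<in> El D Z a a'" "u' \<in> El D Z a' a''"
   "v \<in> El D Z b b'" "v' \<in> El D Z b' b''"
  and sq: "ucomp V D a b b' v f = ucomp V D a a' b' f' u"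
   "ucomp V D a' b' b'' v' f' = ucomp V D a' a'' b'' f'' u'"
 shows "ucomp V D a b b'' (ucomp V D b b' b'' v' v) f = ucomp V D a a'' b'' f'' (ucomp V D a a' a'' u' u)"
proof -
 have "ucomp V D a b b'' (ucomp V D b b' b'' v' v) f = ucomp V D a b' b'' v' (ucomp V D a a' b' f' u)"
  using ucomp_assoc[OF D o(1,4,5,6) ty(7,6,1)] sq(1) by simp
 also have "\<dots> = ucomp V D a a' b'' (ucomp V D a' a'' b'' f'' u') u"
  using ucomp_assoc[OF D o(1,2,5,6) ty(7,2,4)] sq(2) by simp
 also have "\<dots> = ucomp V D a a'' b'' f'' (ucomp V D a a' a'' u' u)"
  by (rule ucomp_assoc[OF D o(1,2,3,6) ty(3,5,4)])
 finally show ?thesis .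
qed

text \<open>The transpose of \<open>paste_vertical\<close>: the two directions are exchanged, so the
  squares are glued along \<open>v\<close>.\<close>

lemma paste_horizontal:
 assumes D: "vcategory V D" and o: "a \<in> ob D" "b \<in> ob D" "c \<in> ob D" "a' \<in> ob D" "b' \<in> ob D" "c' \<in> ob D"
  and ty: "f \<in> El D Z a b" "g \<in> El D Z b c" "f' \<in> El D Z a' b'"
   "g' \<in> El D Z b' c'" "u \<in> El D Z a a'" "v \<in> El D Z b b'"
   "w \<in> El D Z c c'"
  and sq: "ucomp V D a b b' v f = ucomp V D a a' b' f' u"
   "ucomp V D b c c' w g = ucomp V D b b' c' g' v"
 shows "ucomp V D a c c' w (ucomp V D a b c g f) = ucomp V D a a' c' (ucomp V D a' b' c' g' f') u"
 by (rule paste_vertical[OF D o(1,2,3,4,5,6) ty(5,6,7,1,2,3,4) sq(1)[symmetric] sq(2)[symmetric], symmetric])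

lemma stage_unt: "unt C a \<cdot> Bang V Z = uid C Z a"
 by (simp add: uid_def)

lemma stage_app [simp]:
 assumes "vfunctor V F" "fsrc F = C" "a \<in> ob C" "b \<in> ob C" "f \<in> El C (Term V) a b" "Z \<in> Obj V"
 shows "(fhm F a b \<cdot> f) \<cdot> Bang V Z = fhm F a b \<cdot> f \<cdot> Bang V Z"
 by (rule vfun_app_Comp[OF assms(1-5) Bang_Hom[OF assms(6)]])

lemma vnatural_id [simp]:
 assumes F: "vfunctor V F" shows "vnatural V (vnat_id F)"
proof (rule vnaturalI[OF F F refl refl refl refl, where A = "elements (fsrc F)"])
 note C = vfunD(1,2)[OF F]
 show "dfam (fsrc F) (elements (fsrc F))" using C by (simp add: dfam_elements)
 fix a b f Z assume *: "a \<in> ob (fsrc F)" "b \<in> ob (fsrc F)" "f \<in> elements (fsrc F) a b" "Dom V f = Z"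
 then have f: "f \<in> El (fsrc F) Z a b" by (simp add: elements_def Hom_iff)
 then show "ucomp V (ftgt F) (fob F a) (fob F b) (fob F b) (ncomp (vnat_id F) b \<cdot> Bang V Z) (fhm F a b \<cdot> f) =
    ucomp V (ftgt F) (fob F a) (fob F a) (fob F b) (fhm F a b \<cdot> f) (ncomp (vnat_id F) a \<cdot> Bang V Z)"
  using * C F by (simp add: stage_unt)
qed (use F vfunD(1,2)[OF F] in \<open>auto simp: vnat_id_def\<close>)

lemma vnatural_vcomp [simp]:
 assumes t: "vnatural V t" and s: "vnatural V s" "nsrc s = ntgt t"
 shows "vnatural V (vnat_vcomp V s t)"
proof -
 define F where "F = nsrc t" define G where "G = ntgt t" define H where "H = ntgt s"
 define C where "C = fsrc F" define D where "D = ftgt F"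
 have st: "nsrc t = F" "ntgt t = G" "nsrc s = G" "ntgt s = H" using s by (simp_all add: F_def G_def H_def)
 have F: "vfunctor V F" "vfunctor V G" "vfunctor V H" "fsrc F = C" "fsrc G = C" "fsrc H = C"
  "ftgt F = D" "ftgt G = D" "ftgt H = D"
  using natD(1-4)[OF t] natD(1-4)[OF s(1)] st by (simp_all add: C_def D_def)
 have C: "vcategory V C" "vcategory V D" using vfunD(1,2)[OF F(1)] F by simp_all
 note ty = ncomp_Hom[OF t st(1,2)] ncomp_Hom[OF s(1) st(3,4)]
 show ?thesis
 proof (rule vnaturalI[OF F(1,3), where A = "elements C"])
  show "dfam C (elements C)" using C by (simp add: dfam_elements)
  fix a assume a: "a \<in> ob C"
  then show "ncomp (vnat_vcomp V s t) a \<in> El D (Term V) (fob F a) (fob H a)"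
   using st F C ucomp_Hom[OF C(2) _ _ _ ty(2)[OF F(5,8) a] ty(1)[OF F(4,7) a]] by simp
  fix b f Z assume *: "b \<in> ob C" "f \<in> elements C a b" "Dom V f = Z"
  then have f: "f \<in> El C Z a b" and Z: "Z \<in> Obj V" by (auto simp: elements_def Hom_iff)
  have 1: "ncomp t a \<in> El D (Term V) (fob F a) (fob G a)" "ncomp t b \<in> El D (Term V) (fob F b) (fob G b)"
   "ncomp s a \<in> El D (Term V) (fob G a) (fob H a)" "ncomp s b \<in> El D (Term V) (fob G b) (fob H b)"
   using a * F by (simp_all add: ty)
  show "ucomp V D (fob F a) (fob F b) (fob H b) (ncomp (vnat_vcomp V s t) b \<cdot> Bang V Z) (fhm F a b \<cdot> f) =
    ucomp V D (fob F a) (fob H a) (fob H b) (fhm H a b \<cdot> f) (ncomp (vnat_vcomp V s t) a \<cdot> Bang V Z)"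
  proof -
   note 2 = stage_Hom[OF 1(1) Z] stage_Hom[OF 1(2) Z] stage_Hom[OF 1(3) Z] stage_Hom[OF 1(4) Z]
    vfun_app[OF F(1,4,7) a *(1) f] vfun_app[OF F(2,5,8) a *(1) f] vfun_app[OF F(3,6,9) a *(1) f]
   have "ucomp V D (fob F a) (fob F b) (fob H b) (ucomp V D (fob F b) (fob G b) (fob H b) (ncomp s b \<cdot> Bang V Z) (ncomp t b \<cdot> Bang V Z)) (fhm F a b \<cdot> f)
    = ucomp V D (fob F a) (fob H a) (fob H b) (fhm H a b \<cdot> f) (ucomp V D (fob F a) (fob G a) (fob H a) (ncomp s a \<cdot> Bang V Z) (ncomp t a \<cdot> Bang V Z))"
    by (rule paste_vertical[OF C(2) _ _ _ _ _ _ 2(5,6,7,1,3,2,4)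
     nat_sq[OF t st(1,2) F(4,7) a *(1) f] nat_sq[OF s(1) st(3,4) F(5,8) a *(1) f]]) (use F a * in simp_all)
   then show ?thesis using a * F st C 1 Z by simp
  qed
 qed (use F st in \<open>auto simp: vnat_vcomp_def\<close>)
qed

text \<open>The square is obtained by pasting the image under \<open>G\<close> of the square of
  \<open>t\<close> with the square of \<open>s\<close> at the image of the morphism under
  \<open>F'\<close>.\<close>

lemma vnatural_hcomp [simp]:
 assumes t: "vnatural V t" and s: "vnatural V s" "fsrc (nsrc s) = ftgt (nsrc t)"
 shows "vnatural V (vnat_hcomp V s t)"
proof -
 define F where "F = nsrc t" define F' where "F' = ntgt t"
 define G where "G = nsrc s" define G' where "G' = ntgt s"
 define C where "C = fsrc F" define D where "D = ftgt F" define E where "E = ftgt G"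
 have st: "nsrc t = F" "ntgt t = F'" "nsrc s = G" "ntgt s = G'" by (simp_all add: F_def G_def F'_def G'_def)
 have F: "vfunctor V F" "vfunctor V F'" "vfunctor V G" "vfunctor V G'" "fsrc F = C" "fsrc F' = C" "fsrc G = D" "fsrc G' = D"
  "ftgt F = D" "ftgt F' = D" "ftgt G = E" "ftgt G' = E"
  using natD(1-4)[OF t] natD(1-4)[OF s(1)] st s by (simp_all add: C_def D_def E_def)
 have C: "vcategory V C" "vcategory V D" "vcategory V E" using vfunD(1,2)[OF F(1)] vfunD(1,2)[OF F(3)] F by simp_all
 note ty = ncomp_Hom[OF t st(1,2)] ncomp_Hom[OF s(1) st(3,4)]
 show ?thesis
 proof (rule vnaturalI[where F = "G oo F" and G = "G' oo F'" and C = C and D = E and A = "elements C"])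
  show "dfam C (elements C)" using C by (simp add: dfam_elements)
  fix a assume a: "a \<in> ob C"
  then show "ncomp (vnat_hcomp V s t) a \<in> El E (Term V) (fob (G oo F) a) (fob (G' oo F') a)"
   using st F C t s by (simp add: ty vnat_hcomp_ncomp)
  fix b f Z assume *: "b \<in> ob C" "f \<in> elements C a b" "Dom V f = Z"
  then have f: "f \<in> El C Z a b" and Z: "Z \<in> Obj V" by (auto simp: elements_def Hom_iff)
  have 1: "ncomp t a \<in> El D (Term V) (fob F a) (fob F' a)" "ncomp t b \<in> El D (Term V) (fob F b) (fob F' b)"
   "ncomp s (fob F' a) \<in> El E (Term V) (fob G (fob F' a)) (fob G' (fob F' a))"
   "ncomp s (fob F' b) \<in> El E (Term V) (fob G (fob F' b)) (fob G' (fob F' b))"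
   using a * F by (simp_all add: ty)
  have o: "fob F a \<in> ob D" "fob F b \<in> ob D" "fob F' a \<in> ob D" "fob F' b \<in> ob D" using a * F by simp_all
  have F1: "fhm F a b \<cdot> f \<in> El D Z (fob F a) (fob F b)" "fhm F' a b \<cdot> f \<in> El D Z (fob F' a) (fob F' b)"
   using a * f F by simp_all
  note sq = nat_sq[OF t st(1,2) F(5,9) a *(1) f] and sq2 = nat_sq[OF s(1) st(3,4) F(7,11) o(3,4) F1(2)]
  have "fhm G (fob F a) (fob F' b) \<cdot> ucomp V D (fob F a) (fob F b) (fob F' b) (ncomp t b \<cdot> Bang V Z) (fhm F a b \<cdot> f) =
   fhm G (fob F a) (fob F' b) \<cdot> ucomp V D (fob F a) (fob F' a) (fob F' b) (fhm F' a b \<cdot> f) (ncomp t a \<cdot> Bang V Z)"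
   using sq by simp
  then have sq1: "ucomp V E (fob G (fob F a)) (fob G (fob F b)) (fob G (fob F' b))
    (fhm G (fob F b) (fob F' b) \<cdot> ncomp t b \<cdot> Bang V Z) (fhm G (fob F a) (fob F b) \<cdot> fhm F a b \<cdot> f) =
   ucomp V E (fob G (fob F a)) (fob G (fob F' a)) (fob G (fob F' b))
    (fhm G (fob F' a) (fob F' b) \<cdot> fhm F' a b \<cdot> f) (fhm G (fob F a) (fob F' a) \<cdot> ncomp t a \<cdot> Bang V Z)"
   using o F1 1 Z F by (simp add: vfun_ucomp[where Z = Z and C = D and D = E])
  show "ucomp V E (fob (G oo F) a) (fob (G oo F) b) (fob (G' oo F') b) (ncomp (vnat_hcomp V s t) b \<cdot> Bang V Z) (fhm (G oo F) a b \<cdot> f) =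
    ucomp V E (fob (G oo F) a) (fob (G' oo F') a) (fob (G' oo F') b) (fhm (G' oo F') a b \<cdot> f) (ncomp (vnat_hcomp V s t) a \<cdot> Bang V Z)"
  proof -
   note 3 = vfun_app[OF F(3,7,11) o(1,2) F1(1)] vfun_app[OF F(3,7,11) o(3,4) F1(2)] vfun_app[OF F(4,8,12) o(3,4) F1(2)]
    vfun_app[OF F(3,7,11) o(1,3) stage_Hom[OF 1(1) Z]] vfun_app[OF F(3,7,11) o(2,4) stage_Hom[OF 1(2) Z]]
    stage_Hom[OF 1(3) Z] stage_Hom[OF 1(4) Z]
   have "ucomp V E (fob G (fob F a)) (fob G (fob F b)) (fob G' (fob F' b))
     (ucomp V E (fob G (fob F b)) (fob G (fob F' b)) (fob G' (fob F' b)) (ncomp s (fob F' b) \<cdot> Bang V Z) (fhm G (fob F b) (fob F' b) \<cdot> ncomp t b \<cdot> Bang V Z))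
     (fhm G (fob F a) (fob F b) \<cdot> fhm F a b \<cdot> f)
    = ucomp V E (fob G (fob F a)) (fob G' (fob F' a)) (fob G' (fob F' b)) (fhm G' (fob F' a) (fob F' b) \<cdot> fhm F' a b \<cdot> f)
     (ucomp V E (fob G (fob F a)) (fob G (fob F' a)) (fob G' (fob F' a)) (ncomp s (fob F' a) \<cdot> Bang V Z) (fhm G (fob F a) (fob F' a) \<cdot> ncomp t a \<cdot> Bang V Z))"
    by (rule paste_vertical[OF C(3) _ _ _ _ _ _ 3(1,2,3,4,6,5,7) sq1 sq2]) (use F o in simp_all)
   moreover have "ncomp (vnat_hcomp V s t) x \<cdot> Bang V Z = ucomp V E (fob G (fob F x)) (fob G (fob F' x)) (fob G' (fob F' x))
     (ncomp s (fob F' x) \<cdot> Bang V Z) (fhm G (fob F x) (fob F' x) \<cdot> ncomp t x \<cdot> Bang V Z)" if "x \<in> ob C" for x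
   proof -
    have x: "fob F x \<in> ob D" "fob F' x \<in> ob D" using that F by simp_all
    note tx = ty(1)[OF F(5,9) that] and sx = ty(2)[OF F(7,11) x(2)]
    note gt = vfun_app[OF F(3,7,11) x tx]
    have "ncomp (vnat_hcomp V s t) x = ucomp V E (fob G (fob F x)) (fob G (fob F' x)) (fob G' (fob F' x))
     (ncomp s (fob F' x)) (fhm G (fob F x) (fob F' x) \<cdot> ncomp t x)"
     using vnat_hcomp_ncomp[OF st(1,3,2,4)] F(5,11) that by simp
    then show ?thesis
     using stage_ucomp[OF C(3) _ _ _ sx gt Z] stage_app[OF F(3,7) x tx Z] x F by simp
   qed
   moreover have "fob (G oo F) x = fob G (fob F x)" "fob (G' oo F') x = fob G' (fob F' x)" if "x \<in> ob C" for x
    using F that by simp_all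
   ultimately show ?thesis using a *(1) F(5,6,7,8,9,10)
    vfun_comp_app[OF F(1,5,3) _ a *(1) f] vfun_comp_app[OF F(2,6,4) _ a *(1) f]
    by simp
  qed
 qed (use F st in \<open>auto simp: vnat_hcomp_def\<close>)
qed

end

context cartesian_category
begin

section \<open>The axioms of a 2-category\<close>

lemma VCat_simps [simp]:
 "X \<in> cell0 (VCat U V) \<longleftrightarrow> vcategory V X \<and> ob X \<in> Small U"
 "F \<in> cell1 (VCat U V) \<longleftrightarrow> vfunctor V F \<and> ob (fsrc F) \<in> Small U \<and> ob (ftgt F) \<in> Small U"
 "t \<in> cell2 (VCat U V) \<longleftrightarrow> vnatural V t \<and> ob (fsrc (nsrc t)) \<in> Small U \<and> ob (ftgt (nsrc t)) \<in> Small U"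
 "src1 (VCat U V) = fsrc" "tgt1 (VCat U V) = ftgt" "src2 (VCat U V) = nsrc" "tgt2 (VCat U V) = ntgt"
 "id1 (VCat U V) = vfun_id V" "comp1 (VCat U V) = vfun_comp V" "id2 (VCat U V) = vnat_id"
 "vcomp (VCat U V) = vnat_vcomp V" "hcomp (VCat U V) = vnat_hcomp V"
 by (simp_all add: VCat_def Let_def)

lemma VCat_one_cells [simp]:
 "F \<in> one_cells (VCat U V) X Y \<longleftrightarrow>
  vfunctor V F \<and> fsrc F = X \<and> ftgt F = Y \<and> ob X \<in> Small U \<and> ob Y \<in> Small U"
 by (auto simp: one_cells_def)

lemma VCat_two_cells [simp]:
 "t \<in> two_cells (VCat U V) F G \<longleftrightarrow>
  vnatural V t \<and> nsrc t = F \<and> ntgt t = G \<and> ob (fsrc F) \<in> Small U \<and> ob (ftgt F) \<in> Small U"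
 by (auto simp: two_cells_def)

text \<open>Once all functors are distributed over composites, the two sides differ only by the
  naturality square of \<open>t\<close> at a component of \<open>s'\<close>.\<close>

lemma vnat_interchange:
 assumes s: "vnatural V s" "vnatural V s'" "nsrc s' = ntgt s"
  and t: "vnatural V t" "vnatural V t'" "nsrc t' = ntgt t" and st: "ftgt (nsrc s) = fsrc (nsrc t)"
 shows "vnat_hcomp V (vnat_vcomp V t' t) (vnat_vcomp V s' s)
    = vnat_vcomp V (vnat_hcomp V t' s') (vnat_hcomp V t s)"
proof -
 define F where "F = nsrc s" define F' where "F' = ntgt s" define F'' where "F'' = ntgt s'"
 define G where "G = nsrc t" define G' where "G' = ntgt t" define G'' where "G'' = ntgt t'"
 define C where "C = fsrc F" define D where "D = ftgt F" define E where "E = ftgt G"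
 have n: "nsrc s = F" "ntgt s = F'" "nsrc s' = F'" "ntgt s' = F''" "nsrc t = G" "ntgt t = G'" "nsrc t' = G'" "ntgt t' = G''"
  using s t by (simp_all add: F_def G_def F'_def G'_def F''_def G''_def)
 have F: "vfunctor V F" "vfunctor V F'" "vfunctor V F''" "vfunctor V G" "vfunctor V G'" "vfunctor V G''"
  "fsrc F = C" "fsrc F' = C" "fsrc F'' = C" "fsrc G = D" "fsrc G' = D" "fsrc G'' = D"
  "ftgt F = D" "ftgt F' = D" "ftgt F'' = D" "ftgt G = E" "ftgt G' = E" "ftgt G'' = E"
  using natD(1-4)[OF s(1)] natD(1-4)[OF s(2)] natD(1-4)[OF t(1)] natD(1-4)[OF t(2)] n st
  by (simp_all add: C_def D_def E_def)
 have C: "vcategory V C" "vcategory V D" "vcategory V E" using vfunD(1,2)[OF F(1)] vfunD(1,2)[OF F(4)] F by simp_all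
 show ?thesis
 proof (rule vnatural_eqI)
  fix a assume "a \<in> ob (fsrc (nsrc (vnat_vcomp V (vnat_hcomp V t' s') (vnat_hcomp V t s))))"
  then have a: "a \<in> ob C" using n F by simp
  then have o: "fob F a \<in> ob D" "fob F' a \<in> ob D" "fob F'' a \<in> ob D" using F by simp_all
  have q: "fob G (fob F a) \<in> ob E" "fob G (fob F' a) \<in> ob E" "fob G (fob F'' a) \<in> ob E" "fob G' (fob F' a) \<in> ob E"
    "fob G' (fob F'' a) \<in> ob E" "fob G'' (fob F'' a) \<in> ob E" using F o by simp_all
  note sa = ncomp_Hom[OF s(1) n(1,2) F(7,13) a] and sa' = ncomp_Hom[OF s(2) n(3,4) F(8,14) a]
  note ta = ncomp_Hom[OF t(1) n(5,6) F(10,16) o(2)] ncomp_Hom[OF t(1) n(5,6) F(10,16) o(3)]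
   and ta' = ncomp_Hom[OF t(2) n(7,8) F(11,17) o(3)]
  note Gs = vfun_app[OF F(4,10,16) o(1,2) sa] vfun_app[OF F(4,10,16) o(2,3) sa'] vfun_app[OF F(5,11,17) o(2,3) sa']
  note sq = nat_sq_Term[OF t(1) n(5,6) F(10,16) o(2,3) sa']
  let ?l = "ucomp V E (fob G (fob F a)) (fob G (fob F'' a)) (fob G'' (fob F'' a))
    (ucomp V E (fob G (fob F'' a)) (fob G' (fob F'' a)) (fob G'' (fob F'' a)) (ncomp t' (fob F'' a)) (ncomp t (fob F'' a)))
    (ucomp V E (fob G (fob F a)) (fob G (fob F' a)) (fob G (fob F'' a)) (fhm G (fob F' a) (fob F'' a) \<cdot> ncomp s' a) (fhm G (fob F a) (fob F' a) \<cdot> ncomp s a))"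
  let ?r = "ucomp V E (fob G (fob F a)) (fob G' (fob F' a)) (fob G'' (fob F'' a))
    (ucomp V E (fob G' (fob F' a)) (fob G' (fob F'' a)) (fob G'' (fob F'' a)) (ncomp t' (fob F'' a)) (fhm G' (fob F' a) (fob F'' a) \<cdot> ncomp s' a))
    (ucomp V E (fob G (fob F a)) (fob G (fob F' a)) (fob G' (fob F' a)) (ncomp t (fob F' a)) (fhm G (fob F a) (fob F' a) \<cdot> ncomp s a))"
  have "?l = ucomp V E (fob G (fob F a)) (fob G' (fob F'' a)) (fob G'' (fob F'' a)) (ncomp t' (fob F'' a))
    (ucomp V E (fob G (fob F a)) (fob G (fob F' a)) (fob G' (fob F'' a))
    (ucomp V E (fob G (fob F' a)) (fob G (fob F'' a)) (fob G' (fob F'' a)) (ncomp t (fob F'' a)) (fhm G (fob F' a) (fob F'' a) \<cdot> ncomp s' a))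
    (fhm G (fob F a) (fob F' a) \<cdot> ncomp s a))"
   using ucomp_assoc[OF C(3) q(1,3,5,6) ta' ta(2) ucomp_Hom[OF C(3) q(1,2,3) Gs(2,1)]]
    ucomp_assoc[OF C(3) q(1,2,3,5) ta(2) Gs(2,1)] by simp
  also have "\<dots> = ?r"
   using ucomp_assoc[OF C(3) q(1,4,5,6) ta' Gs(3) ucomp_Hom[OF C(3) q(1,2,4) ta(1) Gs(1)]]
    ucomp_assoc[OF C(3) q(1,2,4,5) Gs(3) ta(1) Gs(1)] sq by simp
  finally have lr: "?l = ?r" .
  have "ncomp (vnat_hcomp V (vnat_vcomp V t' t) (vnat_vcomp V s' s)) a = ?l"
   using vnat_hcomp_ncomp[of "vnat_vcomp V s' s" F "vnat_vcomp V t' t" G F'' G'' a] n F a o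
    vfun_ucomp[OF F(4,10,16) o sa' sa] by simp
  moreover have "ncomp (vnat_vcomp V (vnat_hcomp V t' s') (vnat_hcomp V t s)) a = ?r"
   using vnat_hcomp_ncomp[OF n(3,7,4,8)] vnat_hcomp_ncomp[OF n(1,5,2,6)] n F a o by simp
  ultimately show "ncomp (vnat_hcomp V (vnat_vcomp V t' t) (vnat_vcomp V s' s)) a =
     ncomp (vnat_vcomp V (vnat_hcomp V t' s') (vnat_hcomp V t s)) a"
   using lr by simp
 qed (use n F s t in simp_all)
qed

text \<open>\<open>H\<close> preserves the composite that defines a component of the inner
  horizontal composite; what remains is associativity in the last category.\<close>

lemma vnat_hcomp_assoc:
 assumes s: "vnatural V s" and t: "vnatural V t" and u: "vnatural V u"
  and st: "ftgt (nsrc s) = fsrc (nsrc t)" "ftgt (nsrc t) = fsrc (nsrc u)"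
 shows "vnat_hcomp V (vnat_hcomp V u t) s = vnat_hcomp V u (vnat_hcomp V t s)"
proof -
 define F where "F = nsrc s" define F' where "F' = ntgt s"
 define G where "G = nsrc t" define G' where "G' = ntgt t"
 define H where "H = nsrc u" define H' where "H' = ntgt u"
 define B where "B = fsrc F" define C where "C = ftgt F" define D where "D = ftgt G" define E where "E = ftgt H"
 have n: "nsrc s = F" "ntgt s = F'" "nsrc t = G" "ntgt t = G'" "nsrc u = H" "ntgt u = H'"
  by (simp_all add: F_def G_def F'_def G'_def H_def H'_def)
 have F: "vfunctor V F" "vfunctor V F'" "vfunctor V G" "vfunctor V G'" "vfunctor V H" "vfunctor V H'"
  "fsrc F = B" "fsrc F' = B" "fsrc G = C" "fsrc G' = C" "fsrc H = D" "fsrc H' = D"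
  "ftgt F = C" "ftgt F' = C" "ftgt G = D" "ftgt G' = D" "ftgt H = E" "ftgt H' = E"
  using natD(1-4)[OF s(1)] natD(1-4)[OF u(1)] natD(1-4)[OF t(1)] n st
  by (simp_all add: B_def C_def D_def E_def)
 have C: "vcategory V C" "vcategory V D" "vcategory V E" using vfunD(2)[OF F(1)] vfunD(1,2)[OF F(5)] F by simp_all
 show ?thesis
 proof (rule vnatural_eqI)
  fix a assume "a \<in> ob (fsrc (nsrc (vnat_hcomp V u (vnat_hcomp V t s))))"
  then have a: "a \<in> ob B" using n F by simp
  then have o: "fob F a \<in> ob C" "fob F' a \<in> ob C" using F by simp_all
  have p: "fob G (fob F a) \<in> ob D" "fob G (fob F' a) \<in> ob D" "fob G' (fob F' a) \<in> ob D" using F o by simp_all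
  have q: "fob H (fob G (fob F a)) \<in> ob E" "fob H (fob G (fob F' a)) \<in> ob E" "fob H (fob G' (fob F' a)) \<in> ob E" "fob H' (fob G' (fob F' a)) \<in> ob E"
   using F p by simp_all
  note sa = ncomp_Hom[OF s(1) n(1,2) F(7,13) a]
  note ta = ncomp_Hom[OF t(1) n(3,4) F(9,15) o(2)]
  note ua = ncomp_Hom[OF u(1) n(5,6) F(11,17) p(3)]
  note Gs = vfun_app[OF F(3,9,15) o sa]
  note 1 = vfun_app[OF F(5,11,17) p(2,3) ta] vfun_app[OF F(5,11,17) p(1,2) Gs]
  have hg: "ftgt (H oo G) = E" using F by simp
  have ut: "nsrc (vnat_hcomp V u t) = H oo G" "ntgt (vnat_hcomp V u t) = H' oo G'"
   and ts: "nsrc (vnat_hcomp V t s) = G oo F" "ntgt (vnat_hcomp V t s) = G' oo F'" using n by simp_all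
  have "ncomp (vnat_hcomp V (vnat_hcomp V u t) s) a =
   ucomp V E (fob H (fob G (fob F a))) (fob H (fob G (fob F' a))) (fob H' (fob G' (fob F' a)))
    (ucomp V E (fob H (fob G (fob F' a))) (fob H (fob G' (fob F' a))) (fob H' (fob G' (fob F' a)))
     (ncomp u (fob G' (fob F' a))) (fhm H (fob G (fob F' a)) (fob G' (fob F' a)) \<cdot> ncomp t (fob F' a)))
    (fhm H (fob G (fob F a)) (fob G (fob F' a)) \<cdot> fhm G (fob F a) (fob F' a) \<cdot> ncomp s a)"
   using vnat_hcomp_ncomp[OF n(1) ut(1) n(2) ut(2)] vnat_hcomp_ncomp[OF n(3,5,4,6)] F a o
     vfun_comp_app[OF F(3,9,5) _ o sa] by simp
  moreover have "ncomp (vnat_hcomp V u (vnat_hcomp V t s)) a =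
   ucomp V E (fob H (fob G (fob F a))) (fob H (fob G' (fob F' a))) (fob H' (fob G' (fob F' a)))
     (ncomp u (fob G' (fob F' a)))
    (ucomp V E (fob H (fob G (fob F a))) (fob H (fob G (fob F' a))) (fob H (fob G' (fob F' a)))
      (fhm H (fob G (fob F' a)) (fob G' (fob F' a)) \<cdot> ncomp t (fob F' a))
    (fhm H (fob G (fob F a)) (fob G (fob F' a)) \<cdot> fhm G (fob F a) (fob F' a) \<cdot> ncomp s a))"
   using vnat_hcomp_ncomp[OF ts(1) n(5) ts(2) n(6)] vnat_hcomp_ncomp[OF n(1,3,2,4)] F a o
    vfun_ucomp[OF F(5,11,17) p ta Gs] by simp
  ultimately show "ncomp (vnat_hcomp V (vnat_hcomp V u t) s) a = ncomp (vnat_hcomp V u (vnat_hcomp V t s)) a"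
   using ucomp_assoc[OF C(3) q ua 1] by simp
 qed (use n F s t u in \<open>simp_all add: vfun_comp_assoc\<close>)
qed

lemma two_category_VCat: "two_category (VCat U V)"
proof
 fix f assume "f \<in> cell1 (VCat U V)"
 then show "src1 (VCat U V) f \<in> cell0 (VCat U V) \<and> tgt1 (VCat U V) f \<in> cell0 (VCat U V)"
  using vfunD(1,2)[of f] by simp
next
 fix s assume "s \<in> cell2 (VCat U V)"
 then show "src2 (VCat U V) s \<in> cell1 (VCat U V) \<and> tgt2 (VCat U V) s \<in> cell1 (VCat U V) \<and>
     src1 (VCat U V) (src2 (VCat U V) s) = src1 (VCat U V) (tgt2 (VCat U V) s) \<and>
     tgt1 (VCat U V) (src2 (VCat U V) s) = tgt1 (VCat U V) (tgt2 (VCat U V) s)"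
  using natD(1-4)[of s] by simp
next
 fix f g s
 assume s: "s \<in> two_cells (VCat U V) f g"
 then have F: "vfunctor V f" "vfunctor V g" "fsrc g = fsrc f" "ftgt g = ftgt f" using natD(1-4)[of s] by simp_all
 have ty: "ncomp s a \<in> El (ftgt f) (Term V) (fob f a) (fob g a)" if "a \<in> ob (fsrc f)" for a
  using ncomp_Hom[of s f g] that s by simp
 note C = vfunD(1,2)[OF F(1)]
 show "vcomp (VCat U V) s (id2 (VCat U V) f) = s"
  unfolding VCat_simps by (rule vnatural_eqI) (use s F C ty in simp_all)
 show "vcomp (VCat U V) (id2 (VCat U V) g) s = s"
  unfolding VCat_simps by (rule vnatural_eqI) (use s F C ty in simp_all)
 fix X Y assume f: "f \<in> one_cells (VCat U V) X Y"
 show "hcomp (VCat U V) s (id2 (VCat U V) (id1 (VCat U V) X)) = s"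
  unfolding VCat_simps
 proof (rule vnatural_eqI)
  fix a assume "a \<in> ob (fsrc (nsrc s))"
  then have a: "a \<in> ob X" using s f by simp
  show "ncomp (vnat_hcomp V s (vnat_id (vfun_id V X))) a = ncomp s a"
   using vnat_hcomp_ncomp[of "vnat_id (vfun_id V X)" "vfun_id V X" s f "vfun_id V X" g a] a f s F C ty[of a] by simp
 qed (use s f F C in simp_all)
 show "hcomp (VCat U V) (id2 (VCat U V) (id1 (VCat U V) Y)) s = s"
  unfolding VCat_simps
 proof (rule vnatural_eqI)
  fix a assume "a \<in> ob (fsrc (nsrc s))"
  then have a: "a \<in> ob X" using s f by simp
  show "ncomp (vnat_hcomp V (vnat_id (vfun_id V Y)) s) a = ncomp s a"
   using vnat_hcomp_ncomp[of s f "vnat_id (vfun_id V Y)" "vfun_id V Y" g "vfun_id V Y" a] a f s F C ty[of a]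
    Ide_app[OF ty] by simp
 qed (use s f F C in simp_all)
next
 fix f g h k s t u
 assume s: "s \<in> two_cells (VCat U V) f g" and t: "t \<in> two_cells (VCat U V) g h" and u: "u \<in> two_cells (VCat U V) h k"
 have F: "vfunctor V f" "vfunctor V g" "vfunctor V h" "vfunctor V k" "fsrc g = fsrc f" "ftgt g = ftgt f"
  "fsrc h = fsrc f" "ftgt h = ftgt f" "fsrc k = fsrc f" "ftgt k = ftgt f"
  using natD(1-4)[of s] natD(1-4)[of t] natD(1-4)[of u] s t u by simp_all
 note C = vfunD(1,2)[OF F(1)]
 show "vcomp (VCat U V) (vcomp (VCat U V) u t) s = vcomp (VCat U V) u (vcomp (VCat U V) t s)"
  unfolding VCat_simps
 proof (rule vnatural_eqI)
  fix a assume "a \<in> ob (fsrc (nsrc (vnat_vcomp V u (vnat_vcomp V t s))))"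
  then have a: "a \<in> ob (fsrc f)" using s by simp
  show "ncomp (vnat_vcomp V (vnat_vcomp V u t) s) a = ncomp (vnat_vcomp V u (vnat_vcomp V t s)) a"
   using a s t u F ucomp_assoc[OF C(2), of "fob f a" "fob g a" "fob h a" "fob k a" "ncomp u a" "Term V" "ncomp t a" "ncomp s a"]
    ncomp_Hom[of s f g _ _ a] ncomp_Hom[of t g h _ _ a] ncomp_Hom[of u h k _ _ a] by simp
 qed (use s t u in simp_all)
next
 fix f X Y g Z
 assume f: "f \<in> one_cells (VCat U V) X Y" "g \<in> one_cells (VCat U V) Y Z"
 have C: "vcategory V X" "vcategory V Y" "vcategory V Z" using vfunD(1,2)[of f] vfunD(2)[of g] f by simp_all
 show "hcomp (VCat U V) (id2 (VCat U V) g) (id2 (VCat U V) f) = id2 (VCat U V) (comp1 (VCat U V) g f)"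
  unfolding VCat_simps
 proof (rule vnatural_eqI)
  fix a assume "a \<in> ob (fsrc (nsrc (vnat_id (g oo f))))"
  then have a: "a \<in> ob X" using f by simp
  show "ncomp (vnat_hcomp V (vnat_id g) (vnat_id f)) a = ncomp (vnat_id (g oo f)) a"
   using vnat_hcomp_ncomp[of "vnat_id f" f "vnat_id g" g f g a] a f C by simp
 qed (use f in simp_all)
next
 fix s f f' s' f'' t g g' t' g''
 assume "s \<in> two_cells (VCat U V) f f'" "s' \<in> two_cells (VCat U V) f' f''"
  "t \<in> two_cells (VCat U V) g g'" "t' \<in> two_cells (VCat U V) g' g''" "tgt1 (VCat U V) f = src1 (VCat U V) g"
 then show "hcomp (VCat U V) (vcomp (VCat U V) t' t) (vcomp (VCat U V) s' s) =
    vcomp (VCat U V) (hcomp (VCat U V) t' s') (hcomp (VCat U V) t s)"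
  using vnat_interchange[of s s' t t'] by simp
next
 fix s f f' t g g' u h h'
 assume "s \<in> two_cells (VCat U V) f f'" "t \<in> two_cells (VCat U V) g g'" "u \<in> two_cells (VCat U V) h h'"
  "tgt1 (VCat U V) f = src1 (VCat U V) g" "tgt1 (VCat U V) g = src1 (VCat U V) h"
 then show "hcomp (VCat U V) (hcomp (VCat U V) u t) s = hcomp (VCat U V) u (hcomp (VCat U V) t s)"
  using vnat_hcomp_assoc[of s t u] by simp
qed (auto simp: vfun_comp_assoc)

section \<open>Products of enriched categories\<close>

lemma vcat_prod_simps [simp]:
 "ob (vcat_prod V C D) = ob C \<times> ob D"
 "[|a \<in> ob C; b \<in> ob D; a' \<in> ob C; b' \<in> ob D|]
  ==> hm (vcat_prod V C D) (a, b) (a', b') = Prod V (hm C a a') (hm D b b')"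
 "a \<in> ob C ==> b \<in> ob D ==> unt (vcat_prod V C D) (a, b) = Tuple V (unt C a) (unt D b)"
 by (simp_all add: vcat_prod_def Let_def)

lemma Tuple_in_Hom [simp]:
 "f \<in> Hom V Z X ==> g \<in> Hom V Z Y ==> Tuple V f g \<in> Hom V Z (Prod V X Y)"
 by (rule Tuple_Hom)

lemma Tuple_precomp [simp]:
 "f \<in> Hom V Z X ==> g \<in> Hom V Z Y ==> k \<in> Hom V Z' Z ==> Tuple V f g \<cdot> k = Tuple V (f \<cdot> k) (g \<cdot> k)"
 by (simp add: Hom_iff)

text \<open>Every element of a product hom object is a tuple, so this componentwise rule describes
  composition in the product category completely.\<close>

lemma prod_ucomp [simp]:
 assumes C: "vcategory V C" "vcategory V D"
  and o: "a \<in> ob C" "b \<in> ob D" "a' \<in> ob C" "b' \<in> ob D" "a'' \<in> ob C" "b'' \<in> ob D"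
  and f: "g \<in> El C Z a' a''" "k \<in> El D Z b' b''" "f \<in> El C Z a a'" "h \<in> El D Z b b'"
 shows "ucomp V (vcat_prod V C D) (a, b) (a', b') (a'', b'') (Tuple V g k) (Tuple V f h) =
  Tuple V (ucomp V C a a' a'' g f) (ucomp V D b b' b'' k h)"
proof -
 have h: "hm C a' a'' \<in> Obj V" "hm C a a' \<in> Obj V" "hm D b' b'' \<in> Obj V" "hm D b b' \<in> Obj V" using C o by simp_all
 let ?p = "Pr1 V (Prod V (hm C a' a'') (hm D b' b'')) (Prod V (hm C a a') (hm D b b'))"
 let ?q = "Pr2 V (Prod V (hm C a' a'') (hm D b' b'')) (Prod V (hm C a a') (hm D b b'))"
 have 1: "cmp C a a' a'' \<in> El C (Prod V (hm C a' a'') (hm C a a')) a a''"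
  "cmp D b b' b'' \<in> El D (Prod V (hm D b' b'') (hm D b b')) b b''"
  using vcatD(2)[OF C(1)] vcatD(2)[OF C(2)] o by simp_all
 show ?thesis unfolding ucomp_def
  using o h f 1 by (simp add: vcat_prod_def Let_def ucomp_def Hom_iff)
qed

lemma prod_cmp_Hom:
 assumes C: "vcategory V C" "vcategory V D"
  and o: "a \<in> ob C" "b \<in> ob D" "a' \<in> ob C" "b' \<in> ob D" "a'' \<in> ob C" "b'' \<in> ob D"
 shows "cmp (vcat_prod V C D) (a, b) (a', b') (a'', b'') \<in>
  Hom V (Prod V (Prod V (hm C a' a'') (hm D b' b'')) (Prod V (hm C a a') (hm D b b'))) (Prod V (hm C a a'') (hm D b b''))"
proof -
 have h: "hm C a' a'' \<in> Obj V" "hm C a a' \<in> Obj V" "hm D b' b'' \<in> Obj V" "hm D b b' \<in> Obj V" using C o by simp_all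
 have 1: "cmp C a a' a'' \<in> El C (Prod V (hm C a' a'') (hm C a a')) a a''"
  "cmp D b b' b'' \<in> El D (Prod V (hm D b' b'') (hm D b b')) b b''"
  using vcatD(2)[OF C(1)] vcatD(2)[OF C(2)] o by simp_all
 show ?thesis using o h 1 by (simp add: vcat_prod_def Let_def ucomp_def Hom_iff)
qed

definition prodfam :: "('o => 'o => 'a set) => ('p => 'p => 'a set) => 'o \<times> 'p => 'o \<times> 'p => 'a set" where
 "prodfam A B x y = tuples (A (fst x) (fst y)) (B (snd x) (snd y))"

lemma dfam_prodfam:
 assumes "dfam C A" "dfam D B" shows "dfam (vcat_prod V C D) (prodfam A B)"
 using assms by (auto simp: dfam_def prodfam_def dense_tuples)

lemma prodfamE:
 assumes "x \<in> prodfam A B (a, b) (a', b')" "Dom V x = Z" "dfam C A" "dfam D B"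
  "a \<in> ob C" "b \<in> ob D" "a' \<in> ob C" "b' \<in> ob D"
 obtains f g where "x = Tuple V f g" "f \<in> A a a'" "g \<in> B b b'" "f \<in> El C Z a a'" "g \<in> El D Z b b'"
  "Dom V f = Z" "Dom V g = Z"
proof -
 obtain f g where x: "x = Tuple V f g" "f \<in> A a a'" "g \<in> B b b'" "Dom V f = Dom V g"
  using assms(1) by (auto simp: prodfam_def tuples_def)
 have "dense (hm C a a') (A a a')" "dense (hm D b b') (B b b')" using assms by (auto simp: dfam_def)
 then have "f \<in> Arr V" "g \<in> Arr V" "Cod V f = hm C a a'" "Cod V g = hm D b b'" using x denseD by blast+
 then show ?thesis using that[OF x(1-3)] x assms(2) by (simp add: Hom_iff)
qed

lemma vcategory_prod [simp]:
 assumes C: "vcategory V C" and D: "vcategory V D"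
 shows "vcategory V (vcat_prod V C D)"
proof (rule vcategoryI[OF dfam_prodfam[OF dfam_elements[OF C] dfam_elements[OF D]]])
 note E = prodfamE[OF _ _ dfam_elements[OF C] dfam_elements[OF D]]
 let ?P = "vcat_prod V C D" let ?A = "prodfam (elements C) (elements D)"
 show "cmp ?P x y z \<in> El ?P (Prod V (hm ?P y z) (hm ?P x y)) x z"
  if "x \<in> ob ?P" "y \<in> ob ?P" "z \<in> ob ?P" for x y z
  using that prod_cmp_Hom[OF C D] by auto
 show "unt ?P x \<in> El ?P (Term V) x x" if "x \<in> ob ?P" for x
  using that C D by auto
 have uid: "uid ?P Z (a, b) = Tuple V (uid C Z a) (uid D Z b)" if "a \<in> ob C" "b \<in> ob D" "Z \<in> Obj V" for Z a b
  using that Tuple_precomp[OF unt_Hom[OF C] unt_Hom[OF D] Bang_Hom] by (simp add: uid_def)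
 fix x y assume xy: "x \<in> ob ?P" "y \<in> ob ?P"
 obtain a b a' b' where xy': "x = (a, b)" "y = (a', b')" by (cases x, cases y)
 with xy have o: "a \<in> ob C" "b \<in> ob D" "a' \<in> ob C" "b' \<in> ob D" by simp_all
 show "ucomp V ?P x y y (uid ?P Z y) f = f" "ucomp V ?P x x y f (uid ?P Z x) = f" if f: "f \<in> ?A x y" "Dom V f = Z" for f Z
 proof -
  obtain f1 f2 where f: "f = Tuple V f1 f2" "f1 \<in> El C Z a a'" "f2 \<in> El D Z b b'"
   using E[OF f[unfolded xy'] o] by metis
  then have Z: "Z \<in> Obj V" using HomD by blast
  show "ucomp V ?P x y y (uid ?P Z y) f = f" "ucomp V ?P x x y f (uid ?P Z x) = f"
   unfolding xy' f(1) uid[OF o(1,2) Z] uid[OF o(3,4) Z]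
   using prod_ucomp[OF C D o o(3,4) uid_Hom[OF C o(3) Z] uid_Hom[OF D o(4) Z] f(2,3)]
    prod_ucomp[OF C D o(1,2) o f(2,3) uid_Hom[OF C o(1) Z] uid_Hom[OF D o(2) Z]]
    C D o f by simp_all
 qed
 fix z w f g h Z assume zw: "z \<in> ob ?P" "w \<in> ob ?P" "h \<in> ?A z w" "g \<in> ?A y z" "f \<in> ?A x y" "Dom V h = Z" "Dom V g = Z" "Dom V f = Z"
 obtain c d c' d' where zw': "z = (c, d)" "w = (c', d')" by (cases z, cases w)
 with zw have o': "c \<in> ob C" "d \<in> ob D" "c' \<in> ob C" "d' \<in> ob D" by simp_all
 obtain f1 f2 where f: "f = Tuple V f1 f2" "f1 \<in> El C Z a a'" "f2 \<in> El D Z b b'"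
  using E[OF zw(5,8)[unfolded xy'] o] by metis
 obtain g1 g2 where g: "g = Tuple V g1 g2" "g1 \<in> El C Z a' c" "g2 \<in> El D Z b' d"
  using E[OF zw(4,7)[unfolded xy' zw'] o(3,4) o'(1,2)] by metis
 obtain h1 h2 where h: "h = Tuple V h1 h2" "h1 \<in> El C Z c c'" "h2 \<in> El D Z d d'"
  using E[OF zw(3,6)[unfolded xy' zw'] o'] by metis
 note oC = o(1,3) o'(1,3) and oD = o(2,4) o'(2,4)
 show "ucomp V ?P x y w (ucomp V ?P y z w h g) f = ucomp V ?P x z w h (ucomp V ?P x y z g f)"
  unfolding xy' zw' f(1) g(1) h(1)
  using prod_ucomp[OF C D o(3,4) o' h(2,3) g(2,3)] prod_ucomp[OF C D o o'(1,2) g(2,3) f(2,3)]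
   prod_ucomp[OF C D o o'(3,4) ucomp_Hom[OF C oC(2-4) h(2) g(2)] ucomp_Hom[OF D oD(2-4) h(3) g(3)] f(2,3)]
   prod_ucomp[OF C D o(1,2) o' h(2,3) ucomp_Hom[OF C oC(1-3) g(2) f(2)] ucomp_Hom[OF D oD(1-3) g(3) f(3)]]
   ucomp_assoc[OF C oC h(2) g(2) f(2)] ucomp_assoc[OF D oD h(3) g(3) f(3)] by simp
qed (auto simp: vcat_prod_def Let_def)

end

section \<open>Symmetric monoidal structures in terms of generalised elements\<close>

context cartesian_category
begin

section \<open>Products of functors, rebracketing and exchange of factors\<close>

lemma vfun_prod_simps [simp]:
 "fsrc (vfun_prod V F G) = vcat_prod V (fsrc F) (fsrc G)"
 "ftgt (vfun_prod V F G) = vcat_prod V (ftgt F) (ftgt G)"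
 "a \<in> ob (fsrc F) ==> b \<in> ob (fsrc G) ==> fob (vfun_prod V F G) (a, b) = (fob F a, fob G b)"
 by (simp_all add: vfun_prod_def Let_def)

lemma vfun_prod_app [simp]:
 assumes F: "vfunctor V F" "vfunctor V G"
  and o: "a \<in> ob (fsrc F)" "b \<in> ob (fsrc G)" "a' \<in> ob (fsrc F)" "b' \<in> ob (fsrc G)"
  and f: "f \<in> El (fsrc F) Z a a'" "g \<in> El (fsrc G) Z b b'"
 shows "fhm (vfun_prod V F G) (a, b) (a', b') \<cdot> Tuple V f g = Tuple V (fhm F a a' \<cdot> f) (fhm G b b' \<cdot> g)"
 using vfunD(4)[OF F(1) o(1,3)] vfunD(4)[OF F(2) o(2,4)] o f by (simp add: vfun_prod_def Let_def Hom_iff)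

lemma vfunctor_prod [simp]:
 assumes F: "vfunctor V F" and G: "vfunctor V G"
 shows "vfunctor V (vfun_prod V F G)"
proof -
 note C = vfunD(1,2)[OF F] vfunD(1,2)[OF G]
 let ?P = "vfun_prod V F G"
 show ?thesis
 proof (rule vfunctorI)
  show "dfam (fsrc ?P) (prodfam (elements (fsrc F)) (elements (fsrc G)))"
   using dfam_prodfam[OF dfam_elements[OF C(1)] dfam_elements[OF C(3)]] by simp
  note E = prodfamE[OF _ _ dfam_elements[OF C(1)] dfam_elements[OF C(3)]]
  fix x assume x: "x \<in> ob (fsrc ?P)"
  obtain a b where x': "x = (a, b)" "a \<in> ob (fsrc F)" "b \<in> ob (fsrc G)" using x by auto
  show "fob ?P x \<in> ob (ftgt ?P)" using x' F G by simp
  show "fhm ?P x x \<cdot> unt (fsrc ?P) x = unt (ftgt ?P) (fob ?P x)"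
   using x' F G vfun_prod_app[OF F G x'(2,3,2,3) unt_Hom[OF C(1) x'(2)] unt_Hom[OF C(3) x'(3)]] by simp
  fix y assume y: "y \<in> ob (fsrc ?P)"
  obtain a' b' where y': "y = (a', b')" "a' \<in> ob (fsrc F)" "b' \<in> ob (fsrc G)" using y by auto
  show "fhm ?P x y \<in> El (ftgt ?P) (hm (fsrc ?P) x y) (fob ?P x) (fob ?P y)"
   using x' y' F G vfunD(4)[OF F x'(2) y'(2)] vfunD(4)[OF G x'(3) y'(3)] by (simp add: vfun_prod_def Let_def Hom_iff)
  fix z f g Z assume z: "z \<in> ob (fsrc ?P)" and g: "g \<in> prodfam (elements (fsrc F)) (elements (fsrc G)) y z" "Dom V g = Z"
   and f: "f \<in> prodfam (elements (fsrc F)) (elements (fsrc G)) x y" "Dom V f = Z"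
  obtain a'' b'' where z': "z = (a'', b'')" "a'' \<in> ob (fsrc F)" "b'' \<in> ob (fsrc G)" using z by auto
  obtain f1 f2 where f': "f = Tuple V f1 f2" "f1 \<in> El (fsrc F) Z a a'" "f2 \<in> El (fsrc G) Z b b'"
   using E[OF f[unfolded x'(1) y'(1)] x'(2,3) y'(2,3)] by metis
  obtain g1 g2 where g': "g = Tuple V g1 g2" "g1 \<in> El (fsrc F) Z a' a''" "g2 \<in> El (fsrc G) Z b' b''"
   using E[OF g[unfolded z'(1) y'(1)] y'(2,3) z'(2,3)] by metis
  have o: "fob F a \<in> ob (ftgt F)" "fob F a' \<in> ob (ftgt F)" "fob F a'' \<in> ob (ftgt F)"
   "fob G b \<in> ob (ftgt G)" "fob G b' \<in> ob (ftgt G)" "fob G b'' \<in> ob (ftgt G)" using x' y' z' F G by simp_all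
  note u = ucomp_Hom[OF C(1) x'(2) y'(2) z'(2) g'(2) f'(2)] ucomp_Hom[OF C(3) x'(3) y'(3) z'(3) g'(3) f'(3)]
  show "fhm ?P x z \<cdot> ucomp V (fsrc ?P) x y z g f =
    ucomp V (ftgt ?P) (fob ?P x) (fob ?P y) (fob ?P z) (fhm ?P y z \<cdot> g) (fhm ?P x y \<cdot> f)"
   unfolding x'(1) y'(1) z'(1) f'(1) g'(1)
   using x'(2,3) y'(2,3) z'(2,3) F G vfun_prod_app[OF F G x'(2,3) y'(2,3) f'(2,3)] vfun_prod_app[OF F G y'(2,3) z'(2,3) g'(2,3)]
    vfun_prod_app[OF F G x'(2,3) z'(2,3) u] prod_ucomp[OF C(1,3) x'(2,3) y'(2,3) z'(2,3) g'(2,3) f'(2,3)]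
    prod_ucomp[OF C(2,4) o(1,4,2,5,3,6) vfun_app[OF F refl refl y'(2) z'(2) g'(2)] vfun_app[OF G refl refl y'(3) z'(3) g'(3)]
     vfun_app[OF F refl refl x'(2) y'(2) f'(2)] vfun_app[OF G refl refl x'(3) y'(3) f'(3)]]
    vfun_ucomp[OF F refl refl x'(2) y'(2) z'(2) g'(2) f'(2)] vfun_ucomp[OF G refl refl x'(3) y'(3) z'(3) g'(3) f'(3)]
   by simp
 qed (use C in \<open>auto simp: vfun_prod_def Let_def\<close>)
qed

lemma vfun_assoc_simps [simp]:
 "fsrc (vfun_assoc V C D E) = vcat_prod V (vcat_prod V C D) E"
 "ftgt (vfun_assoc V C D E) = vcat_prod V C (vcat_prod V D E)"
 "[|a \<in> ob C; b \<in> ob D; c \<in> ob E|] ==> fob (vfun_assoc V C D E) ((a, b), c) = (a, (b, c))"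
 by (simp_all add: vfun_assoc_def Let_def)

lemma vfun_assoc_app [simp]:
 assumes "a \<in> ob C" "b \<in> ob D" "c \<in> ob E" "a' \<in> ob C" "b' \<in> ob D" "c' \<in> ob E"
  "f \<in> El C Z a a'" "g \<in> El D Z b b'" "h \<in> El E Z c c'"
 shows "fhm (vfun_assoc V C D E) ((a, b), c) ((a', b'), c') \<cdot> Tuple V (Tuple V f g) h = Tuple V f (Tuple V g h)"
 using assms by (simp add: vfun_assoc_def Let_def Hom_iff)

text \<open>On tuples of elements the functor merely rebrackets, and composition on both sides is
  componentwise.\<close>

lemma vfunctor_assoc [simp]:
 assumes C: "vcategory V C" and D: "vcategory V D" and E: "vcategory V E"
 shows "vfunctor V (vfun_assoc V C D E)"
proof -
 let ?P = "vfun_assoc V C D E"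
 have A: "dfam (vcat_prod V C D) (prodfam (elements C) (elements D))"
  by (rule dfam_prodfam[OF dfam_elements[OF C] dfam_elements[OF D]])
 note E1 = prodfamE[OF _ _ A dfam_elements[OF E]] and E2 = prodfamE[OF _ _ dfam_elements[OF C] dfam_elements[OF D]]
 note CD = vcategory_prod[OF C D] and DE = vcategory_prod[OF D E]
 have el: "\<exists>f1 f2 f3. f = Tuple V (Tuple V f1 f2) f3 \<and> f1 \<in> El C Z a a' \<and>
   f2 \<in> El D Z b b' \<and> f3 \<in> El E Z c c'"
  if f: "f \<in> prodfam (prodfam (elements C) (elements D)) (elements E) ((a, b), c) ((a', b'), c')" "Dom V f = Z"
   and o: "a \<in> ob C" "b \<in> ob D" "c \<in> ob E" "a' \<in> ob C" "b' \<in> ob D" "c' \<in> ob E" for f Z a b c a' b' c'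
 proof -
  have o': "(a, b) \<in> ob (vcat_prod V C D)" "(a', b') \<in> ob (vcat_prod V C D)" using o by simp_all
  obtain p f3 where p: "f = Tuple V p f3" "p \<in> prodfam (elements C) (elements D) (a, b) (a', b')" "Dom V p = Z" "f3 \<in> El E Z c c'"
   using E1[OF f o'(1) o(3) o'(2) o(6)] by metis
  obtain f1 f2 where "p = Tuple V f1 f2" "f1 \<in> El C Z a a'" "f2 \<in> El D Z b b'"
   using E2[OF p(2,3) o(1,2,4,5)] by metis
  with p show ?thesis by blast
 qed
 show ?thesis
 proof (rule vfunctorI)
  show "dfam (fsrc ?P) (prodfam (prodfam (elements C) (elements D)) (elements E))"
   using dfam_prodfam[OF A dfam_elements[OF E]] by simp
  fix x assume x: "x \<in> ob (fsrc ?P)"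
  obtain a b c where x': "x = ((a, b), c)" and o: "a \<in> ob C" "b \<in> ob D" "c \<in> ob E" using x by auto
  show "fob ?P x \<in> ob (ftgt ?P)" using x' o by simp
  show "fhm ?P x x \<cdot> unt (fsrc ?P) x = unt (ftgt ?P) (fob ?P x)"
   unfolding x' using o vfun_assoc_app[OF o o unt_Hom[OF C] unt_Hom[OF D] unt_Hom[OF E]] by simp
  fix y assume y: "y \<in> ob (fsrc ?P)"
  obtain a' b' c' where y': "y = ((a', b'), c')" and o': "a' \<in> ob C" "b' \<in> ob D" "c' \<in> ob E" using y by auto
  show "fhm ?P x y \<in> El (ftgt ?P) (hm (fsrc ?P) x y) (fob ?P x) (fob ?P y)"
   unfolding x' y' using o o' C D E by (simp add: vfun_assoc_def Let_def Hom_iff)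
  fix z f g Z assume z: "z \<in> ob (fsrc ?P)" and g: "g \<in> prodfam (prodfam (elements C) (elements D)) (elements E) y z" "Dom V g = Z"
   and f: "f \<in> prodfam (prodfam (elements C) (elements D)) (elements E) x y" "Dom V f = Z"
  obtain a'' b'' c'' where z': "z = ((a'', b''), c'')" and o'': "a'' \<in> ob C" "b'' \<in> ob D" "c'' \<in> ob E" using z by auto
  obtain f1 f2 f3 where f': "f = Tuple V (Tuple V f1 f2) f3" and fh: "f1 \<in> El C Z a a'" "f2 \<in> El D Z b b'" "f3 \<in> El E Z c c'"
   using el[OF f[unfolded x' y'] o o'] by blast
  obtain g1 g2 g3 where g': "g = Tuple V (Tuple V g1 g2) g3" and gh: "g1 \<in> El C Z a' a''" "g2 \<in> El D Z b' b''" "g3 \<in> El E Z c' c''"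
   using el[OF g[unfolded y' z'] o' o''] by blast
  have p: "(a, b) \<in> ob (vcat_prod V C D)" "(a', b') \<in> ob (vcat_prod V C D)" "(a'', b'') \<in> ob (vcat_prod V C D)"
    "(b, c) \<in> ob (vcat_prod V D E)" "(b', c') \<in> ob (vcat_prod V D E)" "(b'', c'') \<in> ob (vcat_prod V D E)"
   using o o' o'' by simp_all
  have t: "Tuple V f1 f2 \<in> El (vcat_prod V C D) Z (a, b) (a', b')"
    "Tuple V g1 g2 \<in> El (vcat_prod V C D) Z (a', b') (a'', b'')"
    "Tuple V f2 f3 \<in> El (vcat_prod V D E) Z (b, c) (b', c')"
    "Tuple V g2 g3 \<in> El (vcat_prod V D E) Z (b', c') (b'', c'')"
   using o o' o'' fh gh by simp_all
  have u: "ucomp V C a a' a'' g1 f1 \<in> El C Z a a''" "ucomp V D b b' b'' g2 f2 \<in> El D Z b b''"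
   "ucomp V E c c' c'' g3 f3 \<in> El E Z c c''" using C D E o o' o'' fh gh by simp_all
  have "ucomp V (fsrc ?P) x y z g f = Tuple V (Tuple V (ucomp V C a a' a'' g1 f1) (ucomp V D b b' b'' g2 f2)) (ucomp V E c c' c'' g3 f3)"
   unfolding x' y' z' f' g' using prod_ucomp[OF CD E p(1) o(3) p(2) o'(3) p(3) o''(3) t(2) gh(3) t(1) fh(3)]
    prod_ucomp[OF C D o(1,2) o'(1,2) o''(1,2) gh(1,2) fh(1,2)] by simp
  moreover have "fhm ?P y z \<cdot> g = Tuple V g1 (Tuple V g2 g3)" "fhm ?P x y \<cdot> f = Tuple V f1 (Tuple V f2 f3)"
   unfolding x' y' z' f' g' by (rule vfun_assoc_app[OF o' o'' gh] vfun_assoc_app[OF o o' fh])+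
  moreover have "ucomp V (ftgt ?P) (fob ?P x) (fob ?P y) (fob ?P z) (Tuple V g1 (Tuple V g2 g3)) (Tuple V f1 (Tuple V f2 f3))
   = Tuple V (ucomp V C a a' a'' g1 f1) (Tuple V (ucomp V D b b' b'' g2 f2) (ucomp V E c c' c'' g3 f3))"
   unfolding x' y' z' using o o' o'' prod_ucomp[OF C DE o(1) p(4) o'(1) p(5) o''(1) p(6) gh(1) t(4) fh(1) t(3)]
    prod_ucomp[OF D E o(2,3) o'(2,3) o''(2,3) gh(2,3) fh(2,3)] by simp
  ultimately show "fhm ?P x z \<cdot> ucomp V (fsrc ?P) x y z g f =
    ucomp V (ftgt ?P) (fob ?P x) (fob ?P y) (fob ?P z) (fhm ?P y z \<cdot> g) (fhm ?P x y \<cdot> f)"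
   using vfun_assoc_app[OF o o'' u] x' z' by simp
 qed (use C D E in \<open>auto simp: vfun_assoc_def Let_def\<close>)
qed

lemma vfun_swap_simps [simp]:
 "fsrc (vfun_swap V C D) = vcat_prod V C D" "ftgt (vfun_swap V C D) = vcat_prod V D C"
 "[|a \<in> ob C; b \<in> ob D|] ==> fob (vfun_swap V C D) (a, b) = (b, a)"
 by (simp_all add: vfun_swap_def Let_def)

lemma vfun_swap_app [simp]:
 assumes "a \<in> ob C" "b \<in> ob D" "a' \<in> ob C" "b' \<in> ob D" "f \<in> El C Z a a'" "g \<in> El D Z b b'"
 shows "fhm (vfun_swap V C D) (a, b) (a', b') \<cdot> Tuple V f g = Tuple V g f"
 using assms by (simp add: vfun_swap_def Let_def Hom_iff)

lemma vfunctor_swap [simp]: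
 assumes C: "vcategory V C" and D: "vcategory V D"
 shows "vfunctor V (vfun_swap V C D)"
proof -
 let ?P = "vfun_swap V C D"
 note E = prodfamE[OF _ _ dfam_elements[OF C] dfam_elements[OF D]]
 show ?thesis
 proof (rule vfunctorI)
  show "dfam (fsrc ?P) (prodfam (elements C) (elements D))"
   using dfam_prodfam[OF dfam_elements[OF C] dfam_elements[OF D]] by simp
  fix x assume x: "x \<in> ob (fsrc ?P)"
  obtain a b where x': "x = (a, b)" and o: "a \<in> ob C" "b \<in> ob D" using x by auto
  show "fob ?P x \<in> ob (ftgt ?P)" using x' o by simp
  show "fhm ?P x x \<cdot> unt (fsrc ?P) x = unt (ftgt ?P) (fob ?P x)"
   unfolding x' using o vfun_swap_app[OF o o unt_Hom[OF C] unt_Hom[OF D]] by simp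
  fix y assume y: "y \<in> ob (fsrc ?P)"
  obtain a' b' where y': "y = (a', b')" and o': "a' \<in> ob C" "b' \<in> ob D" using y by auto
  show "fhm ?P x y \<in> El (ftgt ?P) (hm (fsrc ?P) x y) (fob ?P x) (fob ?P y)"
   unfolding x' y' using o o' C D by (simp add: vfun_swap_def Let_def Hom_iff)
  fix z f g Z assume z: "z \<in> ob (fsrc ?P)" and g: "g \<in> prodfam (elements C) (elements D) y z" "Dom V g = Z"
   and f: "f \<in> prodfam (elements C) (elements D) x y" "Dom V f = Z"
  obtain a'' b'' where z': "z = (a'', b'')" and o'': "a'' \<in> ob C" "b'' \<in> ob D" using z by auto
  obtain f1 f2 where f': "f = Tuple V f1 f2" and fh: "f1 \<in> El C Z a a'" "f2 \<in> El D Z b b'"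
   using E[OF f[unfolded x' y'] o o'] by metis
  obtain g1 g2 where g': "g = Tuple V g1 g2" and gh: "g1 \<in> El C Z a' a''" "g2 \<in> El D Z b' b''"
   using E[OF g[unfolded y' z'] o' o''] by metis
  have u: "ucomp V C a a' a'' g1 f1 \<in> El C Z a a''" "ucomp V D b b' b'' g2 f2 \<in> El D Z b b''"
   using C D o o' o'' fh gh by simp_all
  show "fhm ?P x z \<cdot> ucomp V (fsrc ?P) x y z g f =
    ucomp V (ftgt ?P) (fob ?P x) (fob ?P y) (fob ?P z) (fhm ?P y z \<cdot> g) (fhm ?P x y \<cdot> f)"
   unfolding x' y' z' f' g'
   using prod_ucomp[OF C D o o' o'' gh fh] prod_ucomp[OF D C o(2,1) o'(2,1) o''(2,1) gh(2,1) fh(2,1)]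
    vfun_swap_app[OF o o'' u] vfun_swap_app[OF o o' fh] vfun_swap_app[OF o' o'' gh] o o' o'' by simp
 qed (use C D in \<open>auto simp: vfun_swap_def Let_def\<close>)
qed

text \<open>The data needed to form tensor products of objects and morphisms. It is kept apart from
  \<open>symmetric_monoidal\<close> because the calculus of \<open>tarr\<close> is already used
  while the axioms of a structure are being verified.\<close>

definition is_tensor :: "('o, 'v, 'a) vcat => ('o, 'v, 'a) symmon => bool" where
 "is_tensor C M \<longleftrightarrow> vcategory V C \<and> vfunctor V (tens M) \<and> fsrc (tens M) = vcat_prod V C C \<and> ftgt (tens M) = C"

lemma is_tensorD:
 assumes "is_tensor C M"
 shows "vcategory V C" "vfunctor V (tens M)" "fsrc (tens M) = vcat_prod V C C" "ftgt (tens M) = C"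
 using assms by (simp_all add: is_tensor_def)

lemma tob_ob [simp]:
 assumes "is_tensor C M" "a \<in> ob C" "b \<in> ob C" shows "tob M a b \<in> ob C"
 unfolding tob_def by (rule vfun_fob[OF is_tensorD(2-4)[OF assms(1)]]) (use assms in simp)

lemma tarr_Hom [simp]:
 assumes T: "is_tensor C M" and o: "a \<in> ob C" "a' \<in> ob C" "b \<in> ob C" "b' \<in> ob C"
  and f: "f \<in> El C Z a a'" "g \<in> El C Z b b'"
 shows "tarr V M a a' b b' f g \<in> El C Z (tob M a b) (tob M a' b')"
 unfolding tarr_def tob_def
 by (rule vfun_app[OF is_tensorD(2-4)[OF T]]) (use o f in simp_all)

lemma tarr_Comp [simp]:
 assumes T: "is_tensor C M" and o: "a \<in> ob C" "a' \<in> ob C" "b \<in> ob C" "b' \<in> ob C"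
  and f: "f \<in> El C Z a a'" "g \<in> El C Z b b'" and k: "k \<in> Hom V Z' Z"
 shows "tarr V M a a' b b' f g \<cdot> k = tarr V M a a' b b' (f \<cdot> k) (g \<cdot> k)"
proof -
 have "(fhm (tens M) (a, b) (a', b') \<cdot> Tuple V f g) \<cdot> k = fhm (tens M) (a, b) (a', b') \<cdot> (Tuple V f g \<cdot> k)"
  by (rule vfun_app_Comp[OF is_tensorD(2,3)[OF T] _ _ _ k]) (use o f in simp_all)
 with Tuple_precomp[OF f k] show ?thesis by (simp add: tarr_def)
qed

text \<open>The interchange law: functoriality of \<open>tens M\<close>, applied to a componentwise
  composite of pairs.\<close>

lemma tarr_ucomp:
 assumes T: "is_tensor C M"
  and o: "a \<in> ob C" "a' \<in> ob C" "a'' \<in> ob C" "b \<in> ob C" "b' \<in> ob C" "b'' \<in> ob C"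
  and f: "f' \<in> El C Z a' a''" "f \<in> El C Z a a'" "g' \<in> El C Z b' b''" "g \<in> El C Z b b'"
 shows "tarr V M a a'' b b'' (ucomp V C a a' a'' f' f) (ucomp V C b b' b'' g' g) =
  ucomp V C (tob M a b) (tob M a' b') (tob M a'' b'') (tarr V M a' a'' b' b'' f' g') (tarr V M a a' b b' f g)"
proof -
 have "(a, b) \<in> ob (vcat_prod V C C)" "(a', b') \<in> ob (vcat_prod V C C)" "(a'', b'') \<in> ob (vcat_prod V C C)"
  "Tuple V f' g' \<in> El (vcat_prod V C C) Z (a', b') (a'', b'')"
  "Tuple V f g \<in> El (vcat_prod V C C) Z (a, b) (a', b')" using o f by simp_all
 note e = vfun_ucomp[OF is_tensorD(2-4)[OF T] this]
 show ?thesis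
  using e prod_ucomp[OF is_tensorD(1,1)[OF T] o(1,4,2,5,3,6) f(1,3,2,4)] by (simp add: tarr_def tob_def)
qed

lemma tarr_uid [simp]:
 assumes T: "is_tensor C M" and o: "a \<in> ob C" "b \<in> ob C" and Z: "Z \<in> Obj V"
 shows "tarr V M a a b b (uid C Z a) (uid C Z b) = uid C Z (tob M a b)"
proof -
 note C = is_tensorD(1)[OF T]
 have ab: "(a, b) \<in> ob (vcat_prod V C C)" using o by simp
 have "uid (vcat_prod V C C) Z (a, b) = Tuple V (uid C Z a) (uid C Z b)"
  using o C Z Tuple_precomp[OF unt_Hom[OF C o(1)] unt_Hom[OF C o(2)] Bang_Hom[OF Z]] by (simp add: uid_def)
 then show ?thesis using vfun_uid[OF is_tensorD(2-4)[OF T] ab Z] by (simp add: tarr_def tob_def)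
qed

lemma tarr_unt [simp]:
 assumes T: "is_tensor C M" and o: "a \<in> ob C" "b \<in> ob C"
 shows "tarr V M a a b b (unt C a) (unt C b) = unt C (tob M a b)"
 using tarr_uid[OF T o Term_Obj] is_tensorD(1)[OF T] o T by simp

text \<open>Like \<open>asc_tgt\<close> and \<open>symm_tgt\<close>, one of the functors that
  \<open>monoidal\<close> and \<open>symmetric_monoidal\<close> prescribe as ends of the
  constraints. Naming them separates the computation of their action on elements from the
  axioms.\<close>

definition asc_src :: "('o, 'v, 'a) vcat => ('o, 'v, 'a) symmon => (('o \<times> 'o) \<times> 'o, 'o, 'v, 'a) vfun" where
 "asc_src C M = tens M oo vfun_prod V (tens M) (vfun_id V C)"

definition asc_tgt :: "('o, 'v, 'a) vcat => ('o, 'v, 'a) symmon => (('o \<times> 'o) \<times> 'o, 'o, 'v, 'a) vfun" where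
 "asc_tgt C M = tens M oo (vfun_prod V (vfun_id V C) (tens M) oo vfun_assoc V C C C)"

definition symm_tgt :: "('o, 'v, 'a) vcat => ('o, 'v, 'a) symmon => ('o \<times> 'o, 'o, 'v, 'a) vfun" where
 "symm_tgt C M = tens M oo vfun_swap V C C"

lemma asc_src_vfunctor:
 assumes T: "is_tensor C M"
 shows "vfunctor V (asc_src C M)" "fsrc (asc_src C M) = vcat_prod V (vcat_prod V C C) C" "ftgt (asc_src C M) = C"
  "[|a \<in> ob C; b \<in> ob C; c \<in> ob C|] ==> fob (asc_src C M) ((a, b), c) = tob M (tob M a b) c"
 using is_tensorD[OF T] by (simp_all add: asc_src_def tob_def)

lemma asc_src_app:
 assumes T: "is_tensor C M" and o: "a \<in> ob C" "b \<in> ob C" "c \<in> ob C" "a' \<in> ob C" "b' \<in> ob C" "c' \<in> ob C"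
  and f: "f \<in> El C Z a a'" "g \<in> El C Z b b'" "h \<in> El C Z c c'"
 shows "fhm (asc_src C M) ((a, b), c) ((a', b'), c') \<cdot> Tuple V (Tuple V f g) h =
  tarr V M (tob M a b) (tob M a' b') c c' (tarr V M a a' b b' f g) h"
proof -
 note t = is_tensorD[OF T]
 have fg: "Tuple V f g \<in> El (fsrc (tens M)) Z (a, b) (a', b')" using t o f by simp
 then have fgh: "Tuple V (Tuple V f g) h \<in> El (vcat_prod V (fsrc (tens M)) C) Z ((a, b), c) ((a', b'), c')"
  using t o f by simp
 have p: "fsrc (vfun_prod V (tens M) (vfun_id V C)) = vcat_prod V (fsrc (tens M)) C" "fsrc (tens M) = ftgt (vfun_prod V (tens M) (vfun_id V C))" using t by simp_all
 have q: "((a, b), c) \<in> ob (vcat_prod V (fsrc (tens M)) C)" "((a', b'), c') \<in> ob (vcat_prod V (fsrc (tens M)) C)"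
  "(a, b) \<in> ob (fsrc (tens M))" "(a', b') \<in> ob (fsrc (tens M))" "c \<in> ob (fsrc (vfun_id V C))" "c' \<in> ob (fsrc (vfun_id V C))"
  using t o by simp_all
 have h: "h \<in> El (fsrc (vfun_id V C)) Z c c'" using f by simp
 have "fhm (asc_src C M) ((a, b), c) ((a', b'), c') \<cdot> Tuple V (Tuple V f g) h =
  fhm (tens M) (fob (vfun_prod V (tens M) (vfun_id V C)) ((a, b), c)) (fob (vfun_prod V (tens M) (vfun_id V C)) ((a', b'), c'))
   \<cdot> Tuple V (fhm (tens M) (a, b) (a', b') \<cdot> Tuple V f g) (fhm (vfun_id V C) c c' \<cdot> h)"
  unfolding asc_src_def vfun_comp_app[OF vfunctor_prod[OF t(2) vfunctor_id[OF t(1)]] p(1) t(2) p(2) q(1,2) fgh]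
   vfun_prod_app[OF t(2) vfunctor_id[OF t(1)] q(3,5,4,6) fg h] ..
 then show ?thesis using q o f unfolding tarr_def tob_def by simp
qed

lemma asc_tgt_vfunctor:
 assumes T: "is_tensor C M"
 shows "vfunctor V (asc_tgt C M)" "fsrc (asc_tgt C M) = vcat_prod V (vcat_prod V C C) C" "ftgt (asc_tgt C M) = C"
  "[|a \<in> ob C; b \<in> ob C; c \<in> ob C|] ==> fob (asc_tgt C M) ((a, b), c) = tob M a (tob M b c)"
 using is_tensorD[OF T] by (simp_all add: asc_tgt_def tob_def)

lemma asc_tgt_app:
 assumes T: "is_tensor C M" and o: "a \<in> ob C" "b \<in> ob C" "c \<in> ob C" "a' \<in> ob C" "b' \<in> ob C" "c' \<in> ob C"
  and f: "f \<in> El C Z a a'" "g \<in> El C Z b b'" "h \<in> El C Z c c'"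
 shows "fhm (asc_tgt C M) ((a, b), c) ((a', b'), c') \<cdot> Tuple V (Tuple V f g) h =
  tarr V M a a' (tob M b c) (tob M b' c') f (tarr V M b b' c c' g h)"
proof -
 note t = is_tensorD[OF T]
 let ?A = "vfun_assoc V C C C" let ?P = "vfun_prod V (vfun_id V C) (tens M)"
 have gh: "Tuple V g h \<in> El (fsrc (tens M)) Z (b, c) (b', c')" using t o f by simp
 have fgh: "Tuple V (Tuple V f g) h \<in> El (vcat_prod V (vcat_prod V C C) C) Z ((a, b), c) ((a', b'), c')"
  using t o f by simp
 have 1: "vfunctor V ?A" "fsrc ?A = vcat_prod V (vcat_prod V C C) C" "vfunctor V ?P" "fsrc ?P = ftgt ?A"
  using t by simp_all
 have 2: "((a, b), c) \<in> ob (vcat_prod V (vcat_prod V C C) C)" "((a', b'), c') \<in> ob (vcat_prod V (vcat_prod V C C) C)"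
  using o by simp_all
 have 3: "vfunctor V (?P oo ?A)" "fsrc (?P oo ?A) = vcat_prod V (vcat_prod V C C) C" "fsrc (tens M) = ftgt (?P oo ?A)"
  using t 1 by simp_all
 have "fhm (asc_tgt C M) ((a, b), c) ((a', b'), c') \<cdot> Tuple V (Tuple V f g) h =
  fhm (tens M) (a, fob (tens M) (b, c)) (a', fob (tens M) (b', c')) \<cdot> fhm ?P (a, (b, c)) (a', (b', c')) \<cdot> Tuple V f (Tuple V g h)"
  unfolding asc_tgt_def vfun_comp_app[OF 3(1,2) t(2) 3(3) 2 fgh] vfun_comp_app[OF 1 2 fgh]
   vfun_assoc_app[OF o f] using t o by simp
 also have "fhm ?P (a, (b, c)) (a', (b', c')) \<cdot> Tuple V f (Tuple V g h) = Tuple V f (fhm (tens M) (b, c) (b', c') \<cdot> Tuple V g h)"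
  using vfun_prod_app[OF vfunctor_id[OF t(1)] t(2) _ _ _ _ _ gh, of a a' f] t o f by simp
 finally show ?thesis by (simp add: tarr_def tob_def)
qed

lemma symm_tgt_vfunctor:
 assumes T: "is_tensor C M"
 shows "vfunctor V (symm_tgt C M)" "fsrc (symm_tgt C M) = vcat_prod V C C" "ftgt (symm_tgt C M) = C"
  "[|a \<in> ob C; b \<in> ob C|] ==> fob (symm_tgt C M) (a, b) = tob M b a"
 using is_tensorD[OF T] by (simp_all add: symm_tgt_def tob_def)

lemma symm_tgt_app:
 assumes T: "is_tensor C M" and o: "a \<in> ob C" "b \<in> ob C" "a' \<in> ob C" "b' \<in> ob C"
  and f: "f \<in> El C Z a a'" "g \<in> El C Z b b'"
 shows "fhm (symm_tgt C M) (a, b) (a', b') \<cdot> Tuple V f g = tarr V M b b' a a' g f"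
proof -
 note t = is_tensorD[OF T]
 have p: "fsrc (vfun_swap V C C) = vcat_prod V C C" "fsrc (tens M) = ftgt (vfun_swap V C C)" using t by simp_all
 have fg: "Tuple V f g \<in> El (vcat_prod V C C) Z (a, b) (a', b')" using t o f by simp
 have q: "(a, b) \<in> ob (vcat_prod V C C)" "(a', b') \<in> ob (vcat_prod V C C)" using o by simp_all
 show ?thesis unfolding symm_tgt_def tarr_def vfun_comp_app[OF vfunctor_swap[OF t(1,1)] p(1) t(2) p(2) q fg] vfun_swap_app[OF o f]
  using o by simp
qed

end

section \<open>The constraints at an arbitrary stage\<close>

context cartesian_category
begin

text \<open>Components of the constraint live at the terminal stage. As constant morphisms at stage
  \<open>Z\<close> they can be composed with arbitrary elements of the hom objects.\<close>

definition alpha :: "('o, 'v, 'a) symmon => 'v => 'o => 'o => 'o => 'a" where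
 "alpha M Z a b c = ncomp (asc M) ((a, b), c) \<cdot> Bang V Z"

definition sigma :: "('o, 'v, 'a) symmon => 'v => 'o => 'o => 'a" where
 "sigma M Z a b = ncomp (symm M) (a, b) \<cdot> Bang V Z"

text \<open>\<open>vnat_iso\<close> only asserts that an inverse exists, so one is selected by
  choice; its components are determined by \<open>inverse_unique\<close>.\<close>

definition alphainv :: "('o, 'v, 'a) vcat => ('o, 'v, 'a) symmon => 'v => 'o => 'o => 'o => 'a" where
 "alphainv C M Z a b c = ncomp (SOME s. vnatural V s \<and> nsrc s = ntgt (asc M) \<and> ntgt s = nsrc (asc M) \<and>
    vnat_vcomp V s (asc M) = vnat_id (nsrc (asc M)) \<and> vnat_vcomp V (asc M) s = vnat_id (ntgt (asc M))) ((a, b), c) \<cdot> Bang V Z"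

lemma symmetric_monoidal_is_tensor:
 assumes "symmetric_monoidal V C M" shows "is_tensor C M"
 using assms vfunD(2)[of "tens M"] unfolding symmetric_monoidal_def monoidal_def is_tensor_def Let_def by auto

lemma symmetric_monoidal_vcategory: "symmetric_monoidal V C M ==> vcategory V C"
 by (rule is_tensorD(1)[OF symmetric_monoidal_is_tensor])

lemma symmetric_monoidal_asc:
 assumes "symmetric_monoidal V C M"
 shows "vnatural V (asc M)" "nsrc (asc M) = asc_src C M" "ntgt (asc M) = asc_tgt C M"
  "vnatural V (symm M)" "nsrc (symm M) = tens M" "ntgt (symm M) = symm_tgt C M"
 using assms unfolding symmetric_monoidal_def monoidal_def asc_src_def asc_tgt_def symm_tgt_def Let_def vnat_iso_def
 by simp_all

lemma alpha_component:
 assumes S: "symmetric_monoidal V C M" and o: "a \<in> ob C" "b \<in> ob C" "c \<in> ob C"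
 shows "ncomp (asc M) ((a, b), c) \<in> El C (Term V) (tob M (tob M a b) c) (tob M a (tob M b c))"
proof -
 note n = symmetric_monoidal_asc[OF S] and T = symmetric_monoidal_is_tensor[OF S]
 show ?thesis
  using ncomp_Hom[OF n(1-3) asc_src_vfunctor(2,3)[OF T], of "((a, b), c)"] o
   asc_src_vfunctor(4)[OF T o] asc_tgt_vfunctor(4)[OF T o] by simp
qed

lemma alpha_Hom [simp]:
 assumes "symmetric_monoidal V C M" "a \<in> ob C" "b \<in> ob C" "c \<in> ob C" "Z \<in> Obj V"
 shows "alpha M Z a b c \<in> El C Z (tob M (tob M a b) c) (tob M a (tob M b c))"
 unfolding alpha_def by (rule stage_Hom[OF alpha_component[OF assms(1-4)] assms(5)])

lemma alpha_Comp [simp]: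
 assumes "symmetric_monoidal V C M" "a \<in> ob C" "b \<in> ob C" "c \<in> ob C" "k \<in> Hom V Z' Z"
 shows "alpha M Z a b c \<cdot> k = alpha M Z' a b c"
 unfolding alpha_def by (rule stage_Comp[OF alpha_component[OF assms(1-4)] assms(5)])

lemma alpha_Term:
 assumes "symmetric_monoidal V C M" "a \<in> ob C" "b \<in> ob C" "c \<in> ob C"
 shows "alpha M (Term V) a b c = ncomp (asc M) ((a, b), c)"
 using stage_Term[OF alpha_component[OF assms(1-4)]] by (simp add: alpha_def)

text \<open>The naturality square of \<open>asc M\<close> at the element ((\<open>f\<close>,
  \<open>g\<close>), \<open>h\<close>), rewritten by the formulas for its two ends.\<close>

lemma alpha_natural:
 assumes S: "symmetric_monoidal V C M" and o: "a \<in> ob C" "b \<in> ob C" "c \<in> ob C" "a' \<in> ob C" "b' \<in> ob C" "c' \<in> ob C"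
  and f: "f \<in> El C Z a a'" "g \<in> El C Z b b'" "h \<in> El C Z c c'"
 shows "ucomp V C (tob M (tob M a b) c) (tob M (tob M a' b') c') (tob M a' (tob M b' c')) (alpha M Z a' b' c')
   (tarr V M (tob M a b) (tob M a' b') c c' (tarr V M a a' b b' f g) h) =
  ucomp V C (tob M (tob M a b) c) (tob M a (tob M b c)) (tob M a' (tob M b' c'))
   (tarr V M a a' (tob M b c) (tob M b' c') f (tarr V M b b' c c' g h)) (alpha M Z a b c)"
proof -
 note n = symmetric_monoidal_asc[OF S] and T = symmetric_monoidal_is_tensor[OF S]
 have fgh: "((a, b), c) \<in> ob (vcat_prod V (vcat_prod V C C) C)" "((a', b'), c') \<in> ob (vcat_prod V (vcat_prod V C C) C)"
   "Tuple V (Tuple V f g) h \<in> El (vcat_prod V (vcat_prod V C C) C) Z ((a, b), c) ((a', b'), c')"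
  using o f by simp_all
 note e = nat_sq[OF n(1-3) asc_src_vfunctor(2,3)[OF T] fgh]
 show ?thesis using e unfolding asc_src_app[OF T o f] asc_tgt_app[OF T o f] asc_src_vfunctor(4)[OF T o(1-3)]
   asc_src_vfunctor(4)[OF T o(4-6)] asc_tgt_vfunctor(4)[OF T o(1-3)] asc_tgt_vfunctor(4)[OF T o(4-6)]
  by (simp add: alpha_def)
qed

lemma alphainv:
 assumes S: "symmetric_monoidal V C M" and o: "a \<in> ob C" "b \<in> ob C" "c \<in> ob C" and Z: "Z \<in> Obj V"
 shows "alphainv C M Z a b c \<in> El C Z (tob M a (tob M b c)) (tob M (tob M a b) c)"
  "ucomp V C (tob M (tob M a b) c) (tob M a (tob M b c)) (tob M (tob M a b) c) (alphainv C M Z a b c) (alpha M Z a b c)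
   = uid C Z (tob M (tob M a b) c)"
  "ucomp V C (tob M a (tob M b c)) (tob M (tob M a b) c) (tob M a (tob M b c)) (alpha M Z a b c) (alphainv C M Z a b c)
   = uid C Z (tob M a (tob M b c))"
  "k \<in> Hom V Z' Z ==> alphainv C M Z a b c \<cdot> k = alphainv C M Z' a b c"
proof -
 note n = symmetric_monoidal_asc[OF S] and T = symmetric_monoidal_is_tensor[OF S]
 note C = is_tensorD(1)[OF T]
 define s where "s = (SOME s. vnatural V s \<and> nsrc s = ntgt (asc M) \<and> ntgt s = nsrc (asc M) \<and>
    vnat_vcomp V s (asc M) = vnat_id (nsrc (asc M)) \<and> vnat_vcomp V (asc M) s = vnat_id (ntgt (asc M)))"
 have "\<exists>s. vnatural V s \<and> nsrc s = ntgt (asc M) \<and> ntgt s = nsrc (asc M) \<and>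
    vnat_vcomp V s (asc M) = vnat_id (nsrc (asc M)) \<and> vnat_vcomp V (asc M) s = vnat_id (ntgt (asc M))"
  using S unfolding symmetric_monoidal_def monoidal_def Let_def vnat_iso_def by blast
 from someI_ex[OF this, folded s_def]
 have s: "vnatural V s" "nsrc s = asc_tgt C M" "ntgt s = asc_src C M"
  "vnat_vcomp V s (asc M) = vnat_id (asc_src C M)" "vnat_vcomp V (asc M) s = vnat_id (asc_tgt C M)"
  using n by simp_all
 let ?x = "((a, b), c)"
 have x: "?x \<in> ob (vcat_prod V (vcat_prod V C C) C)" using o by simp
 note F = asc_src_vfunctor[OF T] asc_tgt_vfunctor[OF T]
 have d: "alphainv C M Z a b c = ncomp s ?x \<cdot> Bang V Z" for Z by (simp add: alphainv_def s_def)
 have h: "ncomp s ?x \<in> El C (Term V) (tob M a (tob M b c)) (tob M (tob M a b) c)"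
  using ncomp_Hom[OF s(1-3) F(6,7) x] F(4)[OF o] F(8)[OF o] by simp
 note oo = tob_ob[OF T tob_ob[OF T o(1,2)] o(3)] tob_ob[OF T o(1) tob_ob[OF T o(2,3)]]
 have "ncomp (vnat_vcomp V s (asc M)) ?x = ncomp (vnat_id (asc_src C M)) ?x"
  "ncomp (vnat_vcomp V (asc M) s) ?x = ncomp (vnat_id (asc_tgt C M)) ?x" using s by simp_all
 then have e: "ucomp V C (tob M (tob M a b) c) (tob M a (tob M b c)) (tob M (tob M a b) c) (ncomp s ?x) (ncomp (asc M) ?x)
   = unt C (tob M (tob M a b) c)"
  "ucomp V C (tob M a (tob M b c)) (tob M (tob M a b) c) (tob M a (tob M b c)) (ncomp (asc M) ?x) (ncomp s ?x)
   = unt C (tob M a (tob M b c))"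
  using n s(1-3) F o x by (simp_all del: vcat_prod_simps(1))
 note ac = alpha_component[OF S o]
 show "alphainv C M Z a b c \<in> El C Z (tob M a (tob M b c)) (tob M (tob M a b) c)"
  unfolding d by (rule stage_Hom[OF h Z])
 show "ucomp V C (tob M (tob M a b) c) (tob M a (tob M b c)) (tob M (tob M a b) c) (alphainv C M Z a b c) (alpha M Z a b c)
   = uid C Z (tob M (tob M a b) c)"
  "ucomp V C (tob M a (tob M b c)) (tob M (tob M a b) c) (tob M a (tob M b c)) (alpha M Z a b c) (alphainv C M Z a b c)
   = uid C Z (tob M a (tob M b c))"
  unfolding d alpha_def using stage_ucomp[OF C oo(1,2,1) h ac Z] stage_ucomp[OF C oo(2,1,2) ac h Z] e
  by (simp_all add: uid_def)
 show "k \<in> Hom V Z' Z ==> alphainv C M Z a b c \<cdot> k = alphainv C M Z' a b c"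
  unfolding d by (rule stage_Comp[OF h])
qed

lemmas alphainv_Hom [simp] = alphainv(1) and alphainv_Comp [simp] = alphainv(4)[OF _ _ _ _ HomD(5)]

lemma sigma_component:
 assumes S: "symmetric_monoidal V C M" and o: "a \<in> ob C" "b \<in> ob C"
 shows "ncomp (symm M) (a, b) \<in> El C (Term V) (tob M a b) (tob M b a)"
proof -
 note n = symmetric_monoidal_asc[OF S] and T = symmetric_monoidal_is_tensor[OF S]
 show ?thesis
  using ncomp_Hom[OF n(4-6) is_tensorD(3,4)[OF T], of "(a, b)"] o
   symm_tgt_vfunctor(4)[OF T o] by (simp add: tob_def)
qed

lemma sigma_Hom [simp]:
 assumes "symmetric_monoidal V C M" "a \<in> ob C" "b \<in> ob C" "Z \<in> Obj V"
 shows "sigma M Z a b \<in> El C Z (tob M a b) (tob M b a)"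
 unfolding sigma_def by (rule stage_Hom[OF sigma_component[OF assms(1-3)] assms(4)])

lemma sigma_Comp [simp]:
 assumes "symmetric_monoidal V C M" "a \<in> ob C" "b \<in> ob C" "k \<in> Hom V Z' Z"
 shows "sigma M Z a b \<cdot> k = sigma M Z' a b"
 unfolding sigma_def by (rule stage_Comp[OF sigma_component[OF assms(1-3)] assms(4)])

lemma sigma_Term:
 assumes "symmetric_monoidal V C M" "a \<in> ob C" "b \<in> ob C"
 shows "sigma M (Term V) a b = ncomp (symm M) (a, b)"
 using stage_Term[OF sigma_component[OF assms(1-3)]] by (simp add: sigma_def)

lemma sigma_natural:
 assumes S: "symmetric_monoidal V C M" and o: "a \<in> ob C" "b \<in> ob C" "a' \<in> ob C" "b' \<in> ob C"
  and f: "f \<in> El C Z a a'" "g \<in> El C Z b b'"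
 shows "ucomp V C (tob M a b) (tob M a' b') (tob M b' a') (sigma M Z a' b') (tarr V M a a' b b' f g) =
  ucomp V C (tob M a b) (tob M b a) (tob M b' a') (tarr V M b b' a a' g f) (sigma M Z a b)"
proof -
 note n = symmetric_monoidal_asc[OF S] and T = symmetric_monoidal_is_tensor[OF S]
 have fg: "(a, b) \<in> ob (vcat_prod V C C)" "(a', b') \<in> ob (vcat_prod V C C)"
   "Tuple V f g \<in> El (vcat_prod V C C) Z (a, b) (a', b')"
  using o f by simp_all
 note e = nat_sq[OF n(4-6) is_tensorD(3,4)[OF T] fg]
 show ?thesis using e unfolding symm_tgt_app[OF T o f] symm_tgt_vfunctor(4)[OF T o(1-2)]
   symm_tgt_vfunctor(4)[OF T o(3-4)] by (simp add: sigma_def tob_def tarr_def)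
qed

lemma ucomp_stage_eq:
 assumes "vcategory V C" "a \<in> ob C" "b \<in> ob C" "c \<in> ob C" "g \<in> El C (Term V) b c" "f \<in> El C (Term V) a b"
  "ucomp V C a b c g f = r" "Z \<in> Obj V"
 shows "ucomp V C a b c (g \<cdot> Bang V Z) (f \<cdot> Bang V Z) = r \<cdot> Bang V Z"
 using stage_ucomp[OF assms(1-6,8)] assms by simp

lemma sigma_sigma:
 assumes S: "symmetric_monoidal V C M" and o: "a \<in> ob C" "b \<in> ob C" and Z: "Z \<in> Obj V"
 shows "ucomp V C (tob M a b) (tob M b a) (tob M a b) (sigma M Z b a) (sigma M Z a b) = uid C Z (tob M a b)"
proof -
 note T = symmetric_monoidal_is_tensor[OF S]
 have "ucomp V C (tob M a b) (tob M b a) (tob M a b) (ncomp (symm M) (b, a)) (ncomp (symm M) (a, b)) = unt C (tob M a b)"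
  using S o unfolding symmetric_monoidal_def Let_def by blast
 from ucomp_stage_eq[OF is_tensorD(1)[OF T] _ _ _ sigma_component[OF S o(2,1)] sigma_component[OF S o] this Z]
 show ?thesis using T o by (simp add: uid_def sigma_def)
qed

text \<open>The axiom is an equation at the terminal stage; composition with the unique map from
  \<open>Z\<close> distributes over \<open>ucomp\<close> and \<open>tarr\<close> and carries it to
  stage \<open>Z\<close>.\<close>

lemma pentagon:
 assumes S: "symmetric_monoidal V C M" and o: "a \<in> ob C" "b \<in> ob C" "c \<in> ob C" "d \<in> ob C" and Z: "Z \<in> Obj V"
  and T: "T = tob M"
 shows "ucomp V C (T (T (T a b) c) d) (T (T a b) (T c d)) (T a (T b (T c d)))
      (alpha M Z a b (T c d)) (alpha M Z (T a b) c d) =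
     ucomp V C (T (T (T a b) c) d) (T a (T (T b c) d)) (T a (T b (T c d)))
      (tarr V M a a (T (T b c) d) (T b (T c d)) (uid C Z a) (alpha M Z b c d))
      (ucomp V C (T (T (T a b) c) d) (T (T a (T b c)) d) (T a (T (T b c) d))
       (alpha M Z a (T b c) d)
       (tarr V M (T (T a b) c) (T a (T b c)) d d (alpha M Z a b c) (uid C Z d)))"
proof -
 note t = symmetric_monoidal_is_tensor[OF S] note C = is_tensorD(1)[OF t]
 have TT [simp]: "T x y \<in> ob C" if "x \<in> ob C" "y \<in> ob C" for x y using tob_ob[OF t that] T by simp
 note ac = alpha_component[OF S, folded T]
 have e: "ucomp V C (T (T (T a b) c) d) (T (T a b) (T c d)) (T a (T b (T c d)))
      (ncomp (asc M) ((a, b), T c d)) (ncomp (asc M) ((T a b, c), d)) =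
     ucomp V C (T (T (T a b) c) d) (T a (T (T b c) d)) (T a (T b (T c d)))
      (tarr V M a a (T (T b c) d) (T b (T c d)) (unt C a) (ncomp (asc M) ((b, c), d)))
      (ucomp V C (T (T (T a b) c) d) (T (T a (T b c)) d) (T a (T (T b c) d))
       (ncomp (asc M) ((a, T b c), d))
       (tarr V M (T (T a b) c) (T a (T b c)) d d (ncomp (asc M) ((a, b), c)) (unt C d)))"
  using S o unfolding symmetric_monoidal_def monoidal_def Let_def T by blast
 have h: "tarr V M a a (T (T b c) d) (T b (T c d)) (unt C a) (ncomp (asc M) ((b, c), d)) \<in> El C (Term V) (T a (T (T b c) d)) (T a (T b (T c d)))"
  "tarr V M (T (T a b) c) (T a (T b c)) d d (ncomp (asc M) ((a, b), c)) (unt C d) \<in> El C (Term V) (T (T (T a b) c) d) (T (T a (T b c)) d)"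
  unfolding T by (rule tarr_Hom[OF t]; use o S C t ac[unfolded T] in simp)+
 have h2: "ucomp V C (T (T (T a b) c) d) (T (T a (T b c)) d) (T a (T (T b c) d))
       (ncomp (asc M) ((a, T b c), d)) (tarr V M (T (T a b) c) (T a (T b c)) d d (ncomp (asc M) ((a, b), c)) (unt C d))
   \<in> El C (Term V) (T (T (T a b) c) d) (T a (T (T b c) d))"
  by (rule ucomp_Hom[OF C _ _ _ ac h(2)]) (use o in simp_all)
 have "ucomp V C (T (T (T a b) c) d) (T (T a b) (T c d)) (T a (T b (T c d)))
      (alpha M Z a b (T c d)) (alpha M Z (T a b) c d) = ucomp V C (T (T (T a b) c) d) (T (T a b) (T c d)) (T a (T b (T c d)))
      (ncomp (asc M) ((a, b), T c d)) (ncomp (asc M) ((T a b, c), d)) \<cdot> Bang V Z"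
  unfolding alpha_def by (rule stage_ucomp[OF C _ _ _ ac ac Z, symmetric]) (use o in simp_all)
 also have "\<dots> = ucomp V C (T (T (T a b) c) d) (T a (T (T b c) d)) (T a (T b (T c d)))
      (tarr V M a a (T (T b c) d) (T b (T c d)) (unt C a) (ncomp (asc M) ((b, c), d)) \<cdot> Bang V Z)
      (ucomp V C (T (T (T a b) c) d) (T (T a (T b c)) d) (T a (T (T b c) d))
       (ncomp (asc M) ((a, T b c), d) \<cdot> Bang V Z)
       (tarr V M (T (T a b) c) (T a (T b c)) d d (ncomp (asc M) ((a, b), c)) (unt C d) \<cdot> Bang V Z))"
  unfolding e using o stage_ucomp[OF C _ _ _ h(1) h2 Z] stage_ucomp[OF C _ _ _ ac h(2) Z] by simp
 also have "tarr V M a a (T (T b c) d) (T b (T c d)) (unt C a) (ncomp (asc M) ((b, c), d)) \<cdot> Bang V Z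
  = tarr V M a a (T (T b c) d) (T b (T c d)) (uid C Z a) (alpha M Z b c d)"
  unfolding alpha_def uid_def by (rule tarr_Comp[OF t _ _ _ _ unt_Hom[OF C] ac Bang_Hom[OF Z]]) (use o in simp_all)
 also have "tarr V M (T (T a b) c) (T a (T b c)) d d (ncomp (asc M) ((a, b), c)) (unt C d) \<cdot> Bang V Z
  = tarr V M (T (T a b) c) (T a (T b c)) d d (alpha M Z a b c) (uid C Z d)"
  unfolding alpha_def uid_def by (rule tarr_Comp[OF t _ _ _ _ ac unt_Hom[OF C] Bang_Hom[OF Z]]) (use o in simp_all)
 finally show ?thesis by (simp add: alpha_def)
qed

lemma hexagon:
 assumes S: "symmetric_monoidal V C M" and o: "a \<in> ob C" "b \<in> ob C" "c \<in> ob C" and Z: "Z \<in> Obj V"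
  and T: "T = tob M"
 shows "ucomp V C (T (T a b) c) (T (T b c) a) (T b (T c a)) (alpha M Z b c a)
      (ucomp V C (T (T a b) c) (T a (T b c)) (T (T b c) a) (sigma M Z a (T b c)) (alpha M Z a b c)) =
     ucomp V C (T (T a b) c) (T b (T a c)) (T b (T c a))
      (tarr V M b b (T a c) (T c a) (uid C Z b) (sigma M Z a c))
      (ucomp V C (T (T a b) c) (T (T b a) c) (T b (T a c))
       (alpha M Z b a c)
       (tarr V M (T a b) (T b a) c c (sigma M Z a b) (uid C Z c)))"
proof -
 note t = symmetric_monoidal_is_tensor[OF S] note C = is_tensorD(1)[OF t]
 have TT [simp]: "T x y \<in> ob C" if "x \<in> ob C" "y \<in> ob C" for x y using tob_ob[OF t that] T by simp
 note ac = alpha_component[OF S, folded T] and sc = sigma_component[OF S, folded T]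
 have e: "ucomp V C (T (T a b) c) (T (T b c) a) (T b (T c a)) (ncomp (asc M) ((b, c), a))
      (ucomp V C (T (T a b) c) (T a (T b c)) (T (T b c) a) (ncomp (symm M) (a, T b c)) (ncomp (asc M) ((a, b), c))) =
     ucomp V C (T (T a b) c) (T b (T a c)) (T b (T c a))
      (tarr V M b b (T a c) (T c a) (unt C b) (ncomp (symm M) (a, c)))
      (ucomp V C (T (T a b) c) (T (T b a) c) (T b (T a c))
       (ncomp (asc M) ((b, a), c))
       (tarr V M (T a b) (T b a) c c (ncomp (symm M) (a, b)) (unt C c)))"
  using S o unfolding symmetric_monoidal_def Let_def T by blast
 have h: "tarr V M b b (T a c) (T c a) (unt C b) (ncomp (symm M) (a, c)) \<in> El C (Term V) (T b (T a c)) (T b (T c a))"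
  "tarr V M (T a b) (T b a) c c (ncomp (symm M) (a, b)) (unt C c) \<in> El C (Term V) (T (T a b) c) (T (T b a) c)"
  unfolding T by (rule tarr_Hom[OF t]; use o S C t sc[unfolded T] in simp)+
 have h2: "ucomp V C (T (T a b) c) (T (T b a) c) (T b (T a c)) (ncomp (asc M) ((b, a), c))
       (tarr V M (T a b) (T b a) c c (ncomp (symm M) (a, b)) (unt C c))
   \<in> El C (Term V) (T (T a b) c) (T b (T a c))"
  by (rule ucomp_Hom[OF C _ _ _ ac h(2)]) (use o in simp_all)
 have h3: "ucomp V C (T (T a b) c) (T a (T b c)) (T (T b c) a) (ncomp (symm M) (a, T b c)) (ncomp (asc M) ((a, b), c))
   \<in> El C (Term V) (T (T a b) c) (T (T b c) a)"
  by (rule ucomp_Hom[OF C _ _ _ sc ac]) (use o in simp_all)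
 have "ucomp V C (T (T a b) c) (T (T b c) a) (T b (T c a)) (alpha M Z b c a)
      (ucomp V C (T (T a b) c) (T a (T b c)) (T (T b c) a) (sigma M Z a (T b c)) (alpha M Z a b c)) =
   ucomp V C (T (T a b) c) (T (T b c) a) (T b (T c a)) (ncomp (asc M) ((b, c), a))
      (ucomp V C (T (T a b) c) (T a (T b c)) (T (T b c) a) (ncomp (symm M) (a, T b c)) (ncomp (asc M) ((a, b), c))) \<cdot> Bang V Z"
  unfolding alpha_def sigma_def using o stage_ucomp[OF C _ _ _ ac h3 Z] stage_ucomp[OF C _ _ _ sc ac Z] by simp
 also have "\<dots> = ucomp V C (T (T a b) c) (T b (T a c)) (T b (T c a))
      (tarr V M b b (T a c) (T c a) (unt C b) (ncomp (symm M) (a, c)) \<cdot> Bang V Z)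
      (ucomp V C (T (T a b) c) (T (T b a) c) (T b (T a c))
       (ncomp (asc M) ((b, a), c) \<cdot> Bang V Z)
       (tarr V M (T a b) (T b a) c c (ncomp (symm M) (a, b)) (unt C c) \<cdot> Bang V Z))"
  unfolding e using o stage_ucomp[OF C _ _ _ h(1) h2 Z] stage_ucomp[OF C _ _ _ ac h(2) Z] by simp
 also have "tarr V M b b (T a c) (T c a) (unt C b) (ncomp (symm M) (a, c)) \<cdot> Bang V Z
  = tarr V M b b (T a c) (T c a) (uid C Z b) (sigma M Z a c)"
  unfolding sigma_def uid_def by (rule tarr_Comp[OF t _ _ _ _ unt_Hom[OF C] sc Bang_Hom[OF Z]]) (use o in simp_all)
 also have "tarr V M (T a b) (T b a) c c (ncomp (symm M) (a, b)) (unt C c) \<cdot> Bang V Z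
  = tarr V M (T a b) (T b a) c c (sigma M Z a b) (uid C Z c)"
  unfolding sigma_def uid_def by (rule tarr_Comp[OF t _ _ _ _ sc unt_Hom[OF C] Bang_Hom[OF Z]]) (use o in simp_all)
 finally show ?thesis by (simp add: alpha_def)
qed

text \<open>The ends of both constraints are determined by the tensor functor, so a structure
  amounts to that functor and two families of components. Outside their domains these are
  \<open>undefined\<close>, as \<open>vnatural\<close> requires.\<close>

definition mk_symmon ::
 "('o, 'v, 'a) vcat => ('o \<times> 'o, 'o, 'v, 'a) vfun => ('o => 'o => 'o => 'a) => ('o => 'o => 'a)
  => ('o, 'v, 'a) symmon" where
 "mk_symmon C T al sg =
   \<lparr>tens = T,
   asc = \<lparr>nsrc = T oo vfun_prod V T (vfun_id V C),
       ntgt = T oo (vfun_prod V (vfun_id V C) T oo vfun_assoc V C C C),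
       ncomp = (\<lambda>((a, b), c)\<in>(ob C \<times> ob C) \<times> ob C. al a b c)\<rparr>,
   symm = \<lparr>nsrc = T, ntgt = T oo vfun_swap V C C, ncomp = (\<lambda>(a, b)\<in>ob C \<times> ob C. sg a b)\<rparr>\<rparr>"

lemma mk_symmon_simps [simp]:
 "tens (mk_symmon C T al sg) = T"
 "nsrc (asc (mk_symmon C T al sg)) = asc_src C (mk_symmon C T al sg)"
 "ntgt (asc (mk_symmon C T al sg)) = asc_tgt C (mk_symmon C T al sg)"
 "[|a \<in> ob C; b \<in> ob C; c \<in> ob C|] ==> ncomp (asc (mk_symmon C T al sg)) ((a, b), c) = al a b c"
 "x \<notin> (ob C \<times> ob C) \<times> ob C ==> ncomp (asc (mk_symmon C T al sg)) x = undefined"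
 "nsrc (symm (mk_symmon C T al sg)) = T"
 "ntgt (symm (mk_symmon C T al sg)) = symm_tgt C (mk_symmon C T al sg)"
 "[|a \<in> ob C; b \<in> ob C|] ==> ncomp (symm (mk_symmon C T al sg)) (a, b) = sg a b"
 "y \<notin> ob C \<times> ob C ==> ncomp (symm (mk_symmon C T al sg)) y = undefined"
 by (simp_all add: mk_symmon_def asc_src_def asc_tgt_def symm_tgt_def)

text \<open>The square is composed with \<open>vi\<close> on one side and \<open>ui\<close> on the
  other, and the two inverse pairs cancel.\<close>

lemma inverse_natural:
 assumes D: "vcategory V D" and o: "a \<in> ob D" "a' \<in> ob D" "b \<in> ob D" "b' \<in> ob D"
  and ty: "f \<in> El D Z a b" "g \<in> El D Z a' b'" "u \<in> El D Z a a'" "ui \<in> El D Z a' a"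
   "v \<in> El D Z b b'" "vi \<in> El D Z b' b"
  and u: "ucomp V D a' a a' u ui = uid D Z a'" and v: "ucomp V D b b' b vi v = uid D Z b"
  and sq: "ucomp V D a b b' v f = ucomp V D a a' b' g u"
 shows "ucomp V D a' b' b vi g = ucomp V D a' a b f ui"
proof -
 have "ucomp V D a' b' b vi g = ucomp V D a' b' b vi (ucomp V D a' a' b' g (ucomp V D a' a a' u ui))"
  using D o ty u by simp
 also have "\<dots> = ucomp V D a' b' b vi (ucomp V D a' a b' (ucomp V D a b b' v f) ui)"
  using ucomp_assoc[OF D o(2,1,2,4) ty(2,3,4)] sq by simp
 also have "\<dots> = ucomp V D a' a b (ucomp V D a b b (ucomp V D b b' b vi v) f) ui"
  using ucomp_assoc[OF D o(2,1,4,3) ty(6) ucomp_Hom[OF D o(1,3,4) ty(5,1)] ty(4)]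
   ucomp_assoc[OF D o(1,3,4,3) ty(6,5,1)] by simp
 finally show ?thesis using D o ty v by simp
qed

text \<open>Pointwise inverses of a natural transformation are automatically natural, by
  \<open>inverse_natural\<close> at each stage.\<close>

lemma vnat_isoI:
 assumes t: "vnatural V t" "nsrc t = F" "ntgt t = G" "fsrc F = C" "ftgt F = D"
  and ty: "\<And>x. x \<in> ob C ==> ti x \<in> El D (Term V) (fob G x) (fob F x)"
  and inv: "\<And>x. x \<in> ob C ==> ucomp V D (fob F x) (fob G x) (fob F x) (ti x) (ncomp t x) = unt D (fob F x)"
   "\<And>x. x \<in> ob C ==> ucomp V D (fob G x) (fob F x) (fob G x) (ncomp t x) (ti x) = unt D (fob G x)"
 shows "vnat_iso V t"
proof -
 have F: "vfunctor V F" "vfunctor V G" "fsrc G = C" "ftgt G = D" using natD(1-4)[OF t(1)] t by simp_all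
 have C: "vcategory V C" "vcategory V D" using vfunD(1,2)[OF F(1)] t by simp_all
 define s where "s = \<lparr>nsrc = G, ntgt = F, ncomp = restrict ti (ob C)\<rparr>"
 have s: "vnatural V s"
 proof (rule vnaturalI[OF F(2,1,3,4) t(4,5) _ _ dfam_elements[OF C(1)]])
  fix x y f Z assume x: "x \<in> ob C" "y \<in> ob C" and f: "f \<in> elements C x y" "Dom V f = Z"
  then have f: "f \<in> El C Z x y" and Z: "Z \<in> Obj V" by (auto simp: elements_def Hom_iff)
  have o: "fob F x \<in> ob D" "fob G x \<in> ob D" "fob F y \<in> ob D" "fob G y \<in> ob D" using x F t by simp_all
  note n = ncomp_Hom[OF t x(1)] ncomp_Hom[OF t x(2)]
  show "ucomp V D (fob G x) (fob G y) (fob F y) (ncomp s y \<cdot> Bang V Z) (fhm G x y \<cdot> f) =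
    ucomp V D (fob G x) (fob F x) (fob F y) (fhm F x y \<cdot> f) (ncomp s x \<cdot> Bang V Z)"
  proof (rule inverse_natural[OF C(2) o vfun_app[OF F(1) t(4,5) x f] vfun_app[OF F(2,3,4) x f] stage_Hom[OF n(1) Z] _ stage_Hom[OF n(2) Z]
     _ _ _ nat_sq[OF t x f]])
   show "ucomp V D (fob G x) (fob F x) (fob G x) (ncomp t x \<cdot> Bang V Z) (ncomp s x \<cdot> Bang V Z) = uid D Z (fob G x)"
    using ucomp_stage_eq[OF C(2) o(2,1,2) n(1) ty[OF x(1)] inv(2)[OF x(1)] Z] x by (simp add: s_def uid_def)
   show "ucomp V D (fob F y) (fob G y) (fob F y) (ncomp s y \<cdot> Bang V Z) (ncomp t y \<cdot> Bang V Z) = uid D Z (fob F y)"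
    using ucomp_stage_eq[OF C(2) o(3,4,3) ty[OF x(2)] n(2) inv(1)[OF x(2)] Z] x by (simp add: s_def uid_def)
  qed (use x stage_Hom[OF ty[OF x(1)] Z] stage_Hom[OF ty[OF x(2)] Z] in \<open>simp_all add: s_def\<close>)
 qed (use t F ty in \<open>simp_all add: s_def\<close>)
 have s': "nsrc s = G" "ntgt s = F" "\<And>x. x \<in> ob C ==> ncomp s x = ti x" by (simp_all add: s_def)
 have "vnat_vcomp V s t = vnat_id F"
  by (rule vnatural_eqI[OF vnatural_vcomp[OF t(1) s] vnatural_id[OF F(1)]]) (use s' t F inv in simp_all)
 moreover have "vnat_vcomp V t s = vnat_id G"
  by (rule vnatural_eqI[OF vnatural_vcomp[OF s t(1)] vnatural_id[OF F(2)]]) (use s' t F inv in simp_all)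
 ultimately show ?thesis unfolding vnat_iso_def using t s s' by blast
qed

text \<open>Only naturality involves varying elements, and it is reduced to a dense family; the
  remaining axioms are equations between components at the terminal stage.\<close>

lemma symmetric_monoidalI:
 fixes C al sg and Tn
 defines "M \<equiv> mk_symmon C Tn al sg" defines "T \<equiv> tob M"
 assumes t: "is_tensor C M" and A: "dfam C A"
  and al: "\<And>a b c. [|a \<in> ob C; b \<in> ob C; c \<in> ob C|] ==> al a b c \<in> El C (Term V) (T (T a b) c) (T a (T b c))"
  and ai: "\<And>a b c. [|a \<in> ob C; b \<in> ob C; c \<in> ob C|] ==> ai a b c \<in> El C (Term V) (T a (T b c)) (T (T a b) c)"
  and sg: "\<And>a b. [|a \<in> ob C; b \<in> ob C|] ==> sg a b \<in> El C (Term V) (T a b) (T b a)"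
  and al_nat: "\<And>a b c a' b' c' f g h Z. [|a \<in> ob C; b \<in> ob C; c \<in> ob C; a' \<in> ob C; b' \<in> ob C; c' \<in> ob C;
    f \<in> A a a'; g \<in> A b b'; h \<in> A c c'; Dom V f = Z; Dom V g = Z; Dom V h = Z|] ==>
   ucomp V C (T (T a b) c) (T (T a' b') c') (T a' (T b' c')) (al a' b' c' \<cdot> Bang V Z)
    (tarr V M (T a b) (T a' b') c c' (tarr V M a a' b b' f g) h) =
   ucomp V C (T (T a b) c) (T a (T b c)) (T a' (T b' c'))
    (tarr V M a a' (T b c) (T b' c') f (tarr V M b b' c c' g h)) (al a b c \<cdot> Bang V Z)"
  and sg_nat: "\<And>a b a' b' f g Z. [|a \<in> ob C; b \<in> ob C; a' \<in> ob C; b' \<in> ob C;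
    f \<in> A a a'; g \<in> A b b'; Dom V f = Z; Dom V g = Z|] ==>
   ucomp V C (T a b) (T a' b') (T b' a') (sg a' b' \<cdot> Bang V Z) (tarr V M a a' b b' f g) =
   ucomp V C (T a b) (T b a) (T b' a') (tarr V M b b' a a' g f) (sg a b \<cdot> Bang V Z)"
  and ai_al: "\<And>a b c. [|a \<in> ob C; b \<in> ob C; c \<in> ob C|] ==>
   ucomp V C (T (T a b) c) (T a (T b c)) (T (T a b) c) (ai a b c) (al a b c) = unt C (T (T a b) c)"
  and al_ai: "\<And>a b c. [|a \<in> ob C; b \<in> ob C; c \<in> ob C|] ==>
   ucomp V C (T a (T b c)) (T (T a b) c) (T a (T b c)) (al a b c) (ai a b c) = unt C (T a (T b c))"
  and sg_sg: "\<And>a b. [|a \<in> ob C; b \<in> ob C|] ==>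
   ucomp V C (T a b) (T b a) (T a b) (sg b a) (sg a b) = unt C (T a b)"
  and pent: "\<And>a b c d. [|a \<in> ob C; b \<in> ob C; c \<in> ob C; d \<in> ob C|] ==>
     ucomp V C (T (T (T a b) c) d) (T (T a b) (T c d)) (T a (T b (T c d)))
      (al a b (T c d)) (al (T a b) c d) =
     ucomp V C (T (T (T a b) c) d) (T a (T (T b c) d)) (T a (T b (T c d)))
      (tarr V M a a (T (T b c) d) (T b (T c d)) (unt C a) (al b c d))
      (ucomp V C (T (T (T a b) c) d) (T (T a (T b c)) d) (T a (T (T b c) d))
       (al a (T b c) d)
       (tarr V M (T (T a b) c) (T a (T b c)) d d (al a b c) (unt C d)))"
  and hex: "\<And>a b c. [|a \<in> ob C; b \<in> ob C; c \<in> ob C|] ==>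
     ucomp V C (T (T a b) c) (T (T b c) a) (T b (T c a)) (al b c a)
      (ucomp V C (T (T a b) c) (T a (T b c)) (T (T b c) a) (sg a (T b c)) (al a b c)) =
     ucomp V C (T (T a b) c) (T b (T a c)) (T b (T c a))
      (tarr V M b b (T a c) (T c a) (unt C b) (sg a c))
      (ucomp V C (T (T a b) c) (T (T b a) c) (T b (T a c))
       (al b a c)
       (tarr V M (T a b) (T b a) c c (sg a b) (unt C c)))"
 shows "symmetric_monoidal V C M"
proof -
 note C = is_tensorD(1)[OF t]
 have TT: "T x y \<in> ob C" if "x \<in> ob C" "y \<in> ob C" for x y using tob_ob[OF t that] T_def by simp
 note F = asc_src_vfunctor[OF t, folded T_def] asc_tgt_vfunctor[OF t, folded T_def] symm_tgt_vfunctor[OF t, folded T_def]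
 note tn = is_tensorD(2-4)[OF t]
 have Tm: "tens M = Tn" by (simp add: M_def)
 have T1: "fob (tens M) (a, b) = T a b" for a b by (simp add: T_def tob_def)
 have AA: "dfam (vcat_prod V (vcat_prod V C C) C) (prodfam (prodfam A A) A)" "dfam (vcat_prod V C C) (prodfam A A)"
  by (intro dfam_prodfam A)+
 have n1: "vnatural V (asc M)"
 proof (rule vnaturalI[OF F(1,5,2,3,6,7)])
  show "nsrc (asc M) = asc_src C M" "ntgt (asc M) = asc_tgt C M" by (simp_all add: M_def)
  show "dfam (vcat_prod V (vcat_prod V C C) C) (prodfam (prodfam A A) A)" by (rule AA(1))
  fix x assume "x \<in> ob (vcat_prod V (vcat_prod V C C) C)"
  then obtain a b c where x: "x = ((a, b), c)" and o: "a \<in> ob C" "b \<in> ob C" "c \<in> ob C" by auto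
  show "ncomp (asc M) x \<in> El C (Term V) (fob (asc_src C M) x) (fob (asc_tgt C M) x)"
   unfolding x F(4)[OF o] F(8)[OF o] using al[OF o] o by (simp add: M_def)
  fix y f Z assume "y \<in> ob (vcat_prod V (vcat_prod V C C) C)" and f: "f \<in> prodfam (prodfam A A) A x y" "Dom V f = Z"
  then obtain a' b' c' where y: "y = ((a', b'), c')" and o': "a' \<in> ob C" "b' \<in> ob C" "c' \<in> ob C" by auto
  have o2: "(a, b) \<in> ob (vcat_prod V C C)" "(a', b') \<in> ob (vcat_prod V C C)" using o o' by simp_all
  obtain p h where p: "f = Tuple V p h" "p \<in> prodfam A A (a, b) (a', b')" "Dom V p = Z" and
    h: "h \<in> El C Z c c'" "h \<in> A c c'" "Dom V h = Z"
   using prodfamE[OF f[unfolded x y] AA(2) A o2(1) o(3) o2(2) o'(3)] by metis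
  obtain k g where k: "p = Tuple V k g" "k \<in> El C Z a a'" "g \<in> El C Z b b'" "k \<in> A a a'" "g \<in> A b b'"
    "Dom V k = Z" "Dom V g = Z"
   using prodfamE[OF p(2,3) A A o(1,2) o'(1,2)] by metis
  show "ucomp V C (fob (asc_src C M) x) (fob (asc_src C M) y) (fob (asc_tgt C M) y) (ncomp (asc M) y \<cdot> Bang V Z)
    (fhm (asc_src C M) x y \<cdot> f) =
    ucomp V C (fob (asc_src C M) x) (fob (asc_tgt C M) x) (fob (asc_tgt C M) y) (fhm (asc_tgt C M) x y \<cdot> f)
    (ncomp (asc M) x \<cdot> Bang V Z)"
   unfolding x y p(1) k(1) F(4)[OF o] F(8)[OF o] F(4)[OF o'] F(8)[OF o'] asc_src_app[OF t o o' k(2,3) h(1)]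
    asc_tgt_app[OF t o o' k(2,3) h(1)]
   using al_nat[OF o o' k(4,5) h(2) k(6,7) h(3)] o o' by (simp add: M_def T_def)
 next
  fix x assume "x \<notin> ob (vcat_prod V (vcat_prod V C C) C)"
  then show "ncomp (asc M) x = undefined" by (simp add: M_def)
 qed
 have n2: "vnatural V (symm M)"
 proof (rule vnaturalI[OF tn(1) F(9) tn(2,3) F(10,11)])
  show "nsrc (symm M) = tens M" "ntgt (symm M) = symm_tgt C M" by (simp_all add: M_def)
  show "dfam (vcat_prod V C C) (prodfam A A)" by (rule AA(2))
  fix x assume "x \<in> ob (vcat_prod V C C)"
  then obtain a b where x: "x = (a, b)" and o: "a \<in> ob C" "b \<in> ob C" by auto
  show "ncomp (symm M) x \<in> El C (Term V) (fob (tens M) x) (fob (symm_tgt C M) x)"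
   unfolding x T1 F(12)[OF o] using sg[OF o] o by (simp add: M_def)
  fix y f Z assume "y \<in> ob (vcat_prod V C C)" and f: "f \<in> prodfam A A x y" "Dom V f = Z"
  then obtain a' b' where y: "y = (a', b')" and o': "a' \<in> ob C" "b' \<in> ob C" by auto
  obtain k g where k: "f = Tuple V k g" "k \<in> El C Z a a'" "g \<in> El C Z b b'" "k \<in> A a a'" "g \<in> A b b'"
    "Dom V k = Z" "Dom V g = Z"
   using prodfamE[OF f[unfolded x y] A A o o'] by metis
  show "ucomp V C (fob (tens M) x) (fob (tens M) y) (fob (symm_tgt C M) y) (ncomp (symm M) y \<cdot> Bang V Z)
    (fhm (tens M) x y \<cdot> f) =
    ucomp V C (fob (tens M) x) (fob (symm_tgt C M) x) (fob (symm_tgt C M) y) (fhm (symm_tgt C M) x y \<cdot> f)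
    (ncomp (symm M) x \<cdot> Bang V Z)"
   unfolding x y k(1) T1 F(12)[OF o] F(12)[OF o'] symm_tgt_app[OF t o o' k(2,3)]
   using sg_nat[OF o o' k(4,5) k(6,7)] o o' by (simp add: M_def T_def tarr_def)
 next
  fix x assume "x \<notin> ob (vcat_prod V C C)"
  then show "ncomp (symm M) x = undefined" by (simp add: M_def)
 qed
 have nM: "nsrc (asc M) = asc_src C M" "ntgt (asc M) = asc_tgt C M" "nsrc (symm M) = tens M" "ntgt (symm M) = symm_tgt C M"
  by (simp_all add: M_def)
 have i1: "vnat_iso V (asc M)"
 proof (rule vnat_isoI[OF n1 nM(1,2) F(2,3), where ti = "\<lambda>((a, b), c). ai a b c"])
  fix x assume "x \<in> ob (vcat_prod V (vcat_prod V C C) C)"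
  then obtain a b c where x: "x = ((a, b), c)" and o: "a \<in> ob C" "b \<in> ob C" "c \<in> ob C" by auto
  have e: "ncomp (asc M) ((a, b), c) = al a b c" using o by (simp add: M_def)
  show "(case x of (xa, xb) => (case xa of (a, b) => ai a b) xb) \<in> El C (Term V) (fob (asc_tgt C M) x) (fob (asc_src C M) x)"
   "ucomp V C (fob (asc_src C M) x) (fob (asc_tgt C M) x) (fob (asc_src C M) x) (case x of (xa, xb) => (case xa of (a, b) => ai a b) xb) (ncomp (asc M) x) = unt C (fob (asc_src C M) x)"
   "ucomp V C (fob (asc_tgt C M) x) (fob (asc_src C M) x) (fob (asc_tgt C M) x) (ncomp (asc M) x) (case x of (xa, xb) => (case xa of (a, b) => ai a b) xb) = unt C (fob (asc_tgt C M) x)"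
   unfolding x F(4)[OF o] F(8)[OF o] e using ai[OF o] ai_al[OF o] al_ai[OF o] by simp_all
 qed
 have i2: "vnat_iso V (symm M)"
 \<comment> \<open>The involution axiom \<open>sg_sg\<close> makes the symmetry with exchanged
   arguments the inverse.\<close>
 proof (rule vnat_isoI[OF n2 nM(3,4) tn(2,3), where ti = "\<lambda>(a, b). sg b a"])
  fix x assume "x \<in> ob (vcat_prod V C C)"
  then obtain a b where x: "x = (a, b)" and o: "a \<in> ob C" "b \<in> ob C" by auto
  have e: "ncomp (symm M) (a, b) = sg a b" using o by (simp add: M_def)
  show "(case x of (a, b) => sg b a) \<in> El C (Term V) (fob (symm_tgt C M) x) (fob (tens M) x)"
   "ucomp V C (fob (tens M) x) (fob (symm_tgt C M) x) (fob (tens M) x) (case x of (a, b) => sg b a) (ncomp (symm M) x) = unt C (fob (tens M) x)"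
   "ucomp V C (fob (symm_tgt C M) x) (fob (tens M) x) (fob (symm_tgt C M) x) (ncomp (symm M) x) (case x of (a, b) => sg b a) = unt C (fob (symm_tgt C M) x)"
   unfolding x T1 F(12)[OF o] e using sg[OF o(2,1)] sg_sg[OF o] sg_sg[OF o(2,1)] by simp_all
 qed
 have ncal: "ncomp (asc M) ((a, b), c) = al a b c" if "a \<in> ob C" "b \<in> ob C" "c \<in> ob C" for a b c
  using that by (simp add: M_def)
 have ncsg: "ncomp (symm M) (a, b) = sg a b" if "a \<in> ob C" "b \<in> ob C" for a b
  using that by (simp add: M_def)
 have "monoidal V C M"
  unfolding monoidal_def Let_def T_def[symmetric]
  by (intro conjI ballI tn i1 nM(1,2)[unfolded asc_src_def asc_tgt_def]) (simp add: ncal TT pent)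
 then show ?thesis
  unfolding symmetric_monoidal_def Let_def T_def[symmetric]
  by (intro conjI ballI i2 nM(3,4)[unfolded symm_tgt_def]) (simp_all add: ncal ncsg TT hex sg_sg)
qed

text \<open>The ends of the constraints depend on the tensor functor alone, so once the tensors
  agree only components are left to compare.\<close>

lemma symmon_eqI:
 assumes M: "symmetric_monoidal V C M" and N: "symmetric_monoidal V C N" and t: "tens M = tens N"
  and al: "\<And>a b c. [|a \<in> ob C; b \<in> ob C; c \<in> ob C|] ==> ncomp (asc M) ((a, b), c) = ncomp (asc N) ((a, b), c)"
  and sg: "\<And>a b. [|a \<in> ob C; b \<in> ob C|] ==> ncomp (symm M) (a, b) = ncomp (symm N) (a, b)"
 shows "M = N"
proof -
 note m = symmetric_monoidal_asc[OF M] and n = symmetric_monoidal_asc[OF N]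
 have 1: "nsrc (asc M) = nsrc (asc N)" "ntgt (asc M) = ntgt (asc N)" "nsrc (symm M) = nsrc (symm N)" "ntgt (symm M) = ntgt (symm N)"
  using m n t by (simp_all add: asc_src_def asc_tgt_def symm_tgt_def)
 have "asc M = asc N"
  by (rule vnatural_eqI[OF m(1) n(1) 1(1,2)])
   (use al n(2) asc_src_vfunctor(2)[OF symmetric_monoidal_is_tensor[OF N]] in auto)
 moreover have "symm M = symm N"
  by (rule vnatural_eqI[OF m(4) n(4) 1(3,4)])
   (use sg n(5) is_tensorD(3)[OF symmetric_monoidal_is_tensor[OF N]] in auto)
 ultimately show ?thesis using t by (intro symmon.equality) auto
qed

end

section \<open>Strict monoidal functors\<close>

context cartesian_category
begin

lemma inverse_unique:
 assumes C: "vcategory V C" and o: "a \<in> ob C" "b \<in> ob C"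
  and ty: "f \<in> El C Z a b" "g \<in> El C Z b a" "g' \<in> El C Z b a"
  and e: "ucomp V C a b a g f = uid C Z a" "ucomp V C b a b f g' = uid C Z b"
 shows "g = g'"
 using ucomp_assoc[OF C o(2,1,2,1) ty(2,1,3)] e C o ty by simp

lemma alphainv_natural:
 assumes S: "symmetric_monoidal V C M" and o: "a \<in> ob C" "b \<in> ob C" "c \<in> ob C" "a' \<in> ob C" "b' \<in> ob C" "c' \<in> ob C"
  and f: "f \<in> El C Z a a'" "g \<in> El C Z b b'" "h \<in> El C Z c c'"
 shows "ucomp V C (tob M a (tob M b c)) (tob M a' (tob M b' c')) (tob M (tob M a' b') c') (alphainv C M Z a' b' c')
   (tarr V M a a' (tob M b c) (tob M b' c') f (tarr V M b b' c c' g h)) =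
  ucomp V C (tob M a (tob M b c)) (tob M (tob M a b) c) (tob M (tob M a' b') c')
   (tarr V M (tob M a b) (tob M a' b') c c' (tarr V M a a' b b' f g) h) (alphainv C M Z a b c)"
proof -
 note t = symmetric_monoidal_is_tensor[OF S] note C = is_tensorD(1)[OF t]
 have Z: "Z \<in> Obj V" using HomD(4)[OF f(1)] .
 note tt = tob_ob[OF t]
 note o1 = tt[OF tt[OF o(1,2)] o(3)] tt[OF o(1) tt[OF o(2,3)]] tt[OF tt[OF o(4,5)] o(6)] tt[OF o(4) tt[OF o(5,6)]]
 show ?thesis
  by (rule inverse_natural[OF C o1(1,2,3,4) _ _ alpha_Hom[OF S o(1-3) Z] alphainv_Hom[OF S o(1-3) Z] alpha_Hom[OF S o(4-6) Z] alphainv_Hom[OF S o(4-6) Z]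
   alphainv(3)[OF S o(1-3) Z] alphainv(2)[OF S o(4-6) Z] alpha_natural[OF S o f]])
   (use t o f in \<open>simp_all\<close>)
qed

lemma strict_monoidal_vfunctor:
 assumes "strict_monoidal V C M D N P" shows "vfunctor V P" "fsrc P = C" "ftgt P = D"
 using assms unfolding strict_monoidal_def by auto

lemma strict_monoidal_tob:
 assumes P: "strict_monoidal V C M D N P" and T: "is_tensor C M" and o: "a \<in> ob C" "b \<in> ob C"
 shows "fob P (tob M a b) = tob N (fob P a) (fob P b)"
proof -
 note p = strict_monoidal_vfunctor[OF P] and t = is_tensorD[OF T]
 have "fob (P oo tens M) (a, b) = fob (tens N oo vfun_prod V P P) (a, b)"
  using P unfolding strict_monoidal_def by simp
 then show ?thesis using o p t by (simp add: tob_def)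
qed

lemma strict_monoidal_tarr:
 assumes P: "strict_monoidal V C M D N P" and T: "is_tensor C M" "is_tensor D N"
  and o: "a \<in> ob C" "a' \<in> ob C" "b \<in> ob C" "b' \<in> ob C" and f: "f \<in> El C Z a a'" "g \<in> El C Z b b'"
 shows "fhm P (tob M a b) (tob M a' b') \<cdot> tarr V M a a' b b' f g =
  tarr V N (fob P a) (fob P a') (fob P b) (fob P b') (fhm P a a' \<cdot> f) (fhm P b b' \<cdot> g)"
proof -
 note p = strict_monoidal_vfunctor[OF P] and t = is_tensorD[OF T(1)] and n = is_tensorD[OF T(2)]
 have ab: "(a, b) \<in> ob (vcat_prod V C C)" "(a', b') \<in> ob (vcat_prod V C C)" using o by simp_all
 have fg: "Tuple V f g \<in> El (vcat_prod V C C) Z (a, b) (a', b')" using o f by simp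
 have q: "vfunctor V (vfun_prod V P P)" "fsrc (vfun_prod V P P) = vcat_prod V C C" "fsrc (tens N) = ftgt (vfun_prod V P P)"
  "fsrc P = ftgt (tens M)"
  using p t n by simp_all
 have "fhm (P oo tens M) (a, b) (a', b') \<cdot> Tuple V f g =
    fhm (tens N oo vfun_prod V P P) (a, b) (a', b') \<cdot> Tuple V f g"
  using P unfolding strict_monoidal_def by simp
 moreover have "fhm (vfun_prod V P P) (a, b) (a', b') \<cdot> Tuple V f g = Tuple V (fhm P a a' \<cdot> f) (fhm P b b' \<cdot> g)"
  using vfun_prod_app[OF p(1,1)] o f p(2) by simp
 ultimately show ?thesis
  unfolding vfun_comp_app[OF t(2,3) p(1) q(4) ab fg] vfun_comp_app[OF q(1,2) n(2) q(3) ab fg]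
  using o p(2) by (simp add: tarr_def tob_def)
qed

lemma strict_monoidal_alpha:
 assumes P: "strict_monoidal V C M D N P" and M: "symmetric_monoidal V C M" and N: "symmetric_monoidal V D N"
  and o: "a \<in> ob C" "b \<in> ob C" "c \<in> ob C" and Z: "Z \<in> Obj V"
 shows "fhm P (tob M (tob M a b) c) (tob M a (tob M b c)) \<cdot> alpha M Z a b c = alpha N Z (fob P a) (fob P b) (fob P c)"
proof -
 note p = strict_monoidal_vfunctor[OF P] and T = symmetric_monoidal_is_tensor[OF M]
 note tt = tob_ob[OF T]
 have "fhm P (tob M (tob M a b) c) (tob M a (tob M b c)) \<cdot> ncomp (asc M) ((a, b), c) =
    ncomp (asc N) ((fob P a, fob P b), fob P c)"
  using P o unfolding strict_monoidal_def by blast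
 then show ?thesis
  using stage_app[OF p(1,2) tt[OF tt[OF o(1,2)] o(3)] tt[OF o(1) tt[OF o(2,3)]] alpha_component[OF M o] Z]
  by (simp add: alpha_def)
qed

lemma strict_monoidal_sigma:
 assumes P: "strict_monoidal V C M D N P" and M: "symmetric_monoidal V C M" and N: "symmetric_monoidal V D N"
  and o: "a \<in> ob C" "b \<in> ob C" and Z: "Z \<in> Obj V"
 shows "fhm P (tob M a b) (tob M b a) \<cdot> sigma M Z a b = sigma N Z (fob P a) (fob P b)"
proof -
 note p = strict_monoidal_vfunctor[OF P] and T = symmetric_monoidal_is_tensor[OF M]
 note tt = tob_ob[OF T]
 have "fhm P (tob M a b) (tob M b a) \<cdot> ncomp (symm M) (a, b) = ncomp (symm N) (fob P a, fob P b)"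
  using P o unfolding strict_monoidal_def by blast
 then show ?thesis
  using stage_app[OF p(1,2) tt[OF o] tt[OF o(2,1)] sigma_component[OF M o] Z]
  by (simp add: sigma_def)
qed

text \<open>Functors preserve inverses: the image of the inverse is a left inverse of the constraint
  of \<open>N\<close>, hence equal to its inverse.\<close>

lemma strict_monoidal_alphainv:
 assumes P: "strict_monoidal V C M D N P" and M: "symmetric_monoidal V C M" and N: "symmetric_monoidal V D N"
  and o: "a \<in> ob C" "b \<in> ob C" "c \<in> ob C" and Z: "Z \<in> Obj V"
 shows "fhm P (tob M a (tob M b c)) (tob M (tob M a b) c) \<cdot> alphainv C M Z a b c = alphainv D N Z (fob P a) (fob P b) (fob P c)"
proof -
 note p = strict_monoidal_vfunctor[OF P] and T = symmetric_monoidal_is_tensor[OF M]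
 note tt = tob_ob[OF T] and D = symmetric_monoidal_vcategory[OF N]
 note o1 = tt[OF tt[OF o(1,2)] o(3)] tt[OF o(1) tt[OF o(2,3)]]
 have oP: "fob P a \<in> ob D" "fob P b \<in> ob D" "fob P c \<in> ob D" using o p by simp_all
 have e: "fob P (tob M (tob M a b) c) = tob N (tob N (fob P a) (fob P b)) (fob P c)"
   "fob P (tob M a (tob M b c)) = tob N (fob P a) (tob N (fob P b) (fob P c))"
  using strict_monoidal_tob[OF P T] o tt by simp_all
 note q = vfun_app[OF p o1(2,1) alphainv_Hom[OF M o Z]] vfun_fob[OF p o1(1)] vfun_fob[OF p o1(2)]
 have "fhm P (tob M (tob M a b) c) (tob M (tob M a b) c) \<cdot> ucomp V C (tob M (tob M a b) c) (tob M a (tob M b c)) (tob M (tob M a b) c) (alphainv C M Z a b c) (alpha M Z a b c)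
  = uid D Z (fob P (tob M (tob M a b) c))"
  using alphainv(2)[OF M o Z] vfun_uid[OF p o1(1) Z] by simp
 then have 1: "ucomp V D (fob P (tob M (tob M a b) c)) (fob P (tob M a (tob M b c))) (fob P (tob M (tob M a b) c))
  (fhm P (tob M a (tob M b c)) (tob M (tob M a b) c) \<cdot> alphainv C M Z a b c) (alpha N Z (fob P a) (fob P b) (fob P c))
  = uid D Z (fob P (tob M (tob M a b) c))"
  using vfun_ucomp[OF p o1(1,2,1) alphainv_Hom[OF M o Z] alpha_Hom[OF M o Z]] strict_monoidal_alpha[OF P M N o Z] by simp
 show ?thesis
  by (rule inverse_unique[OF D q(2,3) _ q(1) _ 1]) (use alphainv[OF N oP Z] alpha_Hom[OF N oP Z] e in simp_all)
qed

text \<open>Compatibility with the tensor functor is an equality of functors on a product category,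
  tested on pairs from the dense family.\<close>

lemma strict_monoidalI:
 assumes P: "vfunctor V P" "fsrc P = C" "ftgt P = D" and A: "dfam C A" and T: "is_tensor C M" "is_tensor D N"
  and ob: "\<And>a b. a \<in> ob C ==> b \<in> ob C ==> fob P (tob M a b) = tob N (fob P a) (fob P b)"
  and hm: "\<And>a a' b b' f g Z. [|a \<in> ob C; a' \<in> ob C; b \<in> ob C; b' \<in> ob C; f \<in> A a a'; g \<in> A b b'; Dom V f = Z; Dom V g = Z|]
   ==> fhm P (tob M a b) (tob M a' b') \<cdot> tarr V M a a' b b' f g =
    tarr V N (fob P a) (fob P a') (fob P b) (fob P b') (fhm P a a' \<cdot> f) (fhm P b b' \<cdot> g)"
  and al: "\<And>a b c. [|a \<in> ob C; b \<in> ob C; c \<in> ob C|] ==>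
   fhm P (tob M (tob M a b) c) (tob M a (tob M b c)) \<cdot> ncomp (asc M) ((a, b), c) =
    ncomp (asc N) ((fob P a, fob P b), fob P c)"
  and sg: "\<And>a b. [|a \<in> ob C; b \<in> ob C|] ==>
   fhm P (tob M a b) (tob M b a) \<cdot> ncomp (symm M) (a, b) = ncomp (symm N) (fob P a, fob P b)"
 shows "strict_monoidal V C M D N P"
proof -
 note t = is_tensorD[OF T(1)] and n = is_tensorD[OF T(2)]
 have q: "vfunctor V (vfun_prod V P P)" "fsrc (vfun_prod V P P) = vcat_prod V C C" "fsrc (tens N) = ftgt (vfun_prod V P P)"
  "fsrc P = ftgt (tens M)"
  using P t n by simp_all
 have src: "fsrc (tens N oo vfun_prod V P P) = vcat_prod V C C" using P by simp
 have "P oo tens M = tens N oo vfun_prod V P P"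
 proof (rule vfunctor_eqI[OF vfunctor_comp[OF t(2) P(1) q(4)] vfunctor_comp[OF q(1) n(2) q(3)]])
  show "dfam (fsrc (tens N oo vfun_prod V P P)) (prodfam A A)"
   using dfam_prodfam[OF A A] q by simp
  fix x assume "x \<in> ob (fsrc (tens N oo vfun_prod V P P))"
  then obtain a b where x: "x = (a, b)" and o: "a \<in> ob C" "b \<in> ob C" unfolding src by auto
  show "fob (P oo tens M) x = fob (tens N oo vfun_prod V P P) x"
   using ob[OF o] t q P o by (simp add: x tob_def)
  fix y f Z assume "y \<in> ob (fsrc (tens N oo vfun_prod V P P))" and f: "f \<in> prodfam A A x y"
   "f \<in> El (fsrc (tens N oo vfun_prod V P P)) Z x y"
  then obtain a' b' where y: "y = (a', b')" and o': "a' \<in> ob C" "b' \<in> ob C" unfolding src by auto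
  have fZ: "Dom V f = Z" using f(2) by (rule HomD)
  obtain k g where k: "f = Tuple V k g" "k \<in> El C Z a a'" "g \<in> El C Z b b'" "k \<in> A a a'" "g \<in> A b b'"
    "Dom V k = Z" "Dom V g = Z"
   using prodfamE[OF f(1)[unfolded x y] fZ A A o o'] by metis
  have ab: "(a, b) \<in> ob (vcat_prod V C C)" "(a', b') \<in> ob (vcat_prod V C C)" using o o' by simp_all
  have fg: "Tuple V k g \<in> El (vcat_prod V C C) Z (a, b) (a', b')" using o o' k by simp
  have "fhm (vfun_prod V P P) (a, b) (a', b') \<cdot> Tuple V k g = Tuple V (fhm P a a' \<cdot> k) (fhm P b b' \<cdot> g)"
   using vfun_prod_app[OF P(1,1)] o o' k P(2) by simp
  then show "fhm (P oo tens M) x y \<cdot> f = fhm (tens N oo vfun_prod V P P) x y \<cdot> f"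
   unfolding x y k(1) vfun_comp_app[OF t(2,3) P(1) q(4) ab fg] vfun_comp_app[OF q(1,2) n(2) q(3) ab fg]
   using hm[OF o(1) o'(1) o(2) o'(2) k(4-7)] o o' P(2) by (simp add: tarr_def tob_def)
 qed (use t q P n in simp_all)
 then show ?thesis unfolding strict_monoidal_def using P al sg by blast
qed

section \<open>Identities, composites and images\<close>

lemma strict_monoidal_id:
 assumes M: "symmetric_monoidal V C M"
 shows "strict_monoidal V C M C M (vfun_id V C)"
proof -
 note T = symmetric_monoidal_is_tensor[OF M] note C = is_tensorD(1)[OF T] and tt = tob_ob[OF T]
 show ?thesis
 proof (rule strict_monoidalI[OF vfunctor_id[OF C] _ _ dfam_elements[OF C] T T])
  fix a b c assume o: "a \<in> ob C" "b \<in> ob C" "c \<in> ob C"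
  show "fhm (vfun_id V C) (tob M (tob M a b) c) (tob M a (tob M b c)) \<cdot> ncomp (asc M) ((a, b), c) =
    ncomp (asc M) ((fob (vfun_id V C) a, fob (vfun_id V C) b), fob (vfun_id V C) c)"
   using o tt Ide_app[OF alpha_component[OF M o]] by simp
 next
  fix a b assume o: "a \<in> ob C" "b \<in> ob C"
  show "fhm (vfun_id V C) (tob M a b) (tob M b a) \<cdot> ncomp (symm M) (a, b) = ncomp (symm M) (fob (vfun_id V C) a, fob (vfun_id V C) b)"
   using o tt Ide_app[OF sigma_component[OF M o]] by simp
 next
  fix a a' b b' f g Z assume o: "a \<in> ob C" "a' \<in> ob C" "b \<in> ob C" "b' \<in> ob C"
   and "f \<in> elements C a a'" "g \<in> elements C b b'" "Dom V f = Z" "Dom V g = Z"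
  then have f: "f \<in> El C Z a a'" "g \<in> El C Z b b'" by (simp_all add: elements_def Hom_iff)
  show "fhm (vfun_id V C) (tob M a b) (tob M a' b') \<cdot> tarr V M a a' b b' f g =
    tarr V M (fob (vfun_id V C) a) (fob (vfun_id V C) a') (fob (vfun_id V C) b) (fob (vfun_id V C) b')
    (fhm (vfun_id V C) a a' \<cdot> f) (fhm (vfun_id V C) b b' \<cdot> g)"
   using o f tt Ide_app[OF tarr_Hom[OF T o f]] by simp
 qed (use tt in simp_all)
qed

lemma strict_monoidal_comp:
 assumes P: "strict_monoidal V C M D N P" and Q: "strict_monoidal V D N E L Q"
  and M: "symmetric_monoidal V C M" and N: "symmetric_monoidal V D N" and L: "symmetric_monoidal V E L"
 shows "strict_monoidal V C M E L (Q oo P)"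
proof -
 note p = strict_monoidal_vfunctor[OF P] and q = strict_monoidal_vfunctor[OF Q]
 note TM = symmetric_monoidal_is_tensor[OF M] and TN = symmetric_monoidal_is_tensor[OF N] and TL = symmetric_monoidal_is_tensor[OF L]
 note C = is_tensorD(1)[OF TM] and tt = tob_ob[OF TM]
 have qp: "fsrc Q = ftgt P" using p q by simp
 note PQ = vfun_comp_app[OF p(1,2) q(1) qp]
 have obP: "fob P x \<in> ob D" if "x \<in> ob C" for x using that p by simp
 have ob: "fob (Q oo P) x = fob Q (fob P x)" if "x \<in> ob C" for x using that p by simp
 note sP = strict_monoidal_tob[OF P TM] and sQ = strict_monoidal_tob[OF Q TN]
 show ?thesis
 proof (rule strict_monoidalI[OF vfunctor_comp[OF p(1) q(1) qp] _ _ dfam_elements[OF C] TM TL])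
  fix a b assume o: "a \<in> ob C" "b \<in> ob C"
  show "fob (Q oo P) (tob M a b) = tob L (fob (Q oo P) a) (fob (Q oo P) b)"
   using o by (simp add: ob tt sP sQ obP)
  show "fhm (Q oo P) (tob M a b) (tob M b a) \<cdot> ncomp (symm M) (a, b) = ncomp (symm L) (fob (Q oo P) a, fob (Q oo P) b)"
   using PQ[OF tt[OF o] tt[OF o(2,1)] sigma_component[OF M o]] strict_monoidal_sigma[OF P M N o Term_Obj]
    strict_monoidal_sigma[OF Q N L obP[OF o(1)] obP[OF o(2)] Term_Obj] o q
   by (simp add: ob sP obP sigma_Term[OF M] sigma_Term[OF N] sigma_Term[OF L])
  fix c assume o3: "c \<in> ob C"
  note oo = o o3
  show "fhm (Q oo P) (tob M (tob M a b) c) (tob M a (tob M b c)) \<cdot> ncomp (asc M) ((a, b), c) =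
    ncomp (asc L) ((fob (Q oo P) a, fob (Q oo P) b), fob (Q oo P) c)"
   using PQ[OF tt[OF tt[OF oo(1,2)] oo(3)] tt[OF oo(1) tt[OF oo(2,3)]] alpha_component[OF M oo]] strict_monoidal_alpha[OF P M N oo Term_Obj]
    strict_monoidal_alpha[OF Q N L obP[OF oo(1)] obP[OF oo(2)] obP[OF oo(3)] Term_Obj] oo q tt
   by (simp add: ob sP obP alpha_Term[OF M] alpha_Term[OF N] alpha_Term[OF L])
 next
  fix a a' b b' f g Z assume o: "a \<in> ob C" "a' \<in> ob C" "b \<in> ob C" "b' \<in> ob C"
   and "f \<in> elements C a a'" "g \<in> elements C b b'" "Dom V f = Z" "Dom V g = Z"
  then have f: "f \<in> El C Z a a'" "g \<in> El C Z b b'" by (simp_all add: elements_def Hom_iff)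
  note oP = obP[OF o(1)] obP[OF o(2)] obP[OF o(3)] obP[OF o(4)]
  show "fhm (Q oo P) (tob M a b) (tob M a' b') \<cdot> tarr V M a a' b b' f g =
    tarr V L (fob (Q oo P) a) (fob (Q oo P) a') (fob (Q oo P) b) (fob (Q oo P) b')
    (fhm (Q oo P) a a' \<cdot> f) (fhm (Q oo P) b b' \<cdot> g)"
   unfolding ob[OF o(1)] ob[OF o(2)] ob[OF o(3)] ob[OF o(4)] PQ[OF o(1,2) f(1)] PQ[OF o(3,4) f(2)]
    PQ[OF tt[OF o(1,3)] tt[OF o(2,4)] tarr_Hom[OF TM o f]] strict_monoidal_tarr[OF P TM TN o f] sP[OF o(1,3)] sP[OF o(2,4)]
   by (rule strict_monoidal_tarr[OF Q TN TL oP vfun_app[OF p o(1,2) f(1)] vfun_app[OF p o(3,4) f(2)]])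
 qed (use p q in simp_all)
qed

text \<open>
 A structure on \<open>C\<close> that is the image of a symmetric monoidal structure under a functor with a
 section satisfies all axioms, because every diagram in \<open>C\<close> is the image of one upstairs.
\<close>

lemma symmetric_monoidal_image:
 fixes C al sg and Tn
 defines "N \<equiv> mk_symmon C Tn al sg"
 assumes M: "symmetric_monoidal V E M" and N: "is_tensor C N"
  and h: "vfunctor V h" "fsrc h = E" "ftgt h = C" and e: "vfunctor V e" "fsrc e = C" "ftgt e = E"
  and he: "h oo e = vfun_id V C"
  and ob: "\<And>a b. a \<in> ob E ==> b \<in> ob E ==> fob h (tob M a b) = tob N (fob h a) (fob h b)"
  and hm: "\<And>a a' b b' f g Z. [|a \<in> ob E; a' \<in> ob E; b \<in> ob E; b' \<in> ob E; f \<in> El E Z a a'; g \<in> El E Z b b'|]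
   ==> fhm h (tob M a b) (tob M a' b') \<cdot> tarr V M a a' b b' f g =
    tarr V N (fob h a) (fob h a') (fob h b) (fob h b') (fhm h a a' \<cdot> f) (fhm h b b' \<cdot> g)"
  and al: "\<And>a b c. [|a \<in> ob E; b \<in> ob E; c \<in> ob E|] ==>
   al (fob h a) (fob h b) (fob h c) = fhm h (tob M (tob M a b) c) (tob M a (tob M b c)) \<cdot> ncomp (asc M) ((a, b), c)"
  and sg: "\<And>a b. [|a \<in> ob E; b \<in> ob E|] ==> sg (fob h a) (fob h b) = fhm h (tob M a b) (tob M b a) \<cdot> ncomp (symm M) (a, b)"
 shows "symmetric_monoidal V C N"
proof -
 note t = symmetric_monoidal_is_tensor[OF M] note E = is_tensorD(1)[OF t] note C = is_tensorD(1)[OF N]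
 note tt = tob_ob[OF t]
 have hf: "fsrc h = ftgt e" using h e by simp
 have eo: "fob e a \<in> ob E" if "a \<in> ob C" for a using that e by simp
 have heo: "fob h (fob e a) = a" if "a \<in> ob C" for a
 proof -
  have "fob (h oo e) a = fob (vfun_id V C) a" using he by simp
  then show ?thesis using that e by simp
 qed
 have heh: "fhm h (fob e a) (fob e b) \<cdot> fhm e a b \<cdot> f = f" if "a \<in> ob C" "b \<in> ob C" "f \<in> El C Z a b" for a b f Z
 proof -
  have "fhm (h oo e) a b \<cdot> f = f" using he that by simp
  then show ?thesis using vfun_comp_app[OF e(1,2) h(1) hf that] by simp
 qed
 have ehom: "fhm e a b \<cdot> f \<in> El E Z (fob e a) (fob e b)" if "a \<in> ob C" "b \<in> ob C" "f \<in> El C Z a b" for a b f Z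
  using vfun_app[OF e that] .
 define T where "T = tob N"
 define a3 where "a3 a b c = alpha M (Term V) a b c" for a b c
 define s2 where "s2 a b = sigma M (Term V) a b" for a b
 have obT: "fob h (tob M a b) = T (fob h a) (fob h b)" if "a \<in> ob E" "b \<in> ob E" for a b using ob[OF that] T_def by simp
 have T2: "T a b = fob h (tob M (fob e a) (fob e b))" if "a \<in> ob C" "b \<in> ob C" for a b
  using obT[OF eo[OF that(1)] eo[OF that(2)]] heo that by simp
 have al': "fhm h (tob M (tob M a b) c) (tob M a (tob M b c)) \<cdot> alpha M (Term V) a b c = al (fob h a) (fob h b) (fob h c)"
  if "a \<in> ob E" "b \<in> ob E" "c \<in> ob E" for a b c
  using al[OF that] alpha_Term[OF M that] by simp
 have sg': "fhm h (tob M a b) (tob M b a) \<cdot> sigma M (Term V) a b = sg (fob h a) (fob h b)"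
  if "a \<in> ob E" "b \<in> ob E" for a b
  using sg[OF that] sigma_Term[OF M that] by simp
 have alZ: "fhm h (tob M (tob M a b) c) (tob M a (tob M b c)) \<cdot> alpha M Z a b c = al (fob h a) (fob h b) (fob h c) \<cdot> Bang V Z"
  if o: "a \<in> ob E" "b \<in> ob E" "c \<in> ob E" and Z: "Z \<in> Obj V" for a b c Z
  using stage_app[OF h(1,2) tt[OF tt[OF o(1,2)] o(3)] tt[OF o(1) tt[OF o(2,3)]] alpha_component[OF M o] Z] al[OF o]
  by (simp add: alpha_def)
 have sgZ: "fhm h (tob M a b) (tob M b a) \<cdot> sigma M Z a b = sg (fob h a) (fob h b) \<cdot> Bang V Z"
  if o: "a \<in> ob E" "b \<in> ob E" and Z: "Z \<in> Obj V" for a b Z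
  using stage_app[OF h(1,2) tt[OF o] tt[OF o(2,1)] sigma_component[OF M o] Z] sg[OF o]
  by (simp add: sigma_def)
 have hu: "fhm h a a \<cdot> unt E a = unt C (fob h a)" if "a \<in> ob E" for a using vfun_unt[OF h that] .
 note hc = vfun_ucomp[OF h] and hap = vfun_app[OF h]
 note Z = Term_Obj
 note tH = alpha_Hom[OF M _ _ _ Z] alphainv_Hom[OF M _ _ _ Z] sigma_Hom[OF M _ _ Z]
 have tb: "tob N (fob h a) (fob h b) = fob h (tob M a b)" if "a \<in> ob E" "b \<in> ob E" for a b using ob[OF that] by simp
 show ?thesis
 \<comment> \<open>The inverse associativity must be given as a function of objects of
   \<open>C\<close>, so it is computed at their images under the section \<open>e\<close>.\<close>
 proof (rule symmetric_monoidalI[where C = C and Tn = Tn and al = al and sg = sg and A = "elements C" and ai = "\<lambda>a b c. fhm h (tob M (fob e a) (tob M (fob e b) (fob e c))) (tob M (tob M (fob e a) (fob e b)) (fob e c)) \<cdot> alphainv E M (Term V) (fob e a) (fob e b) (fob e c)",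
    folded N_def, OF N dfam_elements[OF C]])
  fix a b assume o2: "a \<in> ob C" "b \<in> ob C"
  \<comment> \<open>Writing each object of \<open>C\<close> as an image under \<open>h\<close> turns
    all structure on \<open>C\<close> into \<open>h\<close> applied to structure of
    \<open>M\<close>.\<close>
  define x where "x = fob e a" define y where "y = fob e b"
  have x: "x \<in> ob E" "a = fob h x" "y \<in> ob E" "b = fob h y" "x = fob e a" "y = fob e b"
   using eo[OF o2(1)] eo[OF o2(2)] heo[OF o2(1)] heo[OF o2(2)] by (simp_all add: x_def y_def)
  have xy: "x \<in> ob E" "y \<in> ob E" by (rule x(1) x(3))+
  show "sg a b \<in> El C (Term V) (tob N a b) (tob N b a)"
   unfolding x(2,4) tb[OF xy] tb[OF xy(2,1)] sg'[OF xy, symmetric]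
   by (rule hap[OF tt[OF xy] tt[OF xy(2,1)] tH(3)[OF xy]])
  show "ucomp V C (tob N a b) (tob N b a) (tob N a b) (sg b a) (sg a b) = unt C (tob N a b)"
   unfolding x(2,4) tb[OF xy] tb[OF xy(2,1)] sg'[OF xy, symmetric] sg'[OF xy(2,1), symmetric]
    hc[OF tt[OF xy] tt[OF xy(2,1)] tt[OF xy] tH(3)[OF xy(2,1)] tH(3)[OF xy], symmetric] sigma_sigma[OF M xy Z]
   using hu[OF tt[OF xy]] E tt[OF xy] by simp
  fix c assume o3: "c \<in> ob C"
  define z where "z = fob e c"
  have z: "z \<in> ob E" "c = fob h z" "z = fob e c" using eo[OF o3] heo[OF o3] by (simp_all add: z_def)
  note xyz = x(1,3) z(1)
  note yz = tt[OF xyz(2,3)] and xy1 = tt[OF xyz(1,2)]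
  note o1 = tt[OF xyz(1) yz] tt[OF xy1 xyz(3)]
  have tb3: "tob N (tob N a b) c = fob h (tob M (tob M x y) z)" "tob N a (tob N b c) = fob h (tob M x (tob M y z))"
   unfolding x(2,4) z(2) using tb xyz yz xy1 by simp_all
  show al1: "al a b c \<in> El C (Term V) (tob N (tob N a b) c) (tob N a (tob N b c))"
   unfolding tb3 unfolding x(2,4) z(2) al'[OF xyz, symmetric] by (rule hap[OF o1(2,1) tH(1)[OF xyz]])
  show ai1: "fhm h (tob M (fob e a) (tob M (fob e b) (fob e c))) (tob M (tob M (fob e a) (fob e b)) (fob e c)) \<cdot> alphainv E M (Term V) (fob e a) (fob e b) (fob e c)
   \<in> El C (Term V) (tob N a (tob N b c)) (tob N (tob N a b) c)"
   unfolding tb3 x(5,6)[symmetric] z(3)[symmetric] by (rule hap[OF o1 tH(2)[OF xyz]])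
  show "ucomp V C (tob N (tob N a b) c) (tob N a (tob N b c)) (tob N (tob N a b) c)
    (fhm h (tob M (fob e a) (tob M (fob e b) (fob e c))) (tob M (tob M (fob e a) (fob e b)) (fob e c)) \<cdot> alphainv E M (Term V) (fob e a) (fob e b) (fob e c))
    (al a b c) = unt C (tob N (tob N a b) c)"
   unfolding tb3 x(5,6)[symmetric] z(3)[symmetric]
   unfolding x(2,4) z(2) al'[OF xyz, symmetric] hc[OF o1(2,1,2) tH(2)[OF xyz] tH(1)[OF xyz], symmetric] alphainv(2)[OF M xyz Z]
   using hu[OF o1(2)] E o1 by simp
  show "ucomp V C (tob N a (tob N b c)) (tob N (tob N a b) c) (tob N a (tob N b c)) (al a b c)
    (fhm h (tob M (fob e a) (tob M (fob e b) (fob e c))) (tob M (tob M (fob e a) (fob e b)) (fob e c)) \<cdot> alphainv E M (Term V) (fob e a) (fob e b) (fob e c))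
    = unt C (tob N a (tob N b c))"
   unfolding tb3 x(5,6)[symmetric] z(3)[symmetric]
   unfolding x(2,4) z(2) al'[OF xyz, symmetric] hc[OF o1(1,2,1) tH(1)[OF xyz] tH(2)[OF xyz], symmetric] alphainv(3)[OF M xyz Z]
   using hu[OF o1(1)] E o1 by simp
  have hal: "al (fob h x) (fob h y) (fob h z) \<in> El C (Term V) (fob h (tob M (tob M x y) z)) (fob h (tob M x (tob M y z)))"
   if "x \<in> ob E" "y \<in> ob E" "z \<in> ob E" for x y z
   unfolding al'[OF that, symmetric] using hap[OF tt[OF tt[OF that(1,2)] that(3)] tt[OF that(1) tt[OF that(2,3)]] tH(1)[OF that]] .
  show "ucomp V C (tob N (tob N a b) c) (tob N (tob N b c) a) (tob N b (tob N c a)) (al b c a)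
    (ucomp V C (tob N (tob N a b) c) (tob N a (tob N b c)) (tob N (tob N b c) a) (sg a (tob N b c)) (al a b c)) =
    ucomp V C (tob N (tob N a b) c) (tob N b (tob N a c)) (tob N b (tob N c a))
    (tarr V N b b (tob N a c) (tob N c a) (unt C b) (sg a c))
    (ucomp V C (tob N (tob N a b) c) (tob N (tob N b a) c) (tob N b (tob N a c)) (al b a c)
     (tarr V N (tob N a b) (tob N b a) c c (sg a b) (unt C c)))"
  proof -
   \<comment> \<open>The hexagon in \<open>E\<close>, carried to \<open>C\<close> by
     \<open>h\<close>.\<close>
   note hx = arg_cong[where f = "\<lambda>k. fhm h (tob M (tob M x y) z) (tob M y (tob M z x)) \<cdot> k", OF hexagon[OF M xyz Z refl]]
   show ?thesis
    using hx xyz E t M C hu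
    by (simp add: x(2,4) z(2) tb hc[of _ _ _ _ "Term V"] al' sg' hm[of _ _ _ _ _ "Term V"] heo)
  qed
  fix d assume o4: "d \<in> ob C"
  define w where "w = fob e d"
  have w: "w \<in> ob E" "d = fob h w" using eo[OF o4] heo[OF o4] by (simp_all add: w_def)
  show "ucomp V C (tob N (tob N (tob N a b) c) d) (tob N (tob N a b) (tob N c d)) (tob N a (tob N b (tob N c d))) (al a b (tob N c d)) (al (tob N a b) c d) =
    ucomp V C (tob N (tob N (tob N a b) c) d) (tob N a (tob N (tob N b c) d)) (tob N a (tob N b (tob N c d)))
    (tarr V N a a (tob N (tob N b c) d) (tob N b (tob N c d)) (unt C a) (al b c d))
    (ucomp V C (tob N (tob N (tob N a b) c) d) (tob N (tob N a (tob N b c)) d) (tob N a (tob N (tob N b c) d)) (al a (tob N b c) d)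
     (tarr V N (tob N (tob N a b) c) (tob N a (tob N b c)) d d (al a b c) (unt C d)))"
  proof -
   note hx = arg_cong[where f = "\<lambda>k. fhm h (tob M (tob M (tob M x y) z) w) (tob M x (tob M y (tob M z w))) \<cdot> k", OF pentagon[OF M xyz w(1) Z refl]]
   show ?thesis
    using hx xyz w(1) E t M C hu
    by (simp add: x(2,4) z(2) w(2) tb hc[of _ _ _ _ "Term V"] al' sg' hm[of _ _ _ _ _ "Term V"] heo)
  qed
 next
  fix a b c a' b' c' f g k Z
  assume o: "a \<in> ob C" "b \<in> ob C" "c \<in> ob C" and o': "a' \<in> ob C" "b' \<in> ob C" "c' \<in> ob C"
   and "f \<in> elements C a a'" "g \<in> elements C b b'" "k \<in> elements C c c'" "Dom V f = Z" "Dom V g = Z" "Dom V k = Z"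
  then have f: "f \<in> El C Z a a'" "g \<in> El C Z b b'" "k \<in> El C Z c c'" and Z: "Z \<in> Obj V"
   by (auto simp: elements_def Hom_iff)
  note x = eo[OF o(1)] eo[OF o(2)] eo[OF o(3)] and x' = eo[OF o'(1)] eo[OF o'(2)] eo[OF o'(3)]
  note ef = ehom[OF o(1) o'(1) f(1)] ehom[OF o(2) o'(2) f(2)] ehom[OF o(3) o'(3) f(3)]
  note hef = heh[OF o(1) o'(1) f(1)] heh[OF o(2) o'(2) f(2)] heh[OF o(3) o'(3) f(3)]
  \<comment> \<open>By \<open>hef\<close>, each morphism of \<open>C\<close> is recovered from its
    image under \<open>e\<close>, so the naturality square in \<open>E\<close> has the required
    square as its image.\<close>
  note hx = arg_cong[where f = "\<lambda>k. fhm h (tob M (tob M (fob e a) (fob e b)) (fob e c)) (tob M (fob e a') (tob M (fob e b') (fob e c'))) \<cdot> k", OF alpha_natural[OF M x x' ef]]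
  show "ucomp V C (tob N (tob N a b) c) (tob N (tob N a' b') c') (tob N a' (tob N b' c')) (al a' b' c' \<cdot> Bang V Z)
    (tarr V N (tob N a b) (tob N a' b') c c' (tarr V N a a' b b' f g) k) =
    ucomp V C (tob N (tob N a b) c) (tob N a (tob N b c)) (tob N a' (tob N b' c'))
    (tarr V N a a' (tob N b c) (tob N b' c') f (tarr V N b b' c c' g k)) (al a b c \<cdot> Bang V Z)"
   using hx x x' o o' ef E t M Z
   by (simp add: ob hc[of _ _ _ _ Z] alZ hm[of _ _ _ _ _ Z] heo hef)
 next
  fix a b a' b' f g Z
  assume o: "a \<in> ob C" "b \<in> ob C" and o': "a' \<in> ob C" "b' \<in> ob C"
   and "f \<in> elements C a a'" "g \<in> elements C b b'" "Dom V f = Z" "Dom V g = Z"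
  then have f: "f \<in> El C Z a a'" "g \<in> El C Z b b'" and Z: "Z \<in> Obj V"
   by (auto simp: elements_def Hom_iff)
  note x = eo[OF o(1)] eo[OF o(2)] and x' = eo[OF o'(1)] eo[OF o'(2)]
  note ef = ehom[OF o(1) o'(1) f(1)] ehom[OF o(2) o'(2) f(2)]
  note hef = heh[OF o(1) o'(1) f(1)] heh[OF o(2) o'(2) f(2)]
  note hx = arg_cong[where f = "\<lambda>k. fhm h (tob M (fob e a) (fob e b)) (tob M (fob e b') (fob e a')) \<cdot> k", OF sigma_natural[OF M x x' ef]]
  show "ucomp V C (tob N a b) (tob N a' b') (tob N b' a') (sg a' b' \<cdot> Bang V Z) (tarr V N a a' b b' f g) =
    ucomp V C (tob N a b) (tob N b a) (tob N b' a') (tarr V N b b' a a' g f) (sg a b \<cdot> Bang V Z)"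
   using hx x x' o o' ef E t M Z
   by (simp add: ob hc[of _ _ _ _ Z] sgZ hm[of _ _ _ _ _ Z] heo hef)
 qed
qed

end

section \<open>From free symmetric monoidal categories to the 2-monad\<close>

text \<open>Between strict monoidal functors the comparison morphisms are identities, so monoidality
  of a transformation is an equation between its components.\<close>

definition (in cartesian_category) monoidal_nat ::
 "('o, 'v, 'a) symmon => ('p, 'v, 'a) symmon => ('o, 'p, 'v, 'a) vnat => bool" where
 "monoidal_nat M N t \<longleftrightarrow> (\<forall>x\<in>ob (fsrc (nsrc t)). \<forall>y\<in>ob (fsrc (nsrc t)).
   ncomp t (tob M x y) =
    tarr V N (fob (nsrc t) x) (fob (ntgt t) x) (fob (nsrc t) y) (fob (ntgt t) y) (ncomp t x) (ncomp t y))"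

text \<open>
 \<open>FA C\<close> stands for the generalised elements of the hom objects of \<open>Fr C\<close> that are generated by those of
 \<open>C\<close>. In a coproduct these are not all elements, but maps out of it are determined by them.
\<close>

locale free_symm = cartesian_category V for V :: "('v, 'a) cartcat" (structure) +
 fixes U :: "'u univ"
  and Fr :: "('u, 'v, 'a) vcat => ('u, 'v, 'a) vcat"
  and FM :: "('u, 'v, 'a) vcat => ('u, 'v, 'a) symmon"
  and FE :: "('u, 'v, 'a) vcat => ('u, 'u, 'v, 'a) vfun"
  and FA :: "('u, 'v, 'a) vcat => 'u => 'u => 'a set"
 assumes Fr_small: "C \<in> cell0 (VCat U V) ==> ob (Fr C) \<in> Small U"
  and FM_sm: "C \<in> cell0 (VCat U V) ==> symmetric_monoidal V (Fr C) (FM C)"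
  and FE_fun: "C \<in> cell0 (VCat U V) ==> vfunctor V (FE C) \<and> fsrc (FE C) = C \<and> ftgt (FE C) = Fr C"
  and ext_ex: "[|C \<in> cell0 (VCat U V); symmetric_monoidal V D N; vfunctor V G; fsrc G = C; ftgt G = D|]
   ==> \<exists>P. strict_monoidal V (Fr C) (FM C) (D :: ('u, 'v, 'a) vcat) N P \<and> P oo FE C = G"
  and gen_ob: "[|C \<in> cell0 (VCat U V); x \<in> ob (Fr C); \<And>a. a \<in> ob C ==> R (fob (FE C) a);
   \<And>s t. s \<in> ob (Fr C) ==> t \<in> ob (Fr C) ==> R s ==> R t ==> R (tob (FM C) s t)|] ==> R x"
  and rec_ob: "C \<in> cell0 (VCat U V) ==> \<exists>\<tau> :: 'u => 'a. (\<forall>a\<in>ob C. \<tau> (fob (FE C) a) = base a) \<and>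
   (\<forall>x\<in>ob (Fr C). \<forall>y\<in>ob (Fr C). \<tau> (tob (FM C) x y) = step x y (\<tau> x) (\<tau> y))"
  and FA_dense: "C \<in> cell0 (VCat U V) ==> dfam (Fr C) (FA C)"
  and gen_hm: "[|C \<in> cell0 (VCat U V); s \<in> ob (Fr C); t \<in> ob (Fr C); f \<in> FA C s t; f \<in> El (Fr C) Z s t;
   \<And>a b f. [|a \<in> ob C; b \<in> ob C; f \<in> El C Z a b|] ==> R2 (fob (FE C) a) (fob (FE C) b) (fhm (FE C) a b \<cdot> f);
   \<And>a. a \<in> ob (Fr C) ==> R2 a a (uid (Fr C) Z a);
   \<And>a b c g f. [|a \<in> ob (Fr C); b \<in> ob (Fr C); c \<in> ob (Fr C); g \<in> El (Fr C) Z b c; f \<in> El (Fr C) Z a b;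
    R2 b c g; R2 a b f|] ==> R2 a c (ucomp V (Fr C) a b c g f);
   \<And>a a' b b' f g. [|a \<in> ob (Fr C); a' \<in> ob (Fr C); b \<in> ob (Fr C); b' \<in> ob (Fr C); f \<in> El (Fr C) Z a a';
    g \<in> El (Fr C) Z b b'; R2 a a' f; R2 b b' g|] ==> R2 (tob (FM C) a b) (tob (FM C) a' b') (tarr V (FM C) a a' b b' f g);
   \<And>a b c. [|a \<in> ob (Fr C); b \<in> ob (Fr C); c \<in> ob (Fr C)|] ==>
    R2 (tob (FM C) (tob (FM C) a b) c) (tob (FM C) a (tob (FM C) b c)) (alpha (FM C) Z a b c);
   \<And>a b c. [|a \<in> ob (Fr C); b \<in> ob (Fr C); c \<in> ob (Fr C)|] ==>
    R2 (tob (FM C) a (tob (FM C) b c)) (tob (FM C) (tob (FM C) a b) c) (alphainv (Fr C) (FM C) Z a b c);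
   \<And>a b. [|a \<in> ob (Fr C); b \<in> ob (Fr C)|] ==> R2 (tob (FM C) a b) (tob (FM C) b a) (sigma (FM C) Z a b)|]
   ==> R2 s t f"
begin

section \<open>Uniqueness of extensions, and extension of transformations\<close>

abbreviation K where "K C \<equiv> C \<in> cell0 (VCat U V)"

lemma KD: "K C ==> vcategory V C" "K C ==> ob C \<in> Small U"
 by simp_all

lemma K_Fr: "K C ==> K (Fr C)"
 using Fr_small symmetric_monoidal_vcategory[OF FM_sm] by simp

lemma FE_D: assumes "K C" shows "vfunctor V (FE C)" "fsrc (FE C) = C" "ftgt (FE C) = Fr C"
 using FE_fun[OF assms] by auto

abbreviation strict_ext where
 "strict_ext C D N P \<equiv> strict_monoidal V (Fr C) (FM C) D N P"

text \<open>Agreement on generating objects and morphisms spreads along tensor products, composites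
  and constraints, all of which both functors preserve; the elements reached in this way are
  dense.\<close>

lemma ext_unique:
 assumes C: "K C" and N: "symmetric_monoidal V D N" and P: "strict_ext C D N P" and Q: "strict_ext C D N Q"
  and eq: "P oo FE C = Q oo FE C"
 shows "P = Q"
proof -
 note e = FE_D[OF C] and p = strict_monoidal_vfunctor[OF P] and q = strict_monoidal_vfunctor[OF Q]
 note M = FM_sm[OF C] and TM = symmetric_monoidal_is_tensor[OF FM_sm[OF C]] and TN = symmetric_monoidal_is_tensor[OF N]
 have ep: "fsrc P = ftgt (FE C)" "fsrc Q = ftgt (FE C)" using e p q by simp_all
 have ob: "fob P x = fob Q x" if "x \<in> ob (Fr C)" for x
  using C that
 proof (rule gen_ob)
  fix a assume a: "a \<in> ob C"
  have "fob (P oo FE C) a = fob (Q oo FE C) a" using eq by simp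
  then show "fob P (fob (FE C) a) = fob Q (fob (FE C) a)" using a e by simp
 qed (simp add: strict_monoidal_tob[OF P TM] strict_monoidal_tob[OF Q TM])
 show ?thesis
 proof (rule vfunctor_eqI[OF p(1) q(1), where A = "FA C"], unfold p q)
  fix s t f Z assume "s \<in> ob (Fr C)" "t \<in> ob (Fr C)" "f \<in> FA C s t" "f \<in> El (Fr C) Z s t"
  then show "fhm P s t \<cdot> f = fhm Q s t \<cdot> f"
  proof (rule gen_hm[OF C])
   have Z: "Z \<in> Obj V" using HomD(4)[OF \<open>f \<in> El (Fr C) Z s t\<close>] .
   fix a b f assume o: "a \<in> ob C" "b \<in> ob C" and f: "f \<in> El C Z a b"
   have "fhm (P oo FE C) a b \<cdot> f = fhm (Q oo FE C) a b \<cdot> f" using eq by simp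
   then show "fhm P (fob (FE C) a) (fob (FE C) b) \<cdot> fhm (FE C) a b \<cdot> f = fhm Q (fob (FE C) a) (fob (FE C) b) \<cdot> fhm (FE C) a b \<cdot> f"
    unfolding vfun_comp_app[OF e(1,2) p(1) ep(1) o f] vfun_comp_app[OF e(1,2) q(1) ep(2) o f] .
  next
   fix a assume a: "a \<in> ob (Fr C)"
   have Z: "Z \<in> Obj V" using HomD(4)[OF \<open>f \<in> El (Fr C) Z s t\<close>] .
   show "fhm P a a \<cdot> uid (Fr C) Z a = fhm Q a a \<cdot> uid (Fr C) Z a"
    using vfun_uid[OF p a Z] vfun_uid[OF q a Z] ob[OF a] by simp
   fix b assume b: "b \<in> ob (Fr C)"
   show "fhm P (tob (FM C) a b) (tob (FM C) b a) \<cdot> sigma (FM C) Z a b = fhm Q (tob (FM C) a b) (tob (FM C) b a) \<cdot> sigma (FM C) Z a b"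
    using strict_monoidal_sigma[OF P M N a b Z] strict_monoidal_sigma[OF Q M N a b Z] ob[OF a] ob[OF b] by simp
   fix c assume c: "c \<in> ob (Fr C)"
   show "fhm P (tob (FM C) (tob (FM C) a b) c) (tob (FM C) a (tob (FM C) b c)) \<cdot> alpha (FM C) Z a b c =
     fhm Q (tob (FM C) (tob (FM C) a b) c) (tob (FM C) a (tob (FM C) b c)) \<cdot> alpha (FM C) Z a b c"
    using strict_monoidal_alpha[OF P M N a b c Z] strict_monoidal_alpha[OF Q M N a b c Z] ob[OF a] ob[OF b] ob[OF c] by simp
   show "fhm P (tob (FM C) a (tob (FM C) b c)) (tob (FM C) (tob (FM C) a b) c) \<cdot> alphainv (Fr C) (FM C) Z a b c =
     fhm Q (tob (FM C) a (tob (FM C) b c)) (tob (FM C) (tob (FM C) a b) c) \<cdot> alphainv (Fr C) (FM C) Z a b c"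
    using strict_monoidal_alphainv[OF P M N a b c Z] strict_monoidal_alphainv[OF Q M N a b c Z] ob[OF a] ob[OF b] ob[OF c] by simp
   fix g f assume gf: "g \<in> El (Fr C) Z b c" "f \<in> El (Fr C) Z a b"
    "fhm P b c \<cdot> g = fhm Q b c \<cdot> g" "fhm P a b \<cdot> f = fhm Q a b \<cdot> f"
   show "fhm P a c \<cdot> ucomp V (Fr C) a b c g f = fhm Q a c \<cdot> ucomp V (Fr C) a b c g f"
    using vfun_ucomp[OF p a b c gf(1,2)] vfun_ucomp[OF q a b c gf(1,2)] gf(3,4) ob[OF a] ob[OF b] ob[OF c] by simp
  next
   fix a a' b b' f g assume o: "a \<in> ob (Fr C)" "a' \<in> ob (Fr C)" "b \<in> ob (Fr C)" "b' \<in> ob (Fr C)"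
    and fg: "f \<in> El (Fr C) Z a a'" "g \<in> El (Fr C) Z b b'"
     "fhm P a a' \<cdot> f = fhm Q a a' \<cdot> f" "fhm P b b' \<cdot> g = fhm Q b b' \<cdot> g"
   show "fhm P (tob (FM C) a b) (tob (FM C) a' b') \<cdot> tarr V (FM C) a a' b b' f g =
     fhm Q (tob (FM C) a b) (tob (FM C) a' b') \<cdot> tarr V (FM C) a a' b b' f g"
    unfolding strict_monoidal_tarr[OF P TM TN o fg(1,2)] strict_monoidal_tarr[OF Q TM TN o fg(1,2)]
    using fg(3,4) ob o by simp
  qed
 qed (use p q FA_dense[OF C] ob in simp_all)
qed

text \<open>Monoidality dictates the components by recursion on objects. Naturality is then a
  property of morphisms that is closed under all the generating operations.\<close>

lemma ext2_ex:
 assumes C: "K C" and N: "symmetric_monoidal V D N" and P: "strict_ext C D N P" and Q: "strict_ext C D N Q"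
  and t: "vnatural V t" "nsrc t = P oo FE C" "ntgt t = Q oo FE C"
 shows "\<exists>t'. vnatural V t' \<and> nsrc t' = P \<and> ntgt t' = Q \<and> monoidal_nat (FM C) N t' \<and>
   (\<forall>a\<in>ob C. ncomp t' (fob (FE C) a) = ncomp t a)"
proof -
 note e = FE_D[OF C] and p = strict_monoidal_vfunctor[OF P] and q = strict_monoidal_vfunctor[OF Q]
 note M = FM_sm[OF C] and TM = symmetric_monoidal_is_tensor[OF FM_sm[OF C]] and TN = symmetric_monoidal_is_tensor[OF N]
 note tt = tob_ob[OF TM] and D = is_tensorD(1)[OF TN]
 have ep: "fsrc P = ftgt (FE C)" "fsrc Q = ftgt (FE C)" using e p q by simp_all
 note pt = strict_monoidal_tob[OF P TM] and qt = strict_monoidal_tob[OF Q TM]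
 \<comment> \<open>The recursion yields untyped arrows of \<open>V\<close>; that they are morphisms
   between the right objects is proved afterwards by induction.\<close>
 obtain \<tau> where \<tau>: "\<And>a. a \<in> ob C ==> \<tau> (fob (FE C) a) = ncomp t a"
   "\<And>x y. x \<in> ob (Fr C) ==> y \<in> ob (Fr C) ==> \<tau> (tob (FM C) x y) = tarr V N (fob P x) (fob Q x) (fob P y) (fob Q y) (\<tau> x) (\<tau> y)"
  using rec_ob[OF C, of "ncomp t" "\<lambda>x y. tarr V N (fob P x) (fob Q x) (fob P y) (fob Q y)"] by blast
 have t_ty: "fsrc (P oo FE C) = C" "ftgt (P oo FE C) = D" using e p by simp_all
 have pq: "fob P x \<in> ob D" "fob Q x \<in> ob D" if "x \<in> ob (Fr C)" for x using that p q by simp_all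
 have ty: "\<tau> x \<in> El D (Term V) (fob P x) (fob Q x)" if "x \<in> ob (Fr C)" for x
  using C that
 proof (rule gen_ob)
  fix a assume a: "a \<in> ob C"
  show "\<tau> (fob (FE C) a) \<in> El D (Term V) (fob P (fob (FE C) a)) (fob Q (fob (FE C) a))"
   using ncomp_Hom[OF t t_ty a] \<tau>(1)[OF a] a e by simp
 next
  fix x y assume o: "x \<in> ob (Fr C)" "y \<in> ob (Fr C)" and h: "\<tau> x \<in> El D (Term V) (fob P x) (fob Q x)"
   "\<tau> y \<in> El D (Term V) (fob P y) (fob Q y)"
  show "\<tau> (tob (FM C) x y) \<in> El D (Term V) (fob P (tob (FM C) x y)) (fob Q (tob (FM C) x y))"
   unfolding \<tau>(2)[OF o] pt[OF o] qt[OF o] by (rule tarr_Hom[OF TN]) (use pq o h in simp_all)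
 qed
 define t' where "t' = \<lparr>nsrc = P, ntgt = Q, ncomp = restrict \<tau> (ob (Fr C))\<rparr>"
 have t': "nsrc t' = P" "ntgt t' = Q" "\<And>x. x \<in> ob (Fr C) ==> ncomp t' x = \<tau> x"
  "\<And>x. x \<notin> ob (Fr C) ==> ncomp t' x = undefined"
  by (simp_all add: t'_def)
 have st: "\<tau> (tob (FM C) x y) \<cdot> Bang V Z = tarr V N (fob P x) (fob Q x) (fob P y) (fob Q y) (\<tau> x \<cdot> Bang V Z) (\<tau> y \<cdot> Bang V Z)"
  if "x \<in> ob (Fr C)" "y \<in> ob (Fr C)" "Z \<in> Obj V" for x y Z
  unfolding \<tau>(2)[OF that(1,2)] by (rule tarr_Comp[OF TN _ _ _ _ _ _ Bang_Hom[OF that(3)]]) (use pq ty that in simp_all)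
 have "vnatural V t'"
 proof (rule vnaturalI[OF p(1) q(1) p(2,3) q(2,3) t'(1,2) FA_dense[OF C]])
  fix s r f Z assume o: "s \<in> ob (Fr C)" "r \<in> ob (Fr C)" and f: "f \<in> FA C s r" and "Dom V f = Z"
  then have fh: "f \<in> El (Fr C) Z s r" using dfam_Hom[OF FA_dense[OF C]] by blast
  have Z: "Z \<in> Obj V" using HomD(4)[OF fh] .
  \<comment> \<open>The naturality square at the fixed stage \<open>Z\<close>, as a predicate of
    source, target and morphism to which \<open>gen_hm\<close> applies.\<close>
  define R where "R s r f \<longleftrightarrow>
   ucomp V D (fob P s) (fob P r) (fob Q r) (\<tau> r \<cdot> Bang V Z) (fhm P s r \<cdot> f) =
   ucomp V D (fob P s) (fob Q s) (fob Q r) (fhm Q s r \<cdot> f) (\<tau> s \<cdot> Bang V Z)" for s r f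
  have tyZ: "\<tau> x \<cdot> Bang V Z \<in> El D Z (fob P x) (fob Q x)" if "x \<in> ob (Fr C)" for x
   by (rule stage_Hom[OF ty[OF that] Z])
  have "R s r f"
   using o f fh
  proof (rule gen_hm[OF C])
   fix a b f assume o: "a \<in> ob C" "b \<in> ob C" and f: "f \<in> El C Z a b"
   show "R (fob (FE C) a) (fob (FE C) b) (fhm (FE C) a b \<cdot> f)"
    using nat_sq[OF t t_ty o f] vfun_comp_app[OF e(1,2) p(1) ep(1) o f] vfun_comp_app[OF e(1,2) q(1) ep(2) o f] e \<tau>(1) o
    by (simp add: R_def)
  next
   fix a assume a: "a \<in> ob (Fr C)"
   show "R a a (uid (Fr C) Z a)"
    unfolding R_def vfun_uid[OF p a Z] vfun_uid[OF q a Z] using D pq[OF a] tyZ[OF a] by simp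
   fix b assume b: "b \<in> ob (Fr C)"
   have ab: "\<tau> (tob (FM C) a b) \<cdot> Bang V Z = tarr V N (fob P a) (fob Q a) (fob P b) (fob Q b) (\<tau> a \<cdot> Bang V Z) (\<tau> b \<cdot> Bang V Z)"
     "\<tau> (tob (FM C) b a) \<cdot> Bang V Z = tarr V N (fob P b) (fob Q b) (fob P a) (fob Q a) (\<tau> b \<cdot> Bang V Z) (\<tau> a \<cdot> Bang V Z)"
    using st a b Z by simp_all
   \<comment> \<open>At a constraint, the square of the new transformation is the naturality square
     of that constraint of \<open>N\<close> at the components, read in the other direction.\<close>
   show "R (tob (FM C) a b) (tob (FM C) b a) (sigma (FM C) Z a b)"
    unfolding R_def strict_monoidal_sigma[OF P M N a b Z] strict_monoidal_sigma[OF Q M N a b Z] pt[OF a b] pt[OF b a] qt[OF a b] qt[OF b a] ab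
    by (rule sigma_natural[OF N pq(1)[OF a] pq(1)[OF b] pq(2)[OF a] pq(2)[OF b] tyZ[OF a] tyZ[OF b], symmetric])
   fix c assume c: "c \<in> ob (Fr C)"
   note bc = tt[OF b c] and ab' = tt[OF a b]
   have abc: "\<tau> (tob (FM C) (tob (FM C) a b) c) \<cdot> Bang V Z = tarr V N (tob N (fob P a) (fob P b)) (tob N (fob Q a) (fob Q b)) (fob P c) (fob Q c)
     (tarr V N (fob P a) (fob Q a) (fob P b) (fob Q b) (\<tau> a \<cdot> Bang V Z) (\<tau> b \<cdot> Bang V Z)) (\<tau> c \<cdot> Bang V Z)"
    "\<tau> (tob (FM C) a (tob (FM C) b c)) \<cdot> Bang V Z = tarr V N (fob P a) (fob Q a) (tob N (fob P b) (fob P c)) (tob N (fob Q b) (fob Q c))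
     (\<tau> a \<cdot> Bang V Z) (tarr V N (fob P b) (fob Q b) (fob P c) (fob Q c) (\<tau> b \<cdot> Bang V Z) (\<tau> c \<cdot> Bang V Z))"
    using st[OF ab' c Z] st[OF a b Z] st[OF a bc Z] st[OF b c Z] pt[OF a b] qt[OF a b] pt[OF b c] qt[OF b c] by simp_all
   have pq3: "fob P (tob (FM C) (tob (FM C) a b) c) = tob N (tob N (fob P a) (fob P b)) (fob P c)"
    "fob P (tob (FM C) a (tob (FM C) b c)) = tob N (fob P a) (tob N (fob P b) (fob P c))"
    "fob Q (tob (FM C) (tob (FM C) a b) c) = tob N (tob N (fob Q a) (fob Q b)) (fob Q c)"
    "fob Q (tob (FM C) a (tob (FM C) b c)) = tob N (fob Q a) (tob N (fob Q b) (fob Q c))"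
    using pt[OF ab' c] pt[OF a bc] qt[OF ab' c] qt[OF a bc] pt[OF a b] qt[OF a b] pt[OF b c] qt[OF b c] by simp_all
   note nat = N pq(1)[OF a] pq(1)[OF b] pq(1)[OF c] pq(2)[OF a] pq(2)[OF b] pq(2)[OF c] tyZ[OF a] tyZ[OF b] tyZ[OF c]
   show "R (tob (FM C) (tob (FM C) a b) c) (tob (FM C) a (tob (FM C) b c)) (alpha (FM C) Z a b c)"
    unfolding R_def strict_monoidal_alpha[OF P M N a b c Z] strict_monoidal_alpha[OF Q M N a b c Z] abc pq3
    by (rule alpha_natural[OF nat, symmetric])
   show "R (tob (FM C) a (tob (FM C) b c)) (tob (FM C) (tob (FM C) a b) c) (alphainv (Fr C) (FM C) Z a b c)"
    unfolding R_def strict_monoidal_alphainv[OF P M N a b c Z] strict_monoidal_alphainv[OF Q M N a b c Z] abc pq3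
    by (rule alphainv_natural[OF nat, symmetric])
   fix g f assume gf: "g \<in> El (Fr C) Z b c" "f \<in> El (Fr C) Z a b" "R b c g" "R a b f"
   show "R a c (ucomp V (Fr C) a b c g f)"
    unfolding R_def vfun_ucomp[OF p a b c gf(1,2)] vfun_ucomp[OF q a b c gf(1,2)]
    by (rule paste_horizontal[OF D pq(1)[OF a] pq(1)[OF b] pq(1)[OF c] pq(2)[OF a] pq(2)[OF b] pq(2)[OF c]
      vfun_app[OF p a b gf(2)] vfun_app[OF p b c gf(1)] vfun_app[OF q a b gf(2)] vfun_app[OF q b c gf(1)]
      tyZ[OF a] tyZ[OF b] tyZ[OF c] gf(4,3)[unfolded R_def]])
  next
   fix a a' b b' f g assume o: "a \<in> ob (Fr C)" "a' \<in> ob (Fr C)" "b \<in> ob (Fr C)" "b' \<in> ob (Fr C)"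
    and fg: "f \<in> El (Fr C) Z a a'" "g \<in> El (Fr C) Z b b'" and R: "R a a' f" "R b b' g"
   note oP = pq(1)[OF o(1)] pq(1)[OF o(2)] pq(1)[OF o(3)] pq(1)[OF o(4)]
   note oQ = pq(2)[OF o(1)] pq(2)[OF o(2)] pq(2)[OF o(3)] pq(2)[OF o(4)]
   note P' = vfun_app[OF p o(1,2) fg(1)] vfun_app[OF p o(3,4) fg(2)] and Q' = vfun_app[OF q o(1,2) fg(1)] vfun_app[OF q o(3,4) fg(2)]
   note ty' = tyZ[OF o(1)] tyZ[OF o(2)] tyZ[OF o(3)] tyZ[OF o(4)]
   \<comment> \<open>By the interchange law, the square at a tensor product of morphisms is the
     tensor product of the two squares.\<close>
   show "R (tob (FM C) a b) (tob (FM C) a' b') (tarr V (FM C) a a' b b' f g)"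
    unfolding R_def strict_monoidal_tarr[OF P TM TN o fg(1,2)] strict_monoidal_tarr[OF Q TM TN o fg(1,2)]
     pt[OF o(1,3)] pt[OF o(2,4)] qt[OF o(1,3)] qt[OF o(2,4)] st[OF o(1,3) Z] st[OF o(2,4) Z]
     tarr_ucomp[OF TN oP(1,2) oQ(2) oP(3,4) oQ(4) ty'(2) P'(1) ty'(4) P'(2), symmetric]
     tarr_ucomp[OF TN oP(1) oQ(1,2) oP(3) oQ(3,4) Q'(1) ty'(1) Q'(2) ty'(3), symmetric]
    using R by (simp add: R_def)
  qed
  then show "ucomp V D (fob P s) (fob P r) (fob Q r) (ncomp t' r \<cdot> Bang V Z) (fhm P s r \<cdot> f) =
    ucomp V D (fob P s) (fob Q s) (fob Q r) (fhm Q s r \<cdot> f) (ncomp t' s \<cdot> Bang V Z)"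
   using o t' by (simp add: R_def)
 qed (use t' ty in simp_all)
 moreover have "monoidal_nat (FM C) N t'"
  unfolding monoidal_nat_def using t' p \<tau>(2) tt by simp
 moreover have "\<forall>a\<in>ob C. ncomp t' (fob (FE C) a) = ncomp t a"
  using t' \<tau>(1) e by simp
 ultimately show ?thesis using t' by blast
qed

text \<open>Monoidality computes the component at a tensor product from those at the factors, so
  induction on generated objects applies.\<close>

lemma nat_unique:
 assumes C: "K C" and t: "vnatural V t" "vnatural V t'" "nsrc t = nsrc t'" "ntgt t = ntgt t'" "fsrc (nsrc t') = Fr C"
  and m: "monoidal_nat (FM C) N t" "monoidal_nat (FM C) N t'"
  and eq: "\<And>a. a \<in> ob C ==> ncomp t (fob (FE C) a) = ncomp t' (fob (FE C) a)"
 shows "t = t'"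
proof (rule vnatural_eqI[OF t(1-4)], unfold t(5))
 fix x assume "x \<in> ob (Fr C)"
 with C show "ncomp t x = ncomp t' x"
  by (rule gen_ob) (use eq m t in \<open>simp_all add: monoidal_nat_def\<close>)
qed

end

section \<open>Composition of monoidal transformations\<close>

context cartesian_category
begin

lemma monoidal_nat_id:
 assumes P: "strict_monoidal V C M D N P" and M: "is_tensor C M" and N: "is_tensor D N"
 shows "monoidal_nat M N (vnat_id P)"
proof -
 note p = strict_monoidal_vfunctor[OF P] note tt = tob_ob[OF M]
 show ?thesis unfolding monoidal_nat_def
  using strict_monoidal_tob[OF P M] p tt N by simp
qed

text \<open>The interchange law exchanges the tensor product with composition of components.\<close>

lemma monoidal_nat_vcomp:
 assumes N: "is_tensor D N" and M: "is_tensor C M"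
  and t: "vnatural V t" "nsrc t = P" "ntgt t = Q" "monoidal_nat M N t"
  and s: "vnatural V s" "nsrc s = Q" "ntgt s = R" "monoidal_nat M N s"
  and P: "strict_monoidal V C M D N P" and Q: "strict_monoidal V C M D N Q" and R: "strict_monoidal V C M D N R"
 shows "monoidal_nat M N (vnat_vcomp V s t)"
 unfolding monoidal_nat_def
proof (intro ballI)
 note p = strict_monoidal_vfunctor[OF P] and q = strict_monoidal_vfunctor[OF Q] and r = strict_monoidal_vfunctor[OF R]
 fix x y assume "x \<in> ob (fsrc (nsrc (vnat_vcomp V s t)))" "y \<in> ob (fsrc (nsrc (vnat_vcomp V s t)))"
 then have o: "x \<in> ob C" "y \<in> ob C" using p t by simp_all
 note xy = tob_ob[OF M o]
 note tx = ncomp_Hom[OF t(1-3) p(2,3) o(1)] ncomp_Hom[OF t(1-3) p(2,3) o(2)]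
 note sx = ncomp_Hom[OF s(1-3) q(2,3) o(1)] ncomp_Hom[OF s(1-3) q(2,3) o(2)]
 have v: "ncomp (vnat_vcomp V s t) z = ucomp V D (fob P z) (fob Q z) (fob R z) (ncomp s z) (ncomp t z)" if "z \<in> ob C" for z
  using that t s p by simp
 have m: "ncomp t (tob M x y) = tarr V N (fob P x) (fob Q x) (fob P y) (fob Q y) (ncomp t x) (ncomp t y)"
  "ncomp s (tob M x y) = tarr V N (fob Q x) (fob R x) (fob Q y) (fob R y) (ncomp s x) (ncomp s y)"
  using t s o p q unfolding monoidal_nat_def by simp_all
 have "fob P x \<in> ob D" "fob P y \<in> ob D" "fob Q x \<in> ob D" "fob Q y \<in> ob D" "fob R x \<in> ob D" "fob R y \<in> ob D" using p q r o by simp_all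
 note e = tarr_ucomp[OF N this(1,3,5,2,4,6) sx(1) tx(1) sx(2) tx(2)]
 have "ncomp (vnat_vcomp V s t) (tob M x y) = tarr V N (fob P x) (fob R x) (fob P y) (fob R y) (ncomp (vnat_vcomp V s t) x) (ncomp (vnat_vcomp V s t) y)"
  unfolding v[OF xy] v[OF o(1)] v[OF o(2)] m strict_monoidal_tob[OF P M o] strict_monoidal_tob[OF Q M o] strict_monoidal_tob[OF R M o]
  by (rule e[symmetric])
 then show "ncomp (vnat_vcomp V s t) (tob M x y) = tarr V N (fob (nsrc (vnat_vcomp V s t)) x) (fob (ntgt (vnat_vcomp V s t)) x)
   (fob (nsrc (vnat_vcomp V s t)) y) (fob (ntgt (vnat_vcomp V s t)) y) (ncomp (vnat_vcomp V s t) x) (ncomp (vnat_vcomp V s t) y)"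
  using t s by simp
qed

text \<open>Strictness of \<open>Q\<close> moves it inside the tensor product of components of
  \<open>t\<close>; the interchange law then combines the result with the components of
  \<open>s\<close>.\<close>

lemma monoidal_nat_hcomp:
 assumes M: "is_tensor C M" and N: "is_tensor D N" and L: "is_tensor E L"
  and t: "vnatural V t" "nsrc t = P" "ntgt t = P'" "monoidal_nat M N t"
  and s: "vnatural V s" "nsrc s = Q" "ntgt s = Q'" "monoidal_nat N L s"
  and P: "strict_monoidal V C M D N P" and P': "strict_monoidal V C M D N P'"
  and Q: "strict_monoidal V D N E L Q" and Q': "strict_monoidal V D N E L Q'"
 shows "monoidal_nat M L (vnat_hcomp V s t)"
 unfolding monoidal_nat_def
proof (intro ballI)
 note p = strict_monoidal_vfunctor[OF P] and q = strict_monoidal_vfunctor[OF Q] and p' = strict_monoidal_vfunctor[OF P'] and q' = strict_monoidal_vfunctor[OF Q']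
 fix x y assume "x \<in> ob (fsrc (nsrc (vnat_hcomp V s t)))" "y \<in> ob (fsrc (nsrc (vnat_hcomp V s t)))"
 then have o: "x \<in> ob C" "y \<in> ob C" using p t by simp_all
 note xy = tob_ob[OF M o]
 have oP: "fob P x \<in> ob D" "fob P y \<in> ob D" "fob P' x \<in> ob D" "fob P' y \<in> ob D" using p p' o by simp_all
 have oQ: "fob Q (fob P x) \<in> ob E" "fob Q (fob P y) \<in> ob E" "fob Q (fob P' x) \<in> ob E" "fob Q (fob P' y) \<in> ob E"
  "fob Q' (fob P' x) \<in> ob E" "fob Q' (fob P' y) \<in> ob E" using q q' oP by simp_all
 note tx = ncomp_Hom[OF t(1-3) p(2,3) o(1)] ncomp_Hom[OF t(1-3) p(2,3) o(2)]
 note sx = ncomp_Hom[OF s(1-3) q(2,3) oP(3)] ncomp_Hom[OF s(1-3) q(2,3) oP(4)]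
 note Qt = vfun_app[OF q oP(1,3) tx(1)] vfun_app[OF q oP(2,4) tx(2)]
 have v: "ncomp (vnat_hcomp V s t) z = ucomp V E (fob Q (fob P z)) (fob Q (fob P' z)) (fob Q' (fob P' z)) (ncomp s (fob P' z)) (fhm Q (fob P z) (fob P' z) \<cdot> ncomp t z)" if "z \<in> ob C" for z
  using that vnat_hcomp_ncomp[OF t(2) s(2) t(3) s(3)] p q by simp
 have m: "ncomp t (tob M x y) = tarr V N (fob P x) (fob P' x) (fob P y) (fob P' y) (ncomp t x) (ncomp t y)"
  "ncomp s (tob N (fob P' x) (fob P' y)) = tarr V L (fob Q (fob P' x)) (fob Q' (fob P' x)) (fob Q (fob P' y)) (fob Q' (fob P' y)) (ncomp s (fob P' x)) (ncomp s (fob P' y))"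
  using t s o p q oP unfolding monoidal_nat_def by simp_all
 note e = tarr_ucomp[OF L oQ(1,3,5,2,4,6) sx(1) Qt(1) sx(2) Qt(2)]
 have "ncomp (vnat_hcomp V s t) (tob M x y) = tarr V L (fob Q (fob P x)) (fob Q' (fob P' x)) (fob Q (fob P y)) (fob Q' (fob P' y)) (ncomp (vnat_hcomp V s t) x) (ncomp (vnat_hcomp V s t) y)"
  unfolding v[OF xy] v[OF o(1)] v[OF o(2)] m(1) strict_monoidal_tob[OF P M o] strict_monoidal_tob[OF P' M o] m(2)
   strict_monoidal_tob[OF Q N oP(1,2)] strict_monoidal_tob[OF Q N oP(3,4)] strict_monoidal_tob[OF Q' N oP(3,4)]
   strict_monoidal_tarr[OF Q N L oP(1,3,2,4) tx]
  by (rule e[symmetric])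
 then show "ncomp (vnat_hcomp V s t) (tob M x y) = tarr V L (fob (nsrc (vnat_hcomp V s t)) x) (fob (ntgt (vnat_hcomp V s t)) x)
   (fob (nsrc (vnat_hcomp V s t)) y) (fob (ntgt (vnat_hcomp V s t)) y) (ncomp (vnat_hcomp V s t) x) (ncomp (vnat_hcomp V s t) y)"
  using t s o p p' by simp
qed

end

section \<open>The 2-monad and its laws\<close>

context free_symm
begin

text \<open>The extension is selected by choice, but \<open>ext_unique\<close> makes it the only
  one. Functoriality and the monad laws thereby become comparisons on generators.\<close>

definition free1 :: "('u, 'u, 'v, 'a) vfun => ('u, 'u, 'v, 'a) vfun" where
 "free1 F = (SOME P. strict_ext (fsrc F) (Fr (ftgt F)) (FM (ftgt F)) P \<and>
   P oo FE (fsrc F) = FE (ftgt F) oo F)"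

text \<open>The monoidal extension of the whiskering of \<open>s\<close> with the unit; it exists by
  \<open>ext2_ex\<close> and is unique by \<open>nat_unique\<close>.\<close>

definition free2 :: "('u, 'u, 'v, 'a) vnat => ('u, 'u, 'v, 'a) vnat" where
 "free2 s = (let C = fsrc (nsrc s); D = ftgt (nsrc s) in
   (SOME t. vnatural V t \<and> nsrc t = free1 (nsrc s) \<and> ntgt t = free1 (ntgt s) \<and> monoidal_nat (FM C) (FM D) t \<and>
    (\<forall>a\<in>ob C. ncomp t (fob (FE C) a) = fhm (FE D) (fob (nsrc s) a) (fob (ntgt s) a) \<cdot> ncomp s a)))"

text \<open>The counit of the free-forgetful adjunction at \<open>FM C\<close>: formal tensor
  products of formal objects are evaluated to formal objects.\<close>

definition free_mu :: "('u, 'v, 'a) vcat => ('u, 'u, 'v, 'a) vfun" where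
 "free_mu C = (SOME P. strict_ext (Fr C) (Fr C) (FM C) P \<and> P oo FE (Fr C) = vfun_id V (Fr C))"

definition free_monad :: "(('u, 'v, 'a) vcat, ('u, 'u, 'v, 'a) vfun, ('u, 'u, 'v, 'a) vnat) monad_data" where
 "free_monad = \<lparr>T0 = Fr, T1 = free1, T2 = free2, mu = free_mu, eta = FE\<rparr>"

lemma FM_tensor: "K C ==> is_tensor (Fr C) (FM C)"
 by (rule symmetric_monoidal_is_tensor[OF FM_sm])

lemma free1:
 assumes F: "vfunctor V F" "fsrc F = C" "ftgt F = D" and C: "K C" and D: "K D"
 shows "strict_ext C (Fr D) (FM D) (free1 F)" "free1 F oo FE C = FE D oo F"
  "vfunctor V (free1 F)" "fsrc (free1 F) = Fr C" "ftgt (free1 F) = Fr D"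
proof -
 note e = FE_D[OF D]
 have "\<exists>P. strict_ext C (Fr D) (FM D) P \<and> P oo FE C = FE D oo F"
  by (rule ext_ex[OF C FM_sm[OF D]]) (use e F in simp_all)
 from someI_ex[OF this]
 show 1: "strict_ext C (Fr D) (FM D) (free1 F)" "free1 F oo FE C = FE D oo F"
  unfolding free1_def F by blast+
 show "vfunctor V (free1 F)" "fsrc (free1 F) = Fr C" "ftgt (free1 F) = Fr D"
  using strict_monoidal_vfunctor[OF 1(1)] by simp_all
qed

lemma free_mu:
 assumes C: "K C"
 shows "strict_ext (Fr C) (Fr C) (FM C) (free_mu C)" "free_mu C oo FE (Fr C) = vfun_id V (Fr C)"
  "vfunctor V (free_mu C)" "fsrc (free_mu C) = Fr (Fr C)" "ftgt (free_mu C) = Fr C"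
proof -
 have "\<exists>P. strict_ext (Fr C) (Fr C) (FM C) P \<and> P oo FE (Fr C) = vfun_id V (Fr C)"
  by (rule ext_ex[OF K_Fr[OF C] FM_sm[OF C]]) (use KD[OF K_Fr[OF C]] in simp_all)
 from someI_ex[OF this]
 show 1: "strict_ext (Fr C) (Fr C) (FM C) (free_mu C)" "free_mu C oo FE (Fr C) = vfun_id V (Fr C)"
  unfolding free_mu_def by blast+
 show "vfunctor V (free_mu C)" "fsrc (free_mu C) = Fr (Fr C)" "ftgt (free_mu C) = Fr C"
  using strict_monoidal_vfunctor[OF 1(1)] by simp_all
qed

lemma comp_eqD:
 assumes "G oo F = H" "a \<in> ob (fsrc F)"
 shows "fob G (fob F a) = fob H a"
 using assms by auto

lemma comp_eq_appD:
 assumes "G oo F = H" "vfunctor V F" "vfunctor V G" "fsrc G = ftgt F" "fsrc F = C" "a \<in> ob C" "b \<in> ob C" "f \<in> El C Z a b"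
 shows "fhm G (fob F a) (fob F b) \<cdot> fhm F a b \<cdot> f = fhm H a b \<cdot> f"
 using vfun_comp_app[OF assms(2,5,3,4,6-8)] assms(1) by simp

lemma free2:
 assumes s: "vnatural V s" "nsrc s = F" "ntgt s = G" and F: "fsrc F = C" "ftgt F = D" and C: "K C" and D: "K D"
 shows "vnatural V (free2 s)" "nsrc (free2 s) = free1 F" "ntgt (free2 s) = free1 G" "monoidal_nat (FM C) (FM D) (free2 s)"
  "a \<in> ob C ==> ncomp (free2 s) (fob (FE C) a) = fhm (FE D) (fob F a) (fob G a) \<cdot> ncomp s a"
proof -
 have f: "vfunctor V F" "vfunctor V G" "fsrc G = C" "ftgt G = D" using natD(1-4)[OF s(1)] s F by simp_all
 note e = FE_D[OF D] and cd = KD(1)[OF K_Fr[OF D]]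
 note P = free1[OF f(1) F C D] and Q = free1[OF f(2-4) C D]
 let ?t = "vnat_hcomp V (vnat_id (FE D)) s"
 have t: "vnatural V ?t" "nsrc ?t = free1 F oo FE C" "ntgt ?t = free1 G oo FE C"
  using s e F P Q by simp_all
 have c: "ncomp ?t a = fhm (FE D) (fob F a) (fob G a) \<cdot> ncomp s a" if a: "a \<in> ob C" for a
 proof -
  have o: "fob F a \<in> ob D" "fob G a \<in> ob D" using a f F by simp_all
  show ?thesis
   using vnat_hcomp_ncomp[OF s(2) _ s(3), of "vnat_id (FE D)" "FE D" "FE D" a] a F o e cd
    vfun_app[OF e o ncomp_Hom[OF s F a]] by simp
 qed
 have "\<exists>t. vnatural V t \<and> nsrc t = free1 F \<and> ntgt t = free1 G \<and> monoidal_nat (FM C) (FM D) t \<and>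
    (\<forall>a\<in>ob C. ncomp t (fob (FE C) a) = fhm (FE D) (fob F a) (fob G a) \<cdot> ncomp s a)"
  using ext2_ex[OF C FM_sm[OF D] P(1) Q(1) t] c by simp
 from someI_ex[OF this]
 show "vnatural V (free2 s)" "nsrc (free2 s) = free1 F" "ntgt (free2 s) = free1 G" "monoidal_nat (FM C) (FM D) (free2 s)"
  "a \<in> ob C ==> ncomp (free2 s) (fob (FE C) a) = fhm (FE D) (fob F a) (fob G a) \<cdot> ncomp s a"
  unfolding free2_def Let_def s F by blast+
qed

lemma free1_id: assumes C: "K C" shows "free1 (vfun_id V C) = vfun_id V (Fr C)"
proof -
 note c = KD(1)[OF C] and e = FE_D[OF C]
 note f = free1[OF vfunctor_id[OF c] vfun_id_simps(1,2) C C]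
 show ?thesis
  by (rule ext_unique[OF C FM_sm[OF C] f(1) strict_monoidal_id[OF FM_sm[OF C]]]) (use f(2) e in simp)
qed

text \<open>Both sides are strict monoidal, so it suffices to restrict along \<open>FE C\<close>,
  where the defining equations of the extensions apply.\<close>

lemma free1_comp:
 assumes F: "vfunctor V F" "fsrc F = C" "ftgt F = D" and G: "vfunctor V G" "fsrc G = D" "ftgt G = E"
  and C: "K C" and D: "K D" and E: "K E"
 shows "free1 (G oo F) = free1 G oo free1 F"
proof -
 have GF: "vfunctor V (G oo F)" "fsrc (G oo F) = C" "ftgt (G oo F) = E" using F G by simp_all
 note f = free1[OF F C D] and g = free1[OF G D E] and gf = free1[OF GF C E]
 note e = FE_D[OF C] FE_D[OF D] FE_D[OF E]
 show ?thesis
 proof (rule ext_unique[OF C FM_sm[OF E] gf(1) strict_monoidal_comp[OF f(1) g(1) FM_sm[OF C] FM_sm[OF D] FM_sm[OF E]]])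
  have "(free1 G oo free1 F) oo FE C = free1 G oo (FE D oo F)"
   using f g e vfun_comp_assoc[of "FE C" "free1 F" "free1 G"] by simp
  also have "\<dots> = (FE E oo G) oo F"
   using f g e F vfun_comp_assoc[of F "FE D" "free1 G"] by simp
  also have "\<dots> = FE E oo (G oo F)"
   using G e F vfun_comp_assoc[of F G "FE E"] by simp
  finally show "free1 (G oo F) oo FE C = (free1 G oo free1 F) oo FE C"
   using gf(2) by simp
 qed
qed

lemma free2_id:
 assumes F: "vfunctor V F" "fsrc F = C" "ftgt F = D" and C: "K C" and D: "K D"
 shows "free2 (vnat_id F) = vnat_id (free1 F)"
proof -
 note f = free1[OF F C D] and g = free2[OF vnatural_id[OF F(1)] vnat_simps(1,2) F(2,3) C D]
 note e = FE_D[OF C] FE_D[OF D]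
 show ?thesis
 proof (rule nat_unique[OF C g(1) vnatural_id[OF f(3)] _ _ _ g(4) monoidal_nat_id[OF f(1) FM_tensor[OF C] FM_tensor[OF D]]])
  fix a assume a: "a \<in> ob C"
  then have "fob (free1 F) (fob (FE C) a) = fob (FE D) (fob F a)" using comp_eqD[OF f(2)] e F by simp
  then show "ncomp (free2 (vnat_id F)) (fob (FE C) a) = ncomp (vnat_id (free1 F)) (fob (FE C) a)"
   using g(5)[OF a] a F f e by simp
 qed (use f g in simp_all)
qed

text \<open>Both transformations are monoidal, so they are compared on generators, where
  \<open>FE D\<close> preserves the composite of components.\<close>

lemma free2_vcomp:
 assumes s: "vnatural V s" "nsrc s = F" "ntgt s = G" and t: "vnatural V t" "nsrc t = G" "ntgt t = H"
  and F: "fsrc F = C" "ftgt F = D" and C: "K C" and D: "K D"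
 shows "free2 (vnat_vcomp V t s) = vnat_vcomp V (free2 t) (free2 s)"
proof -
 have G: "fsrc G = C" "ftgt G = D" "vfunctor V F" "vfunctor V G" "vfunctor V H" "fsrc H = C" "ftgt H = D"
  using natD(1-4)[OF s(1)] natD(1-4)[OF t(1)] s t F by simp_all
 have ts: "vnatural V (vnat_vcomp V t s)" "nsrc (vnat_vcomp V t s) = F" "ntgt (vnat_vcomp V t s) = H" using s t by simp_all
 note s2 = free2[OF s F C D] and t2 = free2[OF t G(1,2) C D] and ts2 = free2[OF ts F C D]
 note f = free1[OF G(3) F C D] and g = free1[OF G(4,1,2) C D] and h = free1[OF G(5-7) C D]
 note e = FE_D[OF C] FE_D[OF D]
 have v: "vnatural V (vnat_vcomp V (free2 t) (free2 s))" using s2 t2 by simp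
 show ?thesis
 proof (rule nat_unique[OF C ts2(1) v _ _ _ ts2(4)
   monoidal_nat_vcomp[OF FM_tensor[OF D] FM_tensor[OF C] s2(1-4) t2(1-4) f(1) g(1) h(1)]])
  fix a assume a: "a \<in> ob C"
  have o: "fob F a \<in> ob D" "fob G a \<in> ob D" "fob H a \<in> ob D" using a F G by simp_all
  have q: "fob (free1 F) (fob (FE C) a) = fob (FE D) (fob F a)" "fob (free1 G) (fob (FE C) a) = fob (FE D) (fob G a)"
   "fob (free1 H) (fob (FE C) a) = fob (FE D) (fob H a)"
   using comp_eqD[OF f(2)] comp_eqD[OF g(2)] comp_eqD[OF h(2)] a e F G by simp_all
  note sa = ncomp_Hom[OF s F a] and ta = ncomp_Hom[OF t G(1,2) a]
  have "ncomp (vnat_vcomp V t s) a = ucomp V D (fob F a) (fob G a) (fob H a) (ncomp t a) (ncomp s a)"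
   using a s t F by simp
  then have "ncomp (free2 (vnat_vcomp V t s)) (fob (FE C) a) =
   ucomp V (Fr D) (fob (FE D) (fob F a)) (fob (FE D) (fob G a)) (fob (FE D) (fob H a))
    (fhm (FE D) (fob G a) (fob H a) \<cdot> ncomp t a) (fhm (FE D) (fob F a) (fob G a) \<cdot> ncomp s a)"
   using ts2(5)[OF a] vfun_ucomp[OF e(4-6) o ta sa] by simp
  then show "ncomp (free2 (vnat_vcomp V t s)) (fob (FE C) a) = ncomp (vnat_vcomp V (free2 t) (free2 s)) (fob (FE C) a)"
   using a s2 t2 f e q by simp
 qed (use s2 t2 ts2 f in simp_all)
qed

text \<open>On the image of the unit, \<open>free1 G\<close> agrees with \<open>FE E\<close> after
  \<open>G\<close>. This identifies the components at generators, and monoidality extends the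
  equality.\<close>

lemma free2_hcomp:
 assumes s: "vnatural V s" "nsrc s = F" "ntgt s = F'" and t: "vnatural V t" "nsrc t = G" "ntgt t = G'"
  and F: "fsrc F = C" "ftgt F = D" and G: "fsrc G = D" "ftgt G = E" and C: "K C" and D: "K D" and E: "K E"
 shows "free2 (vnat_hcomp V t s) = vnat_hcomp V (free2 t) (free2 s)"
proof -
 have F': "vfunctor V F" "vfunctor V F'" "fsrc F' = C" "ftgt F' = D"
  and G': "vfunctor V G" "vfunctor V G'" "fsrc G' = D" "ftgt G' = E"
  using natD(1-4)[OF s(1)] natD(1-4)[OF t(1)] s t F G by simp_all
 have ts: "vnatural V (vnat_hcomp V t s)" "nsrc (vnat_hcomp V t s) = G oo F" "ntgt (vnat_hcomp V t s) = G' oo F'"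
  "fsrc (G oo F) = C" "ftgt (G oo F) = E"
  using s t F G by simp_all
 note s2 = free2[OF s F C D] and t2 = free2[OF t G D E] and ts2 = free2[OF ts C E]
 note f = free1[OF F'(1) F C D] and f' = free1[OF F'(2-4) C D] and g = free1[OF G'(1) G D E] and g' = free1[OF G'(2-4) D E]
 note e = FE_D[OF C] FE_D[OF D] FE_D[OF E]
 have c1: "free1 (G oo F) = free1 G oo free1 F" by (rule free1_comp[OF F'(1) F G'(1) G C D E])
 have c2: "free1 (G' oo F') = free1 G' oo free1 F'" by (rule free1_comp[OF F'(2-4) G'(2-4) C D E])
 have v: "vnatural V (vnat_hcomp V (free2 t) (free2 s))" using s2 t2 f g by simp
 show ?thesis
 proof (rule nat_unique[OF C ts2(1) v _ _ _ ts2(4)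
   monoidal_nat_hcomp[OF FM_tensor[OF C] FM_tensor[OF D] FM_tensor[OF E] s2(1-4) t2(1-4) f(1) f'(1) g(1) g'(1)]])
  fix a assume a: "a \<in> ob C"
  have o: "fob F a \<in> ob D" "fob F' a \<in> ob D" using a F F' by simp_all
  have p: "fob G (fob F a) \<in> ob E" "fob G (fob F' a) \<in> ob E" "fob G' (fob F' a) \<in> ob E" using o G G' by simp_all
  have q: "fob (free1 F) (fob (FE C) a) = fob (FE D) (fob F a)" "fob (free1 F') (fob (FE C) a) = fob (FE D) (fob F' a)"
   using comp_eqD[OF f(2)] comp_eqD[OF f'(2)] a e F F' by simp_all
  have r: "fob (free1 G) (fob (FE D) x) = fob (FE E) (fob G x)" "fob (free1 G') (fob (FE D) x) = fob (FE E) (fob G' x)" if "x \<in> ob D" for x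
   using comp_eqD[OF g(2)] comp_eqD[OF g'(2)] that e G G' by simp_all
  note sa = ncomp_Hom[OF s F a] and ta = ncomp_Hom[OF t G o(2)]
  note Gs = vfun_app[OF G'(1) G o sa]
  have gD: "fsrc (free1 G) = ftgt (FE D)" "fsrc (FE E) = ftgt G" using g e G by simp_all
  have "fhm (free1 G) (fob (FE D) (fob F a)) (fob (FE D) (fob F' a)) \<cdot> fhm (FE D) (fob F a) (fob F' a) \<cdot> ncomp s a =
    fhm (FE E) (fob G (fob F a)) (fob G (fob F' a)) \<cdot> fhm G (fob F a) (fob F' a) \<cdot> ncomp s a"
   using comp_eq_appD[OF g(2) e(4) g(3) gD(1) e(5) o sa] vfun_comp_app[OF G'(1) G(1) e(7) gD(2) o sa] by simp
  moreover have "ncomp (vnat_hcomp V t s) a = ucomp V E (fob G (fob F a)) (fob G (fob F' a)) (fob G' (fob F' a))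
    (ncomp t (fob F' a)) (fhm G (fob F a) (fob F' a) \<cdot> ncomp s a)"
   using vnat_hcomp_ncomp[OF s(2) t(2) s(3) t(3)] a F G by simp
  moreover have "ncomp (vnat_hcomp V (free2 t) (free2 s)) (fob (FE C) a) =
   ucomp V (Fr E) (fob (FE E) (fob G (fob F a))) (fob (FE E) (fob G (fob F' a))) (fob (FE E) (fob G' (fob F' a)))
    (fhm (FE E) (fob G (fob F' a)) (fob G' (fob F' a)) \<cdot> ncomp t (fob F' a))
    (fhm (free1 G) (fob (FE D) (fob F a)) (fob (FE D) (fob F' a)) \<cdot> fhm (FE D) (fob F a) (fob F' a) \<cdot> ncomp s a)"
   using vnat_hcomp_ncomp[OF s2(2) t2(2) s2(3) t2(3), of "fob (FE C) a"] a f g e q r o s2(5)[OF a] t2(5)[OF o(2)] by simp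
  ultimately show "ncomp (free2 (vnat_hcomp V t s)) (fob (FE C) a) = ncomp (vnat_hcomp V (free2 t) (free2 s)) (fob (FE C) a)"
   using ts2(5)[OF a] vfun_ucomp[OF e(7-9) p ta Gs] a F F' G G' by simp
 qed (use s2 t2 ts2 f c1 c2 in simp_all)
qed

text \<open>Along the unit of \<open>Fr C\<close>, both strict functors restrict to
  \<open>free1 F\<close>.\<close>

lemma free_mu_natural:
 assumes F: "vfunctor V F" "fsrc F = C" "ftgt F = D" and C: "K C" and D: "K D"
 shows "free_mu D oo free1 (free1 F) = free1 F oo free_mu C"
proof -
 note f = free1[OF F C D] and kC = K_Fr[OF C] and kD = K_Fr[OF D]
 note ff = free1[OF f(3-5) kC kD] and mC = free_mu[OF C] and mD = free_mu[OF D]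
 note e = FE_D[OF kC] FE_D[OF kD]
 show ?thesis
 proof (rule ext_unique[OF kC FM_sm[OF D]])
  show "strict_ext (Fr C) (Fr D) (FM D) (free_mu D oo free1 (free1 F))"
   by (rule strict_monoidal_comp[OF ff(1) mD(1) FM_sm[OF kC] FM_sm[OF kD] FM_sm[OF D]])
  show "strict_ext (Fr C) (Fr D) (FM D) (free1 F oo free_mu C)"
   by (rule strict_monoidal_comp[OF mC(1) f(1) FM_sm[OF kC] FM_sm[OF C] FM_sm[OF D]])
  have "(free_mu D oo free1 (free1 F)) oo FE (Fr C) = free_mu D oo (FE (Fr D) oo free1 F)"
   using vfun_comp_assoc[OF e(1) ff(3) mD(3)] ff mD e by simp
  also have "\<dots> = free1 F"
   using vfun_comp_assoc[OF f(3) e(4) mD(3)] mD e f by simp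
  also have "\<dots> = (free1 F oo free_mu C) oo FE (Fr C)"
   using vfun_comp_assoc[OF e(1) mC(3) f(3)] mC e f by simp
  finally show "(free_mu D oo free1 (free1 F)) oo FE (Fr C) = (free1 F oo free_mu C) oo FE (Fr C)" .
 qed
qed

text \<open>Both sides are monoidal transformations out of the twice free category. A generator
  there is an object of \<open>Fr C\<close>, and at it both have the component of
  \<open>free2 s\<close>.\<close>

lemma free_mu_natural2:
 assumes s: "vnatural V s" "nsrc s = F" "ntgt s = G" and F: "fsrc F = C" "ftgt F = D" and C: "K C" and D: "K D"
 shows "vnat_hcomp V (vnat_id (free_mu D)) (free2 (free2 s)) = vnat_hcomp V (free2 s) (vnat_id (free_mu C))"
proof -
 have G: "fsrc G = C" "ftgt G = D" "vfunctor V F" "vfunctor V G" using natD(1-4)[OF s(1)] s F by simp_all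
 note kC = K_Fr[OF C] and kD = K_Fr[OF D]
 note f = free1[OF G(3) F C D] and g = free1[OF G(4,1,2) C D]
 note ff = free1[OF f(3-5) kC kD] and gg = free1[OF g(3-5) kC kD] and mC = free_mu[OF C] and mD = free_mu[OF D]
 note e = FE_D[OF kC] FE_D[OF kD]
 note s2 = free2[OF s F C D] note s22 = free2[OF s2(1-3) f(4,5) kC kD]
 note TC = FM_tensor[OF C] and TD = FM_tensor[OF D] and TkC = FM_tensor[OF kC] and TkD = FM_tensor[OF kD]
 have iC: "vnatural V (vnat_id (free_mu C))" and iD: "vnatural V (vnat_id (free_mu D))" using mC mD by simp_all
 have l: "vnatural V (vnat_hcomp V (vnat_id (free_mu D)) (free2 (free2 s)))" using s22 mD ff by simp
 have r: "vnatural V (vnat_hcomp V (free2 s) (vnat_id (free_mu C)))" using s2 mC f by simp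
 show ?thesis
 proof (rule nat_unique[OF kC l r])
  show "monoidal_nat (FM (Fr C)) (FM D) (vnat_hcomp V (vnat_id (free_mu D)) (free2 (free2 s)))"
   by (rule monoidal_nat_hcomp[OF TkC TkD TD s22(1-4) iD vnat_simps(1,2) monoidal_nat_id[OF mD(1) TkD TD] ff(1) gg(1) mD(1) mD(1)])
  show "monoidal_nat (FM (Fr C)) (FM D) (vnat_hcomp V (free2 s) (vnat_id (free_mu C)))"
   by (rule monoidal_nat_hcomp[OF TkC TC TD iC vnat_simps(1,2) monoidal_nat_id[OF mC(1) TkC TC] s2(1-4) mC(1) mC(1) f(1) g(1)])
  fix a assume a: "a \<in> ob (Fr C)"
  have o: "fob (free1 F) a \<in> ob (Fr D)" "fob (free1 G) a \<in> ob (Fr D)" using a f g by simp_all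
  note cd = KD(1)[OF K_Fr[OF D]] and cc = KD(1)[OF K_Fr[OF C]]
  note sa = ncomp_Hom[OF s2(1-3) f(4,5) a]
  have mu: "fob (free_mu C) (fob (FE (Fr C)) a) = a" using comp_eqD[OF mC(2)] a e by simp
  have mu': "fob (free_mu D) (fob (FE (Fr D)) x) = x" if "x \<in> ob (Fr D)" for x using comp_eqD[OF mD(2)] that e by simp
  have q: "fob (free1 (free1 F)) (fob (FE (Fr C)) a) = fob (FE (Fr D)) (fob (free1 F) a)"
   "fob (free1 (free1 G)) (fob (FE (Fr C)) a) = fob (FE (Fr D)) (fob (free1 G) a)"
   using comp_eqD[OF ff(2)] comp_eqD[OF gg(2)] a e f g by simp_all
  have m: "fsrc (free_mu D) = ftgt (FE (Fr D))" using mD e by simp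
  have "ncomp (vnat_hcomp V (vnat_id (free_mu D)) (free2 (free2 s))) (fob (FE (Fr C)) a) = ncomp (free2 s) a"
   using vnat_hcomp_ncomp[OF s22(2) _ s22(3), of "vnat_id (free_mu D)" "free_mu D" "free_mu D" "fob (FE (Fr C)) a"]
    a ff e q mD o mu' s22(5)[OF a] comp_eq_appD[OF mD(2) e(4) mD(3) m e(5) o sa] Ide_app[OF sa] sa cd by simp
  moreover have "ncomp (vnat_hcomp V (free2 s) (vnat_id (free_mu C))) (fob (FE (Fr C)) a) = ncomp (free2 s) a"
   using vnat_hcomp_ncomp[OF _ s2(2) _ s2(3), of "vnat_id (free_mu C)" "free_mu C" "free_mu C" "fob (FE (Fr C)) a"]
    a e mC mu f o sa cd by simp
  ultimately show "ncomp (vnat_hcomp V (vnat_id (free_mu D)) (free2 (free2 s))) (fob (FE (Fr C)) a) =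
     ncomp (vnat_hcomp V (free2 s) (vnat_id (free_mu C))) (fob (FE (Fr C)) a)" by simp
 qed (use s2 s22 mC ff f free_mu_natural[OF G(3) F C D] free_mu_natural[OF G(4,1,2) C D] in simp_all)
qed

text \<open>This is the defining property of \<open>free2 s\<close> on generators, written as an
  equality of transformations.\<close>

lemma FE_natural2:
 assumes s: "vnatural V s" "nsrc s = F" "ntgt s = G" and F: "fsrc F = C" "ftgt F = D" and C: "K C" and D: "K D"
 shows "vnat_hcomp V (vnat_id (FE D)) s = vnat_hcomp V (free2 s) (vnat_id (FE C))"
proof -
 have G: "fsrc G = C" "ftgt G = D" "vfunctor V F" "vfunctor V G" using natD(1-4)[OF s(1)] s F by simp_all
 note f = free1[OF G(3) F C D] and g = free1[OF G(4,1,2) C D] and e = FE_D[OF C] FE_D[OF D]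
 note s2 = free2[OF s F C D] and cd = KD(1)[OF K_Fr[OF D]]
 show ?thesis
 proof (rule vnatural_eqI)
  fix a assume "a \<in> ob (fsrc (nsrc (vnat_hcomp V (free2 s) (vnat_id (FE C)))))"
  then have a: "a \<in> ob C" using e by simp
  have o: "fob F a \<in> ob D" "fob G a \<in> ob D" using a G F by simp_all
  have ea: "fob (FE C) a \<in> ob (Fr C)" using a e by simp
  note sa = vfun_app[OF e(4-6) o ncomp_Hom[OF s F a]]
  have q: "fob (free1 F) (fob (FE C) a) = fob (FE D) (fob F a)" "fob (free1 G) (fob (FE C) a) = fob (FE D) (fob G a)"
   using comp_eqD[OF f(2)] comp_eqD[OF g(2)] a e F G by simp_all
  show "ncomp (vnat_hcomp V (vnat_id (FE D)) s) a = ncomp (vnat_hcomp V (free2 s) (vnat_id (FE C))) a"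
   using vnat_hcomp_ncomp[OF s(2) _ s(3), of "vnat_id (FE D)" "FE D" "FE D" a]
    vnat_hcomp_ncomp[OF _ s2(2) _ s2(3), of "vnat_id (FE C)" "FE C" "FE C" a] a e F o sa cd ea f s2(5)[OF a] q by simp
 qed (use s s2 e F f g in simp_all)
qed

text \<open>Along the unit both strict functors restrict to \<open>free_mu C\<close>, by naturality
  of the unit and the unit law.\<close>

lemma free_mu_assoc:
 assumes C: "K C"
 shows "free_mu C oo free1 (free_mu C) = free_mu C oo free_mu (Fr C)"
proof -
 note kC = K_Fr[OF C] note kkC = K_Fr[OF kC]
 note m = free_mu[OF C] and mm = free_mu[OF kC] note fm = free1[OF m(3-5) kkC kC]
 note e = FE_D[OF kC] FE_D[OF kkC]
 show ?thesis
 proof (rule ext_unique[OF kkC FM_sm[OF C]])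
  show "strict_ext (Fr (Fr C)) (Fr C) (FM C) (free_mu C oo free1 (free_mu C))"
   by (rule strict_monoidal_comp[OF fm(1) m(1) FM_sm[OF kkC] FM_sm[OF kC] FM_sm[OF C]])
  show "strict_ext (Fr (Fr C)) (Fr C) (FM C) (free_mu C oo free_mu (Fr C))"
   by (rule strict_monoidal_comp[OF mm(1) m(1) FM_sm[OF kkC] FM_sm[OF kC] FM_sm[OF C]])
  have "(free_mu C oo free1 (free_mu C)) oo FE (Fr (Fr C)) = free_mu C oo (FE (Fr C) oo free_mu C)"
   using vfun_comp_assoc[OF e(4) fm(3) m(3)] fm m e by simp
  also have "\<dots> = free_mu C" using vfun_comp_assoc[OF m(3) e(1) m(3)] m e by simp
  also have "\<dots> = (free_mu C oo free_mu (Fr C)) oo FE (Fr (Fr C))"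
   using vfun_comp_assoc[OF e(4) mm(3) m(3)] m mm e by simp
  finally show "(free_mu C oo free1 (free_mu C)) oo FE (Fr (Fr C)) =
   (free_mu C oo free_mu (Fr C)) oo FE (Fr (Fr C))" .
 qed
qed

text \<open>Uniqueness of extensions once more: both sides restrict to \<open>FE C\<close>. The
  other unit law is the defining equation of \<open>free_mu\<close>.\<close>

lemma free_mu_FE:
 assumes C: "K C"
 shows "free_mu C oo free1 (FE C) = vfun_id V (Fr C)"
proof -
 note kC = K_Fr[OF C] note m = free_mu[OF C] and e = FE_D[OF C] FE_D[OF kC] note fe = free1[OF e(1-3) C kC]
 show ?thesis
 proof (rule ext_unique[OF C FM_sm[OF C]])
  show "strict_ext C (Fr C) (FM C) (free_mu C oo free1 (FE C))"
   by (rule strict_monoidal_comp[OF fe(1) m(1) FM_sm[OF C] FM_sm[OF kC] FM_sm[OF C]])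
  show "strict_ext C (Fr C) (FM C) (vfun_id V (Fr C))" by (rule strict_monoidal_id[OF FM_sm[OF C]])
  show "(free_mu C oo free1 (FE C)) oo FE C = vfun_id V (Fr C) oo FE C"
   using vfun_comp_assoc[OF e(1) fe(3) m(3)] vfun_comp_assoc[OF e(1) e(4) m(3)] fe m e by simp
 qed
qed

lemma free_monad_simps [simp]:
 "T0 free_monad = Fr" "T1 free_monad = free1" "T2 free_monad = free2" "mu free_monad = free_mu" "eta free_monad = FE"
 by (simp_all add: free_monad_def)

lemma vfun_K: "vfunctor V f ==> fsrc f = X ==> ob X \<in> Small U ==> K X"
 "vfunctor V f ==> ftgt f = X ==> ob X \<in> Small U ==> K X"
 using vfunD(1,2)[of f] by auto

lemma two_monad_free: "two_monad (VCat U V) free_monad"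
proof (intro two_monad.intro two_monad_axioms.intro two_category_VCat, unfold VCat_simps(4-) VCat_one_cells VCat_two_cells free_monad_simps)
 fix X assume X: "K X"
 show "K (Fr X)" by (rule K_Fr[OF X])
 show "free1 (vfun_id V X) = vfun_id V (Fr X)" by (rule free1_id[OF X])
 show "vfunctor V (free_mu X) \<and> fsrc (free_mu X) = Fr (Fr X) \<and> ftgt (free_mu X) = Fr X \<and> ob (Fr (Fr X)) \<in> Small U \<and> ob (Fr X) \<in> Small U"
  using free_mu[OF X] Fr_small X Fr_small[OF K_Fr[OF X]] by simp
 show "vfunctor V (FE X) \<and> fsrc (FE X) = X \<and> ftgt (FE X) = Fr X \<and> ob X \<in> Small U \<and> ob (Fr X) \<in> Small U"
  using FE_D[OF X] Fr_small X by simp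
 show "free_mu X oo free1 (free_mu X) = free_mu X oo free_mu (Fr X)" by (rule free_mu_assoc[OF X])
 show "free_mu X oo FE (Fr X) = vfun_id V (Fr X)" by (rule free_mu(2)[OF X])
 show "free_mu X oo free1 (FE X) = vfun_id V (Fr X)" by (rule free_mu_FE[OF X])
next
 fix f X Y assume f: "vfunctor V f \<and> fsrc f = X \<and> ftgt f = Y \<and> ob X \<in> Small U \<and> ob Y \<in> Small U"
 then have k: "K X" "K Y" and f': "vfunctor V f" "fsrc f = X" "ftgt f = Y" using vfun_K[of f] by auto
 show "vfunctor V (free1 f) \<and> fsrc (free1 f) = Fr X \<and> ftgt (free1 f) = Fr Y \<and> ob (Fr X) \<in> Small U \<and> ob (Fr Y) \<in> Small U"
  using free1[OF f' k] Fr_small[OF k(1)] Fr_small[OF k(2)] by simp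
 show "free_mu Y oo free1 (free1 f) = free1 f oo free_mu X" by (rule free_mu_natural[OF f' k])
 show "FE Y oo f = free1 f oo FE X" by (rule free1(2)[OF f' k, symmetric])
 fix g s assume "vnatural V s \<and> nsrc s = f \<and> ntgt s = g \<and> ob (fsrc f) \<in> Small U \<and> ob (ftgt f) \<in> Small U"
 then have s: "vnatural V s" "nsrc s = f" "ntgt s = g" by auto
 show "vnat_hcomp V (vnat_id (free_mu Y)) (free2 (free2 s)) = vnat_hcomp V (free2 s) (vnat_id (free_mu X))"
  by (rule free_mu_natural2[OF s f'(2,3) k])
 show "vnat_hcomp V (vnat_id (FE Y)) s = vnat_hcomp V (free2 s) (vnat_id (FE X))"
  by (rule FE_natural2[OF s f'(2,3) k])
next
 fix f X Y g Z assume "vfunctor V f \<and> fsrc f = X \<and> ftgt f = Y \<and> ob X \<in> Small U \<and> ob Y \<in> Small U"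
  "vfunctor V g \<and> fsrc g = Y \<and> ftgt g = Z \<and> ob Y \<in> Small U \<and> ob Z \<in> Small U"
 then have k: "K X" "K Y" "K Z" and f: "vfunctor V f" "fsrc f = X" "ftgt f = Y" "vfunctor V g" "fsrc g = Y" "ftgt g = Z"
  using vfun_K[of f] vfun_K[of g] by auto
 show "free1 (g oo f) = free1 g oo free1 f" by (rule free1_comp[OF f k])
next
 fix f assume "f \<in> cell1 (VCat U V)"
 then have f: "vfunctor V f" and k: "K (fsrc f)" "K (ftgt f)" using vfun_K[of f] by auto
 show "free2 (vnat_id f) = vnat_id (free1 f)" by (rule free2_id[OF f refl refl k])
next
 fix s f g assume a: "vnatural V s \<and> nsrc s = f \<and> ntgt s = g \<and> ob (fsrc f) \<in> Small U \<and> ob (ftgt f) \<in> Small U"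
 then have s: "vnatural V s" "nsrc s = f" "ntgt s = g" by auto
 have f: "vfunctor V f" using natD(1)[OF s(1)] s by simp
 have k: "K (fsrc f)" "K (ftgt f)" using a vfun_K[OF f] by auto
 show "vnatural V (free2 s) \<and> nsrc (free2 s) = free1 f \<and> ntgt (free2 s) = free1 g \<and> ob (fsrc (free1 f)) \<in> Small U \<and> ob (ftgt (free1 f)) \<in> Small U"
  using free2[OF s refl refl k] free1[OF f refl refl k] Fr_small[OF k(1)] Fr_small[OF k(2)] by simp
 fix t h assume "vnatural V t \<and> nsrc t = g \<and> ntgt t = h \<and> ob (fsrc g) \<in> Small U \<and> ob (ftgt g) \<in> Small U"
 then have t: "vnatural V t" "nsrc t = g" "ntgt t = h" by auto
 show "free2 (vnat_vcomp V t s) = vnat_vcomp V (free2 t) (free2 s)" by (rule free2_vcomp[OF s t refl refl k])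
next
 fix s f f' t g g' assume a: "vnatural V s \<and> nsrc s = f \<and> ntgt s = f' \<and> ob (fsrc f) \<in> Small U \<and> ob (ftgt f) \<in> Small U"
  "vnatural V t \<and> nsrc t = g \<and> ntgt t = g' \<and> ob (fsrc g) \<in> Small U \<and> ob (ftgt g) \<in> Small U" "ftgt f = fsrc g"
 then have s: "vnatural V s" "nsrc s = f" "ntgt s = f'" and t: "vnatural V t" "nsrc t = g" "ntgt t = g'" by auto
 have f: "vfunctor V f" and g: "vfunctor V g" using natD(1)[OF s(1)] s natD(1)[OF t(1)] t by simp_all
 have k: "K (fsrc f)" "K (fsrc g)" "K (ftgt g)" using a vfun_K[OF f] vfun_K[OF g] by auto
 show "free2 (vnat_hcomp V t s) = vnat_hcomp V (free2 t) (free2 s)" by (rule free2_hcomp[OF s t refl a(3) refl refl k])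
qed

end

section \<open>Algebras as symmetric monoidal categories\<close>

context free_symm
begin

text \<open>Objects and morphisms of \<open>C\<close> are regarded as formal ones by the unit,
  combined in the free category, and evaluated by \<open>h\<close>.\<close>

definition algebra_symmon :: "('u, 'v, 'a) vcat => ('u, 'u, 'v, 'a) vfun => ('u, 'v, 'a) symmon" where
 "algebra_symmon C h = (let e = fob (FE C); T = tob (FM C) in
   mk_symmon C (h oo (tens (FM C) oo vfun_prod V (FE C) (FE C)))
    (\<lambda>a b c. fhm h (T (T (e a) (e b)) (e c)) (T (e a) (T (e b) (e c))) \<cdot> ncomp (asc (FM C)) ((e a, e b), e c))
    (\<lambda>a b. fhm h (T (e a) (e b)) (T (e b) (e a)) \<cdot> ncomp (symm (FM C)) (e a, e b)))"

lemma algebraD: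
 assumes "monad_algebra (VCat U V) free_monad C h"
 shows "K C" "vfunctor V h" "fsrc h = Fr C" "ftgt h = C" "h oo free1 h = h oo free_mu C"
  "h oo FE C = vfun_id V C"
 using assms by (simp_all add: monad_algebra_def)

lemma algebraI:
 assumes "K C" "vfunctor V h" "fsrc h = Fr C" "ftgt h = C" "h oo free1 h = h oo free_mu C"
  "h oo FE C = vfun_id V C"
 shows "monad_algebra (VCat U V) free_monad C h"
 using assms Fr_small by (simp add: monad_algebra_def)

lemma algebra_tensor:
 assumes h: "vfunctor V h" "fsrc h = Fr C" "ftgt h = C" and C: "K C"
 shows "is_tensor C (algebra_symmon C h)"
  "\<And>a b. [|a \<in> ob C; b \<in> ob C|] ==> tob (algebra_symmon C h) a b = fob h (tob (FM C) (fob (FE C) a) (fob (FE C) b))"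
  "\<And>a a' b b' f g Z. [|a \<in> ob C; a' \<in> ob C; b \<in> ob C; b' \<in> ob C; f \<in> El C Z a a'; g \<in> El C Z b b'|] ==>
   tarr V (algebra_symmon C h) a a' b b' f g =
    fhm h (tob (FM C) (fob (FE C) a) (fob (FE C) b)) (tob (FM C) (fob (FE C) a') (fob (FE C) b')) \<cdot>
     tarr V (FM C) (fob (FE C) a) (fob (FE C) a') (fob (FE C) b) (fob (FE C) b') (fhm (FE C) a a' \<cdot> f) (fhm (FE C) b b' \<cdot> g)"
proof -
 note e = FE_D[OF C] and t = is_tensorD[OF FM_tensor[OF C]]
 let ?N = "algebra_symmon C h" let ?p = "vfun_prod V (FE C) (FE C)"
 have T: "tens ?N = h oo (tens (FM C) oo ?p)"
  by (simp add: algebra_symmon_def Let_def)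
 have p: "vfunctor V ?p" "fsrc ?p = vcat_prod V C C" "fsrc (tens (FM C)) = ftgt ?p" using e t by simp_all
 have q: "vfunctor V (tens (FM C) oo ?p)" "fsrc (tens (FM C) oo ?p) = vcat_prod V C C"
  "fsrc h = ftgt (tens (FM C) oo ?p)" using p t h by simp_all
 show "is_tensor C ?N" unfolding is_tensor_def T using KD(1)[OF C] p q h t by simp
 fix a b assume o: "a \<in> ob C" "b \<in> ob C"
 have ab: "(a, b) \<in> ob (vcat_prod V C C)" using o by simp
 show tb: "tob ?N a b = fob h (tob (FM C) (fob (FE C) a) (fob (FE C) b))"
  unfolding tob_def T using o ab p(2) q(2) e by simp
 fix a' b' f g Z assume o': "a' \<in> ob C" "b' \<in> ob C" and fg: "f \<in> El C Z a a'" "g \<in> El C Z b b'"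
 have ab': "(a', b') \<in> ob (vcat_prod V C C)" using o' by simp
 have fg': "Tuple V f g \<in> El (vcat_prod V C C) Z (a, b) (a', b')" using o o' fg by simp
 have pa: "fhm ?p (a, b) (a', b') \<cdot> Tuple V f g = Tuple V (fhm (FE C) a a' \<cdot> f) (fhm (FE C) b b' \<cdot> g)"
  using vfun_prod_app[OF e(1,1), of a b a' b' f Z g] o o' fg e(2) by simp
 show "tarr V ?N a a' b b' f g =
    fhm h (tob (FM C) (fob (FE C) a) (fob (FE C) b)) (tob (FM C) (fob (FE C) a') (fob (FE C) b')) \<cdot>
     tarr V (FM C) (fob (FE C) a) (fob (FE C) a') (fob (FE C) b) (fob (FE C) b') (fhm (FE C) a a' \<cdot> f) (fhm (FE C) b b' \<cdot> g)"
  unfolding tarr_def T vfun_comp_app[OF q(1,2) h(1) q(3) ab ab' fg'] vfun_comp_app[OF p(1,2) t(2) p(3) ab ab' fg'] pa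
  using o o' p(2) e(2) by (simp add: tob_def)
qed

text \<open>
 The associativity law of the algebra, evaluated at formal tensor products of formal objects,
 says that \<open>h\<close> does not change when its arguments are first evaluated.
\<close>

lemma algebra_symmetric_monoidal:
 assumes A: "monad_algebra (VCat U V) free_monad C h"
 shows "symmetric_monoidal V C (algebra_symmon C h)" "strict_ext C C (algebra_symmon C h) h"
proof -
 note C = algebraD(1)[OF A] and h = algebraD(2-4)[OF A] and assoc = algebraD(5)[OF A] and unit = algebraD(6)[OF A]
 note e = FE_D[OF C] and kE = K_Fr[OF C] note e' = FE_D[OF kE]
 note M = FM_sm[OF C] and M' = FM_sm[OF kE] and TM = FM_tensor[OF C] and TM' = FM_tensor[OF kE]
 note f = free1[OF h kE C] and m = free_mu[OF C]
 note N = algebra_tensor[OF h C]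
 let ?N = "algebra_symmon C h" let ?T = "tob (FM C)" let ?e = "fob (FE C)" let ?T' = "tob (FM (Fr C))" let ?e' = "fob (FE (Fr C))"
 note tt = tob_ob[OF TM] and tt' = tob_ob[OF TM']
 have he: "fob h (?e a) = a" if "a \<in> ob C" for a using comp_eqD[OF unit] that e by simp
 have ho: "fob h x \<in> ob C" if "x \<in> ob (Fr C)" for x using that h by simp
 have eo: "?e a \<in> ob (Fr C)" if "a \<in> ob C" for a using that e by simp
 have eo': "?e' x \<in> ob (Fr (Fr C))" if "x \<in> ob (Fr C)" for x using that e' by simp
 \<comment> \<open>On the image of the unit, \<open>free1 h\<close> evaluates formal objects one by
   one, whereas \<open>free_mu C\<close> only removes the outer level of formality.\<close>
 have fe: "fob (free1 h) (?e' x) = ?e (fob h x)" and me: "fob (free_mu C) (?e' x) = x" if "x \<in> ob (Fr C)" for x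
  using comp_eqD[OF f(2)] comp_eqD[OF m(2)] that e' h by simp_all
 have src: "fsrc (free1 h) = ftgt (FE (Fr C))" "fsrc (free_mu C) = ftgt (FE (Fr C))" "fsrc h = ftgt (free1 h)" "fsrc h = ftgt (free_mu C)"
   "fsrc (FE C) = ftgt h"
  using f m e e' h by simp_all
 have feh: "fhm (free1 h) (?e' x) (?e' y) \<cdot> fhm (FE (Fr C)) x y \<cdot> k = fhm (FE C) (fob h x) (fob h y) \<cdot> fhm h x y \<cdot> k"
  and meh: "fhm (free_mu C) (?e' x) (?e' y) \<cdot> fhm (FE (Fr C)) x y \<cdot> k = k"
  if o: "x \<in> ob (Fr C)" "y \<in> ob (Fr C)" and k: "k \<in> El (Fr C) Z x y" for x y k Z
  using comp_eq_appD[OF f(2) e'(1) f(3) src(1) e'(2) o k] comp_eq_appD[OF m(2) e'(1) m(3) src(2) e'(2) o k]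
   vfun_comp_app[OF h(1,2) e(1) src(5) o k] Ide_app[OF k] o by simp_all
 have obs: "fob h (fob (free1 h) X) = fob h (fob (free_mu C) X)" if "X \<in> ob (Fr (Fr C))" for X
 proof -
  have "fob (h oo free1 h) X = fob (h oo free_mu C) X" using assoc by simp
  then show ?thesis using that f m by simp
 qed
 have hms: "fhm h (fob (free1 h) X) (fob (free1 h) Y) \<cdot> fhm (free1 h) X Y \<cdot> w = fhm h (fob (free_mu C) X) (fob (free_mu C) Y) \<cdot> fhm (free_mu C) X Y \<cdot> w"
  if o: "X \<in> ob (Fr (Fr C))" "Y \<in> ob (Fr (Fr C))" and w: "w \<in> El (Fr (Fr C)) Z X Y" for X Y w Z
 proof -
  have "fhm (h oo free1 h) X Y \<cdot> w = fhm (h oo free_mu C) X Y \<cdot> w" using assoc by simp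
  then show ?thesis unfolding vfun_comp_app[OF f(3,4) h(1) src(3) o w] vfun_comp_app[OF m(3,4) h(1) src(4) o w] .
 qed
 note fT = strict_monoidal_tob[OF f(1) TM'] and mT = strict_monoidal_tob[OF m(1) TM']
 have obT: "fob h (?T x y) = fob h (?T (?e (fob h x)) (?e (fob h y)))" if o: "x \<in> ob (Fr C)" "y \<in> ob (Fr C)" for x y
  using obs[OF tt'[OF eo'[OF o(1)] eo'[OF o(2)]]] fT[OF eo'[OF o(1)] eo'[OF o(2)]] mT[OF eo'[OF o(1)] eo'[OF o(2)]] fe o me by simp
 have obN: "fob h (?T x y) = tob ?N (fob h x) (fob h y)" if o: "x \<in> ob (Fr C)" "y \<in> ob (Fr C)" for x y
  using obT[OF o] N(2)[OF ho[OF o(1)] ho[OF o(2)]] by simp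
 have hmN: "fhm h (?T a b) (?T a' b') \<cdot> tarr V (FM C) a a' b b' k l =
    tarr V ?N (fob h a) (fob h a') (fob h b) (fob h b') (fhm h a a' \<cdot> k) (fhm h b b' \<cdot> l)"
  if o: "a \<in> ob (Fr C)" "a' \<in> ob (Fr C)" "b \<in> ob (Fr C)" "b' \<in> ob (Fr C)"
   and k: "k \<in> El (Fr C) Z a a'" "l \<in> El (Fr C) Z b b'" for a a' b b' k l Z
 proof -
  note o' = eo'[OF o(1)] eo'[OF o(2)] eo'[OF o(3)] eo'[OF o(4)]
  note k' = vfun_app[OF e' o(1,2) k(1)] vfun_app[OF e' o(3,4) k(2)]
  have s: "fhm h (fob (free1 h) (?T' (?e' a) (?e' b))) (fob (free1 h) (?T' (?e' a') (?e' b'))) \<cdot>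
    fhm (free1 h) (?T' (?e' a) (?e' b)) (?T' (?e' a') (?e' b')) \<cdot> tarr V (FM (Fr C)) (?e' a) (?e' a') (?e' b) (?e' b') (fhm (FE (Fr C)) a a' \<cdot> k) (fhm (FE (Fr C)) b b' \<cdot> l)
   = fhm h (fob (free_mu C) (?T' (?e' a) (?e' b))) (fob (free_mu C) (?T' (?e' a') (?e' b'))) \<cdot>
    fhm (free_mu C) (?T' (?e' a) (?e' b)) (?T' (?e' a') (?e' b')) \<cdot> tarr V (FM (Fr C)) (?e' a) (?e' a') (?e' b) (?e' b') (fhm (FE (Fr C)) a a' \<cdot> k) (fhm (FE (Fr C)) b b' \<cdot> l)"
   by (rule hms[OF tt'[OF o'(1,3)] tt'[OF o'(2,4)] tarr_Hom[OF TM' o' k']])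
  then have "fhm h (?T (?e (fob h a)) (?e (fob h b))) (?T (?e (fob h a')) (?e (fob h b'))) \<cdot> tarr V (FM C) (?e (fob h a)) (?e (fob h a')) (?e (fob h b)) (?e (fob h b'))
    (fhm (FE C) (fob h a) (fob h a') \<cdot> fhm h a a' \<cdot> k) (fhm (FE C) (fob h b) (fob h b') \<cdot> fhm h b b' \<cdot> l)
   = fhm h (?T a b) (?T a' b') \<cdot> tarr V (FM C) a a' b b' k l"
   unfolding strict_monoidal_tarr[OF f(1) TM' TM o' k'] strict_monoidal_tarr[OF m(1) TM' TM o' k']
    fT[OF o'(1,3)] fT[OF o'(2,4)] mT[OF o'(1,3)] mT[OF o'(2,4)] feh[OF o(1,2) k(1)] feh[OF o(3,4) k(2)] meh[OF o(1,2) k(1)] meh[OF o(3,4) k(2)]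
    fe[OF o(1)] fe[OF o(2)] fe[OF o(3)] fe[OF o(4)] me[OF o(1)] me[OF o(2)] me[OF o(3)] me[OF o(4)] .
  then show ?thesis
   using N(3)[OF ho[OF o(1)] ho[OF o(2)] ho[OF o(3)] ho[OF o(4)] vfun_app[OF h o(1,2) k(1)] vfun_app[OF h o(3,4) k(2)]] by simp
 qed
 define al where "al a b c = fhm h (?T (?T (?e a) (?e b)) (?e c)) (?T (?e a) (?T (?e b) (?e c))) \<cdot> ncomp (asc (FM C)) ((?e a, ?e b), ?e c)" for a b c
 define sg where "sg a b = fhm h (?T (?e a) (?e b)) (?T (?e b) (?e a)) \<cdot> ncomp (symm (FM C)) (?e a, ?e b)" for a b
 define Tn where "Tn = h oo (tens (FM C) oo vfun_prod V (FE C) (FE C))"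
 have Nd: "?N = mk_symmon C Tn al sg" unfolding algebra_symmon_def Let_def al_def sg_def Tn_def ..
 have alN: "al (fob h a) (fob h b) (fob h c) = fhm h (?T (?T a b) c) (?T a (?T b c)) \<cdot> ncomp (asc (FM C)) ((a, b), c)"
  if o: "a \<in> ob (Fr C)" "b \<in> ob (Fr C)" "c \<in> ob (Fr C)" for a b c
 proof -
  note o' = eo'[OF o(1)] eo'[OF o(2)] eo'[OF o(3)] note ab = tt'[OF o'(1,2)] and bc = tt'[OF o'(2,3)]
  note eh = eo[OF ho[OF o(1)]] eo[OF ho[OF o(2)]] eo[OF ho[OF o(3)]]
  note s = hms[OF tt'[OF ab o'(3)] tt'[OF o'(1) bc] alpha_Hom[OF M' o' Term_Obj]]
  show ?thesis using s
   unfolding strict_monoidal_alpha[OF f(1) M' M o' Term_Obj] strict_monoidal_alpha[OF m(1) M' M o' Term_Obj]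
    fT[OF ab o'(3)] fT[OF o'(1) bc] fT[OF o'(1,2)] fT[OF o'(2,3)] mT[OF ab o'(3)] mT[OF o'(1) bc] mT[OF o'(1,2)] mT[OF o'(2,3)]
    fe[OF o(1)] fe[OF o(2)] fe[OF o(3)] me[OF o(1)] me[OF o(2)] me[OF o(3)] alpha_Term[OF M o] alpha_Term[OF M eh] al_def .
 qed
 have sgN: "sg (fob h a) (fob h b) = fhm h (?T a b) (?T b a) \<cdot> ncomp (symm (FM C)) (a, b)"
  if o: "a \<in> ob (Fr C)" "b \<in> ob (Fr C)" for a b
 proof -
  note o' = eo'[OF o(1)] eo'[OF o(2)]
  note eh = eo[OF ho[OF o(1)]] eo[OF ho[OF o(2)]]
  note s = hms[OF tt'[OF o'] tt'[OF o'(2,1)] sigma_Hom[OF M' o' Term_Obj]]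
  show ?thesis using s
   unfolding strict_monoidal_sigma[OF f(1) M' M o' Term_Obj] strict_monoidal_sigma[OF m(1) M' M o' Term_Obj]
    fT[OF o'] fT[OF o'(2,1)] mT[OF o'] mT[OF o'(2,1)]
    fe[OF o(1)] fe[OF o(2)] me[OF o(1)] me[OF o(2)] sigma_Term[OF M o] sigma_Term[OF M eh] sg_def .
 qed
 \<comment> \<open>The unit law of the algebra makes \<open>FE C\<close> a section of
   \<open>h\<close>, so the axioms descend from \<open>FM C\<close>.\<close>
 show "symmetric_monoidal V C ?N"
  unfolding Nd
  by (rule symmetric_monoidal_image[OF M N(1)[unfolded Nd] h e unit obN[unfolded Nd] hmN[unfolded Nd] alN sgN])
 show "strict_ext C C ?N h"
 proof (rule strict_monoidalI[OF h FA_dense[OF C] TM N(1) obN])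
  fix a a' b b' k l Z assume o: "a \<in> ob (Fr C)" "a' \<in> ob (Fr C)" "b \<in> ob (Fr C)" "b' \<in> ob (Fr C)"
   and "k \<in> FA C a a'" "l \<in> FA C b b'" "Dom V k = Z" "Dom V l = Z"
  then have "k \<in> El (Fr C) Z a a'" "l \<in> El (Fr C) Z b b'" using dfam_Hom[OF FA_dense[OF C]] by simp_all
  then show "fhm h (?T a b) (?T a' b') \<cdot> tarr V (FM C) a a' b b' k l =
    tarr V ?N (fob h a) (fob h a') (fob h b) (fob h b') (fhm h a a' \<cdot> k) (fhm h b b' \<cdot> l)"
   by (rule hmN[OF o])
 next
  fix a b c assume o: "a \<in> ob (Fr C)" "b \<in> ob (Fr C)" "c \<in> ob (Fr C)"
  show "fhm h (?T (?T a b) c) (?T a (?T b c)) \<cdot> ncomp (asc (FM C)) ((a, b), c) = ncomp (asc ?N) ((fob h a, fob h b), fob h c)"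
   using alN[OF o] ho o by (simp add: Nd)
 next
  fix a b assume o: "a \<in> ob (Fr C)" "b \<in> ob (Fr C)"
  show "fhm h (?T a b) (?T b a) \<cdot> ncomp (symm (FM C)) (a, b) = ncomp (symm ?N) (fob h a, fob h b)"
   using sgN[OF o] ho o by (simp add: Nd)
 qed
qed

text \<open>\<open>h\<close> is the strict extension of the identity of \<open>C\<close>. Its
  associativity law follows from uniqueness of extensions, and its strictness shows that
  transporting structure along it returns \<open>N\<close>.\<close>

lemma symmetric_monoidal_algebra:
 assumes C: "K C" and N: "symmetric_monoidal V C N"
 shows "\<exists>h. monad_algebra (VCat U V) free_monad C h \<and> algebra_symmon C h = N"
proof -
 note c = KD(1)[OF C] and e = FE_D[OF C] and kE = K_Fr[OF C] note e' = FE_D[OF kE]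
 obtain h where h: "strict_ext C C N h" "h oo FE C = vfun_id V C"
  using ext_ex[OF C N vfunctor_id[OF c]] c by auto
 note h' = strict_monoidal_vfunctor[OF h(1)]
 note f = free1[OF h' kE C] and m = free_mu[OF C] and M = FM_sm[OF C] and TM = FM_tensor[OF C]
 have A: "monad_algebra (VCat U V) free_monad C h"
 proof (rule algebraI[OF C h' _ h(2)])
  show "h oo free1 h = h oo free_mu C"
  proof (rule ext_unique[OF kE N])
   show "strict_ext (Fr C) C N (h oo free1 h)" by (rule strict_monoidal_comp[OF f(1) h(1) FM_sm[OF kE] M N])
   show "strict_ext (Fr C) C N (h oo free_mu C)" by (rule strict_monoidal_comp[OF m(1) h(1) FM_sm[OF kE] M N])
   have "(h oo free1 h) oo FE (Fr C) = h oo (FE C oo h)"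
    using vfun_comp_assoc[OF e'(1) f(3) h'(1)] f e' h' by simp
   also have "\<dots> = h" using vfun_comp_assoc[OF h'(1) e(1) h'(1)] h h' e by simp
   also have "\<dots> = (h oo free_mu C) oo FE (Fr C)"
    using vfun_comp_assoc[OF e'(1) m(3) h'(1)] m e' h' by simp
   finally show "(h oo free1 h) oo FE (Fr C) = (h oo free_mu C) oo FE (Fr C)" .
  qed
 qed
 note S = algebra_symmetric_monoidal[OF A] and t = algebra_tensor[OF h' C]
 note TN = symmetric_monoidal_is_tensor[OF N] note n = is_tensorD[OF TN] and s = is_tensorD[OF t(1)]
 have he: "fob h (fob (FE C) a) = a" if "a \<in> ob C" for a using comp_eqD[OF h(2)] that e by simp
 have eo: "fob (FE C) a \<in> ob (Fr C)" if "a \<in> ob C" for a using that e by simp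
 have hsrc: "fsrc h = ftgt (FE C)" using h' e by simp
 have heh: "fhm h (fob (FE C) a) (fob (FE C) b) \<cdot> fhm (FE C) a b \<cdot> k = k" if "a \<in> ob C" "b \<in> ob C" "k \<in> El C Z a b" for a b k Z
  using comp_eq_appD[OF h(2) e(1) h'(1) hsrc e(2) that] that by simp
 have "algebra_symmon C h = N"
 proof (rule symmon_eqI[OF S(1) N])
  show "tens (algebra_symmon C h) = tens N"
  proof (rule vfunctor_eqI[OF s(2) n(2), where A = "prodfam (elements C) (elements C)"], unfold s n)
   show "dfam (vcat_prod V C C) (prodfam (elements C) (elements C))"
    by (intro dfam_prodfam dfam_elements c)
   fix x assume "x \<in> ob (vcat_prod V C C)"
   then obtain a b where x: "x = (a, b)" and o: "a \<in> ob C" "b \<in> ob C" by auto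
   show "fob (tens (algebra_symmon C h)) x = fob (tens N) x"
    using t(2)[OF o] strict_monoidal_tob[OF h(1) TM eo[OF o(1)] eo[OF o(2)]] he o unfolding x tob_def by simp
   fix y g Z assume "y \<in> ob (vcat_prod V C C)" and g: "g \<in> prodfam (elements C) (elements C) x y" "g \<in> El (vcat_prod V C C) Z x y"
   then obtain a' b' where y: "y = (a', b')" and o': "a' \<in> ob C" "b' \<in> ob C" by auto
   obtain k l where kl: "g = Tuple V k l" "k \<in> El C Z a a'" "l \<in> El C Z b b'"
    using prodfamE[OF g(1)[unfolded x y] HomD(2)[OF g(2)] dfam_elements[OF c] dfam_elements[OF c] o o'] by metis
   have "tarr V (algebra_symmon C h) a a' b b' k l = tarr V N a a' b b' k l"
    using t(3)[OF o(1) o'(1) o(2) o'(2) kl(2,3)]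
     strict_monoidal_tarr[OF h(1) TM TN eo[OF o(1)] eo[OF o'(1)] eo[OF o(2)] eo[OF o'(2)] vfun_app[OF e o(1) o'(1) kl(2)] vfun_app[OF e o(2) o'(2) kl(3)]]
     heh[OF o(1) o'(1) kl(2)] heh[OF o(2) o'(2) kl(3)] he o o' by simp
   then show "fhm (tens (algebra_symmon C h)) x y \<cdot> g = fhm (tens N) x y \<cdot> g" unfolding x y kl(1) tarr_def .
  qed simp_all
  fix a b assume o: "a \<in> ob C" "b \<in> ob C"
  show "ncomp (symm (algebra_symmon C h)) (a, b) = ncomp (symm N) (a, b)"
   using strict_monoidal_sigma[OF h(1) M N eo[OF o(1)] eo[OF o(2)] Term_Obj] sigma_Term[OF M eo[OF o(1)] eo[OF o(2)]] sigma_Term[OF N o] he o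
   by (simp add: algebra_symmon_def Let_def)
  fix d assume d: "d \<in> ob C"
  show "ncomp (asc (algebra_symmon C h)) ((a, b), d) = ncomp (asc N) ((a, b), d)"
   using strict_monoidal_alpha[OF h(1) M N eo[OF o(1)] eo[OF o(2)] eo[OF d] Term_Obj] alpha_Term[OF M eo[OF o(1)] eo[OF o(2)] eo[OF d]] alpha_Term[OF N o d] he o d
   by (simp add: algebra_symmon_def Let_def)
 qed
 with A show ?thesis by blast
qed

text \<open>If \<open>F\<close> is strict, both composites in the morphism equation are strict
  functors out of \<open>Fr C\<close> that restrict to \<open>F\<close>, hence equal. Conversely,
  the equation evaluated at tensor products and constraints of generators expresses strictness of
  \<open>F\<close>.\<close>

lemma algebra_morphism_iff:
 assumes A: "monad_algebra (VCat U V) free_monad C h" and B: "monad_algebra (VCat U V) free_monad D k"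
 shows "monad_algebra_morphism (VCat U V) free_monad C h D k F \<longleftrightarrow>
  strict_monoidal V C (algebra_symmon C h) D (algebra_symmon D k) F"
proof -
 note C = algebraD(1)[OF A] and h = algebraD(2-4)[OF A] and uA = algebraD(6)[OF A]
 note D = algebraD(1)[OF B] and k = algebraD(2-4)[OF B] and uB = algebraD(6)[OF B]
 note SA = algebra_symmetric_monoidal[OF A] and SB = algebra_symmetric_monoidal[OF B]
 note e = FE_D[OF C] FE_D[OF D]
 have "F oo h = k oo free1 F"
  if F: "strict_monoidal V C (algebra_symmon C h) D (algebra_symmon D k) F"
 proof -
  note F' = strict_monoidal_vfunctor[OF F] note f = free1[OF F' C D]
  show ?thesis
  proof (rule ext_unique[OF C SB(1)])
   show "strict_ext C D (algebra_symmon D k) (F oo h)" by (rule strict_monoidal_comp[OF SA(2) F FM_sm[OF C] SA(1) SB(1)])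
   show "strict_ext C D (algebra_symmon D k) (k oo free1 F)" by (rule strict_monoidal_comp[OF f(1) SB(2) FM_sm[OF C] FM_sm[OF D] SB(1)])
   have "(F oo h) oo FE C = F" using vfun_comp_assoc[OF e(1) h(1) F'(1)] e h F' uA by simp
   also have "\<dots> = k oo (FE D oo F)" using vfun_comp_assoc[OF F'(1) e(4) k(1)] e k F' uB by simp
   also have "\<dots> = (k oo free1 F) oo FE C" using vfun_comp_assoc[OF e(1) f(3) k(1)] e k f by simp
   finally show "(F oo h) oo FE C = (k oo free1 F) oo FE C" .
  qed
 qed
 moreover have "strict_monoidal V C (algebra_symmon C h) D (algebra_symmon D k) F"
  if F: "vfunctor V F" "fsrc F = C" "ftgt F = D" and eq: "F oo h = k oo free1 F"
 proof -
  note f = free1[OF F C D]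
  note M = FM_sm[OF C] and L = FM_sm[OF D] and TM = FM_tensor[OF C] and TL = FM_tensor[OF D]
  note tA = algebra_tensor[OF h C] and tB = algebra_tensor[OF k D] and tt = tob_ob[OF TM]
  have eo: "fob (FE C) a \<in> ob (Fr C)" if "a \<in> ob C" for a using that e by simp
  have fe: "fob (free1 F) (fob (FE C) a) = fob (FE D) (fob F a)" if "a \<in> ob C" for a
   using comp_eqD[OF f(2)] that e F by simp
  have s: "fsrc (free1 F) = ftgt (FE C)" "fsrc (FE D) = ftgt F" "fsrc F = ftgt h" "fsrc k = ftgt (free1 F)" using f e F h k by simp_all
  have feh: "fhm (free1 F) (fob (FE C) a) (fob (FE C) b) \<cdot> fhm (FE C) a b \<cdot> g = fhm (FE D) (fob F a) (fob F b) \<cdot> fhm F a b \<cdot> g"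
   if o: "a \<in> ob C" "b \<in> ob C" and g: "g \<in> El C Z a b" for a b g Z
   using comp_eq_appD[OF f(2) e(1) f(3) s(1) e(2) o g] vfun_comp_app[OF F(1,2) e(4) s(2) o g] by simp
  have ob: "fob F (fob h X) = fob k (fob (free1 F) X)" if "X \<in> ob (Fr C)" for X
  proof -
   have "fob (F oo h) X = fob (k oo free1 F) X" using eq by simp
   then show ?thesis using that h f by simp
  qed
  have hm: "fhm F (fob h X) (fob h Y) \<cdot> fhm h X Y \<cdot> w = fhm k (fob (free1 F) X) (fob (free1 F) Y) \<cdot> fhm (free1 F) X Y \<cdot> w"
   if o: "X \<in> ob (Fr C)" "Y \<in> ob (Fr C)" and w: "w \<in> El (Fr C) Z X Y" for X Y w Z
  proof -
   have "fhm (F oo h) X Y \<cdot> w = fhm (k oo free1 F) X Y \<cdot> w" using eq by simp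
   then show ?thesis unfolding vfun_comp_app[OF h(1,2) F(1) s(3) o w] vfun_comp_app[OF f(3,4) k(1) s(4) o w] .
  qed
  have Fo: "fob F a \<in> ob D" if "a \<in> ob C" for a using that F by simp
  have eD: "fob (FE D) x \<in> ob (Fr D)" if "x \<in> ob D" for x using that e by simp
  note fT = strict_monoidal_tob[OF f(1) TM]
  have hea: "fob h (fob (FE C) a) = a" if "a \<in> ob C" for a using comp_eqD[OF uA] that e by simp
  note hT = strict_monoidal_tob[OF SA(2) TM]
  show ?thesis
  proof (rule strict_monoidalI[OF F dfam_elements[OF KD(1)[OF C]] tA(1) tB(1)])
   fix a b assume o: "a \<in> ob C" "b \<in> ob C"
   note eo2 = eo[OF o(1)] eo[OF o(2)] and Fo2 = Fo[OF o(1)] Fo[OF o(2)]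
   show tob: "fob F (tob (algebra_symmon C h) a b) = tob (algebra_symmon D k) (fob F a) (fob F b)"
    unfolding tA(2)[OF o] tB(2)[OF Fo2] ob[OF tt[OF eo2]] fT[OF eo2] fe[OF o(1)] fe[OF o(2)] ..
   have "fhm F (tob (algebra_symmon C h) a b) (tob (algebra_symmon C h) b a) \<cdot> ncomp (symm (algebra_symmon C h)) (a, b) =
    fhm F (fob h (tob (FM C) (fob (FE C) a) (fob (FE C) b))) (fob h (tob (FM C) (fob (FE C) b) (fob (FE C) a))) \<cdot>
     fhm h (tob (FM C) (fob (FE C) a) (fob (FE C) b)) (tob (FM C) (fob (FE C) b) (fob (FE C) a)) \<cdot> sigma (FM C) (Term V) (fob (FE C) a) (fob (FE C) b)"
    unfolding tA(2)[OF o] tA(2)[OF o(2,1)] sigma_Term[OF M eo2] using o by (simp add: algebra_symmon_def Let_def)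
   also have "\<dots> = ncomp (symm (algebra_symmon D k)) (fob F a, fob F b)"
    unfolding hm[OF tt[OF eo2] tt[OF eo2(2,1)] sigma_Hom[OF M eo2 Term_Obj]] strict_monoidal_sigma[OF f(1) M L eo2 Term_Obj]
     fT[OF eo2] fT[OF eo2(2,1)] fe[OF o(1)] fe[OF o(2)] sigma_Term[OF L eD[OF Fo2(1)] eD[OF Fo2(2)]]
    using Fo2 by (simp add: algebra_symmon_def Let_def)
   finally show "fhm F (tob (algebra_symmon C h) a b) (tob (algebra_symmon C h) b a) \<cdot> ncomp (symm (algebra_symmon C h)) (a, b) =
    ncomp (symm (algebra_symmon D k)) (fob F a, fob F b)" .
   fix c assume c: "c \<in> ob C"
   note eo3 = eo2 eo[OF c] and Fo3 = Fo2 Fo[OF c]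
   note ab = tt[OF eo3(1,2)] and bc = tt[OF eo3(2,3)]
   have t3: "tob (algebra_symmon C h) (tob (algebra_symmon C h) a b) c = fob h (tob (FM C) (tob (FM C) (fob (FE C) a) (fob (FE C) b)) (fob (FE C) c))"
    "tob (algebra_symmon C h) a (tob (algebra_symmon C h) b c) = fob h (tob (FM C) (fob (FE C) a) (tob (FM C) (fob (FE C) b) (fob (FE C) c)))"
    unfolding hT[OF ab eo3(3)] hT[OF eo3(1) bc] hT[OF eo3(1,2)] hT[OF eo3(2,3)] using hea o c by simp_all
   have "fhm F (tob (algebra_symmon C h) (tob (algebra_symmon C h) a b) c) (tob (algebra_symmon C h) a (tob (algebra_symmon C h) b c)) \<cdot> ncomp (asc (algebra_symmon C h)) ((a, b), c) =
    fhm F (fob h (tob (FM C) (tob (FM C) (fob (FE C) a) (fob (FE C) b)) (fob (FE C) c))) (fob h (tob (FM C) (fob (FE C) a) (tob (FM C) (fob (FE C) b) (fob (FE C) c)))) \<cdot>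
     fhm h (tob (FM C) (tob (FM C) (fob (FE C) a) (fob (FE C) b)) (fob (FE C) c)) (tob (FM C) (fob (FE C) a) (tob (FM C) (fob (FE C) b) (fob (FE C) c))) \<cdot> alpha (FM C) (Term V) (fob (FE C) a) (fob (FE C) b) (fob (FE C) c)"
    unfolding t3 alpha_Term[OF M eo3] using o c by (simp add: algebra_symmon_def Let_def)
   also have "\<dots> = ncomp (asc (algebra_symmon D k)) ((fob F a, fob F b), fob F c)"
    unfolding hm[OF tt[OF ab eo3(3)] tt[OF eo3(1) bc] alpha_Hom[OF M eo3 Term_Obj]] strict_monoidal_alpha[OF f(1) M L eo3 Term_Obj]
     fT[OF ab eo3(3)] fT[OF eo3(1) bc] fT[OF eo3(1,2)] fT[OF eo3(2,3)] fe[OF o(1)] fe[OF o(2)] fe[OF c] alpha_Term[OF L eD[OF Fo3(1)] eD[OF Fo3(2)] eD[OF Fo3(3)]]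
    using Fo3 by (simp add: algebra_symmon_def Let_def)
   finally show "fhm F (tob (algebra_symmon C h) (tob (algebra_symmon C h) a b) c) (tob (algebra_symmon C h) a (tob (algebra_symmon C h) b c)) \<cdot> ncomp (asc (algebra_symmon C h)) ((a, b), c) =
    ncomp (asc (algebra_symmon D k)) ((fob F a, fob F b), fob F c)" .
  next
   fix a a' b b' g l Z assume o: "a \<in> ob C" "a' \<in> ob C" "b \<in> ob C" "b' \<in> ob C"
    and "g \<in> elements C a a'" "l \<in> elements C b b'" "Dom V g = Z" "Dom V l = Z"
   then have g: "g \<in> El C Z a a'" "l \<in> El C Z b b'" by (simp_all add: elements_def Hom_iff)
   note eo4 = eo[OF o(1)] eo[OF o(2)] eo[OF o(3)] eo[OF o(4)]
   note eg = vfun_app[OF e(1-3) o(1,2) g(1)] vfun_app[OF e(1-3) o(3,4) g(2)]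
   show "fhm F (tob (algebra_symmon C h) a b) (tob (algebra_symmon C h) a' b') \<cdot> tarr V (algebra_symmon C h) a a' b b' g l =
    tarr V (algebra_symmon D k) (fob F a) (fob F a') (fob F b) (fob F b') (fhm F a a' \<cdot> g) (fhm F b b' \<cdot> l)"
    unfolding tA(3)[OF o g] tA(2)[OF o(1,3)] tA(2)[OF o(2,4)] hm[OF tt[OF eo4(1,3)] tt[OF eo4(2,4)] tarr_Hom[OF TM eo4 eg]]
     strict_monoidal_tarr[OF f(1) TM TL eo4 eg] fT[OF eo4(1,3)] fT[OF eo4(2,4)] feh[OF o(1,2) g(1)] feh[OF o(3,4) g(2)]
     fe[OF o(1)] fe[OF o(2)] fe[OF o(3)] fe[OF o(4)]
     tB(3)[OF Fo[OF o(1)] Fo[OF o(2)] Fo[OF o(3)] Fo[OF o(4)] vfun_app[OF F o(1,2) g(1)] vfun_app[OF F o(3,4) g(2)]] ..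
  qed
 qed
 ultimately show ?thesis
  using A B C D strict_monoidal_vfunctor[of C _ D _ F] by (auto simp: monad_algebra_morphism_def)
qed

lemma algebras_are_symmetric_monoidal_free: "algebras_are_symmetric_monoidal U V free_monad"
 unfolding algebras_are_symmetric_monoidal_def
proof (intro exI conjI ballI allI impI)
 fix C assume C: "K C"
 show "bij_betw (algebra_symmon C) {h. monad_algebra (VCat U V) free_monad C h} {M. symmetric_monoidal V C M}"
 proof (rule bij_betw_imageI)
  show "inj_on (algebra_symmon C) {h. monad_algebra (VCat U V) free_monad C h}"
  proof (rule inj_onI, simp)
   fix h k assume A: "monad_algebra (VCat U V) free_monad C h" and B: "monad_algebra (VCat U V) free_monad C k"
    and eq: "algebra_symmon C h = algebra_symmon C k"
   \<comment> \<open>A structure map is recovered from its structure as the strict extension of the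
     identity.\<close>
   show "h = k"
    by (rule ext_unique[OF C algebra_symmetric_monoidal(1)[OF A] algebra_symmetric_monoidal(2)[OF A]
     algebra_symmetric_monoidal(2)[OF B, folded eq]])
     (use algebraD(6)[OF A] algebraD(6)[OF B] in simp)
  qed
  show "algebra_symmon C ` {h. monad_algebra (VCat U V) free_monad C h} = {M. symmetric_monoidal V C M}"
   using algebra_symmetric_monoidal(1) symmetric_monoidal_algebra[OF C] by blast
 qed
next
 fix C D h k F assume "monad_algebra (VCat U V) free_monad C h" "monad_algebra (VCat U V) free_monad D k"
 then show "monad_algebra_morphism (VCat U V) free_monad C h D k F \<longleftrightarrow>
  strict_monoidal V C (algebra_symmon C h) D (algebra_symmon D k) F"
  by (rule algebra_morphism_iff)
qed

end

section \<open>Formal coherence isomorphisms\<close>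

text \<open>Formal tensor products. The empty tree is absent because the structures have no
  unit.\<close>

datatype 'b btree = Lf 'b | Nd "'b btree" "'b btree"

abbreviation leaves_in :: "'b btree => 'b set => bool"  (infix "<:" 50) where
 "t <: A \<equiv> set_btree t \<subseteq> A"

text \<open>Identity, associativity and its inverse, symmetry, composites and tensor products. Terms
  are untyped: source and target are supplied by the tree acted on, so a single countable type
  serves all categories.\<close>

datatype expr = EId | EAs | EAi | ESy | EComp expr expr | ETens expr expr

text \<open>
 Every expression acts on every tree: where it does not make sense it acts as the identity. This
 keeps all operations total, and makes the action natural in the labels of the tree.
\<close>

primrec reorder :: "expr => 'b btree => 'b btree" where
 "reorder EId t = t"
| "reorder EAs t = (case t of Nd (Nd a b) c => Nd a (Nd b c) | _ => t)"
| "reorder EAi t = (case t of Nd a (Nd b c) => Nd (Nd a b) c | _ => t)"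
| "reorder ESy t = (case t of Nd a b => Nd b a | _ => t)"
| "reorder (EComp e f) t = reorder e (reorder f t)"
| "reorder (ETens e f) t = (case t of Nd a b => Nd (reorder e a) (reorder f b) | _ => t)"

text \<open>\<open>reorder\<close> never inspects labels. Hence it acts alike on trees of objects,
  trees of arrows and bare shapes, and can be exchanged with \<open>adom\<close>,
  \<open>acod\<close> and \<open>shape\<close>.\<close>

lemma map_reorder: "map_btree g (reorder e t) = reorder e (map_btree g t)"
 by (induction e arbitrary: t) (simp_all split: btree.split)

lemma set_reorder [simp]: "set_btree (reorder e t) = set_btree t"
 by (induction e arbitrary: t) (auto split: btree.split)

abbreviation shape :: "'b btree => unit btree" where
 "shape \<equiv> map_btree (\<lambda>_. ())"

lemma map_btree_eq_Nd: "map_btree g t = Nd a b \<longleftrightarrow> (\<exists>a' b'. t = Nd a' b' \<and> map_btree g a' = a \<and> map_btree g b' = b)"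
 by (cases t) auto

lemma map_btree_eq_Lf: "map_btree g t = Lf x \<longleftrightarrow> (\<exists>y. t = Lf y \<and> g y = x)"
 by (cases t) auto

lemma shape_map [simp]: "shape (map_btree g t) = shape t"
 by (simp add: btree.map_comp o_def)

text \<open>\<open>eqv\<close> contains the axioms at each source shape, and identifies with \<open>EId\<close> what \<open>reorder\<close> treats as the identity.\<close>

inductive eqv :: "unit btree => expr => expr => bool" where
 refl: "eqv s e e"
| sym: "eqv s e f ==> eqv s f e"
| trans: "eqv s e f ==> eqv s f g ==> eqv s e g"
| comp: "eqv s e e' ==> eqv (reorder e s) f f' ==> eqv s (EComp f e) (EComp f' e')"
| tens: "eqv a e e' ==> eqv b f f' ==> eqv (Nd a b) (ETens e f) (ETens e' f')"
| assoc: "eqv s (EComp (EComp g f) e) (EComp g (EComp f e))"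
| idl: "eqv s (EComp EId e) e"
| idr: "eqv s (EComp e EId) e"
| tens_comp: "eqv (Nd a b) (ETens (EComp e' e) (EComp f' f)) (EComp (ETens e' f') (ETens e f))"
| tens_id: "eqv (Nd a b) (ETens EId EId) EId"
| tens_Lf: "eqv (Lf x) (ETens e f) EId"
| as_nat: "eqv (Nd (Nd a b) c) (EComp EAs (ETens (ETens e f) g)) (EComp (ETens e (ETens f g)) EAs)"
| sy_nat: "eqv (Nd a b) (EComp ESy (ETens e f)) (EComp (ETens f e) ESy)"
| ai_as: "eqv (Nd (Nd a b) c) (EComp EAi EAs) EId"
| as_ai: "eqv (Nd a (Nd b c)) (EComp EAs EAi) EId"
| sy_sy: "eqv (Nd a b) (EComp ESy ESy) EId"
| as_Lf: "eqv (Lf x) EAs EId"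
| as_Nd_Lf: "eqv (Nd (Lf x) c) EAs EId"
| ai_Lf: "eqv (Lf x) EAi EId"
| ai_Nd_Lf: "eqv (Nd a (Lf x)) EAi EId"
| sy_Lf: "eqv (Lf x) ESy EId"
| pent: "eqv (Nd (Nd (Nd a b) c) d) (EComp EAs EAs) (EComp (ETens EId EAs) (EComp EAs (ETens EAs EId)))"
| hex: "eqv (Nd (Nd a b) c) (EComp EAs (EComp ESy EAs)) (EComp (ETens EId ESy) (EComp EAs (ETens ESy EId)))"

text \<open>Both sides of each clause of \<open>eqv\<close> move the leaves in the same way, so the
  target of a formal isomorphism depends only on its class.\<close>

lemma eqv_reorder: "eqv s e e' ==> shape t = s ==> reorder e t = reorder e' t"
proof (induction arbitrary: t rule: eqv.induct)
 case (comp s e e' f f')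
 then show ?case by (metis reorder.simps(5) map_reorder)
qed (auto simp: map_btree_eq_Nd map_btree_eq_Lf)

text \<open>A representative picked by choice, not a result of rewriting. It allows summands to be
  indexed by terms instead of equivalence classes.\<close>

definition nf :: "unit btree => expr => expr" where
 "nf s e = (SOME e'. eqv s e e')"

lemma eqv_nf: "eqv s e (nf s e)"
 unfolding nf_def by (rule someI) (rule eqv.refl)

text \<open>Equivalent terms have the same predicate \<open>eqv s\<close>, hence the same chosen
  member of it.\<close>

lemma nf_cong: "eqv s e e' ==> nf s e = nf s e'"
proof -
 assume "eqv s e e'"
 then have "eqv s e = eqv s e'" by (intro ext) (meson eqv.sym eqv.trans)
 then show ?thesis by (simp add: nf_def)
qed

lemma nf_nf [simp]: "nf s (nf s e) = nf s e"
 using nf_cong[OF eqv_nf] by simp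

lemma reorder_nf: "reorder (nf (shape t) e) t = reorder e t"
 using eqv_reorder[OF eqv_nf] by metis

fun zip_btree :: "('b => 'c => 'd) => 'b btree => 'c btree => 'd btree" where
 "zip_btree h (Lf a) (Lf b) = Lf (h a b)"
| "zip_btree h (Nd a b) (Nd c d) = Nd (zip_btree h a c) (zip_btree h b d)"
| "zip_btree h _ _ = undefined"

text \<open>Two trees of equal shape are the projections of one tree of pairs; this reduces
  \<open>zip_reorder\<close> to naturality in the labels.\<close>

lemma same_shape_zip:
 assumes "shape x = shape y" obtains z where "x = map_btree fst z" "y = map_btree snd z"
proof -
 have "\<exists>z. x = map_btree fst z \<and> y = map_btree snd z"
  using assms
 proof (induction x arbitrary: y)
  case (Lf a)
  then obtain b where "y = Lf b" by (cases y) auto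
  then show ?case by (intro exI[of _ "Lf (a, b)"]) simp
 next
  case (Nd x1 x2)
  then obtain y1 y2 where y: "y = Nd y1 y2" "shape x1 = shape y1" "shape x2 = shape y2" by (cases y) auto
  then obtain z1 z2 where "x1 = map_btree fst z1" "y1 = map_btree snd z1" "x2 = map_btree fst z2" "y2 = map_btree snd z2"
   using Nd.IH by metis
  then show ?case using y by (intro exI[of _ "Nd z1 z2"]) simp
 qed
 then show ?thesis using that by blast
qed

lemma zip_map: "zip_btree h (map_btree f z) (map_btree g z) = map_btree (\<lambda>l. h (f l) (g l)) z"
 by (induction z) simp_all

lemma zip_reorder: "shape x = shape y ==> reorder e (zip_btree h x y) = zip_btree h (reorder e x) (reorder e y)"
 by (erule same_shape_zip) (simp add: zip_map flip: map_reorder)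

text \<open>Arrows are stored as triples of source, generalised element of the hom object, and target.\<close>

type_synonym ('o, 'a) arrow = "'o \<times> 'a \<times> 'o"

abbreviation adom :: "('o, 'a) arrow btree => 'o btree" where
 "adom \<equiv> map_btree fst"

abbreviation acod :: "('o, 'a) arrow btree => 'o btree" where
 "acod \<equiv> map_btree (\<lambda>x. snd (snd x))"

section \<open>Evaluation of trees and terms in a symmetric monoidal category\<close>

context cartesian_category
begin

definition arrows :: "('o, 'v, 'a) vcat => 'v => ('o, 'a) arrow set" where
 "arrows C Z = {(a, f, b). a \<in> ob C \<and> b \<in> ob C \<and> f \<in> El C Z a b}"

definition acomp :: "('o, 'v, 'a) vcat => ('o, 'a) arrow btree => ('o, 'a) arrow btree => ('o, 'a) arrow btree" where
 "acomp C = zip_btree (\<lambda>g f. (fst f, ucomp V C (fst f) (fst g) (snd (snd g)) (fst (snd g)) (fst (snd f)), snd (snd g)))"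

definition aid :: "('o, 'v, 'a) vcat => 'v => 'o btree => ('o, 'a) arrow btree" where
 "aid C Z = map_btree (\<lambda>a. (a, uid C Z a, a))"

primrec val :: "('o, 'v, 'a) symmon => 'o btree => 'o" where
 "val N (Lf a) = a"
| "val N (Nd s t) = tob N (val N s) (val N t)"

primrec tensor :: "('o, 'v, 'a) symmon => ('o, 'a) arrow btree => 'a" where
 "tensor N (Lf x) = fst (snd x)"
| "tensor N (Nd p q) = tarr V N (val N (adom p)) (val N (acod p)) (val N (adom q)) (val N (acod q)) (tensor N p) (tensor N q)"

text \<open>The catch-all cases are identities, in agreement with \<open>reorder\<close>, which
  fixes the tree there. Hence every term has a well-typed interpretation at every tree.\<close>

primrec interp :: "('o, 'v, 'a) vcat => ('o, 'v, 'a) symmon => 'v => expr => 'o btree => 'a" where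
 "interp D N Z EId s = uid D Z (val N s)"
| "interp D N Z EAs s = (case s of Nd (Nd a b) c => alpha N Z (val N a) (val N b) (val N c) | _ => uid D Z (val N s))"
| "interp D N Z EAi s = (case s of Nd a (Nd b c) => alphainv D N Z (val N a) (val N b) (val N c) | _ => uid D Z (val N s))"
| "interp D N Z ESy s = (case s of Nd a b => sigma N Z (val N a) (val N b) | _ => uid D Z (val N s))"
| "interp D N Z (EComp f e) s =
  ucomp V D (val N s) (val N (reorder e s)) (val N (reorder f (reorder e s))) (interp D N Z f (reorder e s)) (interp D N Z e s)"
| "interp D N Z (ETens e f) s = (case s of
   Nd a b => tarr V N (val N a) (val N (reorder e a)) (val N b) (val N (reorder f b)) (interp D N Z e a) (interp D N Z f b)
  | _ => uid D Z (val N s))"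

lemma val_ob: "is_tensor D N ==> s <: ob D ==> val N s \<in> ob D"
 by (induction s) auto

lemma set_adom_acod:
 "p <: arrows C Z ==> adom p <: ob C"
 "p <: arrows C Z ==> acod p <: ob C"
 by (auto simp: btree.set_map arrows_def)

lemma tensor_Hom:
 assumes "is_tensor D N"
 shows "p <: arrows D Z ==> tensor N p \<in> El D Z (val N (adom p)) (val N (acod p))"
proof (induction p)
 case (Lf x)
 then show ?case by (auto simp: arrows_def)
next
 case (Nd p q)
 then have pq: "p <: arrows D Z" "q <: arrows D Z" by simp_all
 show ?case
  unfolding tensor.simps btree.map val.simps
  by (rule tarr_Hom[OF assms _ _ _ _ Nd.IH(1)[OF pq(1)] Nd.IH(2)[OF pq(2)]])
   (intro val_ob[OF assms] set_adom_acod[OF pq(1)] set_adom_acod[OF pq(2)])+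
qed

text \<open>The interchange law, iterated over the tree.\<close>

lemma tensor_acomp:
 assumes T: "is_tensor D N"
 shows "p <: arrows D Z ==> q <: arrows D Z ==> adom q = acod p ==>
  tensor N (acomp D q p) = ucomp V D (val N (adom p)) (val N (acod p)) (val N (acod q)) (tensor N q) (tensor N p) \<and>
  adom (acomp D q p) = adom p \<and> acod (acomp D q p) = acod q"
proof (induction p arbitrary: q)
 case (Lf x)
 then obtain y where "q = Lf y" by (cases q) auto
 with Lf show ?case by (simp add: acomp_def)
next
 case (Nd p1 p2)
 then obtain q1 q2 where q: "q = Nd q1 q2" "adom q1 = acod p1" "adom q2 = acod p2" by (cases q) auto
 have s: "p1 <: arrows D Z" "p2 <: arrows D Z" "q1 <: arrows D Z" "q2 <: arrows D Z"
  using Nd.prems q by simp_all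
 note v = val_ob[OF T]
 have e: "acomp D q (Nd p1 p2) = Nd (acomp D q1 p1) (acomp D q2 p2)" by (simp add: acomp_def q)
 note h = tensor_Hom[OF T s(1)] tensor_Hom[OF T s(2)] tensor_Hom[OF T s(3)] tensor_Hom[OF T s(4)]
 note IH = Nd.IH(1)[OF s(1,3) q(2)] Nd.IH(2)[OF s(2,4) q(3)]
 note tu = tarr_ucomp[OF T v[OF set_adom_acod(1)[OF s(1)]] v[OF set_adom_acod(2)[OF s(1)]] v[OF set_adom_acod(2)[OF s(3)]]
   v[OF set_adom_acod(1)[OF s(2)]] v[OF set_adom_acod(2)[OF s(2)]] v[OF set_adom_acod(2)[OF s(4)]] h(3)[unfolded q(2)] h(1) h(4)[unfolded q(3)] h(2)]
 show ?case unfolding e using IH tu q(2,3) unfolding q(1) by simp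
qed

context
 fixes D :: "('o, 'v, 'a) vcat" and N Z
 assumes S: "symmetric_monoidal V D N" and Z: "Z \<in> Obj V"
begin

private lemma T: "is_tensor D N" by (rule symmetric_monoidal_is_tensor[OF S])
private lemma D: "vcategory V D" by (rule is_tensorD(1)[OF T])

lemma interp_Hom: "s <: ob D ==> interp D N Z e s \<in> El D Z (val N s) (val N (reorder e s))"
proof (induction e arbitrary: s)
 case (EComp e f)
 have o: "reorder f s <: ob D" "reorder e (reorder f s) <: ob D" using EComp.prems by simp_all
 show ?case
  unfolding interp.simps reorder.simps
  by (rule ucomp_Hom[OF D val_ob[OF T EComp.prems] val_ob[OF T o(1)] val_ob[OF T o(2)] EComp.IH(1)[OF o(1)] EComp.IH(2)[OF EComp.prems]])
next
 case (ETens e f)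
 show ?case
 proof (cases s)
  case (Nd a b)
  with ETens.prems have ab: "a <: ob D" "b <: ob D" by simp_all
  then have ab': "reorder e a <: ob D" "reorder f b <: ob D" by simp_all
  show ?thesis unfolding Nd interp.simps reorder.simps btree.case val.simps
   by (rule tarr_Hom[OF T val_ob[OF T ab(1)] val_ob[OF T ab'(1)] val_ob[OF T ab(2)] val_ob[OF T ab'(2)] ETens.IH(1)[OF ab(1)] ETens.IH(2)[OF ab(2)]])
 qed (use ETens.prems D Z in simp)
qed (use S D T Z val_ob[OF T] in \<open>auto split: btree.split\<close>)

text \<open>Soundness of \<open>eqv\<close>: its clauses are laws of enriched categories, of the
  tensor functor or of the constraints, and those at degenerate shapes hold by the catch-all cases
  of \<open>interp\<close>.\<close>

lemma interp_eqv:
 "eqv u e e' ==> shape s = u ==> s <: ob D ==> interp D N Z e s = interp D N Z e' s"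
proof (induction arbitrary: s rule: eqv.induct)
 case (comp u e e' f f')
 have a: "reorder e s = reorder e' s" by (rule eqv_reorder[OF comp.hyps(1) comp.prems(1)])
 have b: "reorder f (reorder e s) = reorder f' (reorder e s)" by (rule eqv_reorder[OF comp.hyps(2)]) (use comp.prems in \<open>simp add: map_reorder\<close>)
 have "interp D N Z f (reorder e s) = interp D N Z f' (reorder e s)" by (rule comp.IH(2)) (use comp.prems in \<open>simp_all add: map_reorder\<close>)
 with a b comp.IH(1)[OF comp.prems] show ?case by simp
next
 case (tens a e e' b f f')
 then obtain x y where s: "s = Nd x y" "shape x = a" "shape y = b" by (auto simp: map_btree_eq_Nd)
 with tens.prems have o: "x <: ob D" "y <: ob D" by simp_all
 show ?case using tens.IH(1)[OF s(2) o(1)] tens.IH(2)[OF s(3) o(2)] eqv_reorder[OF tens.hyps(1) s(2)] eqv_reorder[OF tens.hyps(2) s(3)]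
  by (simp add: s(1))
next
 case (assoc u g f e)
 have o: "reorder e s <: ob D" "reorder f (reorder e s) <: ob D" "reorder g (reorder f (reorder e s)) <: ob D"
  using assoc.prems by simp_all
 show ?case
  using ucomp_assoc[OF D val_ob[OF T assoc.prems(2)] val_ob[OF T o(1)] val_ob[OF T o(2)] val_ob[OF T o(3)]
   interp_Hom[OF o(2)] interp_Hom[OF o(1)] interp_Hom[OF assoc.prems(2)]] by simp
next
 case (idl u e)
 have o: "reorder e s <: ob D" using idl.prems by simp
 show ?case using ucomp_uid(1)[OF D val_ob[OF T idl.prems(2)] val_ob[OF T o] interp_Hom[OF idl.prems(2)]] by simp
next
 case (idr u e)
 have o: "reorder e s <: ob D" using idr.prems by simp
 show ?case using ucomp_uid(2)[OF D val_ob[OF T idr.prems(2)] val_ob[OF T o] interp_Hom[OF idr.prems(2)]] by simp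
next
 case (tens_comp a b e' e f' f)
 then obtain x y where s: "s = Nd x y" by (auto simp: map_btree_eq_Nd)
 with tens_comp.prems have o: "x <: ob D" "y <: ob D" by simp_all
 then have o': "reorder e x <: ob D" "reorder f y <: ob D" "reorder e' (reorder e x) <: ob D" "reorder f' (reorder f y) <: ob D"
  by simp_all
 show ?case
  using tarr_ucomp[OF T val_ob[OF T o(1)] val_ob[OF T o'(1)] val_ob[OF T o'(3)] val_ob[OF T o(2)] val_ob[OF T o'(2)] val_ob[OF T o'(4)]
   interp_Hom[OF o'(1)] interp_Hom[OF o(1)] interp_Hom[OF o'(2)] interp_Hom[OF o(2)]]
  by (simp add: s)
next
 case (tens_id a b)
 then obtain x y where s: "s = Nd x y" by (auto simp: map_btree_eq_Nd)
 with tens_id.prems have o: "x <: ob D" "y <: ob D" by simp_all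
 show ?case using tarr_uid[OF T val_ob[OF T o(1)] val_ob[OF T o(2)] Z] by (simp add: s)
next
 case (as_nat a b c e f g)
 then obtain x y z where s: "s = Nd (Nd x y) z" by (auto simp: map_btree_eq_Nd)
 with as_nat.prems have o: "x <: ob D" "y <: ob D" "z <: ob D" by simp_all
 then have o': "reorder e x <: ob D" "reorder f y <: ob D" "reorder g z <: ob D" by simp_all
 show ?case
  using alpha_natural[OF S val_ob[OF T o(1)] val_ob[OF T o(2)] val_ob[OF T o(3)] val_ob[OF T o'(1)] val_ob[OF T o'(2)] val_ob[OF T o'(3)]
   interp_Hom[OF o(1)] interp_Hom[OF o(2)] interp_Hom[OF o(3)]] by (simp add: s)
next
 case (sy_nat a b e f)
 then obtain x y where s: "s = Nd x y" by (auto simp: map_btree_eq_Nd)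
 with sy_nat.prems have o: "x <: ob D" "y <: ob D" by simp_all
 then have o': "reorder e x <: ob D" "reorder f y <: ob D" by simp_all
 show ?case
  using sigma_natural[OF S val_ob[OF T o(1)] val_ob[OF T o(2)] val_ob[OF T o'(1)] val_ob[OF T o'(2)]
   interp_Hom[OF o(1)] interp_Hom[OF o(2)]] by (simp add: s)
next
 case (ai_as a b c)
 then obtain x y z where s: "s = Nd (Nd x y) z" by (auto simp: map_btree_eq_Nd)
 with ai_as.prems have o: "x <: ob D" "y <: ob D" "z <: ob D" by simp_all
 show ?case using alphainv(2)[OF S val_ob[OF T o(1)] val_ob[OF T o(2)] val_ob[OF T o(3)] Z] by (simp add: s)
next
 case (as_ai a b c)
 then obtain x y z where s: "s = Nd x (Nd y z)" by (auto simp: map_btree_eq_Nd)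
 with as_ai.prems have o: "x <: ob D" "y <: ob D" "z <: ob D" by simp_all
 show ?case using alphainv(3)[OF S val_ob[OF T o(1)] val_ob[OF T o(2)] val_ob[OF T o(3)] Z] by (simp add: s)
next
 case (sy_sy a b)
 then obtain x y where s: "s = Nd x y" by (auto simp: map_btree_eq_Nd)
 with sy_sy.prems have o: "x <: ob D" "y <: ob D" by simp_all
 show ?case using sigma_sigma[OF S val_ob[OF T o(1)] val_ob[OF T o(2)] Z] by (simp add: s)
next
 case (pent a b c d)
 then obtain x y z w where s: "s = Nd (Nd (Nd x y) z) w" by (auto simp: map_btree_eq_Nd)
 with pent.prems have o: "x <: ob D" "y <: ob D" "z <: ob D" "w <: ob D" by simp_all
 show ?case using pentagon[OF S val_ob[OF T o(1)] val_ob[OF T o(2)] val_ob[OF T o(3)] val_ob[OF T o(4)] Z HOL.refl] by (simp add: s)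
next
 case (hex a b c)
 then obtain x y z where s: "s = Nd (Nd x y) z" by (auto simp: map_btree_eq_Nd)
 with hex.prems have o: "x <: ob D" "y <: ob D" "z <: ob D" by simp_all
 show ?case using hexagon[OF S val_ob[OF T o(1)] val_ob[OF T o(2)] val_ob[OF T o(3)] Z HOL.refl] by (simp add: s)
qed (auto simp: map_btree_eq_Nd map_btree_eq_Lf)

text \<open>A coherence isomorphism can be moved past a tensor product of arrows if these are
  permuted accordingly. The composition rule of the free category is modelled on this law.\<close>

lemma interp_natural:
 "p <: arrows D Z ==>
  ucomp V D (val N (adom p)) (val N (reorder e (adom p))) (val N (reorder e (acod p))) (tensor N (reorder e p)) (interp D N Z e (adom p)) =
  ucomp V D (val N (adom p)) (val N (acod p)) (val N (reorder e (acod p))) (interp D N Z e (acod p)) (tensor N p)"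
proof (induction e arbitrary: p)
 case (EComp e f)
 have p: "reorder f p <: arrows D Z" "reorder e (reorder f p) <: arrows D Z" using EComp.prems by simp_all
 note v = val_ob[OF T] note ad = set_adom_acod[OF EComp.prems] and ad1 = set_adom_acod[OF p(1)] and ad2 = set_adom_acod[OF p(2)]
 show ?case
  unfolding interp.simps reorder.simps
  by (rule paste_vertical[OF D v[OF ad(1)] v[OF ad1(1)[unfolded map_reorder]] v[OF ad2(1)[unfolded map_reorder]] v[OF ad(2)] v[OF ad1(2)[unfolded map_reorder]] v[OF ad2(2)[unfolded map_reorder]]
    tensor_Hom[OF T EComp.prems] tensor_Hom[OF T p(1), unfolded map_reorder] tensor_Hom[OF T p(2), unfolded map_reorder]
    interp_Hom[OF ad(1)] interp_Hom[OF ad1(1)[unfolded map_reorder]] interp_Hom[OF ad(2)] interp_Hom[OF ad1(2)[unfolded map_reorder]]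
    EComp.IH(2)[OF EComp.prems, symmetric] EComp.IH(1)[OF p(1), unfolded map_reorder, symmetric], symmetric])
next
 case (ETens e f)
 show ?case
 proof (cases p)
  case (Lf x)
  then show ?thesis using ETens.prems D tensor_Hom[OF T ETens.prems] val_ob[OF T] set_adom_acod[OF ETens.prems] by simp
 next
  case (Nd p1 p2)
  with ETens.prems have s: "p1 <: arrows D Z" "p2 <: arrows D Z" by simp_all
  then have s': "reorder e p1 <: arrows D Z" "reorder f p2 <: arrows D Z" by simp_all
  note v = val_ob[OF T]
  note a1 = set_adom_acod[OF s(1)] and a2 = set_adom_acod[OF s(2)] and b1 = set_adom_acod[OF s'(1), unfolded map_reorder] and b2 = set_adom_acod[OF s'(2), unfolded map_reorder]
  note h = tensor_Hom[OF T s(1)] tensor_Hom[OF T s(2)] tensor_Hom[OF T s'(1), unfolded map_reorder] tensor_Hom[OF T s'(2), unfolded map_reorder]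
  note i = interp_Hom[OF a1(1), of e] interp_Hom[OF a1(2), of e] interp_Hom[OF a2(1), of f] interp_Hom[OF a2(2), of f]
  show ?thesis
   using ETens.IH(1)[OF s(1)] ETens.IH(2)[OF s(2)]
    tarr_ucomp[OF T v[OF a1(1)] v[OF b1(1)] v[OF b1(2)] v[OF a2(1)] v[OF b2(1)] v[OF b2(2)] h(3) i(1) h(4) i(3)]
    tarr_ucomp[OF T v[OF a1(1)] v[OF a1(2)] v[OF b1(2)] v[OF a2(1)] v[OF a2(2)] v[OF b2(2)] i(2) h(1) i(4) h(2)]
   by (simp add: Nd map_reorder)
 qed
next
 case EId
 then show ?case using D tensor_Hom[OF T EId] val_ob[OF T] set_adom_acod[OF EId] by simp
next
 case EAs
 note id = tensor_Hom[OF T EAs] set_adom_acod[OF EAs]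
 show ?case
 proof (cases p)
  case (Nd p12 p3)
  show ?thesis
  proof (cases p12)
   case (Nd p1 p2)
   with EAs \<open>p = Nd p12 p3\<close> have s: "p1 <: arrows D Z" "p2 <: arrows D Z" "p3 <: arrows D Z" by simp_all
   note v = val_ob[OF T] and a1 = set_adom_acod[OF s(1)] and a2 = set_adom_acod[OF s(2)] and a3 = set_adom_acod[OF s(3)]
   show ?thesis using alpha_natural[OF S v[OF a1(1)] v[OF a2(1)] v[OF a3(1)] v[OF a1(2)] v[OF a2(2)] v[OF a3(2)] tensor_Hom[OF T s(1)] tensor_Hom[OF T s(2)] tensor_Hom[OF T s(3)]]
    Nd \<open>p = Nd p12 p3\<close> by simp
  qed (use id D T val_ob[OF T] Nd in simp)
 qed (use id D val_ob[OF T] in simp)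
next
 case EAi
 note id = tensor_Hom[OF T EAi] set_adom_acod[OF EAi]
 show ?case
 proof (cases p)
  case (Nd p1 p23)
  show ?thesis
  proof (cases p23)
   case (Nd p2 p3)
   with EAi \<open>p = Nd p1 p23\<close> have s: "p1 <: arrows D Z" "p2 <: arrows D Z" "p3 <: arrows D Z" by simp_all
   note v = val_ob[OF T] and a1 = set_adom_acod[OF s(1)] and a2 = set_adom_acod[OF s(2)] and a3 = set_adom_acod[OF s(3)]
   show ?thesis using alphainv_natural[OF S v[OF a1(1)] v[OF a2(1)] v[OF a3(1)] v[OF a1(2)] v[OF a2(2)] v[OF a3(2)] tensor_Hom[OF T s(1)] tensor_Hom[OF T s(2)] tensor_Hom[OF T s(3)]]
    Nd \<open>p = Nd p1 p23\<close> by simp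
  qed (use id D T val_ob[OF T] Nd in simp)
 qed (use id D val_ob[OF T] in simp)
next
 case ESy
 note id = tensor_Hom[OF T ESy] set_adom_acod[OF ESy]
 show ?case
 proof (cases p)
  case (Nd p1 p2)
  with ESy have s: "p1 <: arrows D Z" "p2 <: arrows D Z" by simp_all
  note v = val_ob[OF T] and a1 = set_adom_acod[OF s(1)] and a2 = set_adom_acod[OF s(2)]
  show ?thesis using sigma_natural[OF S v[OF a1(1)] v[OF a2(1)] v[OF a1(2)] v[OF a2(2)] tensor_Hom[OF T s(1)] tensor_Hom[OF T s(2)]]
   Nd by simp
 qed (use id D val_ob[OF T] in simp)
qed

end

end

section \<open>The free symmetric monoidal category\<close>

context cartesian_category
begin

text \<open>A coproduct that remains one after multiplication by any \<open>W\<close>; the choice of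
  \<open>Term V\<close> for \<open>W\<close> recovers the usual universal property. The parameter
  takes the place of cartesian closedness.\<close>

definition distributive_coproduct :: "'i set => ('i => 'v) => 'v => ('i => 'a) => bool" where
 "distributive_coproduct I X H inc \<longleftrightarrow> H \<in> Obj V \<and> (\<forall>i\<in>I. inc i \<in> Hom V (X i) H) \<and>
   (\<forall>W\<in>Obj V. \<forall>Y\<in>Obj V. \<forall>f. (\<forall>i\<in>I. f i \<in> Hom V (Prod V (X i) W) Y) -->
    (\<exists>!g. g \<in> Hom V (Prod V H W) Y \<and>
     (\<forall>i\<in>I. g \<cdot> Tuple V (inc i \<cdot> Pr1 V (X i) W) (Pr2 V (X i) W) = f i)))"

text \<open>The default \<open>Term V\<close> makes the function total; in the summands indexed by
  \<open>idx\<close> the shapes of both trees agree.\<close>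

fun lpower :: "('o, 'v, 'a) vcat => 'o btree => 'o btree => 'v" where
 "lpower C (Lf a) (Lf b) = hm C a b"
| "lpower C (Nd s s') (Nd t t') = Prod V (lpower C s t) (lpower C s' t')"
| "lpower C _ _ = Term V"

primrec atuple :: "('o, 'a) arrow btree => 'a" where
 "atuple (Lf x) = fst (snd x)"
| "atuple (Nd p q) = Tuple V (atuple p) (atuple q)"

text \<open>Change of stage along \<open>k\<close>, for a whole tree of arrows.\<close>

definition apre :: "'a => ('o, 'a) arrow btree => ('o, 'a) arrow btree" where
 "apre k = map_btree (\<lambda>x. (fst x, fst (snd x) \<cdot> k, snd (snd x)))"

lemma apre_simps [simp]:
 "adom (apre k p) = adom p" "acod (apre k p) = acod p" "reorder e (apre k p) = apre k (reorder e p)"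
 "apre k (Nd p q) = Nd (apre k p) (apre k q)" "apre k (Lf x) = Lf (fst x, fst (snd x) \<cdot> k, snd (snd x))"
 by (simp_all add: apre_def btree.map_comp o_def map_reorder)

lemma aid_simps [simp]:
 "adom (aid C Z s) = s" "acod (aid C Z s) = s" "reorder e (aid C Z s) = aid C Z (reorder e s)"
 "aid C Z (Nd s t) = Nd (aid C Z s) (aid C Z t)" "aid C Z (Lf a) = Lf (a, uid C Z a, a)"
 by (simp_all add: aid_def btree.map_comp o_def map_reorder btree.map_ident)

lemma arrows_Obj: "p <: arrows C Z ==> Z \<in> Obj V"
 by (induction p) (auto simp: arrows_def dest: HomD(4))

lemma set_apre: "p <: arrows C Z ==> k \<in> Hom V Z' Z ==> apre k p <: arrows C Z'"
 unfolding apre_def btree.set_map using Comp_Hom by (fastforce simp: arrows_def)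

context
 fixes C :: "('o, 'v, 'a) vcat"
 assumes C: "vcategory V C"
begin

lemma set_aid: "s <: ob C ==> Z \<in> Obj V ==> aid C Z s <: arrows C Z"
 unfolding aid_def btree.set_map using C by (auto simp: arrows_def)

lemma apre_aid: "s <: ob C ==> k \<in> Hom V Z' Z ==> apre k (aid C Z s) = aid C Z' s"
 using C by (induction s) auto

lemma power_Obj: "s <: ob C ==> t <: ob C ==> lpower C s t \<in> Obj V"
 using C by (induction C s t rule: lpower.induct) simp_all

lemma atuple_Hom: "p <: arrows C Z ==> atuple p \<in> Hom V Z (lpower C (adom p) (acod p))"
 by (induction p) (auto simp: arrows_def)

lemma atuple_apre: "p <: arrows C Z ==> k \<in> Hom V Z' Z ==> atuple (apre k p) = atuple p \<cdot> k"
proof (induction p)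
 case (Nd p q)
 then have "p <: arrows C Z" "q <: arrows C Z" by simp_all
 with Nd show ?case using Tuple_precomp[OF atuple_Hom[of p Z] atuple_Hom[of q Z], of k Z'] by simp
qed simp

text \<open>With \<open>atuple_surj\<close>, this identifies trees of arrows with prescribed ends
  and generalised elements of \<open>lpower\<close>, so that elements of an iterated product can be
  handled as trees.\<close>

lemma atuple_inject:
 "p <: arrows C Z ==> q <: arrows C Z ==> adom p = adom q ==> acod p = acod q ==>
  atuple p = atuple q ==> p = q"
proof (induction p arbitrary: q)
 case (Lf x)
 then obtain y where "q = Lf y" by (cases q) auto
 with Lf show ?case by (simp add: prod_eq_iff)
next
 case (Nd p1 p2)
 then obtain q1 q2 where q: "q = Nd q1 q2" "adom p1 = adom q1" "adom p2 = adom q2" "acod p1 = acod q1" "acod p2 = acod q2"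
  by (cases q) auto
 then have s: "p1 <: arrows C Z" "p2 <: arrows C Z" "q1 <: arrows C Z" "q2 <: arrows C Z"
  using Nd.prems by simp_all
 note h = atuple_Hom[OF s(1)] atuple_Hom[OF s(2)] atuple_Hom[OF s(3)] atuple_Hom[OF s(4)]
 have "Tuple V (atuple p1) (atuple p2) = Tuple V (atuple q1) (atuple q2)" using Nd.prems(5) q(1) by simp
 then have "atuple p1 = atuple q1" "atuple p2 = atuple q2"
  using Tuple_inject[of "atuple p1" "atuple p2" "atuple q1" "atuple q2"] h q(2-5) by (simp_all add: Hom_iff)
 then show ?case using Nd.IH(1)[OF s(1,3) q(2,4)] Nd.IH(2)[OF s(2,4) q(3,5)] q(1) by simp
qed

lemma atuple_surj:
 "shape s = shape t ==> s <: ob C ==> t <: ob C ==> k \<in> Hom V Z (lpower C s t) ==>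
  \<exists>p. p <: arrows C Z \<and> adom p = s \<and> acod p = t \<and> atuple p = k"
proof (induction s arbitrary: t k)
 case (Lf a)
 then obtain b where "t = Lf b" by (cases t) auto
 with Lf show ?case by (intro exI[of _ "Lf (a, k, b)"]) (simp add: arrows_def)
next
 case (Nd s1 s2)
 then obtain t1 t2 where t: "t = Nd t1 t2" "shape s1 = shape t1" "shape s2 = shape t2" by (cases t) auto
 have s: "s1 <: ob C" "s2 <: ob C" "t1 <: ob C" "t2 <: ob C"
  using Nd.prems t by simp_all
 have k: "k \<in> Arr V" "Dom V k = Z" "Cod V k = Prod V (lpower C s1 t1) (lpower C s2 t2)" using Nd.prems(4) t by (simp_all add: Hom_iff)
 obtain x y where xy: "k = Tuple V x y" "x \<in> Arr V" "y \<in> Arr V" "Dom V x = Dom V k" "Dom V y = Dom V k"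
  "Cod V x = lpower C s1 t1" "Cod V y = lpower C s2 t2"
  by (rule Tuple_cases[OF k(1,3) power_Obj[OF s(1,3)] power_Obj[OF s(2,4)]])
 have h: "x \<in> Hom V Z (lpower C s1 t1)" "y \<in> Hom V Z (lpower C s2 t2)" using xy(2-7) k by (simp_all add: Hom_iff)
 from Nd.IH(1)[OF t(2) s(1,3) h(1)]
 obtain p where p: "p <: arrows C Z" "adom p = s1" "acod p = t1" "atuple p = x" by (elim exE conjE)
 from Nd.IH(2)[OF t(3) s(2,4) h(2)]
 obtain q where q: "q <: arrows C Z" "adom q = s2" "acod q = t2" "atuple q = y" by (elim exE conjE)
 note pq = p q
 from pq show ?case using t(1) xy(1) by (intro exI[of _ "Nd p q"]) simp
qed

lemma acomp_props:
 "p <: arrows C Z ==> q <: arrows C Z ==> adom q = acod p ==>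
  adom (acomp C q p) = adom p \<and> acod (acomp C q p) = acod q \<and> acomp C q p <: arrows C Z"
proof (induction p arbitrary: q)
 case (Lf x)
 then obtain y where "q = Lf y" by (cases q) auto
 with Lf show ?case using C by (auto simp: acomp_def arrows_def)
next
 case (Nd p1 p2)
 then obtain q1 q2 where "q = Nd q1 q2" by (cases q) auto
 with Nd show ?case by (auto simp: acomp_def)
qed

lemma acomp_Nd [simp]: "acomp C (Nd q1 q2) (Nd p1 p2) = Nd (acomp C q1 p1) (acomp C q2 p2)"
 by (simp add: acomp_def)

lemma acomp_apre:
 "p <: arrows C Z ==> q <: arrows C Z ==> adom q = acod p ==> k \<in> Hom V Z' Z ==>
  apre k (acomp C q p) = acomp C (apre k q) (apre k p)"
proof (induction p arbitrary: q)
 case (Lf x)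
 then obtain y where "q = Lf y" by (cases q) auto
 with Lf show ?case using C by (auto simp: acomp_def arrows_def)
next
 case (Nd p1 p2)
 then obtain q1 q2 where "q = Nd q1 q2" by (cases q) auto
 with Nd show ?case by (auto simp: acomp_def)
qed

lemma acomp_reorder:
 "adom q = acod p ==> reorder e (acomp C q p) = acomp C (reorder e q) (reorder e p)"
 unfolding acomp_def by (rule zip_reorder) (metis shape_map)

lemma acomp_assoc:
 "p <: arrows C Z ==> q <: arrows C Z ==> r <: arrows C Z ==> adom q = acod p ==> adom r = acod q ==>
  acomp C (acomp C r q) p = acomp C r (acomp C q p)"
proof (induction p arbitrary: q r)
 case (Lf x)
 then obtain y where y: "q = Lf y" by (cases q) auto
 with Lf obtain z where z: "r = Lf z" by (cases r) auto
 obtain a f b where x: "x = (a, f, b)" by (cases x)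
 obtain b' g c where y': "y = (b', g, c)" by (cases y)
 obtain c' h d where z': "z = (c', h, d)" by (cases z)
 show ?case using Lf x y z y' z' ucomp_assoc[OF C, of a b c d h Z g f] by (simp add: acomp_def arrows_def)
next
 case (Nd p1 p2)
 then obtain q1 q2 where "q = Nd q1 q2" by (cases q) auto
 moreover from this Nd obtain r1 r2 where "r = Nd r1 r2" by (cases r) auto
 ultimately show ?case using Nd by auto
qed

lemma acomp_aid:
 "p <: arrows C Z ==> acomp C (aid C Z (acod p)) p = p"
 "p <: arrows C Z ==> acomp C p (aid C Z (adom p)) = p"
 using C by (induction p) (auto simp: acomp_def arrows_def)

end

end

section \<open>Hom objects of the free category as coproducts\<close>

locale distributive_category = cartesian_category V for V :: "('v, 'a) cartcat" (structure) +
 assumes ex_coproduct: "(\<And>i :: expr. i \<in> I ==> X i \<in> Obj V) ==> \<exists>H inc. distributive_coproduct I X H inc"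
begin

text \<open>Representatives of the formal isomorphisms from \<open>s\<close> that reach the shape of
  \<open>t\<close>. Labels impose no condition, because the arrows at the leaves connect
  them.\<close>

definition idx :: "'o btree => 'o btree => expr set" where
 "idx s t = {e. nf (shape s) e = e \<and> shape (reorder e s) = shape t}"

definition coprod :: "('o, 'v, 'a) vcat => 'o btree => 'o btree => 'v \<times> (expr => 'a)" where
 "coprod C s t = (SOME c. distributive_coproduct (idx s t) (\<lambda>e. lpower C (reorder e s) t) (fst c) (snd c))"

definition fhom :: "('o, 'v, 'a) vcat => 'o btree => 'o btree => 'v" where
 "fhom C s t = fst (coprod C s t)"

text \<open>
 The generalised element \<open>x\<^sub>1 \<otimes> \<dots> \<otimes> x\<^sub>n\<close> after \<open>e\<close> of the hom object from \<open>s\<close>; the leaves \<open>x\<^sub>i\<close> of \<open>p\<close>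
 start at the leaves of \<open>reorder e s\<close>. Maps out of the hom object are determined by such elements.
\<close>

definition elem :: "('o, 'v, 'a) vcat => 'o btree => expr => ('o, 'a) arrow btree => 'a" where
 "elem C s e p = snd (coprod C s (acod p)) (nf (shape s) e) \<cdot> atuple p"

text \<open>Well-typedness of the formal composite at stage \<open>Z\<close> that consists of
  \<open>e\<close> out of \<open>s\<close> followed by the arrows of \<open>p\<close>; its target is
  \<open>acod p\<close>.\<close>

definition good :: "('o, 'v, 'a) vcat => 'v => 'o btree => expr => ('o, 'a) arrow btree => bool" where
 "good C Z s e p \<longleftrightarrow> s <: ob C \<and> p <: arrows C Z \<and> adom p = reorder e s"

definition els :: "('o, 'v, 'a) vcat => 'o btree => 'o btree => 'a set" where
 "els C s t = {elem C s e p | e p Z. good C Z s e p \<and> acod p = t}"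

lemma elem_cong: "eqv (shape s) e e' ==> elem C s e p = elem C s e' p"
 by (simp add: elem_def nf_cong)

lemma goodD:
 assumes "good C Z s e p"
 shows "s <: ob C" "p <: arrows C Z" "adom p = reorder e s" "acod p <: ob C" "Z \<in> Obj V"
 using assms set_adom_acod(2)[of p C Z] arrows_Obj[of p C Z] by (auto simp: good_def)

lemma good_idx: "good C Z s e p ==> nf (shape s) e \<in> idx s (acod p)"
 unfolding idx_def good_def by (simp add: reorder_nf) (metis shape_map)

lemma good_nf: "good C Z s e p ==> good C Z s (nf (shape s) e) p"
 by (simp add: good_def reorder_nf)

lemma good_cong: "eqv (shape s) e e' ==> good C Z s e p \<longleftrightarrow> good C Z s e' p"
 using eqv_reorder[of "shape s" e e' s] by (simp add: good_def)

lemma good_apre: "good C Z s e p ==> k \<in> Hom V Z' Z ==> good C Z' s e (apre k p)"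
 using set_apre[of p C Z k Z'] by (simp add: good_def)

context
 fixes C :: "('o, 'v, 'a) vcat"
 assumes C: "vcategory V C"
begin

lemma coprod:
 assumes "s <: ob C" "t <: ob C"
 shows "distributive_coproduct (idx s t) (\<lambda>e. lpower C (reorder e s) t) (fhom C s t) (snd (coprod C s t))"
proof -
 have "lpower C (reorder e s) t \<in> Obj V" for e using power_Obj[OF C, of "reorder e s" t] assms by simp
 then have "\<exists>H inc. distributive_coproduct (idx s t) (\<lambda>e. lpower C (reorder e s) t) H inc" by (intro ex_coproduct)
 then have "\<exists>c. distributive_coproduct (idx s t) (\<lambda>e. lpower C (reorder e s) t) (fst c) (snd c)" by auto
 from someI_ex[OF this] show ?thesis by (simp add: coprod_def fhom_def)
qed

lemma fhom_Obj: "s <: ob C ==> t <: ob C ==> fhom C s t \<in> Obj V"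
 using coprod by (auto simp: distributive_coproduct_def)

lemma coprod_inj:
 assumes "s <: ob C" "t <: ob C" "e \<in> idx s t"
 shows "snd (coprod C s t) e \<in> Hom V (lpower C (reorder e s) t) (fhom C s t)"
 using coprod[OF assms(1,2)] assms(3) by (auto simp: distributive_coproduct_def)

lemma elem_Hom: assumes g: "good C Z s e p" shows "elem C s e p \<in> Hom V Z (fhom C s (acod p))"
 unfolding elem_def
 by (rule Comp_Hom[OF _ coprod_inj[OF goodD(1,4)[OF g] good_idx[OF g]]])
  (use atuple_Hom[OF C goodD(2)[OF g]] goodD(3)[OF g] in \<open>simp add: reorder_nf\<close>)

lemma elem_Comp: assumes g: "good C Z s e p" and k: "k \<in> Hom V Z' Z" shows "elem C s e p \<cdot> k = elem C s e (apre k p)"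
proof -
 have "atuple p \<in> Hom V Z (lpower C (reorder (nf (shape s) e) s) (acod p))"
  using atuple_Hom[OF C goodD(2)[OF g]] goodD(3)[OF g] by (simp add: reorder_nf)
 from Comp_assoc[OF k this coprod_inj[OF goodD(1,4)[OF g] good_idx[OF g]]]
 show ?thesis using atuple_apre[OF C goodD(2)[OF g] k] by (simp add: elem_def)
qed

text \<open>The universal property in terms of elements. By the Yoneda argument, an arrow out of a
  summand is a family natural in the stage; invariance under \<open>eqv\<close> makes the family
  depend on the summand alone.\<close>

lemma ex_map:
 assumes st: "s <: ob C" "t <: ob C" and W: "W \<in> Obj V" and Y: "Y \<in> Obj V"
  and ty: "\<And>Z e p w. good C Z s e p ==> acod p = t ==> w \<in> Hom V Z W ==> \<phi> Z e p w \<in> Hom V Z Y"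
  and nat: "\<And>Z Z' e p w k. good C Z s e p ==> acod p = t ==> w \<in> Hom V Z W ==> k \<in> Hom V Z' Z ==>
   \<phi> Z e p w \<cdot> k = \<phi> Z' e (apre k p) (w \<cdot> k)"
  and eqv: "\<And>Z e e' p w. good C Z s e p ==> acod p = t ==> w \<in> Hom V Z W ==> eqv (shape s) e e' ==> \<phi> Z e p w = \<phi> Z e' p w"
 shows "\<exists>!m. m \<in> Hom V (Prod V (fhom C s t) W) Y \<and>
  (\<forall>Z e p w. good C Z s e p --> acod p = t --> w \<in> Hom V Z W --> m \<cdot> Tuple V (elem C s e p) w = \<phi> Z e p w)"
proof -
 let ?X = "\<lambda>e. lpower C (reorder e s) t" let ?in = "snd (coprod C s t)"
 have X: "?X e \<in> Obj V" for e using power_Obj[OF C, of "reorder e s" t] st by simp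
 \<comment> \<open>The universal tree of arrows over the summand of \<open>e\<close>: its tuple is
   the first projection.\<close>
 define u where "u e = (SOME p. p <: arrows C (Prod V (?X e) W) \<and> adom p = reorder e s \<and> acod p = t \<and> atuple p = Pr1 V (?X e) W)" for e
 have u: "u e <: arrows C (Prod V (?X e) W)" "adom (u e) = reorder e s" "acod (u e) = t" "atuple (u e) = Pr1 V (?X e) W"
  if "e \<in> idx s t" for e
 proof -
  have "\<exists>p. p <: arrows C (Prod V (?X e) W) \<and> adom p = reorder e s \<and> acod p = t \<and> atuple p = Pr1 V (?X e) W"
   by (rule atuple_surj[OF C]) (use that st X W in \<open>simp_all add: idx_def Hom_iff\<close>)
  from someI_ex[OF this] show "u e <: arrows C (Prod V (?X e) W)" "adom (u e) = reorder e s" "acod (u e) = t" "atuple (u e) = Pr1 V (?X e) W"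
   by (simp_all add: u_def)
 qed
 have ug: "good C (Prod V (?X e) W) s e (u e)" if "e \<in> idx s t" for e using u[OF that] st by (simp add: good_def)
 have p2: "Pr2 V (?X e) W \<in> Hom V (Prod V (?X e) W) W" for e using X W by (simp add: Hom_iff)
 define f where "f e = \<phi> (Prod V (?X e) W) e (u e) (Pr2 V (?X e) W)" for e
 have f: "\<forall>e\<in>idx s t. f e \<in> Hom V (Prod V (?X e) W) Y"
  unfolding f_def using ty[OF ug u(3) p2] by simp
 have uni: "\<exists>!g. g \<in> Hom V (Prod V (fhom C s t) W) Y \<and>
   (\<forall>e\<in>idx s t. g \<cdot> Tuple V (?in e \<cdot> Pr1 V (?X e) W) (Pr2 V (?X e) W) = f e)"
  using coprod[OF st] W Y f unfolding distributive_coproduct_def by simp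
 have iff: "(\<forall>e\<in>idx s t. m \<cdot> Tuple V (?in e \<cdot> Pr1 V (?X e) W) (Pr2 V (?X e) W) = f e) \<longleftrightarrow>
   (\<forall>Z e p w. good C Z s e p --> acod p = t --> w \<in> Hom V Z W --> m \<cdot> Tuple V (elem C s e p) w = \<phi> Z e p w)"
  if m: "m \<in> Hom V (Prod V (fhom C s t) W) Y" for m
 proof (intro iffI allI impI ballI)
  fix Z e p w assume eq: "\<forall>e\<in>idx s t. m \<cdot> Tuple V (?in e \<cdot> Pr1 V (?X e) W) (Pr2 V (?X e) W) = f e"
   and g: "good C Z s e p" and p: "acod p = t" and w: "w \<in> Hom V Z W"
  define e' where "e' = nf (shape s) e"
  have e': "e' \<in> idx s t" using good_idx[OF g] p by (simp add: e'_def)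
  have g': "good C Z s e' p" using good_nf[OF g] by (simp add: e'_def)
  have ap: "atuple p \<in> Hom V Z (?X e')" using atuple_Hom[OF C goodD(2)[OF g']] goodD(3)[OF g'] p by simp
  let ?k = "Tuple V (atuple p) w"
  have k: "?k \<in> Hom V Z (Prod V (?X e') W)" using ap w by simp
  have i: "?in e' \<in> Hom V (?X e') (fhom C s t)" by (rule coprod_inj[OF st e'])
  \<comment> \<open>Every \<open>p\<close> over this summand is the universal tree restricted along
    \<open>?k\<close>, so naturality determines the family from its value at
    \<open>u e'\<close>.\<close>
  have "apre ?k (u e') = p"
  proof (rule atuple_inject[OF C set_apre[OF u(1)[OF e'] k] goodD(2)[OF g]])
   show "atuple (apre ?k (u e')) = atuple p"
    using atuple_apre[OF C u(1)[OF e'] k] u(4)[OF e'] ap w X W by (simp add: Hom_iff)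
  qed (use u[OF e'] goodD(3)[OF g'] p in simp_all)
  moreover have "Pr2 V (?X e') W \<cdot> ?k = w" using ap w by (simp add: Hom_iff)
  ultimately have 1: "f e' \<cdot> ?k = \<phi> Z e' p w"
   using nat[OF ug[OF e'] u(3)[OF e'] p2 k] by (simp add: f_def)
  have "m \<cdot> Tuple V (elem C s e p) w = (m \<cdot> Tuple V (?in e' \<cdot> Pr1 V (?X e') W) (Pr2 V (?X e') W)) \<cdot> ?k"
   using m i ap w X[of e'] W p unfolding elem_def e'_def[symmetric] by (simp add: Hom_iff)
  also have "\<dots> = \<phi> Z e' p w" using eq e' 1 by simp
  also have "\<dots> = \<phi> Z e p w" using eqv[OF g p w eqv_nf] by (simp add: e'_def)
  finally show "m \<cdot> Tuple V (elem C s e p) w = \<phi> Z e p w" .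
 next
  fix e assume eq: "\<forall>Z e p w. good C Z s e p --> acod p = t --> w \<in> Hom V Z W --> m \<cdot> Tuple V (elem C s e p) w = \<phi> Z e p w"
   and e: "e \<in> idx s t"
  have "elem C s e (u e) = ?in e \<cdot> Pr1 V (?X e) W" using u[OF e] e by (simp add: elem_def idx_def)
  then show "m \<cdot> Tuple V (?in e \<cdot> Pr1 V (?X e) W) (Pr2 V (?X e) W) = f e"
   using eq[rule_format, OF ug[OF e] u(3)[OF e] p2] by (simp add: f_def)
 qed
 have "(\<exists>!m. m \<in> Hom V (Prod V (fhom C s t) W) Y \<and>
   (\<forall>e\<in>idx s t. m \<cdot> Tuple V (?in e \<cdot> Pr1 V (?X e) W) (Pr2 V (?X e) W) = f e)) \<longleftrightarrow>
  (\<exists>!m. m \<in> Hom V (Prod V (fhom C s t) W) Y \<and>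
   (\<forall>Z e p w. good C Z s e p --> acod p = t --> w \<in> Hom V Z W --> m \<cdot> Tuple V (elem C s e p) w = \<phi> Z e p w))"
  by (intro arg_cong[where f = Ex1] ext conj_cong HOL.refl iff)
 from iffD1[OF this uni] show ?thesis .
qed

text \<open>The uniqueness half of \<open>ex_map\<close>, for the family that \<open>g\<close>
  itself defines.\<close>

lemma dense_els:
 assumes st: "s <: ob C" "t <: ob C"
 shows "dense (fhom C s t) (els C s t)"
 unfolding dense_def
proof (intro conjI ballI impI allI)
 show "fhom C s t \<in> Obj V" by (rule fhom_Obj[OF st])
 fix x assume "x \<in> els C s t"
 then obtain e p Z where x: "x = elem C s e p" "good C Z s e p" "acod p = t" by (auto simp: els_def)
 from elem_Hom[OF x(2)] x show "x \<in> Arr V" "Cod V x = fhom C s t" by (simp_all add: Hom_iff)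
 fix k assume "k \<in> Arr V" "Cod V k = Dom V x"
 with elem_Hom[OF x(2)] x have k: "k \<in> Hom V (Dom V k) Z" by (simp add: Hom_iff)
 have "x \<cdot> k = elem C s e (apre k p)" using elem_Comp[OF x(2) k] x(1) by simp
 moreover have "good C (Dom V k) s e (apre k p)" by (rule good_apre[OF x(2) k])
 moreover have "acod (apre k p) = t" using x(3) by simp
 ultimately show "x \<cdot> k \<in> els C s t" unfolding els_def by blast
next
 fix W f g assume W: "W \<in> Obj V" and f: "f \<in> Arr V" "Dom V f = Prod V (fhom C s t) W" and g: "g \<in> Arr V" "Dom V g = Prod V (fhom C s t) W"
  and fg: "Cod V f = Cod V g"
  and eq: "\<forall>x\<in>els C s t. \<forall>w\<in>Arr V. Dom V w = Dom V x --> Cod V w = W --> f \<cdot> Tuple V x w = g \<cdot> Tuple V x w"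
 let ?Y = "Cod V g"
 have h: "f \<in> Hom V (Prod V (fhom C s t) W) ?Y" "g \<in> Hom V (Prod V (fhom C s t) W) ?Y" using f g fg by (simp_all add: Hom_iff)
 have "\<exists>!m. m \<in> Hom V (Prod V (fhom C s t) W) ?Y \<and>
  (\<forall>Z e p w. good C Z s e p --> acod p = t --> w \<in> Hom V Z W --> m \<cdot> Tuple V (elem C s e p) w = g \<cdot> Tuple V (elem C s e p) w)"
 proof (rule ex_map[OF st W])
  fix Z e p w assume a: "good C Z s e p" "acod p = t" "w \<in> Hom V Z W"
  have x: "Tuple V (elem C s e p) w \<in> Hom V Z (Prod V (fhom C s t) W)" using elem_Hom[OF a(1)] a by simp
  show "g \<cdot> Tuple V (elem C s e p) w \<in> Hom V Z ?Y" by (rule Comp_Hom[OF x h(2)])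
  fix Z' k assume k: "k \<in> Hom V Z' Z"
  show "(g \<cdot> Tuple V (elem C s e p) w) \<cdot> k = g \<cdot> Tuple V (elem C s e (apre k p)) (w \<cdot> k)"
   using Comp_assoc[OF k x h(2)] Tuple_precomp[OF elem_Hom[OF a(1)] a(3) k] elem_Comp[OF a(1) k] by simp
 next
  fix Z e e' p w assume "eqv (shape s) e e'"
  then show "g \<cdot> Tuple V (elem C s e p) w = g \<cdot> Tuple V (elem C s e' p) w" by (simp add: elem_cong)
 qed (use g in simp)
 moreover have "f \<cdot> Tuple V (elem C s e p) w = g \<cdot> Tuple V (elem C s e p) w"
  if "good C Z s e p" "acod p = t" "w \<in> Hom V Z W" for Z e p w
 proof -
  have "elem C s e p \<in> els C s t" using that by (auto simp: els_def)
  then show ?thesis using eq that elem_Hom[OF that(1)] by (simp add: Hom_iff)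
 qed
 ultimately show "f = g" using h by blast
qed

text \<open>The parameter in \<open>ex_map\<close> is taken to be \<open>Term V\<close> and then
  removed by pairing with the unique map.\<close>

lemma ex_map1:
 assumes st: "s <: ob C" "t <: ob C" and Y: "Y \<in> Obj V"
  and ty: "\<And>Z e p. good C Z s e p ==> acod p = t ==> \<phi> Z e p \<in> Hom V Z Y"
  and nat: "\<And>Z Z' e p k. good C Z s e p ==> acod p = t ==> k \<in> Hom V Z' Z ==> \<phi> Z e p \<cdot> k = \<phi> Z' e (apre k p)"
  and eqv: "\<And>Z e e' p. good C Z s e p ==> acod p = t ==> eqv (shape s) e e' ==> \<phi> Z e p = \<phi> Z e' p"
 shows "\<exists>m. m \<in> Hom V (fhom C s t) Y \<and> (\<forall>Z e p. good C Z s e p --> acod p = t --> m \<cdot> elem C s e p = \<phi> Z e p)"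
proof -
 let ?H = "fhom C s t" note H = fhom_Obj[OF st]
 have "\<exists>!m. m \<in> Hom V (Prod V ?H (Term V)) Y \<and>
  (\<forall>Z e p w. good C Z s e p --> acod p = t --> w \<in> Hom V Z (Term V) --> m \<cdot> Tuple V (elem C s e p) w = \<phi> Z e p)"
  by (rule ex_map[OF st Term_Obj Y]) (rule ty nat eqv; assumption)+
 then obtain m where m: "m \<in> Hom V (Prod V ?H (Term V)) Y"
  "\<And>Z e p w. good C Z s e p ==> acod p = t ==> w \<in> Hom V Z (Term V) ==> m \<cdot> Tuple V (elem C s e p) w = \<phi> Z e p"
  by blast
 have b: "Tuple V (Ide V ?H) (Bang V ?H) \<in> Hom V ?H (Prod V ?H (Term V))" using H by (simp add: Hom_iff)
 have "(m \<cdot> Tuple V (Ide V ?H) (Bang V ?H)) \<cdot> elem C s e p = \<phi> Z e p" if a: "good C Z s e p" "acod p = t" for Z e p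
 proof -
  have x: "elem C s e p \<in> Hom V Z ?H" using elem_Hom[OF a(1)] a(2) by simp
  have "Tuple V (Ide V ?H) (Bang V ?H) \<cdot> elem C s e p = Tuple V (elem C s e p) (Bang V Z)" using x H by (simp add: Hom_iff)
  then show ?thesis using Comp_assoc[OF x b m(1)] m(2)[OF a, of "Bang V Z"] HomD(4)[OF x] by simp
 qed
 then show ?thesis using Comp_Hom[OF b m(1)] by blast
qed

text \<open>In place of currying, an element of the first coproduct is fixed together with its stage
  \<open>Z\<close>, which serves as parameter for the second. The resulting partial maps are natural
  in that element, and \<open>ex_map\<close> glues them with the second coproduct as
  parameter.\<close>

lemma ex_map2:
 assumes st: "s <: ob C" "t <: ob C" and st': "s' <: ob C" "t' <: ob C" and Y: "Y \<in> Obj V"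
  and ty: "\<And>Z e p e' p'. good C Z s e p ==> acod p = t ==> good C Z s' e' p' ==> acod p' = t' ==> \<phi> Z e p e' p' \<in> Hom V Z Y"
  and nat: "\<And>Z Z' e p e' p' k. good C Z s e p ==> acod p = t ==> good C Z s' e' p' ==> acod p' = t' ==> k \<in> Hom V Z' Z ==>
   \<phi> Z e p e' p' \<cdot> k = \<phi> Z' e (apre k p) e' (apre k p')"
  and eqv: "\<And>Z e f p e' p'. good C Z s e p ==> acod p = t ==> good C Z s' e' p' ==> acod p' = t' ==> eqv (shape s) e f ==>
   \<phi> Z e p e' p' = \<phi> Z f p e' p'"
  and eqv': "\<And>Z e p e' f' p'. good C Z s e p ==> acod p = t ==> good C Z s' e' p' ==> acod p' = t' ==> eqv (shape s') e' f' ==>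
   \<phi> Z e p e' p' = \<phi> Z e p f' p'"
 shows "\<exists>m. m \<in> Hom V (Prod V (fhom C s t) (fhom C s' t')) Y \<and>
  (\<forall>Z e p e' p'. good C Z s e p --> acod p = t --> good C Z s' e' p' --> acod p' = t' -->
   m \<cdot> Tuple V (elem C s e p) (elem C s' e' p') = \<phi> Z e p e' p')"
proof -
 let ?H = "fhom C s t" let ?H' = "fhom C s' t'"
 note H = fhom_Obj[OF st] and H' = fhom_Obj[OF st']
 \<comment> \<open>\<open>P Z e p m\<close> says that \<open>m\<close> is the partial map for the
   fixed pair (\<open>e\<close>, \<open>p\<close>). Its second argument is an element
   \<open>z\<close> of the stage, along which \<open>p\<close> is restricted.\<close>
 define P where "P Z e p m \<longleftrightarrow> m \<in> Hom V (Prod V ?H' Z) Y \<and> (\<forall>Z' e' p' z. good C Z' s' e' p' --> acod p' = t' --> z \<in> Hom V Z' Z -->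
   m \<cdot> Tuple V (elem C s' e' p') z = \<phi> Z' e (apre z p) e' p')" for Z e p m
 have ex1: "\<exists>!m. P Z e p m" if g: "good C Z s e p" "acod p = t" for Z e p
  unfolding P_def
 proof (rule ex_map[OF st' goodD(5)[OF g(1)] Y])
  fix Z' e' p' z assume a: "good C Z' s' e' p'" "acod p' = t'" "z \<in> Hom V Z' Z"
  have g': "good C Z' s e (apre z p)" "acod (apre z p) = t" using good_apre[OF g(1) a(3)] g(2) by simp_all
  show "\<phi> Z' e (apre z p) e' p' \<in> Hom V Z' Y" by (rule ty[OF g' a(1,2)])
  show "\<phi> Z' e (apre z p) e' p' = \<phi> Z' e (apre z p) f' p'" if "eqv (shape s') e' f'" for f'
   by (rule eqv'[OF g' a(1,2) that])
  fix Z'' k assume k: "k \<in> Hom V Z'' Z'"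
  have "apre k (apre z p) = apre (z \<cdot> k) p"
  proof (rule atuple_inject[OF C set_apre[OF set_apre[OF goodD(2)[OF g(1)] a(3)] k] set_apre[OF goodD(2)[OF g(1)] Comp_Hom[OF k a(3)]]])
   show "atuple (apre k (apre z p)) = atuple (apre (z \<cdot> k) p)"
    using atuple_apre[OF C set_apre[OF goodD(2)[OF g(1)] a(3)] k] atuple_apre[OF C goodD(2)[OF g(1)] a(3)] atuple_apre[OF C goodD(2)[OF g(1)] Comp_Hom[OF k a(3)]]
     Comp_assoc[OF k a(3) atuple_Hom[OF C goodD(2)[OF g(1)]]] by simp
  qed simp_all
  then show "\<phi> Z' e (apre z p) e' p' \<cdot> k = \<phi> Z'' e (apre (z \<cdot> k) p) e' (apre k p')" using nat[OF g' a(1,2) k] by simp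
 qed
 define m where "m Z e p = (THE m. P Z e p m)" for Z e p
 have m: "P Z e p (m Z e p)" if "good C Z s e p" "acod p = t" for Z e p
  unfolding m_def by (rule theI'[OF ex1[OF that]])
 have m_eq: "m Z e p = m'" if "good C Z s e p" "acod p = t" "P Z e p m'" for Z e p m'
  using ex1[OF that(1,2)] m[OF that(1,2)] that(3) by blast
 \<comment> \<open>Since \<open>w\<close> already lives at stage \<open>Z\<close>, the stage
   variable of the partial map is set to the identity.\<close>
 define \<psi> where "\<psi> Z e p w = m Z e p \<cdot> Tuple V w (Ide V Z)" for Z e p w
 have apre_id: "apre (Ide V Z) p = p" if "p <: arrows C Z" for Z and p :: "('o, 'a) arrow btree"
  using that unfolding apre_def by (intro btree.map_ident_strong) (auto simp: arrows_def Comp_Ide)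
 have "\<exists>!n. n \<in> Hom V (Prod V ?H ?H') Y \<and>
  (\<forall>Z e p w. good C Z s e p --> acod p = t --> w \<in> Hom V Z ?H' --> n \<cdot> Tuple V (elem C s e p) w = \<psi> Z e p w)"
 proof (rule ex_map[OF st H' Y])
  fix Z e p w assume g: "good C Z s e p" "acod p = t" and w: "w \<in> Hom V Z ?H'"
  note Z = goodD(5)[OF g(1)]
  have mh: "m Z e p \<in> Hom V (Prod V ?H' Z) Y" using m[OF g] by (simp add: P_def)
  have wi: "Tuple V w (Ide V Z) \<in> Hom V Z (Prod V ?H' Z)" using w Z by (simp add: Ide_Hom)
  show "\<psi> Z e p w \<in> Hom V Z Y" unfolding \<psi>_def by (rule Comp_Hom[OF wi mh])
  fix Z' k assume k: "k \<in> Hom V Z' Z"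
  have Z': "Z' \<in> Obj V" using HomD(4)[OF k] .
  have g': "good C Z' s e (apre k p)" "acod (apre k p) = t" using good_apre[OF g(1) k] g(2) by simp_all
  let ?t = "Tuple V (Pr1 V ?H' Z') (k \<cdot> Pr2 V ?H' Z')"
  have t: "?t \<in> Hom V (Prod V ?H' Z') (Prod V ?H' Z)" using k H' Z' by (simp add: Hom_iff)
  \<comment> \<open>Restricting \<open>p\<close> along \<open>k\<close> amounts to composing the
    partial map with \<open>k\<close> in its stage variable; uniqueness of partial maps turns this
    into naturality.\<close>
  have "P Z' e (apre k p) (m Z e p \<cdot> ?t)"
   unfolding P_def
  proof (intro conjI allI impI)
   show "m Z e p \<cdot> ?t \<in> Hom V (Prod V ?H' Z') Y" by (rule Comp_Hom[OF t mh])
   fix Z'' e' p' z assume a: "good C Z'' s' e' p'" "acod p' = t'" and z: "z \<in> Hom V Z'' Z'"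
   have el: "elem C s' e' p' \<in> Hom V Z'' ?H'" using elem_Hom[OF a(1)] a(2) by simp
   have kz: "k \<cdot> z \<in> Hom V Z'' Z" by (rule Comp_Hom[OF z k])
   have ap: "apre z (apre k p) = apre (k \<cdot> z) p"
   proof (rule atuple_inject[OF C set_apre[OF goodD(2)[OF g'(1)] z] set_apre[OF goodD(2)[OF g(1)] kz]])
    show "atuple (apre z (apre k p)) = atuple (apre (k \<cdot> z) p)"
     using atuple_apre[OF C goodD(2)[OF g'(1)] z] atuple_apre[OF C goodD(2)[OF g(1)] k] atuple_apre[OF C goodD(2)[OF g(1)] kz]
      Comp_assoc[OF z k atuple_Hom[OF C goodD(2)[OF g(1)]]] by simp
   qed simp_all
   have "(m Z e p \<cdot> ?t) \<cdot> Tuple V (elem C s' e' p') z = m Z e p \<cdot> Tuple V (elem C s' e' p') (k \<cdot> z)"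
    using mh k z el H' Z' by (simp add: Hom_iff)
   also have "\<dots> = \<phi> Z'' e (apre z (apre k p)) e' p'" using m[OF g] a kz unfolding P_def ap by blast
   finally show "(m Z e p \<cdot> ?t) \<cdot> Tuple V (elem C s' e' p') z = \<phi> Z'' e (apre z (apre k p)) e' p'" .
  qed
  from m_eq[OF g' this] show "\<psi> Z e p w \<cdot> k = \<psi> Z' e (apre k p) (w \<cdot> k)"
   using mh k w H' Z Z' by (simp add: \<psi>_def Hom_iff)
 next
  fix Z e f p w assume g: "good C Z s e p" "acod p = t" and ef: "eqv (shape s) e f"
  have g2: "good C Z s f p" using g(1) good_cong[OF ef] by simp
  have "P Z e p (m Z f p)"
   unfolding P_def
  proof (intro conjI allI impI)
   show "m Z f p \<in> Hom V (Prod V ?H' Z) Y" using m[OF g2 g(2)] by (simp add: P_def)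
   fix Z' e' p' z assume a: "good C Z' s' e' p'" "acod p' = t'" and z: "z \<in> Hom V Z' Z"
   have g': "good C Z' s e (apre z p)" "acod (apre z p) = t" using good_apre[OF g(1) z] g(2) by simp_all
   have "m Z f p \<cdot> Tuple V (elem C s' e' p') z = \<phi> Z' f (apre z p) e' p'" using m[OF g2 g(2)] a z unfolding P_def by blast
   then show "m Z f p \<cdot> Tuple V (elem C s' e' p') z = \<phi> Z' e (apre z p) e' p'" using eqv[OF g' a ef] by simp
  qed
  from m_eq[OF g this] show "\<psi> Z e p w = \<psi> Z f p w" by (simp add: \<psi>_def)
 qed
 then obtain n where n: "n \<in> Hom V (Prod V ?H ?H') Y"
  "\<And>Z e p w. good C Z s e p ==> acod p = t ==> w \<in> Hom V Z ?H' ==> n \<cdot> Tuple V (elem C s e p) w = \<psi> Z e p w" by blast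
 have "n \<cdot> Tuple V (elem C s e p) (elem C s' e' p') = \<phi> Z e p e' p'"
  if g: "good C Z s e p" "acod p = t" and a: "good C Z s' e' p'" "acod p' = t'" for Z e p e' p'
 proof -
  have el: "elem C s' e' p' \<in> Hom V Z ?H'" using elem_Hom[OF a(1)] a(2) by simp
  have "m Z e p \<cdot> Tuple V (elem C s' e' p') (Ide V Z) = \<phi> Z e (apre (Ide V Z) p) e' p'"
   using m[OF g] a Ide_Hom[OF goodD(5)[OF g(1)]] unfolding P_def by blast
  then show ?thesis using n(2)[OF g el] apre_id[OF goodD(2)[OF g(1)]] by (simp add: \<psi>_def)
 qed
 with n(1) show ?thesis by blast
qed

end

end

text \<open>Cells of \<open>VCat U V\<close> have their objects in \<open>'u\<close>, in a small
  set. Trees are therefore stored through an injective coding that preserves smallness.\<close>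

locale free_construction = distributive_category V + universe U
 for V :: "('v, 'a) cartcat" (structure) and U :: "'u univ" +
 fixes enc :: "'u btree => 'u"
 assumes inj_enc: "inj enc"
  and enc_small: "A \<in> Small U ==> enc ` {t. t <: A} \<in> Small U"
begin

abbreviation dec :: "'u => 'u btree" where
 "dec \<equiv> the_inv enc"

lemma dec_enc [simp]: "dec (enc t) = t"
 by (rule the_inv_f_f[OF inj_enc])

lemma enc_eq [simp]: "enc s = enc t \<longleftrightarrow> s = t"
 using inj_enc by (simp add: inj_eq)

definition Fob :: "('u, 'v, 'a) vcat => 'u set" where
 "Fob C = enc ` {t. t <: ob C}"

lemma enc_Fob [simp]: "enc t \<in> Fob C \<longleftrightarrow> t <: ob C"
 by (auto simp: Fob_def)

lemma FobE: assumes "x \<in> Fob C" obtains t where "x = enc t" "t <: ob C"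
 using assms by (auto simp: Fob_def)

text \<open>Composing \<open>q\<close> after \<open>e'\<close> with \<open>p\<close> after
  \<open>e\<close> requires moving \<open>e'\<close> past the arrows of \<open>p\<close>. By
  naturality these are permuted by \<open>e'\<close>, after which terms and arrows compose
  separately.\<close>

definition fcmp :: "('u, 'v, 'a) vcat => 'u btree => 'u btree => 'u btree => 'a" where
 "fcmp C s t u = (SOME m. m \<in> Hom V (Prod V (fhom C t u) (fhom C s t)) (fhom C s u) \<and>
   (\<forall>Z e' q e p. good C Z t e' q --> acod q = u --> good C Z s e p --> acod p = t -->
    m \<cdot> Tuple V (elem C t e' q) (elem C s e p) = elem C s (EComp e' e) (acomp C q (reorder e' p))))"

definition ften :: "('u, 'v, 'a) vcat => 'u btree => 'u btree => 'u btree => 'u btree => 'a" where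
 "ften C s s' t t' = (SOME m. m \<in> Hom V (Prod V (fhom C s t) (fhom C s' t')) (fhom C (Nd s s') (Nd t t')) \<and>
   (\<forall>Z e p f q. good C Z s e p --> acod p = t --> good C Z s' f q --> acod q = t' -->
    m \<cdot> Tuple V (elem C s e p) (elem C s' f q) = elem C (Nd s s') (ETens e f) (Nd p q)))"

definition Fr :: "('u, 'v, 'a) vcat => ('u, 'v, 'a) vcat" where
 "Fr C = \<lparr>ob = Fob C,
   hm = (\<lambda>x y. if x \<in> Fob C \<and> y \<in> Fob C then fhom C (dec x) (dec y) else undefined),
   cmp = (\<lambda>x y z. if x \<in> Fob C \<and> y \<in> Fob C \<and> z \<in> Fob C then fcmp C (dec x) (dec y) (dec z) else undefined),
   unt = (\<lambda>x. if x \<in> Fob C then elem C (dec x) EId (aid C (Term V) (dec x)) else undefined)\<rparr>"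

definition FA :: "('u, 'v, 'a) vcat => 'u => 'u => 'a set" where
 "FA C x y = els C (dec x) (dec y)"

definition FT :: "('u, 'v, 'a) vcat => ('u \<times> 'u, 'u, 'v, 'a) vfun" where
 "FT C = \<lparr>fsrc = vcat_prod V (Fr C) (Fr C), ftgt = Fr C,
   fob = (\<lambda>(x, y)\<in>Fob C \<times> Fob C. enc (Nd (dec x) (dec y))),
   fhm = (\<lambda>x y. if x \<in> Fob C \<times> Fob C \<and> y \<in> Fob C \<times> Fob C
    then ften C (dec (fst x)) (dec (snd x)) (dec (fst y)) (dec (snd y)) else undefined)\<rparr>"

text \<open>Each constraint is the term of the same name with identity arrows at the leaves.\<close>

definition FM :: "('u, 'v, 'a) vcat => ('u, 'v, 'a) symmon" where
 "FM C = mk_symmon (Fr C) (FT C)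
   (\<lambda>x y z. elem C (Nd (Nd (dec x) (dec y)) (dec z)) EAs (aid C (Term V) (Nd (dec x) (Nd (dec y) (dec z)))))
   (\<lambda>x y. elem C (Nd (dec x) (dec y)) ESy (aid C (Term V) (Nd (dec y) (dec x))))"

definition FE :: "('u, 'v, 'a) vcat => ('u, 'u, 'v, 'a) vfun" where
 "FE C = \<lparr>fsrc = C, ftgt = Fr C, fob = (\<lambda>a\<in>ob C. enc (Lf a)),
   fhm = (\<lambda>a b. if a \<in> ob C \<and> b \<in> ob C then elem C (Lf a) EId (Lf (a, Ide V (hm C a b), b)) else undefined)\<rparr>"

abbreviation "fT C \<equiv> tob (FM C)"
abbreviation "fU C \<equiv> ucomp V (Fr C)"
abbreviation "fR C \<equiv> tarr V (FM C)"
abbreviation "coh C s e t \<equiv> elem C s e (aid C (Term V) t)"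

lemma Fr_simps [simp]: "ob (Fr C) = Fob C"
 "s <: ob C ==> t <: ob C ==> hm (Fr C) (enc s) (enc t) = fhom C s t"
 "[|s <: ob C; t <: ob C; u <: ob C|] ==> cmp (Fr C) (enc s) (enc t) (enc u) = fcmp C s t u"
 "s <: ob C ==> unt (Fr C) (enc s) = coh C s EId s"
 by (simp_all add: Fr_def)

context
 fixes C :: "('u, 'v, 'a) vcat"
 assumes C: "vcategory V C"
begin

lemma good_aid: "s <: ob C ==> Z \<in> Obj V ==> t = reorder e s ==> good C Z s e (aid C Z t)"
 using set_aid[OF C, of "reorder e s" Z] by (simp add: good_def)

lemma good_comp:
 assumes q: "good C Z t e' q" and p: "good C Z s e p" "acod p = t"
 shows "good C Z s (EComp e' e) (acomp C q (reorder e' p))" "acod (acomp C q (reorder e' p)) = acod q"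
proof -
 have "reorder e' p <: arrows C Z" "adom q = acod (reorder e' p)"
  using goodD[OF p(1)] goodD[OF q] p(2) by (simp_all add: map_reorder)
 note a = acomp_props[OF C this(1) goodD(2)[OF q] this(2)]
 show "good C Z s (EComp e' e) (acomp C q (reorder e' p))" "acod (acomp C q (reorder e' p)) = acod q"
  using a goodD[OF p(1)] by (simp_all add: good_def map_reorder)
qed

lemma good_ETens: "good C Z s e p ==> good C Z t f q ==> good C Z (Nd s t) (ETens e f) (Nd p q)"
 by (simp add: good_def)

lemma elem_fhom: "good C Z s e p ==> acod p = t ==> elem C s e p \<in> Hom V Z (fhom C s t)"
 using elem_Hom[OF C] by blast

lemma elem_hm: "good C Z s e p ==> acod p = t ==> elem C s e p \<in> El (Fr C) Z (enc s) (enc t)"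
 using elem_fhom goodD(1,4) by (metis Fr_simps(2))

text \<open>The composition rule respects equivalence of both terms and change of stage, as
  \<open>ex_map2\<close> demands.\<close>

lemma fcmp:
 assumes st: "s <: ob C" "t <: ob C" "u <: ob C"
 shows "fcmp C s t u \<in> Hom V (Prod V (fhom C t u) (fhom C s t)) (fhom C s u)"
  "[|good C Z t e' q; acod q = u; good C Z s e p; acod p = t|] ==>
    fcmp C s t u \<cdot> Tuple V (elem C t e' q) (elem C s e p) = elem C s (EComp e' e) (acomp C q (reorder e' p))"
proof -
 have "\<exists>m. m \<in> Hom V (Prod V (fhom C t u) (fhom C s t)) (fhom C s u) \<and>
   (\<forall>Z e' q e p. good C Z t e' q --> acod q = u --> good C Z s e p --> acod p = t -->
    m \<cdot> Tuple V (elem C t e' q) (elem C s e p) = elem C s (EComp e' e) (acomp C q (reorder e' p)))"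
 proof (rule ex_map2[OF C st(2,3,1,2) fhom_Obj[OF C st(1,3)]])
  fix Z e' q e p assume q: "good C Z t e' q" "acod q = u" and p: "good C Z s e p" "acod p = t"
  show "elem C s (EComp e' e) (acomp C q (reorder e' p)) \<in> Hom V Z (fhom C s u)"
   by (rule elem_fhom[OF good_comp(1)[OF q(1) p]]) (use good_comp(2)[OF q(1) p] q in simp)
  have sp: "shape p = shape t" using p(2) by auto
  show "elem C s (EComp e' e) (acomp C q (reorder e' p)) = elem C s (EComp f' e) (acomp C q (reorder f' p))" if f: "eqv (shape t) e' f'" for f'
  proof -
   have "shape (adom p) = shape p" by simp
   \<comment> \<open>\<open>eqv.comp\<close> asks for equivalence at the shape reached by
     \<open>e\<close>; this is the shape of \<open>t\<close>, because a tree of arrows has ends of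
     equal shape.\<close>
   then have sh: "reorder e (shape s) = shape t" using sp goodD(3)[OF p(1)] by (simp flip: map_reorder)
   have "eqv (shape s) (EComp e' e) (EComp f' e)" by (rule eqv.comp[OF eqv.refl]) (simp add: sh f)
   then show ?thesis using eqv_reorder[OF f sp] by (simp add: elem_cong)
  qed
  show "elem C s (EComp e' e) (acomp C q (reorder e' p)) = elem C s (EComp e' f) (acomp C q (reorder e' p))" if "eqv (shape s) e f" for f
   by (rule elem_cong[OF eqv.comp[OF that eqv.refl]])
  fix Z' k assume k: "k \<in> Hom V Z' Z"
  have r: "reorder e' p <: arrows C Z" "adom q = acod (reorder e' p)"
   using goodD[OF p(1)] goodD[OF q(1)] p(2) by (simp_all add: map_reorder)
  show "elem C s (EComp e' e) (acomp C q (reorder e' p)) \<cdot> k = elem C s (EComp e' e) (acomp C (apre k q) (reorder e' (apre k p)))"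
   unfolding elem_Comp[OF C good_comp(1)[OF q(1) p] k] using acomp_apre[OF C r(1) goodD(2)[OF q(1)] r(2) k] by simp
 qed
 from someI_ex[OF this]
 show "fcmp C s t u \<in> Hom V (Prod V (fhom C t u) (fhom C s t)) (fhom C s u)"
  "[|good C Z t e' q; acod q = u; good C Z s e p; acod p = t|] ==>
    fcmp C s t u \<cdot> Tuple V (elem C t e' q) (elem C s e p) = elem C s (EComp e' e) (acomp C q (reorder e' p))"
  unfolding fcmp_def by blast+
qed

lemma ucomp_elem:
 assumes q: "good C Z t e' q" "acod q = u" and p: "good C Z s e p" "acod p = t"
 shows "fU C (enc s) (enc t) (enc u) (elem C t e' q) (elem C s e p) = elem C s (EComp e' e) (acomp C q (reorder e' p))"
 using fcmp[OF goodD(1)[OF p(1)] goodD(1)[OF q(1)] goodD(4)[OF q(1), unfolded q(2)]] assms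
  goodD(1)[OF p(1)] goodD(1)[OF q(1)] goodD(4)[OF q(1)] by (simp add: ucomp_def)

text \<open>Composition with a pure coherence isomorphism, whose leaves carry identities: the terms
  compose and the arrows are only permuted.\<close>

lemma ucomp_aid_left:
 assumes p: "good C Z s e p" "acod p = t" and u: "u = reorder e' t"
 shows "fU C (enc s) (enc t) (enc u) (elem C t e' (aid C Z u)) (elem C s e p) = elem C s (EComp e' e) (reorder e' p)"
proof -
 have t: "t <: ob C" using goodD(4)[OF p(1)] p(2) by simp
 have r: "reorder e' p <: arrows C Z" "u = acod (reorder e' p)" using goodD[OF p(1)] p(2) u by (simp_all add: map_reorder)
 show ?thesis using ucomp_elem[OF good_aid[OF t goodD(5)[OF p(1)] u] _ p] acomp_aid(1)[OF C r(1)] r(2) by simp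
qed

lemma ucomp_aid_right:
 assumes q: "good C Z t e' q" "acod q = u" and t: "t = reorder e s" and s: "s <: ob C"
 shows "fU C (enc s) (enc t) (enc u) (elem C t e' q) (elem C s e (aid C Z t)) = elem C s (EComp e' e) q"
 using ucomp_elem[OF q good_aid[OF s goodD(5)[OF q(1)] t]] acomp_aid(2)[OF C goodD(2)[OF q(1)]] goodD(3)[OF q(1)] by simp

lemma ucomp_aid_aid:
 assumes s: "s <: ob C" and t: "t = reorder e s" and u: "u = reorder e' t" and Z: "Z \<in> Obj V"
 shows "fU C (enc s) (enc t) (enc u) (elem C t e' (aid C Z u)) (elem C s e (aid C Z t)) = elem C s (EComp e' e) (aid C Z u)"
 using ucomp_aid_right[OF good_aid[OF _ Z u] _ t s] s t by simp

lemma elsE: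
 assumes "f \<in> els C s t" "Dom V f = Z"
 obtains e p where "f = elem C s e p" "good C Z s e p" "acod p = t"
proof -
 obtain e p Z' where f: "f = elem C s e p" "good C Z' s e p" "acod p = t" using assms(1) by (auto simp: els_def)
 then have "Z' = Z" using elem_Hom[OF C f(2)] assms(2) by (simp add: Hom_iff)
 with f that show ?thesis by blast
qed

lemma dfam_FA: "dfam (Fr C) (FA C)"
 unfolding dfam_def FA_def using dense_els[OF C] by (auto elim!: FobE)

lemma unt_stage: "s <: ob C ==> Z \<in> Obj V ==> uid (Fr C) Z (enc s) = elem C s EId (aid C Z s)"
 using elem_Comp[OF C good_aid[of s "Term V" s EId] Bang_Hom[of Z]] apre_aid[OF C _ Bang_Hom[of Z]] by (simp add: uid_def)

text \<open>On dense elements each law splits into an equivalence of terms and a leafwise law for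
  the arrows. For associativity, \<open>acomp_reorder\<close> lets a permutation pass through a
  leafwise composite.\<close>

lemma vcategory_Fr: "vcategory V (Fr C)"
proof (rule vcategoryI[OF dfam_FA], unfold Fr_simps)
 fix x y z assume "x \<in> Fob C" "y \<in> Fob C" "z \<in> Fob C"
 then obtain s t u where x: "x = enc s" "y = enc t" "z = enc u" and s: "s <: ob C" "t <: ob C" "u <: ob C"
  by (elim FobE)
 show "cmp (Fr C) x y z \<in> El (Fr C) (Prod V (hm (Fr C) y z) (hm (Fr C) x y)) x z"
  using x s fcmp(1)[OF s] by simp
next
 fix x assume "x \<in> Fob C"
 then obtain s where x: "x = enc s" and s: "s <: ob C" by (elim FobE)
 show "unt (Fr C) x \<in> El (Fr C) (Term V) x x"
  unfolding x Fr_simps(4)[OF s] by (rule elem_hm[OF good_aid[OF s]]) simp_all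
next
 fix x y z w f g h Z assume "x \<in> Fob C" "y \<in> Fob C" "z \<in> Fob C" "w \<in> Fob C" and f: "h \<in> FA C z w" "g \<in> FA C y z" "f \<in> FA C x y"
  and Z: "Dom V h = Z" "Dom V g = Z" "Dom V f = Z"
 then obtain s t u v where x: "x = enc s" "y = enc t" "z = enc u" "w = enc v"
  and s: "s <: ob C" "t <: ob C" "u <: ob C" "v <: ob C"
  by (elim FobE)
 obtain e p where p: "f = elem C s e p" "good C Z s e p" "acod p = t" by (rule elsE[OF _ Z(3)]) (use f x in \<open>simp add: FA_def\<close>)
 obtain e' q where q: "g = elem C t e' q" "good C Z t e' q" "acod q = u" by (rule elsE[OF _ Z(2)]) (use f x in \<open>simp add: FA_def\<close>)
 obtain e'' r where r: "h = elem C u e'' r" "good C Z u e'' r" "acod r = v" by (rule elsE[OF _ Z(1)]) (use f x in \<open>simp add: FA_def\<close>)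
 note rq = good_comp[OF r(2) q(2,3)] and qp = good_comp[OF q(2) p(2,3)]
 have rqv: "acod (acomp C r (reorder e'' q)) = v" "acod (acomp C q (reorder e' p)) = u" using rq(2) qp(2) r q by simp_all
 have sp: "reorder e'' (reorder e' p) <: arrows C Z" "reorder e'' q <: arrows C Z"
  "adom (reorder e'' q) = acod (reorder e'' (reorder e' p))" "adom r = acod (reorder e'' q)" "adom q = acod (reorder e' p)"
  using goodD[OF p(2)] goodD[OF q(2)] goodD[OF r(2)] p q r by (simp_all add: map_reorder)
 show "fU C x y w (fU C y z w h g) f = fU C x z w h (fU C x y z g f)"
  unfolding x p(1) q(1) r(1) ucomp_elem[OF r(2,3) q(2,3)] ucomp_elem[OF q(2,3) p(2,3)] ucomp_elem[OF rq(1) rqv(1) p(2,3)] ucomp_elem[OF r(2,3) qp(1) rqv(2)]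
  using elem_cong[OF eqv.assoc] acomp_assoc[OF C sp(1,2) goodD(2)[OF r(2)] sp(3,4)] acomp_reorder[OF C sp(5)] by simp
next
 fix x y f Z assume "x \<in> Fob C" "y \<in> Fob C" and f: "f \<in> FA C x y" "Dom V f = Z"
 then obtain s t where x: "x = enc s" "y = enc t" and s: "s <: ob C" "t <: ob C" by (elim FobE)
 obtain e p where p: "f = elem C s e p" "good C Z s e p" "acod p = t" by (rule elsE[OF _ f(2)]) (use f x in \<open>simp add: FA_def\<close>)
 note Z = goodD(5)[OF p(2)]
 show "fU C x y y (uid (Fr C) Z y) f = f"
  unfolding x p(1) unt_stage[OF s(2) Z] using ucomp_aid_left[OF p(2,3), of t EId] elem_cong[OF eqv.idl] by simp
 show "fU C x x y f (uid (Fr C) Z x) = f"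
  unfolding x p(1) unt_stage[OF s(1) Z] using ucomp_aid_right[OF p(2,3) _ s(1), of EId] elem_cong[OF eqv.idr] by simp
qed (auto simp: Fr_def)

lemma ften:
 assumes st: "s <: ob C" "s' <: ob C" "t <: ob C" "t' <: ob C"
 shows "ften C s s' t t' \<in> Hom V (Prod V (fhom C s t) (fhom C s' t')) (fhom C (Nd s s') (Nd t t'))"
  "[|good C Z s e p; acod p = t; good C Z s' f q; acod q = t'|] ==>
    ften C s s' t t' \<cdot> Tuple V (elem C s e p) (elem C s' f q) = elem C (Nd s s') (ETens e f) (Nd p q)"
proof -
 have st2: "Nd s s' <: ob C" "Nd t t' <: ob C" using st by simp_all
 have "\<exists>m. m \<in> Hom V (Prod V (fhom C s t) (fhom C s' t')) (fhom C (Nd s s') (Nd t t')) \<and>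
   (\<forall>Z e p f q. good C Z s e p --> acod p = t --> good C Z s' f q --> acod q = t' -->
    m \<cdot> Tuple V (elem C s e p) (elem C s' f q) = elem C (Nd s s') (ETens e f) (Nd p q))"
 proof (rule ex_map2[OF C st(1,3,2,4) fhom_Obj[OF C st2]])
  fix Z e p f q assume p: "good C Z s e p" "acod p = t" and q: "good C Z s' f q" "acod q = t'"
  show "elem C (Nd s s') (ETens e f) (Nd p q) \<in> Hom V Z (fhom C (Nd s s') (Nd t t'))"
   by (rule elem_fhom[OF good_ETens[OF p(1) q(1)]]) (use p q in simp)
  show "elem C (Nd s s') (ETens e f) (Nd p q) = elem C (Nd s s') (ETens e' f) (Nd p q)" if "eqv (shape s) e e'" for e'
   by (rule elem_cong) (simp add: eqv.tens[OF that eqv.refl])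
  show "elem C (Nd s s') (ETens e f) (Nd p q) = elem C (Nd s s') (ETens e f') (Nd p q)" if "eqv (shape s') f f'" for f'
   by (rule elem_cong) (simp add: eqv.tens[OF eqv.refl that])
  fix Z' k assume "k \<in> Hom V Z' Z"
  then show "elem C (Nd s s') (ETens e f) (Nd p q) \<cdot> k = elem C (Nd s s') (ETens e f) (Nd (apre k p) (apre k q))"
   using elem_Comp[OF C good_ETens[OF p(1) q(1)]] by simp
 qed
 from someI_ex[OF this]
 show "ften C s s' t t' \<in> Hom V (Prod V (fhom C s t) (fhom C s' t')) (fhom C (Nd s s') (Nd t t'))"
  "[|good C Z s e p; acod p = t; good C Z s' f q; acod q = t'|] ==>
    ften C s s' t t' \<cdot> Tuple V (elem C s e p) (elem C s' f q) = elem C (Nd s s') (ETens e f) (Nd p q)"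
  unfolding ften_def by blast+
qed

lemma tens_FM: "tens (FM C) = FT C"
 by (simp add: FM_def)

lemma tob_FM [simp]: "s <: ob C ==> t <: ob C ==> fT C (enc s) (enc t) = enc (Nd s t)"
 by (simp add: tob_def tens_FM FT_def)

lemma tarr_FM:
 assumes p: "good C Z s e p" "acod p = t" and q: "good C Z s' f q" "acod q = t'"
 shows "fR C (enc s) (enc t) (enc s') (enc t') (elem C s e p) (elem C s' f q) = elem C (Nd s s') (ETens e f) (Nd p q)"
proof -
 have o: "s <: ob C" "s' <: ob C" "t <: ob C" "t' <: ob C"
  using goodD(1,4)[OF p(1)] goodD(1,4)[OF q(1)] p q by simp_all
 show ?thesis using ften(2)[OF o p q] o by (simp add: tarr_def tens_FM FT_def)
qed

text \<open>Functoriality consists of the clauses \<open>tens_id\<close> and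
  \<open>tens_comp\<close> of \<open>eqv\<close>, together with compatibility of leafwise
  composition with branching.\<close>

lemma is_tensor_FM: "is_tensor (Fr C) (FM C)"
proof -
 have src: "fsrc (FT C) = vcat_prod V (Fr C) (Fr C)" "ftgt (FT C) = Fr C" by (simp_all add: FT_def)
 have "vfunctor V (FT C)"
 proof (rule vfunctorI)
  show "vcategory V (fsrc (FT C))" "vcategory V (ftgt (FT C))" using vcategory_Fr by (simp_all add: src)
  show "dfam (fsrc (FT C)) (prodfam (FA C) (FA C))" unfolding src by (rule dfam_prodfam[OF dfam_FA dfam_FA])
  fix x assume "x \<in> ob (fsrc (FT C))"
  then obtain x1 x2 where "x = (x1, x2)" "x1 \<in> Fob C" "x2 \<in> Fob C" by (auto simp: src)
  then obtain s s' where x: "x = (enc s, enc s')" and s: "s <: ob C" "s' <: ob C" by (elim FobE) simp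
  have fx: "fob (FT C) x = enc (Nd s s')" using s by (simp add: x FT_def)
  show "fob (FT C) x \<in> ob (ftgt (FT C))" using s by (simp add: fx src)
  note ga = good_aid[OF s(1) Term_Obj, of s EId] good_aid[OF s(2) Term_Obj, of s' EId]
  have "fhm (FT C) x x \<cdot> unt (fsrc (FT C)) x = elem C (Nd s s') (ETens EId EId) (Nd (aid C (Term V) s) (aid C (Term V) s'))"
   using ften(2)[OF s s ga(1) _ ga(2)] s by (simp add: x src FT_def)
  also have "\<dots> = coh C (Nd s s') EId (Nd s s')"
   using elem_cong[of "Nd s s'" "ETens EId EId" EId] eqv.tens_id by simp
  finally show "fhm (FT C) x x \<cdot> unt (fsrc (FT C)) x = unt (ftgt (FT C)) (fob (FT C) x)" using s by (simp add: fx src)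
  fix y assume "y \<in> ob (fsrc (FT C))"
  then obtain y1 y2 where "y = (y1, y2)" "y1 \<in> Fob C" "y2 \<in> Fob C" by (auto simp: src)
  then obtain t t' where y: "y = (enc t, enc t')" and t: "t <: ob C" "t' <: ob C" by (elim FobE) simp
  have fy: "fob (FT C) y = enc (Nd t t')" using t by (simp add: y FT_def)
  show "fhm (FT C) x y \<in> El (ftgt (FT C)) (hm (fsrc (FT C)) x y) (fob (FT C) x) (fob (FT C) y)"
   unfolding fx fy src using ften(1)[OF s t] s t by (simp add: x y FT_def)
  fix z f g Z assume "z \<in> ob (fsrc (FT C))" and g: "g \<in> prodfam (FA C) (FA C) y z" "Dom V g = Z" and f: "f \<in> prodfam (FA C) (FA C) x y" "Dom V f = Z"
  then obtain z1 z2 where "z = (z1, z2)" "z1 \<in> Fob C" "z2 \<in> Fob C" by (auto simp: src)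
  then obtain u u' where z: "z = (enc u, enc u')" and u: "u <: ob C" "u' <: ob C" by (elim FobE) simp
  have fz: "fob (FT C) z = enc (Nd u u')" using u by (simp add: z FT_def)
  have o: "enc s \<in> ob (Fr C)" "enc s' \<in> ob (Fr C)" "enc t \<in> ob (Fr C)" "enc t' \<in> ob (Fr C)" "enc u \<in> ob (Fr C)" "enc u' \<in> ob (Fr C)" using s t u by simp_all
  obtain f1 f2 where f': "f = Tuple V f1 f2" "f1 \<in> FA C (enc s) (enc t)" "f2 \<in> FA C (enc s') (enc t')" "Dom V f1 = Z" "Dom V f2 = Z"
   using prodfamE[OF f[unfolded x y] dfam_FA dfam_FA o(1,2,3,4)] by metis
  obtain g1 g2 where g': "g = Tuple V g1 g2" "g1 \<in> FA C (enc t) (enc u)" "g2 \<in> FA C (enc t') (enc u')" "Dom V g1 = Z" "Dom V g2 = Z"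
   using prodfamE[OF g[unfolded y z] dfam_FA dfam_FA o(3,4,5,6)] by metis
  obtain e p where p: "f1 = elem C s e p" "good C Z s e p" "acod p = t" by (rule elsE[OF _ f'(4)]) (use f' in \<open>simp add: FA_def\<close>)
  obtain e' p' where p': "f2 = elem C s' e' p'" "good C Z s' e' p'" "acod p' = t'" by (rule elsE[OF _ f'(5)]) (use f' in \<open>simp add: FA_def\<close>)
  obtain h q where q: "g1 = elem C t h q" "good C Z t h q" "acod q = u" by (rule elsE[OF _ g'(4)]) (use g' in \<open>simp add: FA_def\<close>)
  obtain h' q' where q': "g2 = elem C t' h' q'" "good C Z t' h' q'" "acod q' = u'" by (rule elsE[OF _ g'(5)]) (use g' in \<open>simp add: FA_def\<close>)
  note qp = good_comp[OF q(2) p(2,3)] and qp' = good_comp[OF q'(2) p'(2,3)]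
  have qpu: "acod (acomp C q (reorder h p)) = u" "acod (acomp C q' (reorder h' p')) = u'" using qp(2) qp'(2) q q' by simp_all
  have l: "ucomp V (fsrc (FT C)) x y z g f = Tuple V (elem C s (EComp h e) (acomp C q (reorder h p))) (elem C s' (EComp h' e') (acomp C q' (reorder h' p')))"
   unfolding src x y z f' g' p(1) p'(1) q(1) q'(1)
   using prod_ucomp[OF vcategory_Fr vcategory_Fr o elem_hm[OF q(2,3)] elem_hm[OF q'(2,3)] elem_hm[OF p(2,3)] elem_hm[OF p'(2,3)]]
    ucomp_elem[OF q(2,3) p(2,3)] ucomp_elem[OF q'(2,3) p'(2,3)] by simp
  have fh: "fhm (FT C) x z = ften C s s' u u'" "fhm (FT C) x y = ften C s s' t t'" "fhm (FT C) y z = ften C t t' u u'"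
   using s t u by (simp_all add: x y z FT_def)
  note T1 = good_ETens[OF p(2) p'(2)] and T2 = good_ETens[OF q(2) q'(2)]
  have "fhm (FT C) x z \<cdot> ucomp V (fsrc (FT C)) x y z g f =
    elem C (Nd s s') (ETens (EComp h e) (EComp h' e')) (Nd (acomp C q (reorder h p)) (acomp C q' (reorder h' p')))"
   unfolding l fh by (rule ften(2)[OF s u qp(1) qpu(1) qp'(1) qpu(2)])
  also have "\<dots> = elem C (Nd s s') (EComp (ETens h h') (ETens e e')) (Nd (acomp C q (reorder h p)) (acomp C q' (reorder h' p')))"
   by (rule elem_cong) (simp add: eqv.tens_comp)
  also have "\<dots> = fU C (enc (Nd s s')) (enc (Nd t t')) (enc (Nd u u')) (elem C (Nd t t') (ETens h h') (Nd q q')) (elem C (Nd s s') (ETens e e') (Nd p p'))"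
   using ucomp_elem[OF T2 _ T1, of "Nd u u'"] p p' q q' acomp_Nd[OF C] by simp
  also have "\<dots> = ucomp V (ftgt (FT C)) (fob (FT C) x) (fob (FT C) y) (fob (FT C) z) (fhm (FT C) y z \<cdot> g) (fhm (FT C) x y \<cdot> f)"
   unfolding fx fy fz src fh f' g' p(1) p'(1) q(1) q'(1) ften(2)[OF s t p(2,3) p'(2,3)] ften(2)[OF t u q(2,3) q'(2,3)] ..
  finally show "fhm (FT C) x z \<cdot> ucomp V (fsrc (FT C)) x y z g f =
    ucomp V (ftgt (FT C)) (fob (FT C) x) (fob (FT C) y) (fob (FT C) z) (fhm (FT C) y z \<cdot> g) (fhm (FT C) x y \<cdot> f)" .
 next
  fix x assume "x \<notin> ob (fsrc (FT C))" then show "fob (FT C) x = undefined" by (auto simp: FT_def)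
 next
  fix x y assume "\<not> (x \<in> ob (fsrc (FT C)) \<and> y \<in> ob (fsrc (FT C)))" then show "fhm (FT C) x y = undefined" by (auto simp: FT_def)
 qed
 then show ?thesis unfolding is_tensor_def tens_FM using vcategory_Fr src by simp
qed

text \<open>Both sides of every axiom are computed to single formal composites with the same arrows,
  whose terms are equivalent by the corresponding clause of \<open>eqv\<close>.\<close>

lemma symmetric_monoidal_FM: "symmetric_monoidal V (Fr C) (FM C)"
proof (rule symmetric_monoidalI[where C = "Fr C" and Tn = "FT C" and al = "\<lambda>x y z. coh C (Nd (Nd (dec x) (dec y)) (dec z)) EAs (Nd (dec x) (Nd (dec y) (dec z)))"
   and sg = "\<lambda>x y. coh C (Nd (dec x) (dec y)) ESy (Nd (dec y) (dec x))" and A = "FA C" and ai = "\<lambda>x y z. coh C (Nd (dec x) (Nd (dec y) (dec z))) EAi (Nd (Nd (dec x) (dec y)) (dec z))",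
   folded FM_def, OF is_tensor_FM dfam_FA], unfold Fr_simps(1))
 note Z0 = Term_Obj
 fix a b assume "a \<in> Fob C" "b \<in> Fob C"
 then obtain s t where ab: "a = enc s" "b = enc t" and s: "s <: ob C" "t <: ob C" by (elim FobE)
 have st: "Nd s t <: ob C" "Nd t s <: ob C" using s by simp_all
 show "coh C (Nd (dec a) (dec b)) ESy (Nd (dec b) (dec a)) \<in> El (Fr C) (Term V) (fT C a b) (fT C b a)"
  using elem_hm[OF good_aid[OF st(1) Z0, of "Nd t s" ESy], of "Nd t s"] s by (simp add: ab)
 have "fU C (enc (Nd s t)) (enc (Nd t s)) (enc (Nd s t)) (coh C (Nd t s) ESy (Nd s t)) (coh C (Nd s t) ESy (Nd t s))
  = coh C (Nd s t) (EComp ESy ESy) (Nd s t)"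
  by (rule ucomp_aid_aid[OF st(1) _ _ Z0]) simp_all
 also have "\<dots> = coh C (Nd s t) EId (Nd s t)" by (rule elem_cong) (simp add: eqv.sy_sy)
 finally show "fU C (fT C a b) (fT C b a) (fT C a b)
    (coh C (Nd (dec b) (dec a)) ESy (Nd (dec a) (dec b))) (coh C (Nd (dec a) (dec b)) ESy (Nd (dec b) (dec a))) = unt (Fr C) (fT C a b)"
  using s st by (simp add: ab)
 fix c assume "c \<in> Fob C"
 then obtain u where c: "c = enc u" and u: "u <: ob C" by (elim FobE)
 have stu: "Nd (Nd s t) u <: ob C" "Nd s (Nd t u) <: ob C" "Nd t u <: ob C" using s u by simp_all
 show "coh C (Nd (Nd (dec a) (dec b)) (dec c)) EAs (Nd (dec a) (Nd (dec b) (dec c))) \<in> El (Fr C) (Term V) (fT C (fT C a b) c) (fT C a (fT C b c))"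
  using elem_hm[OF good_aid[OF stu(1) Z0, of "Nd s (Nd t u)" EAs], of "Nd s (Nd t u)"] s u by (simp add: ab c)
 show "coh C (Nd (dec a) (Nd (dec b) (dec c))) EAi (Nd (Nd (dec a) (dec b)) (dec c)) \<in> El (Fr C) (Term V) (fT C a (fT C b c)) (fT C (fT C a b) c)"
  using elem_hm[OF good_aid[OF stu(2) Z0, of "Nd (Nd s t) u" EAi], of "Nd (Nd s t) u"] s u by (simp add: ab c)
 have "fU C (enc (Nd (Nd s t) u)) (enc (Nd s (Nd t u))) (enc (Nd (Nd s t) u)) (coh C (Nd s (Nd t u)) EAi (Nd (Nd s t) u)) (coh C (Nd (Nd s t) u) EAs (Nd s (Nd t u)))
  = coh C (Nd (Nd s t) u) (EComp EAi EAs) (Nd (Nd s t) u)"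
  by (rule ucomp_aid_aid[OF stu(1) _ _ Z0]) simp_all
 also have "\<dots> = coh C (Nd (Nd s t) u) EId (Nd (Nd s t) u)" by (rule elem_cong) (simp add: eqv.ai_as)
 finally show "fU C (fT C (fT C a b) c) (fT C a (fT C b c)) (fT C (fT C a b) c)
    (coh C (Nd (dec a) (Nd (dec b) (dec c))) EAi (Nd (Nd (dec a) (dec b)) (dec c)))
    (coh C (Nd (Nd (dec a) (dec b)) (dec c)) EAs (Nd (dec a) (Nd (dec b) (dec c)))) = unt (Fr C) (fT C (fT C a b) c)"
  using s u st stu by (simp add: ab c)
 have "fU C (enc (Nd s (Nd t u))) (enc (Nd (Nd s t) u)) (enc (Nd s (Nd t u))) (coh C (Nd (Nd s t) u) EAs (Nd s (Nd t u))) (coh C (Nd s (Nd t u)) EAi (Nd (Nd s t) u))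
  = coh C (Nd s (Nd t u)) (EComp EAs EAi) (Nd s (Nd t u))"
  by (rule ucomp_aid_aid[OF stu(2) _ _ Z0]) simp_all
 also have "\<dots> = coh C (Nd s (Nd t u)) EId (Nd s (Nd t u))" by (rule elem_cong) (simp add: eqv.as_ai)
 finally show "fU C (fT C a (fT C b c)) (fT C (fT C a b) c) (fT C a (fT C b c))
    (coh C (Nd (Nd (dec a) (dec b)) (dec c)) EAs (Nd (dec a) (Nd (dec b) (dec c))))
    (coh C (Nd (dec a) (Nd (dec b) (dec c))) EAi (Nd (Nd (dec a) (dec b)) (dec c))) = unt (Fr C) (fT C a (fT C b c))"
  using s u st stu by (simp add: ab c)
 have gi: "good C (Term V) x EId (aid C (Term V) x)" if "x <: ob C" for x using good_aid[OF that Z0, of x EId] by simp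
 have gs: "good C (Term V) (Nd x y) ESy (aid C (Term V) (Nd y x))" if "x <: ob C" "y <: ob C" for x y
  by (rule good_aid[OF _ Z0]) (use that in simp_all)
 have gas: "good C (Term V) (Nd (Nd x y) z) EAs (aid C (Term V) (Nd x (Nd y z)))" if "x <: ob C" "y <: ob C" "z <: ob C" for x y z
  by (rule good_aid[OF _ Z0]) (use that in simp_all)
 let ?I = "aid C (Term V)"
 show "fU C (fT C (fT C a b) c) (fT C (fT C b c) a) (fT C b (fT C c a))
    (coh C (Nd (Nd (dec b) (dec c)) (dec a)) EAs (Nd (dec b) (Nd (dec c) (dec a))))
    (fU C (fT C (fT C a b) c) (fT C a (fT C b c)) (fT C (fT C b c) a)
     (coh C (Nd (dec a) (dec (fT C b c))) ESy (Nd (dec (fT C b c)) (dec a)))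
     (coh C (Nd (Nd (dec a) (dec b)) (dec c)) EAs (Nd (dec a) (Nd (dec b) (dec c))))) =
    fU C (fT C (fT C a b) c) (fT C b (fT C a c)) (fT C b (fT C c a))
    (fR C b b (fT C a c) (fT C c a) (unt (Fr C) b) (coh C (Nd (dec a) (dec c)) ESy (Nd (dec c) (dec a))))
    (fU C (fT C (fT C a b) c) (fT C (fT C b a) c) (fT C b (fT C a c))
     (coh C (Nd (Nd (dec b) (dec a)) (dec c)) EAs (Nd (dec b) (Nd (dec a) (dec c))))
     (fR C (fT C a b) (fT C b a) c c (coh C (Nd (dec a) (dec b)) ESy (Nd (dec b) (dec a))) (unt (Fr C) c)))"
 proof -
  have "fU C (enc (Nd (Nd s t) u)) (enc (Nd (Nd t u) s)) (enc (Nd t (Nd u s)))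
    (elem C (Nd (Nd t u) s) EAs (?I (Nd t (Nd u s))))
    (fU C (enc (Nd (Nd s t) u)) (enc (Nd s (Nd t u))) (enc (Nd (Nd t u) s))
     (elem C (Nd s (Nd t u)) ESy (?I (Nd (Nd t u) s))) (elem C (Nd (Nd s t) u) EAs (?I (Nd s (Nd t u)))))
   = elem C (Nd (Nd s t) u) (EComp EAs (EComp ESy EAs)) (?I (Nd t (Nd u s)))"
   using ucomp_aid_aid[OF stu(1), of "Nd s (Nd t u)" EAs "Nd (Nd t u) s" ESy "Term V"]
    ucomp_aid_aid[OF stu(1), of "Nd (Nd t u) s" "EComp ESy EAs" "Nd t (Nd u s)" EAs "Term V"] by simp
  also have "\<dots> = elem C (Nd (Nd s t) u) (EComp (ETens EId ESy) (EComp EAs (ETens ESy EId))) (?I (Nd t (Nd u s)))"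
   by (rule elem_cong) (simp add: eqv.hex)
  also have "\<dots> = fU C (enc (Nd (Nd s t) u)) (enc (Nd t (Nd s u))) (enc (Nd t (Nd u s)))
    (elem C (Nd t (Nd s u)) (ETens EId ESy) (?I (Nd t (Nd u s))))
    (fU C (enc (Nd (Nd s t) u)) (enc (Nd (Nd t s) u)) (enc (Nd t (Nd s u)))
     (elem C (Nd (Nd t s) u) EAs (?I (Nd t (Nd s u)))) (elem C (Nd (Nd s t) u) (ETens ESy EId) (?I (Nd (Nd t s) u))))"
   using ucomp_aid_aid[OF stu(1), of "Nd (Nd t s) u" "ETens ESy EId" "Nd t (Nd s u)" EAs "Term V"]
    ucomp_aid_aid[OF stu(1), of "Nd t (Nd s u)" "EComp EAs (ETens ESy EId)" "Nd t (Nd u s)" "ETens EId ESy" "Term V"] by simp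
  finally show ?thesis
   using s u tarr_FM[OF gi[OF s(2)] _ gs[OF s(1) u], of t "Nd u s"] tarr_FM[OF gs[OF s] _ gi[OF u], of "Nd t s" u] by (simp add: ab c)
 qed
 fix d assume "d \<in> Fob C"
 then obtain v where d: "d = enc v" and v: "v <: ob C" by (elim FobE)
 have S: "Nd (Nd (Nd s t) u) v <: ob C" using s u v by simp
 show "fU C (fT C (fT C (fT C a b) c) d) (fT C (fT C a b) (fT C c d)) (fT C a (fT C b (fT C c d)))
    (coh C (Nd (Nd (dec a) (dec b)) (dec (fT C c d))) EAs (Nd (dec a) (Nd (dec b) (dec (fT C c d)))))
    (coh C (Nd (Nd (dec (fT C a b)) (dec c)) (dec d)) EAs (Nd (dec (fT C a b)) (Nd (dec c) (dec d)))) =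
    fU C (fT C (fT C (fT C a b) c) d) (fT C a (fT C (fT C b c) d)) (fT C a (fT C b (fT C c d)))
    (fR C a a (fT C (fT C b c) d) (fT C b (fT C c d)) (unt (Fr C) a) (coh C (Nd (Nd (dec b) (dec c)) (dec d)) EAs (Nd (dec b) (Nd (dec c) (dec d)))))
    (fU C (fT C (fT C (fT C a b) c) d) (fT C (fT C a (fT C b c)) d) (fT C a (fT C (fT C b c) d))
     (coh C (Nd (Nd (dec a) (dec (fT C b c))) (dec d)) EAs (Nd (dec a) (Nd (dec (fT C b c)) (dec d))))
     (fR C (fT C (fT C a b) c) (fT C a (fT C b c)) d d
      (coh C (Nd (Nd (dec a) (dec b)) (dec c)) EAs (Nd (dec a) (Nd (dec b) (dec c)))) (unt (Fr C) d)))"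
 proof -
  have "fU C (enc (Nd (Nd (Nd s t) u) v)) (enc (Nd (Nd s t) (Nd u v))) (enc (Nd s (Nd t (Nd u v))))
    (elem C (Nd (Nd s t) (Nd u v)) EAs (?I (Nd s (Nd t (Nd u v))))) (elem C (Nd (Nd (Nd s t) u) v) EAs (?I (Nd (Nd s t) (Nd u v))))
   = elem C (Nd (Nd (Nd s t) u) v) (EComp EAs EAs) (?I (Nd s (Nd t (Nd u v))))"
   using ucomp_aid_aid[OF S, of "Nd (Nd s t) (Nd u v)" EAs "Nd s (Nd t (Nd u v))" EAs "Term V"] by simp
  also have "\<dots> = elem C (Nd (Nd (Nd s t) u) v) (EComp (ETens EId EAs) (EComp EAs (ETens EAs EId))) (?I (Nd s (Nd t (Nd u v))))"
   by (rule elem_cong) (simp add: eqv.pent)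
  also have "\<dots> = fU C (enc (Nd (Nd (Nd s t) u) v)) (enc (Nd s (Nd (Nd t u) v))) (enc (Nd s (Nd t (Nd u v))))
    (elem C (Nd s (Nd (Nd t u) v)) (ETens EId EAs) (?I (Nd s (Nd t (Nd u v)))))
    (fU C (enc (Nd (Nd (Nd s t) u) v)) (enc (Nd (Nd s (Nd t u)) v)) (enc (Nd s (Nd (Nd t u) v)))
     (elem C (Nd (Nd s (Nd t u)) v) EAs (?I (Nd s (Nd (Nd t u) v)))) (elem C (Nd (Nd (Nd s t) u) v) (ETens EAs EId) (?I (Nd (Nd s (Nd t u)) v))))"
   using ucomp_aid_aid[OF S, of "Nd (Nd s (Nd t u)) v" "ETens EAs EId" "Nd s (Nd (Nd t u) v)" EAs "Term V"]
    ucomp_aid_aid[OF S, of "Nd s (Nd (Nd t u) v)" "EComp EAs (ETens EAs EId)" "Nd s (Nd t (Nd u v))" "ETens EId EAs" "Term V"] by simp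
  finally show ?thesis
   using s u v tarr_FM[OF gi[OF s(1)] _ gas[OF s(2) u v], of s "Nd t (Nd u v)"] tarr_FM[OF gas[OF s u] _ gi[OF v], of "Nd s (Nd t u)" v] by (simp add: ab c d)
 qed
next
 fix a b c a' b' c' f g h Z
 assume "a \<in> Fob C" "b \<in> Fob C" "c \<in> Fob C" "a' \<in> Fob C" "b' \<in> Fob C" "c' \<in> Fob C"
  and fg: "f \<in> FA C a a'" "g \<in> FA C b b'" "h \<in> FA C c c'" and Z: "Dom V f = Z" "Dom V g = Z" "Dom V h = Z"
 then obtain s t u s' t' u' where x: "a = enc s" "b = enc t" "c = enc u" "a' = enc s'" "b' = enc t'" "c' = enc u'"
  and s: "s <: ob C" "t <: ob C" "u <: ob C" "s' <: ob C" "t' <: ob C" "u' <: ob C"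
  by (elim FobE)
 obtain e1 p where p: "f = elem C s e1 p" "good C Z s e1 p" "acod p = s'" by (rule elsE[OF _ Z(1)]) (use fg x in \<open>simp add: FA_def\<close>)
 obtain e2 q where q: "g = elem C t e2 q" "good C Z t e2 q" "acod q = t'" by (rule elsE[OF _ Z(2)]) (use fg x in \<open>simp add: FA_def\<close>)
 obtain e3 r where r: "h = elem C u e3 r" "good C Z u e3 r" "acod r = u'" by (rule elsE[OF _ Z(3)]) (use fg x in \<open>simp add: FA_def\<close>)
 note pq = good_ETens[OF p(2) q(2)] and qr = good_ETens[OF q(2) r(2)] note pqr = good_ETens[OF pq r(2)] good_ETens[OF p(2) qr]
 have Zo: "Z \<in> Obj V" by (rule goodD(5)[OF p(2)])
 \<comment> \<open>A constraint is carried to stage \<open>Z\<close> by restricting the identities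
   at its leaves.\<close>
 have stg: "coh C (Nd (Nd x y) z) EAs (Nd x (Nd y z)) \<cdot> Bang V Z = elem C (Nd (Nd x y) z) EAs (aid C Z (Nd x (Nd y z)))"
  if "x <: ob C" "y <: ob C" "z <: ob C" for x y z
  using elem_Comp[OF C good_aid[OF _ Term_Obj, of "Nd (Nd x y) z" "Nd x (Nd y z)" EAs] Bang_Hom[OF Zo]]
   apre_aid[OF C _ Bang_Hom[OF Zo], of "Nd x (Nd y z)"] that by simp
 have S: "Nd (Nd s t) u <: ob C" using s by simp
 have "fU C (enc (Nd (Nd s t) u)) (enc (Nd (Nd s' t') u')) (enc (Nd s' (Nd t' u')))
   (elem C (Nd (Nd s' t') u') EAs (aid C Z (Nd s' (Nd t' u')))) (elem C (Nd (Nd s t) u) (ETens (ETens e1 e2) e3) (Nd (Nd p q) r))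
  = elem C (Nd (Nd s t) u) (EComp EAs (ETens (ETens e1 e2) e3)) (Nd p (Nd q r))"
  using ucomp_aid_left[OF pqr(1), of "Nd (Nd s' t') u'" "Nd s' (Nd t' u')" EAs] p q r by simp
 also have "\<dots> = elem C (Nd (Nd s t) u) (EComp (ETens e1 (ETens e2 e3)) EAs) (Nd p (Nd q r))"
  by (rule elem_cong) (simp add: eqv.as_nat)
 also have "\<dots> = fU C (enc (Nd (Nd s t) u)) (enc (Nd s (Nd t u))) (enc (Nd s' (Nd t' u')))
   (elem C (Nd s (Nd t u)) (ETens e1 (ETens e2 e3)) (Nd p (Nd q r))) (elem C (Nd (Nd s t) u) EAs (aid C Z (Nd s (Nd t u))))"
  using ucomp_aid_right[OF pqr(2) _ _ S, of "Nd s' (Nd t' u')" EAs] p q r by simp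
 finally show "fU C (fT C (fT C a b) c) (fT C (fT C a' b') c') (fT C a' (fT C b' c'))
    (coh C (Nd (Nd (dec a') (dec b')) (dec c')) EAs (Nd (dec a') (Nd (dec b') (dec c'))) \<cdot> Bang V Z)
    (fR C (fT C a b) (fT C a' b') c c' (fR C a a' b b' f g) h) =
    fU C (fT C (fT C a b) c) (fT C a (fT C b c)) (fT C a' (fT C b' c'))
    (fR C a a' (fT C b c) (fT C b' c') f (fR C b b' c c' g h))
    (coh C (Nd (Nd (dec a) (dec b)) (dec c)) EAs (Nd (dec a) (Nd (dec b) (dec c))) \<cdot> Bang V Z)"
  using s stg[OF s(1-3)] stg[OF s(4-6)] tarr_FM[OF p(2,3) q(2,3)] tarr_FM[OF q(2,3) r(2,3)]
   tarr_FM[OF pq _ r(2,3), of "Nd s' t'"] tarr_FM[OF p(2,3) qr, of "Nd t' u'"] p q r by (simp add: x)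
next
 fix a b a' b' f g Z
 assume "a \<in> Fob C" "b \<in> Fob C" "a' \<in> Fob C" "b' \<in> Fob C" and fg: "f \<in> FA C a a'" "g \<in> FA C b b'" and Z: "Dom V f = Z" "Dom V g = Z"
 then obtain s t s' t' where x: "a = enc s" "b = enc t" "a' = enc s'" "b' = enc t'"
  and s: "s <: ob C" "t <: ob C" "s' <: ob C" "t' <: ob C"
  by (elim FobE)
 obtain e1 p where p: "f = elem C s e1 p" "good C Z s e1 p" "acod p = s'" by (rule elsE[OF _ Z(1)]) (use fg x in \<open>simp add: FA_def\<close>)
 obtain e2 q where q: "g = elem C t e2 q" "good C Z t e2 q" "acod q = t'" by (rule elsE[OF _ Z(2)]) (use fg x in \<open>simp add: FA_def\<close>)
 note pq = good_ETens[OF p(2) q(2)] and qp = good_ETens[OF q(2) p(2)]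
 have Zo: "Z \<in> Obj V" by (rule goodD(5)[OF p(2)])
 have stg: "coh C (Nd x y) ESy (Nd y x) \<cdot> Bang V Z = elem C (Nd x y) ESy (aid C Z (Nd y x))"
  if "x <: ob C" "y <: ob C" for x y
  using elem_Comp[OF C good_aid[OF _ Term_Obj, of "Nd x y" "Nd y x" ESy] Bang_Hom[OF Zo]]
   apre_aid[OF C _ Bang_Hom[OF Zo], of "Nd y x"] that by simp
 have S: "Nd s t <: ob C" using s by simp
 have "fU C (enc (Nd s t)) (enc (Nd s' t')) (enc (Nd t' s'))
   (elem C (Nd s' t') ESy (aid C Z (Nd t' s'))) (elem C (Nd s t) (ETens e1 e2) (Nd p q))
  = elem C (Nd s t) (EComp ESy (ETens e1 e2)) (Nd q p)"
  using ucomp_aid_left[OF pq, of "Nd s' t'" "Nd t' s'" ESy] p q by simp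
 also have "\<dots> = elem C (Nd s t) (EComp (ETens e2 e1) ESy) (Nd q p)"
  by (rule elem_cong) (simp add: eqv.sy_nat)
 also have "\<dots> = fU C (enc (Nd s t)) (enc (Nd t s)) (enc (Nd t' s'))
   (elem C (Nd t s) (ETens e2 e1) (Nd q p)) (elem C (Nd s t) ESy (aid C Z (Nd t s)))"
  using ucomp_aid_right[OF qp _ _ S, of "Nd t' s'" ESy] p q by simp
 finally show "fU C (fT C a b) (fT C a' b') (fT C b' a')
    (coh C (Nd (dec a') (dec b')) ESy (Nd (dec b') (dec a')) \<cdot> Bang V Z) (fR C a a' b b' f g) =
    fU C (fT C a b) (fT C b a) (fT C b' a') (fR C b b' a a' g f)
    (coh C (Nd (dec a) (dec b)) ESy (Nd (dec b) (dec a)) \<cdot> Bang V Z)"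
  using s stg[OF s(1,2)] stg[OF s(3,4)] tarr_FM[OF p(2,3) q(2,3)] tarr_FM[OF q(2,3) p(2,3)] by (simp add: x p(1) q(1))
qed

end

end

section \<open>Evaluation under change of stage and under functors\<close>

context cartesian_category
begin

text \<open>The two middle factors of a fourfold composite are exchanged along a commuting square.
  Applied to naturality of a coherence isomorphism, it shows that extensions preserve
  composition.\<close>

lemma ucomp_exchange:
 assumes D: "vcategory V D" and o: "a \<in> ob D" "b \<in> ob D" "c \<in> ob D" "c' \<in> ob D" "d \<in> ob D" "e \<in> ob D"
  and ty: "w \<in> El D Z a b" "z \<in> El D Z b c" "y \<in> El D Z c d" "x \<in> El D Z d e"
   "y' \<in> El D Z b c'" "z' \<in> El D Z c' d"
  and eq: "ucomp V D b c d y z = ucomp V D b c' d z' y'"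
 shows "ucomp V D a c e (ucomp V D c d e x y) (ucomp V D a b c z w) = ucomp V D a c' e (ucomp V D c' d e x z') (ucomp V D a b c' y' w)"
proof -
 have "ucomp V D a c e (ucomp V D c d e x y) (ucomp V D a b c z w) = ucomp V D a d e x (ucomp V D a b d (ucomp V D b c d y z) w)"
  using ucomp_assoc[OF D o(1,3,5,6) ty(4,3) ucomp_Hom[OF D o(1-3) ty(2,1)]] ucomp_assoc[OF D o(1,2,3,5) ty(3,2,1)] by simp
 also have "\<dots> = ucomp V D a c' e (ucomp V D c' d e x z') (ucomp V D a b c' y' w)"
  using ucomp_assoc[OF D o(1,4,5,6) ty(4,6) ucomp_Hom[OF D o(1,2,4) ty(5,1)]] ucomp_assoc[OF D o(1,2,4,5) ty(6,5,1)] eq by simp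
 finally show ?thesis .
qed

lemma tensor_apre:
 assumes T: "is_tensor D N" and k: "k \<in> Hom V Z' Z"
 shows "p <: arrows D Z ==> tensor N (apre k p) = tensor N p \<cdot> k"
proof (induction p)
 case (Nd p q)
 then have s: "p <: arrows D Z" "q <: arrows D Z" by simp_all
 note v = val_ob[OF T]
 show ?case
  using tarr_Comp[OF T v[OF set_adom_acod(1)[OF s(1)]] v[OF set_adom_acod(2)[OF s(1)]] v[OF set_adom_acod(1)[OF s(2)]] v[OF set_adom_acod(2)[OF s(2)]]
   tensor_Hom[OF T s(1)] tensor_Hom[OF T s(2)] k] Nd.IH(1)[OF s(1)] Nd.IH(2)[OF s(2)] by simp
qed simp

lemma tensor_aid:
 assumes T: "is_tensor D N" and Z: "Z \<in> Obj V"
 shows "s <: ob D ==> tensor N (aid D Z s) = uid D Z (val N s)"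
 using tarr_uid[OF T _ _ Z] val_ob[OF T] by (induction s) simp_all

lemma interp_Comp:
 assumes S: "symmetric_monoidal V D N" and k: "k \<in> Hom V Z' Z"
 shows "s <: ob D ==> interp D N Z e s \<cdot> k = interp D N Z' e s"
proof (induction e arbitrary: s)
 case (EComp e f)
 note T = symmetric_monoidal_is_tensor[OF S] note D = is_tensorD(1)[OF T] and Z = HomD(5)[OF k]
 have o: "reorder f s <: ob D" "reorder e (reorder f s) <: ob D" using EComp.prems by simp_all
 show ?case
  using ucomp_Comp[OF D val_ob[OF T EComp.prems] val_ob[OF T o(1)] val_ob[OF T o(2)] interp_Hom[OF S Z o(1)] interp_Hom[OF S Z EComp.prems] k]
   EComp.IH(1)[OF o(1)] EComp.IH(2)[OF EComp.prems] by simp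
next
 case (ETens e f)
 note T = symmetric_monoidal_is_tensor[OF S] note D = is_tensorD(1)[OF T] and Z = HomD(5)[OF k]
 show ?case
 proof (cases s)
  case (Nd a b)
  with ETens.prems have ab: "a <: ob D" "b <: ob D" by simp_all
  then have ab': "reorder e a <: ob D" "reorder f b <: ob D" by simp_all
  show ?thesis
   using tarr_Comp[OF T val_ob[OF T ab(1)] val_ob[OF T ab'(1)] val_ob[OF T ab(2)] val_ob[OF T ab'(2)] interp_Hom[OF S Z ab(1)] interp_Hom[OF S Z ab(2)] k]
    ETens.IH(1)[OF ab(1)] ETens.IH(2)[OF ab(2)] by (simp add: Nd)
 qed (use ETens.prems D k in simp)
qed (use S k symmetric_monoidal_vcategory[OF S] symmetric_monoidal_is_tensor[OF S] val_ob[OF symmetric_monoidal_is_tensor[OF S]] HomD(5)[OF k]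
 in \<open>auto split: btree.split\<close>)

definition amap :: "('o, 'p, 'v, 'a) vfun => ('o, 'a) arrow btree => ('p, 'a) arrow btree" where
 "amap G = map_btree (\<lambda>x. (fob G (fst x), fhm G (fst x) (snd (snd x)) \<cdot> fst (snd x), fob G (snd (snd x))))"

lemma amap_simps [simp]:
 "adom (amap G p) = map_btree (fob G) (adom p)" "acod (amap G p) = map_btree (fob G) (acod p)"
 "amap G (Nd p q) = Nd (amap G p) (amap G q)" "reorder e (amap G p) = amap G (reorder e p)"
 "amap G (Lf (a, f, b)) = Lf (fob G a, fhm G a b \<cdot> f, fob G b)"
 by (simp_all add: amap_def btree.map_comp o_def map_reorder)

lemma set_amap:
 assumes "vfunctor V G" "fsrc G = C" "ftgt G = D" "p <: arrows C Z"
 shows "amap G p <: arrows D Z"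
 using assms(4) vfun_fob[OF assms(1-3)] vfun_app[OF assms(1-3)] unfolding amap_def btree.set_map arrows_def by fastforce

lemma amap_apre:
 assumes "vfunctor V G" "fsrc G = C" "k \<in> Hom V Z' Z"
 shows "p <: arrows C Z ==> amap G (apre k p) = apre k (amap G p)"
 unfolding amap_def apre_def btree.map_comp
 by (rule btree.map_cong0) (use vfun_app_Comp[OF assms(1,2) _ _ _ assms(3)] in \<open>force simp: arrows_def\<close>)

lemma amap_aid:
 assumes "vfunctor V G" "fsrc G = C" "ftgt G = D" "Z \<in> Obj V"
 shows "s <: ob C ==> amap G (aid C Z s) = aid D Z (map_btree (fob G) s)"
 using vfun_uid[OF assms(1-3) _ assms(4)] by (induction s) simp_all

lemma amap_acomp:
 assumes "vfunctor V G" "fsrc G = C" "ftgt G = D"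
 shows "p <: arrows C Z ==> q <: arrows C Z ==> adom q = acod p ==>
  amap G (acomp C q p) = acomp D (amap G q) (amap G p)"
proof (induction p arbitrary: q)
 case (Lf x)
 then obtain y where y: "q = Lf y" by (cases q) auto
 obtain a f b where x: "x = (a, f, b)" by (cases x)
 obtain b' g c where y': "y = (b', g, c)" by (cases y)
 show ?case using Lf vfun_ucomp[OF assms, of a b c g Z f] by (simp add: x y y' acomp_def arrows_def)
next
 case (Nd p1 p2)
 then obtain q1 q2 where "q = Nd q1 q2" by (cases q) auto
 with Nd show ?case by (simp add: acomp_def)
qed

end

section \<open>The universal property of the free category\<close>

context free_construction
begin

context
 fixes C :: "('u, 'v, 'a) vcat"
 assumes C: "vcategory V C"
begin

lemma FE_simps [simp]: "fsrc (FE C) = C" "ftgt (FE C) = Fr C" "a \<in> ob C ==> fob (FE C) a = enc (Lf a)"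
 by (simp_all add: FE_def)

lemma good_Lf: "a \<in> ob C ==> b \<in> ob C ==> f \<in> El C Z a b ==> good C Z (Lf a) EId (Lf (a, f, b))"
 by (simp add: good_def arrows_def)

lemma FE_app:
 assumes o: "a \<in> ob C" "b \<in> ob C" and f: "f \<in> El C Z a b"
 shows "fhm (FE C) a b \<cdot> f = elem C (Lf a) EId (Lf (a, f, b))"
 using elem_Comp[OF C good_Lf[OF o Ide_Hom[OF hm_Obj[OF C o]]] f] o f by (simp add: FE_def)

lemma vfunctor_FE: "vfunctor V (FE C)"
proof (rule vfunctorI[where A = "elements C"], unfold FE_simps(1,2))
 show "vcategory V C" "vcategory V (Fr C)" "dfam C (elements C)" using C vcategory_Fr[OF C] dfam_elements by simp_all
 fix a assume a: "a \<in> ob C"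
 show "fob (FE C) a \<in> ob (Fr C)" using a by simp
 show "fhm (FE C) a a \<cdot> unt C a = unt (Fr C) (fob (FE C) a)"
  using FE_app[OF a a unt_Hom[OF C a]] a C by simp
 fix b assume b: "b \<in> ob C"
 have "elem C (Lf a) EId (Lf (a, Ide V (hm C a b), b)) \<in> El (Fr C) (hm C a b) (enc (Lf a)) (enc (Lf b))"
  by (rule elem_hm[OF C good_Lf[OF a b Ide_Hom[OF hm_Obj[OF C a b]]]]) simp
 then show "fhm (FE C) a b \<in> El (Fr C) (hm C a b) (fob (FE C) a) (fob (FE C) b)"
  using a b by (simp add: FE_def)
 fix c f g Z assume c: "c \<in> ob C" and "g \<in> elements C b c" "f \<in> elements C a b" "Dom V g = Z" "Dom V f = Z"
 then have g: "g \<in> El C Z b c" and f: "f \<in> El C Z a b" by (simp_all add: elements_def Hom_iff)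
 have "fU C (enc (Lf a)) (enc (Lf b)) (enc (Lf c)) (elem C (Lf b) EId (Lf (b, g, c))) (elem C (Lf a) EId (Lf (a, f, b))) =
   elem C (Lf a) (EComp EId EId) (Lf (a, ucomp V C a b c g f, c))"
  using ucomp_elem[OF C good_Lf[OF b c g] _ good_Lf[OF a b f], of "Lf c"] by (simp add: acomp_def)
 also have "\<dots> = elem C (Lf a) EId (Lf (a, ucomp V C a b c g f, c))" by (rule elem_cong[OF eqv.idl])
 finally show "fhm (FE C) a c \<cdot> ucomp V C a b c g f = fU C (fob (FE C) a) (fob (FE C) b) (fob (FE C) c) (fhm (FE C) b c \<cdot> g) (fhm (FE C) a b \<cdot> f)"
  using a b c FE_app[OF a b f] FE_app[OF b c g] FE_app[OF a c ucomp_Hom[OF C a b c g f]] by simp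
qed (auto simp: FE_def)

lemma FM_comps:
 assumes s: "s <: ob C" "t <: ob C" "u <: ob C"
 shows "ncomp (asc (FM C)) ((enc s, enc t), enc u) = coh C (Nd (Nd s t) u) EAs (Nd s (Nd t u))"
  "ncomp (symm (FM C)) (enc s, enc t) = coh C (Nd s t) ESy (Nd t s)"
 using s by (simp_all add: FM_def)

text \<open>For \<open>alphainv\<close>, which is defined by choice, uniqueness of inverses
  identifies it with the formal inverse \<open>EAi\<close>.\<close>

lemma FM_stage:
 assumes s: "s <: ob C" "t <: ob C" "u <: ob C" and Z: "Z \<in> Obj V"
 shows "alpha (FM C) Z (enc s) (enc t) (enc u) = elem C (Nd (Nd s t) u) EAs (aid C Z (Nd s (Nd t u)))"
  "sigma (FM C) Z (enc s) (enc t) = elem C (Nd s t) ESy (aid C Z (Nd t s))"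
  "alphainv (Fr C) (FM C) Z (enc s) (enc t) (enc u) = elem C (Nd s (Nd t u)) EAi (aid C Z (Nd (Nd s t) u))"
proof -
 have S: "Nd (Nd s t) u <: ob C" "Nd s (Nd t u) <: ob C" "Nd s t <: ob C" "Nd t s <: ob C" "Nd t u <: ob C" using s by simp_all
 note B = Bang_Hom[OF Z]
 show al: "alpha (FM C) Z (enc s) (enc t) (enc u) = elem C (Nd (Nd s t) u) EAs (aid C Z (Nd s (Nd t u)))"
  unfolding alpha_def FM_comps(1)[OF s]
  using elem_Comp[OF C good_aid[OF C S(1) Term_Obj, of "Nd s (Nd t u)" EAs] B] apre_aid[OF C S(2) B] by simp
 show "sigma (FM C) Z (enc s) (enc t) = elem C (Nd s t) ESy (aid C Z (Nd t s))"
  unfolding sigma_def FM_comps(2)[OF s]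
  using elem_Comp[OF C good_aid[OF C S(3) Term_Obj, of "Nd t s" ESy] B] apre_aid[OF C S(4) B] by simp
 note SM = symmetric_monoidal_FM[OF C]
 have o: "enc s \<in> ob (Fr C)" "enc t \<in> ob (Fr C)" "enc u \<in> ob (Fr C)" "enc (Nd (Nd s t) u) \<in> ob (Fr C)" "enc (Nd s (Nd t u)) \<in> ob (Fr C)" using s by simp_all
 have T: "fT C (fT C (enc s) (enc t)) (enc u) = enc (Nd (Nd s t) u)" "fT C (enc s) (fT C (enc t) (enc u)) = enc (Nd s (Nd t u))"
  using tob_FM[OF C] s S by simp_all
 have ga: "good C Z (Nd (Nd s t) u) EAs (aid C Z (Nd s (Nd t u)))" by (rule good_aid[OF C S(1) Z]) simp
 have gi: "good C Z (Nd s (Nd t u)) EAi (aid C Z (Nd (Nd s t) u))" by (rule good_aid[OF C S(2) Z]) simp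
 have "fU C (enc (Nd s (Nd t u))) (enc (Nd (Nd s t) u)) (enc (Nd s (Nd t u))) (elem C (Nd (Nd s t) u) EAs (aid C Z (Nd s (Nd t u)))) (elem C (Nd s (Nd t u)) EAi (aid C Z (Nd (Nd s t) u)))
  = elem C (Nd s (Nd t u)) (EComp EAs EAi) (aid C Z (Nd s (Nd t u)))"
  by (rule ucomp_aid_aid[OF C S(2) _ _ Z]) simp_all
 also have "\<dots> = elem C (Nd s (Nd t u)) EId (aid C Z (Nd s (Nd t u)))" by (rule elem_cong) (simp add: eqv.as_ai)
 finally have r: "fU C (enc (Nd s (Nd t u))) (enc (Nd (Nd s t) u)) (enc (Nd s (Nd t u))) (elem C (Nd (Nd s t) u) EAs (aid C Z (Nd s (Nd t u)))) (elem C (Nd s (Nd t u)) EAi (aid C Z (Nd (Nd s t) u)))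
  = uid (Fr C) Z (enc (Nd s (Nd t u)))" using unt_stage[OF C S(2) Z] by simp
 show "alphainv (Fr C) (FM C) Z (enc s) (enc t) (enc u) = elem C (Nd s (Nd t u)) EAi (aid C Z (Nd (Nd s t) u))"
 proof (rule inverse_unique[OF vcategory_Fr[OF C] o(4,5) elem_hm[OF C ga] _ elem_hm[OF C gi] _ r])
  show "alphainv (Fr C) (FM C) Z (enc s) (enc t) (enc u) \<in> El (Fr C) Z (enc (Nd s (Nd t u))) (enc (Nd (Nd s t) u))"
   using alphainv(1)[OF SM o(1-3) Z] T by simp
  show "fU C (enc (Nd (Nd s t) u)) (enc (Nd s (Nd t u))) (enc (Nd (Nd s t) u)) (alphainv (Fr C) (FM C) Z (enc s) (enc t) (enc u))
    (elem C (Nd (Nd s t) u) EAs (aid C Z (Nd s (Nd t u)))) = uid (Fr C) Z (enc (Nd (Nd s t) u))"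
   using alphainv(2)[OF SM o(1-3) Z] T al by simp
 qed simp_all
qed

lemma Fob_induct:
 assumes "x \<in> Fob C" "\<And>a. a \<in> ob C ==> R (fob (FE C) a)"
  "\<And>s t. s \<in> Fob C ==> t \<in> Fob C ==> R s ==> R t ==> R (fT C s t)"
 shows "R x"
proof -
 have "s <: ob C ==> R (enc s)" for s
 proof (induction s)
  case (Lf a) then show ?case using assms(2)[of a] by simp
 next
  case (Nd s t) then show ?case using assms(3)[of "enc s" "enc t"] tob_FM[OF C] by simp
 qed
 with assms(1) show ?thesis by (auto elim: FobE)
qed

text \<open>Objects are coded trees, so structural recursion is available after decoding.\<close>

lemma Fob_rec:
 "\<exists>\<tau> :: 'u => 'x. (\<forall>a\<in>ob C. \<tau> (fob (FE C) a) = base a) \<and>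
   (\<forall>x\<in>Fob C. \<forall>y\<in>Fob C. \<tau> (fT C x y) = step x y (\<tau> x) (\<tau> y))"
proof (intro exI conjI ballI)
 let ?t = "\<lambda>x. rec_btree base (\<lambda>s t u v. step (enc s) (enc t) u v) (dec x)"
 show "?t (fob (FE C) a) = base a" if "a \<in> ob C" for a using that by simp
 fix x y assume "x \<in> Fob C" "y \<in> Fob C"
 then obtain s t where "x = enc s" "y = enc t" "s <: ob C" "t <: ob C" by (elim FobE)
 then show "?t (fT C x y) = step x y (?t x) (?t y)" using tob_FM[OF C] by simp
qed

text \<open>An element of a single summand is a tensor product of generating morphisms after a
  formal isomorphism. The former is generated by induction on the tree of arrows, the latter by
  induction on the term.\<close>

lemma els_induct:
 assumes x: "x \<in> Fob C" "y \<in> Fob C" and f: "f \<in> FA C x y" "f \<in> El (Fr C) Z x y"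
  and gen: "\<And>a b f. [|a \<in> ob C; b \<in> ob C; f \<in> El C Z a b|] ==> R (fob (FE C) a) (fob (FE C) b) (fhm (FE C) a b \<cdot> f)"
  and id: "\<And>a. a \<in> Fob C ==> R a a (uid (Fr C) Z a)"
  and comp: "\<And>a b c g f. [|a \<in> Fob C; b \<in> Fob C; c \<in> Fob C; g \<in> El (Fr C) Z b c; f \<in> El (Fr C) Z a b;
    R b c g; R a b f|] ==> R a c (fU C a b c g f)"
  and tens: "\<And>a a' b b' f g. [|a \<in> Fob C; a' \<in> Fob C; b \<in> Fob C; b' \<in> Fob C; f \<in> El (Fr C) Z a a';
    g \<in> El (Fr C) Z b b'; R a a' f; R b b' g|] ==> R (fT C a b) (fT C a' b') (fR C a a' b b' f g)"
  and al: "\<And>a b c. [|a \<in> Fob C; b \<in> Fob C; c \<in> Fob C|] ==>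
    R (fT C (fT C a b) c) (fT C a (fT C b c)) (alpha (FM C) Z a b c)"
  and ai: "\<And>a b c. [|a \<in> Fob C; b \<in> Fob C; c \<in> Fob C|] ==>
    R (fT C a (fT C b c)) (fT C (fT C a b) c) (alphainv (Fr C) (FM C) Z a b c)"
  and sg: "\<And>a b. [|a \<in> Fob C; b \<in> Fob C|] ==> R (fT C a b) (fT C b a) (sigma (FM C) Z a b)"
 shows "R x y f"
proof -
 have Z: "Z \<in> Obj V" using HomD(4)[OF f(2)] .
 note tob = tob_FM[OF C]
 \<comment> \<open>The arrows at the leaves without a formal isomorphism; at each branching
   \<open>tens_id\<close> keeps the term equal to \<open>EId\<close> up to equivalence.\<close>
 have 1: "p <: arrows C Z ==> R (enc (adom p)) (enc (acod p)) (elem C (adom p) EId p)" for p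
 proof (induction p)
  case (Lf x)
  obtain a g b where x: "x = (a, g, b)" by (cases x)
  with Lf have "a \<in> ob C" "b \<in> ob C" "g \<in> El C Z a b" by (simp_all add: arrows_def)
  then show ?case using gen[of a b g] FE_app[of a b g Z] x by simp
 next
  case (Nd p q)
  then have s: "p <: arrows C Z" "q <: arrows C Z" by simp_all
  note a = set_adom_acod[OF s(1)] set_adom_acod[OF s(2)]
  have g: "good C Z (adom p) EId p" "good C Z (adom q) EId q" using s a by (simp_all add: good_def)
  have "fR C (enc (adom p)) (enc (acod p)) (enc (adom q)) (enc (acod q)) (elem C (adom p) EId p) (elem C (adom q) EId q) =
   elem C (Nd (adom p) (adom q)) EId (Nd p q)"
   using tarr_FM[OF C g(1) HOL.refl g(2) HOL.refl] elem_cong[of "Nd (adom p) (adom q)" "ETens EId EId" EId] eqv.tens_id by simp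
  then show ?case
   using tens[of "enc (adom p)" "enc (acod p)" "enc (adom q)" "enc (acod q)" "elem C (adom p) EId p" "elem C (adom q) EId q"]
    elem_hm[OF C g(1) HOL.refl] elem_hm[OF C g(2) HOL.refl] a Nd.IH(1)[OF s(1)] Nd.IH(2)[OF s(2)] tob by simp
 qed
 have idc: "R (enc s) (enc s) (elem C s EId (aid C Z s))" if "s <: ob C" for s
  using id[of "enc s"] unt_stage[OF C that Z] that by simp
 \<comment> \<open>The formal isomorphism alone, with identities at the leaves.\<close>
 have 2: "s <: ob C ==> R (enc s) (enc (reorder e s)) (elem C s e (aid C Z (reorder e s)))" for e s
 proof (induction e arbitrary: s)
  case EId then show ?case using idc by simp
 next
  case EAs
  \<comment> \<open>At shapes where associativity has no meaning, its term is equivalent to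
    \<open>EId\<close>, and the element is an identity.\<close>
  have ne: "R (enc s) (enc (reorder EAs s)) (elem C s EAs (aid C Z (reorder EAs s)))" if "eqv (shape s) EAs EId"
   using elem_cong[OF that] idc[OF EAs] eqv_reorder[OF that HOL.refl] by simp
  show ?case
  proof (cases s)
   case (Lf a) then show ?thesis using ne eqv.as_Lf by simp
  next
   case (Nd ab c)
   show ?thesis
   proof (cases ab)
    case (Lf a) then show ?thesis using ne eqv.as_Nd_Lf Nd by simp
   next
    case (Nd a b)
    with EAs \<open>s = Nd ab c\<close> have o: "a <: ob C" "b <: ob C" "c <: ob C" by simp_all
    show ?thesis using al[of "enc a" "enc b" "enc c"] FM_stage(1)[OF o Z] o tob Nd \<open>s = Nd ab c\<close> by simp
   qed
  qed
 next
  case EAi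
  have ne: "R (enc s) (enc (reorder EAi s)) (elem C s EAi (aid C Z (reorder EAi s)))" if "eqv (shape s) EAi EId"
   using elem_cong[OF that] idc[OF EAi] eqv_reorder[OF that HOL.refl] by simp
  show ?case
  proof (cases s)
   case (Lf a) then show ?thesis using ne eqv.ai_Lf by simp
  next
   case (Nd a bc)
   show ?thesis
   proof (cases bc)
    case (Lf b) then show ?thesis using ne eqv.ai_Nd_Lf Nd by simp
   next
    case (Nd b c)
    with EAi \<open>s = Nd a bc\<close> have o: "a <: ob C" "b <: ob C" "c <: ob C" by simp_all
    show ?thesis using ai[of "enc a" "enc b" "enc c"] FM_stage(3)[OF o Z] o tob Nd \<open>s = Nd a bc\<close> by simp
   qed
  qed
 next
  case ESy
  show ?case
  proof (cases s)
   case (Lf a)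
   have "eqv (shape s) ESy EId" using eqv.sy_Lf Lf by simp
   from elem_cong[OF this] show ?thesis using idc[OF ESy] Lf by simp
  next
   case (Nd a b)
   with ESy have o: "a <: ob C" "b <: ob C" by simp_all
   show ?thesis using sg[of "enc a" "enc b"] FM_stage(2)[OF o o(1) Z] o tob Nd by simp
  qed
 next
  case (EComp e f)
  have o: "reorder f s <: ob C" "reorder e (reorder f s) <: ob C" using EComp.prems by simp_all
  have "R (enc s) (enc (reorder e (reorder f s))) (fU C (enc s) (enc (reorder f s)) (enc (reorder e (reorder f s)))
    (elem C (reorder f s) e (aid C Z (reorder e (reorder f s)))) (elem C s f (aid C Z (reorder f s))))"
  proof (rule comp)
   show "R (enc s) (enc (reorder f s)) (elem C s f (aid C Z (reorder f s)))" by (rule EComp.IH(2)[OF EComp.prems])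
   show "R (enc (reorder f s)) (enc (reorder e (reorder f s))) (elem C (reorder f s) e (aid C Z (reorder e (reorder f s))))" by (rule EComp.IH(1)[OF o(1)])
   show "elem C s f (aid C Z (reorder f s)) \<in> El (Fr C) Z (enc s) (enc (reorder f s))"
    by (rule elem_hm[OF C good_aid[OF C EComp.prems Z HOL.refl]]) simp
   show "elem C (reorder f s) e (aid C Z (reorder e (reorder f s))) \<in> El (Fr C) Z (enc (reorder f s)) (enc (reorder e (reorder f s)))"
    by (rule elem_hm[OF C good_aid[OF C o(1) Z HOL.refl]]) simp
  qed (use o EComp.prems in simp_all)
  then show ?case using ucomp_aid_aid[OF C EComp.prems HOL.refl HOL.refl Z] by simp
 next
  case (ETens e f)
  show ?case
  proof (cases s)
   case (Lf a)
   have "eqv (shape s) (ETens e f) EId" using eqv.tens_Lf Lf by simp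
   from elem_cong[OF this] show ?thesis using idc[OF ETens.prems] Lf by simp
  next
   case (Nd a b)
   with ETens.prems have o: "a <: ob C" "b <: ob C" by simp_all
   note g = good_aid[OF C o(1) Z HOL.refl, of e] good_aid[OF C o(2) Z HOL.refl, of f]
   have "fR C (enc a) (enc (reorder e a)) (enc b) (enc (reorder f b)) (elem C a e (aid C Z (reorder e a))) (elem C b f (aid C Z (reorder f b)))
    = elem C s (ETens e f) (aid C Z (reorder (ETens e f) s))"
    using tarr_FM[OF C g(1) _ g(2)] Nd by simp
   then show ?thesis
    using tens[of "enc a" "enc (reorder e a)" "enc b" "enc (reorder f b)" "elem C a e (aid C Z (reorder e a))" "elem C b f (aid C Z (reorder f b))"]
     elem_hm[OF C g(1)] elem_hm[OF C g(2)] o ETens.IH(1)[OF o(1)] ETens.IH(2)[OF o(2)] tob Nd by simp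
  qed
 qed
 obtain s t where xy: "x = enc s" "y = enc t" and s: "s <: ob C" "t <: ob C" using x by (elim FobE)
 obtain e p where p: "f = elem C s e p" "good C Z s e p" "acod p = t"
  by (rule elsE[OF C _ HomD(2)[OF f(2)]]) (use f(1) xy in \<open>simp add: FA_def\<close>)
 have r: "reorder e s <: ob C" using s by simp
 have g: "good C Z (reorder e s) EId p" using goodD[OF p(2)] by (simp add: good_def)
 note ga = good_aid[OF C s(1) Z HOL.refl, of e]
 \<comment> \<open>The given element is the composite of the two kinds just treated.\<close>
 have "R (enc s) (enc t) (fU C (enc s) (enc (reorder e s)) (enc t) (elem C (reorder e s) EId p) (elem C s e (aid C Z (reorder e s))))"
  by (rule comp[OF _ _ _ elem_hm[OF C g p(3)] elem_hm[OF C ga]])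
   (use s r 2[OF s(1)] 1[OF goodD(2)[OF p(2)]] goodD(3)[OF p(2)] p(3) in simp_all)
 moreover have "fU C (enc s) (enc (reorder e s)) (enc t) (elem C (reorder e s) EId p) (elem C s e (aid C Z (reorder e s))) = f"
  using ucomp_aid_right[OF C g p(3) HOL.refl s(1)] elem_cong[OF eqv.idl] p(1) by simp
 ultimately show ?thesis by (simp add: xy)
qed

text \<open>The value on a formal composite is forced: the term is interpreted in \<open>D\<close>
  and followed by the tensor product of the images of the arrows. Soundness of \<open>interp\<close>
  makes this independent of the representative of the class.\<close>

lemma ext_exists:
 assumes N: "symmetric_monoidal V D N" and G: "vfunctor V G" "fsrc G = C" "ftgt G = D"
 shows "\<exists>P. strict_monoidal V (Fr C) (FM C) D N P \<and> P oo FE C = G"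
proof -
 note T = symmetric_monoidal_is_tensor[OF N] note D = is_tensorD(1)[OF T] and v = val_ob[OF T]
 let ?G = "map_btree (fob G)"
 have Go: "?G s <: ob D" if "s <: ob C" for s
  using that vfun_fob[OF G] by (auto simp: btree.set_map)
 define ev where "ev Z s e p = ucomp V D (val N (?G s)) (val N (reorder e (?G s))) (val N (?G (acod p)))
   (tensor N (amap G p)) (interp D N Z e (?G s))" for Z s e p
 have gd: "amap G p <: arrows D Z" "?G s <: ob D" "reorder e (?G s) <: ob D"
  "?G (acod p) <: ob D" "adom (amap G p) = reorder e (?G s)" "Z \<in> Obj V" if "good C Z s e p" for Z s e p
  using set_amap[OF G goodD(2)[OF that]] Go[OF goodD(1)[OF that]] Go[OF goodD(4)[OF that]] goodD(3,5)[OF that]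
  by (simp_all add: map_reorder)
 have tG: "tensor N (amap G p) \<in> El D Z (val N (reorder e (?G s))) (val N (?G (acod p)))" if "good C Z s e p" for Z s e p
  using tensor_Hom[OF T gd(1)[OF that]] gd(5)[OF that] by simp
 have iG: "interp D N Z e (?G s) \<in> El D Z (val N (?G s)) (val N (reorder e (?G s)))" if "good C Z s e p" for Z s e p
  by (rule interp_Hom[OF N gd(6)[OF that] gd(2)[OF that]])
 define m where "m s t = (SOME m. m \<in> El D (fhom C s t) (val N (?G s)) (val N (?G t)) \<and>
   (\<forall>Z e p. good C Z s e p --> acod p = t --> m \<cdot> elem C s e p = ev Z s e p))" for s t
 have m: "m s t \<in> El D (fhom C s t) (val N (?G s)) (val N (?G t))"
   "\<And>Z e p. good C Z s e p ==> acod p = t ==> m s t \<cdot> elem C s e p = ev Z s e p"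
  if s: "s <: ob C" and t: "t <: ob C" for s t
 proof -
  have "\<exists>m. m \<in> El D (fhom C s t) (val N (?G s)) (val N (?G t)) \<and>
   (\<forall>Z e p. good C Z s e p --> acod p = t --> m \<cdot> elem C s e p = ev Z s e p)"
  proof (rule ex_map1[OF C s t hm_Obj[OF D v[OF Go[OF s]] v[OF Go[OF t]]]])
   fix Z e p assume g: "good C Z s e p" and p: "acod p = t"
   show "ev Z s e p \<in> El D Z (val N (?G s)) (val N (?G t))"
    unfolding ev_def p[symmetric] by (rule ucomp_Hom[OF D v[OF gd(2)[OF g]] v[OF gd(3)[OF g]] v[OF gd(4)[OF g]] tG[OF g] iG[OF g]])
   show "ev Z s e p = ev Z s e' p" if "eqv (shape s) e e'" for e'
    using interp_eqv[OF N gd(6)[OF g] that _ gd(2)[OF g]] eqv_reorder[OF that, of "?G s"] by (simp add: ev_def)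
   fix Z' k assume k: "k \<in> Hom V Z' Z"
   show "ev Z s e p \<cdot> k = ev Z' s e (apre k p)"
    unfolding ev_def ucomp_Comp[OF D v[OF gd(2)[OF g]] v[OF gd(3)[OF g]] v[OF gd(4)[OF g]] tG[OF g] iG[OF g] k] interp_Comp[OF N k gd(2)[OF g]]
     amap_apre[OF G(1,2) k goodD(2)[OF g]] tensor_apre[OF T k gd(1)[OF g]] by simp
  qed
  from someI_ex[OF this] show "m s t \<in> El D (fhom C s t) (val N (?G s)) (val N (?G t))"
   "\<And>Z e p. good C Z s e p ==> acod p = t ==> m s t \<cdot> elem C s e p = ev Z s e p"
   unfolding m_def by blast+
 qed
 define P where "P = \<lparr>fsrc = Fr C, ftgt = D, fob = (\<lambda>x\<in>Fob C. val N (?G (dec x))),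
   fhm = (\<lambda>x y. if x \<in> Fob C \<and> y \<in> Fob C then m (dec x) (dec y) else undefined)\<rparr>"
 have P: "fsrc P = Fr C" "ftgt P = D" "\<And>s. s <: ob C ==> fob P (enc s) = val N (?G s)"
  "\<And>s t. s <: ob C ==> t <: ob C ==> fhm P (enc s) (enc t) = m s t"
  by (simp_all add: P_def)
 have Pe: "fhm P (enc s) (enc t) \<cdot> elem C s e p = ev Z s e p" if g: "good C Z s e p" "acod p = t" for Z s t e p
 proof -
  have st: "s <: ob C" "t <: ob C" using goodD(1,4)[OF g(1)] g(2) by simp_all
  show ?thesis using m(2)[OF st g] P(4)[OF st] by simp
 qed
 have ev_aid: "ev Z s e (aid C Z (reorder e s)) = interp D N Z e (?G s)" if s: "s <: ob C" and Z: "Z \<in> Obj V" for Z s e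
 proof -
  have g: "good C Z s e (aid C Z (reorder e s))" by (rule good_aid[OF C s Z HOL.refl])
  have "amap G (aid C Z (reorder e s)) = aid D Z (reorder e (?G s))" using amap_aid[OF G Z, of "reorder e s"] s by (simp add: map_reorder)
  then show ?thesis
   using tensor_aid[OF T Z gd(3)[OF g]] ucomp_uid(1)[OF D v[OF gd(2)[OF g]] v[OF gd(3)[OF g]] iG[OF g]] by (simp add: ev_def map_reorder)
 qed
 have PV: "vfunctor V P"
 proof (rule vfunctorI, unfold P(1,2))
  show "vcategory V (Fr C)" "vcategory V D" "dfam (Fr C) (FA C)" using vcategory_Fr[OF C] D dfam_FA[OF C] by simp_all
  fix x assume "x \<in> ob (Fr C)"
  then obtain s where x: "x = enc s" and s: "s <: ob C" by (auto elim: FobE)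
  show "fob P x \<in> ob D" unfolding x P(3)[OF s] by (rule v[OF Go[OF s]])
  show "fhm P x x \<cdot> unt (Fr C) x = unt D (fob P x)"
   using Pe[OF good_aid[OF C s Term_Obj, of s EId]] ev_aid[OF s Term_Obj, of EId] v[OF Go[OF s]] D s by (simp add: x P(3)[OF s])
  fix y assume "y \<in> ob (Fr C)"
  then obtain t where y: "y = enc t" and t: "t <: ob C" by (auto elim: FobE)
  show "fhm P x y \<in> El D (hm (Fr C) x y) (fob P x) (fob P y)"
   using m(1)[OF s t] s t by (simp add: x y P)
  fix z f g Z assume "z \<in> ob (Fr C)" and g: "g \<in> FA C y z" "Dom V g = Z" and f: "f \<in> FA C x y" "Dom V f = Z"
  then obtain u where z: "z = enc u" and u: "u <: ob C" by (auto elim: FobE)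
  obtain e p where p: "f = elem C s e p" "good C Z s e p" "acod p = t" by (rule elsE[OF C _ f(2)]) (use f x y in \<open>simp add: FA_def\<close>)
  obtain e' q where q: "g = elem C t e' q" "good C Z t e' q" "acod q = u" by (rule elsE[OF C _ g(2)]) (use g y z in \<open>simp add: FA_def\<close>)
  note qp = good_comp[OF C q(2) p(2,3)]
  have r: "reorder e' p <: arrows C Z" "adom q = acod (reorder e' p)"
   using goodD[OF p(2)] goodD[OF q(2)] p(3) by (simp_all add: map_reorder)
  have rG: "amap G (reorder e' p) <: arrows D Z" using set_amap[OF G r(1)] .
  have co: "adom (amap G q) = acod (amap G (reorder e' p))" using r(2) by simp
  have ta: "tensor N (amap G (acomp C q (reorder e' p))) = ucomp V D (val N (reorder e' (reorder e (?G s)))) (val N (reorder e' (?G t))) (val N (?G u))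
    (tensor N (amap G q)) (tensor N (amap G (reorder e' p)))"
   using tensor_acomp[OF T rG gd(1)[OF q(2)] co] amap_acomp[OF G r(1) goodD(2)[OF q(2)] r(2)] goodD(3)[OF p(2)] p(3) q(3)
   by (simp add: map_reorder)
  have oo: "reorder e' (reorder e (?G s)) <: ob D" using gd(3)[OF p(2)] by simp
  have rt: "tensor N (amap G (reorder e' p)) \<in> El D Z (val N (reorder e' (reorder e (?G s)))) (val N (reorder e' (?G t)))"
   using tensor_Hom[OF T rG] goodD(3)[OF p(2)] p(3) by (simp add: map_reorder)
  have ri: "interp D N Z e' (reorder e (?G s)) \<in> El D Z (val N (reorder e (?G s))) (val N (reorder e' (reorder e (?G s))))"
   by (rule interp_Hom[OF N gd(6)[OF p(2)] gd(3)[OF p(2)]])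
  \<comment> \<open>The interpretation of \<open>e'\<close> is moved past the images of the arrows
    in \<open>p\<close>, which mirrors the composition rule of \<open>Fr C\<close>.\<close>
  have nat: "ucomp V D (val N (reorder e (?G s))) (val N (reorder e' (reorder e (?G s)))) (val N (reorder e' (?G t))) (tensor N (amap G (reorder e' p))) (interp D N Z e' (reorder e (?G s)))
   = ucomp V D (val N (reorder e (?G s))) (val N (?G t)) (val N (reorder e' (?G t))) (interp D N Z e' (?G t)) (tensor N (amap G p))"
   using interp_natural[OF N gd(6)[OF p(2)] gd(1)[OF p(2)], of e'] gd(5)[OF p(2)] p(3) goodD(3)[OF p(2)] by (simp add: map_reorder)
  have "fhm P x z \<cdot> fU C x y z g f = ev Z s (EComp e' e) (acomp C q (reorder e' p))"
   unfolding x y z p(1) q(1) ucomp_elem[OF C q(2,3) p(2,3)] by (rule Pe[OF qp(1)]) (use qp(2) q(3) in simp)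
  also have "\<dots> = ucomp V D (val N (?G s)) (val N (?G t)) (val N (?G u)) (ev Z t e' q) (ev Z s e p)"
   unfolding ev_def ta interp.simps qp(2) q(3) p(3) reorder.simps
   by (rule ucomp_exchange[OF D v[OF gd(2)[OF p(2)]] v[OF gd(3)[OF p(2)]] v[OF oo] v[OF Go[OF t]] v[OF gd(3)[OF q(2)]] v[OF Go[OF u]]
    iG[OF p(2)] ri rt tG[OF q(2), unfolded q(3)] tG[OF p(2), unfolded p(3)] iG[OF q(2)] nat])
  also have "\<dots> = ucomp V D (fob P x) (fob P y) (fob P z) (fhm P y z \<cdot> g) (fhm P x y \<cdot> f)"
   unfolding x y z p(1) q(1) Pe[OF p(2,3)] Pe[OF q(2,3)] P(3)[OF s] P(3)[OF t] P(3)[OF u] ..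
  finally show "fhm P x z \<cdot> fU C x y z g f = ucomp V D (fob P x) (fob P y) (fob P z) (fhm P y z \<cdot> g) (fhm P x y \<cdot> f)" .
 qed (auto simp: P_def)
 have "strict_monoidal V (Fr C) (FM C) D N P"
 proof (rule strict_monoidalI[OF PV P(1,2) dfam_FA[OF C] is_tensor_FM[OF C] T], unfold Fr_simps(1))
  fix a b assume "a \<in> Fob C" "b \<in> Fob C"
  then obtain s t where ab: "a = enc s" "b = enc t" and s: "s <: ob C" "t <: ob C" by (elim FobE)
  have st: "Nd s t <: ob C" using s by simp
  show "fob P (fT C a b) = tob N (fob P a) (fob P b)"
   using P(3)[OF s(1)] P(3)[OF s(2)] P(3)[OF st] tob_FM[OF C s] by (simp add: ab)
  note vs = v[OF Go[OF s(1)]] v[OF Go[OF s(2)]]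
  show "fhm P (fT C a b) (fT C b a) \<cdot> ncomp (symm (FM C)) (a, b) = ncomp (symm N) (fob P a, fob P b)"
   using Pe[OF good_aid[OF C st Term_Obj, of "Nd t s" ESy], of "Nd t s"] ev_aid[OF st Term_Obj, of ESy] FM_comps(2)[OF s s(1)] sigma_Term[OF N vs]
    tob_FM[OF C s] tob_FM[OF C s(2,1)] P(3)[OF s(1)] P(3)[OF s(2)] by (simp add: ab)
  fix c assume "c \<in> Fob C"
  then obtain u where c: "c = enc u" and u: "u <: ob C" by (elim FobE)
  have stu: "Nd (Nd s t) u <: ob C" using s u by simp
  show "fhm P (fT C (fT C a b) c) (fT C a (fT C b c)) \<cdot> ncomp (asc (FM C)) ((a, b), c) = ncomp (asc N) ((fob P a, fob P b), fob P c)"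
   using Pe[OF good_aid[OF C stu Term_Obj, of "Nd s (Nd t u)" EAs], of "Nd s (Nd t u)"] ev_aid[OF stu Term_Obj, of EAs] FM_comps(1)[OF s u]
    alpha_Term[OF N vs v[OF Go[OF u]]] tob_FM[OF C] s u P(3)[OF s(1)] P(3)[OF s(2)] P(3)[OF u] by (simp add: ab c)
 next
  fix a a' b b' f g Z assume "a \<in> Fob C" "a' \<in> Fob C" "b \<in> Fob C" "b' \<in> Fob C" and fg: "f \<in> FA C a a'" "g \<in> FA C b b'" and Z: "Dom V f = Z" "Dom V g = Z"
  then obtain s s' t t' where x: "a = enc s" "a' = enc s'" "b = enc t" "b' = enc t'"
   and s: "s <: ob C" "s' <: ob C" "t <: ob C" "t' <: ob C" by (elim FobE)
  obtain e p where p: "f = elem C s e p" "good C Z s e p" "acod p = s'" by (rule elsE[OF C _ Z(1)]) (use fg x in \<open>simp add: FA_def\<close>)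
  obtain e' q where q: "g = elem C t e' q" "good C Z t e' q" "acod q = t'" by (rule elsE[OF C _ Z(2)]) (use fg x in \<open>simp add: FA_def\<close>)
  note pq = good_ETens[OF C p(2) q(2)]
  \<comment> \<open>The interchange law separates the tensor product of two values into its
    isomorphisms and its arrows.\<close>
  have "ev Z (Nd s t) (ETens e e') (Nd p q) = tarr V N (val N (?G s)) (val N (?G s')) (val N (?G t)) (val N (?G t')) (ev Z s e p) (ev Z t e' q)"
   using tarr_ucomp[OF T v[OF gd(2)[OF p(2)]] v[OF gd(3)[OF p(2)]] v[OF gd(4)[OF p(2)]] v[OF gd(2)[OF q(2)]] v[OF gd(3)[OF q(2)]] v[OF gd(4)[OF q(2)]] tG[OF p(2)] iG[OF p(2)] tG[OF q(2)] iG[OF q(2)]]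
    gd(5)[OF p(2)] gd(5)[OF q(2)] p(3) q(3) goodD(3)[OF p(2)] goodD(3)[OF q(2)] by (simp add: ev_def map_reorder)
  then show "fhm P (fT C a b) (fT C a' b') \<cdot> fR C a a' b b' f g =
    tarr V N (fob P a) (fob P a') (fob P b) (fob P b') (fhm P a a' \<cdot> f) (fhm P b b' \<cdot> g)"
   using Pe[OF pq, of "Nd s' t'"] Pe[OF p(2,3)] Pe[OF q(2,3)] tarr_FM[OF C p(2,3) q(2,3)] p q tob_FM[OF C s(1,3)] tob_FM[OF C s(2,4)]
    P(3)[OF s(1)] P(3)[OF s(2)] P(3)[OF s(3)] P(3)[OF s(4)] by (simp add: x)
 qed
 moreover have "P oo FE C = G"
 proof -
  have s: "fsrc P = ftgt (FE C)" by (simp add: P(1))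
  show ?thesis
  proof (rule vfunctor_eqI'[OF vfunctor_comp[OF vfunctor_FE PV s] G(1) _ G(2)])
   fix a b f Z assume o: "a \<in> ob C" "b \<in> ob C" and f: "f \<in> El C Z a b"
   have Gf: "fhm G a b \<cdot> f \<in> El D Z (fob G a) (fob G b)" by (rule vfun_app[OF G o f])
   have "fhm (P oo FE C) a b \<cdot> f = fhm P (enc (Lf a)) (enc (Lf b)) \<cdot> elem C (Lf a) EId (Lf (a, f, b))"
    unfolding vfun_comp_app[OF vfunctor_FE FE_simps(1) PV s o f] FE_app[OF o f] using o by simp
   also have "\<dots> = ev Z (Lf a) EId (Lf (a, f, b))" by (rule Pe[OF good_Lf[OF o f]]) simp
   also have "\<dots> = fhm G a b \<cdot> f" using Gf D vfun_fob[OF G o(1)] vfun_fob[OF G o(2)] by (simp add: ev_def)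
   finally show "fhm (P oo FE C) a b \<cdot> f = fhm G a b \<cdot> f" .
  qed (use P G in simp_all)
 qed
 ultimately show ?thesis by blast
qed

end

sublocale free_symm V U Fr FM FE FA
proof
 fix C assume "C \<in> cell0 (VCat U V)"
 then have C: "vcategory V C" and s: "ob C \<in> Small U" by simp_all
 show "ob (Fr C) \<in> Small U" using enc_small[OF s] by (simp add: Fob_def)
 show "symmetric_monoidal V (Fr C) (FM C)" by (rule symmetric_monoidal_FM[OF C])
 show "vfunctor V (FE C) \<and> fsrc (FE C) = C \<and> ftgt (FE C) = Fr C" using vfunctor_FE[OF C] FE_simps[OF C] by simp
 show "dfam (Fr C) (FA C)" by (rule dfam_FA[OF C])
 show "\<exists>\<tau> :: 'u => 'a. (\<forall>a\<in>ob C. \<tau> (fob (FE C) a) = base a) \<and>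
   (\<forall>x\<in>ob (Fr C). \<forall>y\<in>ob (Fr C). \<tau> (fT C x y) = step x y (\<tau> x) (\<tau> y))" for base step
  using Fob_rec[OF C, of base step] by simp
 show "\<exists>P. strict_monoidal V (Fr C) (FM C) D N P \<and> P oo FE C = G"
  if "symmetric_monoidal V D N" "vfunctor V G" "fsrc G = C" "ftgt G = D" for D :: "('u, 'v, 'a) vcat" and N G
  using ext_exists[OF C that] .
 fix x assume x: "x \<in> ob (Fr C)"
 show "R x" if "\<And>a. a \<in> ob C ==> R (fob (FE C) a)"
   "\<And>s t. s \<in> ob (Fr C) ==> t \<in> ob (Fr C) ==> R s ==> R t ==> R (fT C s t)" for R
  using Fob_induct[OF C, of x R] that x by simp
 fix y f Z R2 assume "y \<in> ob (Fr C)" "f \<in> FA C x y" "f \<in> El (Fr C) Z x y"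
   "\<And>a b f. [|a \<in> ob C; b \<in> ob C; f \<in> El C Z a b|] ==> R2 (fob (FE C) a) (fob (FE C) b) (fhm (FE C) a b \<cdot> f)"
   "\<And>a. a \<in> ob (Fr C) ==> R2 a a (uid (Fr C) Z a)"
   "\<And>a b c g f. [|a \<in> ob (Fr C); b \<in> ob (Fr C); c \<in> ob (Fr C); g \<in> El (Fr C) Z b c; f \<in> El (Fr C) Z a b;
    R2 b c g; R2 a b f|] ==> R2 a c (fU C a b c g f)"
   "\<And>a a' b b' f g. [|a \<in> ob (Fr C); a' \<in> ob (Fr C); b \<in> ob (Fr C); b' \<in> ob (Fr C); f \<in> El (Fr C) Z a a';
    g \<in> El (Fr C) Z b b'; R2 a a' f; R2 b b' g|] ==> R2 (fT C a b) (fT C a' b') (fR C a a' b b' f g)"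
   "\<And>a b c. [|a \<in> ob (Fr C); b \<in> ob (Fr C); c \<in> ob (Fr C)|] ==>
    R2 (fT C (fT C a b) c) (fT C a (fT C b c)) (alpha (FM C) Z a b c)"
   "\<And>a b c. [|a \<in> ob (Fr C); b \<in> ob (Fr C); c \<in> ob (Fr C)|] ==>
    R2 (fT C a (fT C b c)) (fT C (fT C a b) c) (alphainv (Fr C) (FM C) Z a b c)"
   "\<And>a b. [|a \<in> ob (Fr C); b \<in> ob (Fr C)|] ==> R2 (fT C a b) (fT C b a) (sigma (FM C) Z a b)"
 then show "R2 x y f" using x unfolding Fr_simps(1) by (intro els_induct[OF C, of x y f Z R2]) simp_all
qed

end

section \<open>Coproducts of simplicial sets\<close>

text \<open>The summands of every hom object are indexed by terms; countability makes the union of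
  small sets over such an index set small.\<close>

instance expr :: countable by countable_datatype

section \<open>Smallness of countable unions and coding of trees\<close>

context universe
begin

lemma ex_nat_code: "\<exists>f :: nat => 'u. inj f \<and> range f \<in> Small U"
proof -
 obtain A where A: "A \<in> Small U" "infinite A" using infinite_small by blast
 then obtain f :: "nat => 'u" where "inj f" "range f \<subseteq> A" using infinite_countable_subset by blast
 with subset_small[OF A(1)] show ?thesis by blast
qed

text \<open>Some small set contains a copy of the natural numbers, which reduces a countable union
  to \<open>Union_small\<close>.\<close>

lemma UN_nat_small:
 assumes "\<And>n :: nat. F n \<in> Small U"
 shows "(\<Union>n. F n) \<in> Small U"
proof -
 obtain f :: "nat => 'u" where f: "inj f" "range f \<in> Small U" using ex_nat_code by blast
 have "(\<Union>a\<in>range f. F (the_inv f a)) \<in> Small U" by (rule Union_small[OF f(2)]) (rule assms)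
 with f(1) show ?thesis by (simp add: the_inv_f_f)
qed

lemma UN_countable_small:
 fixes F :: "'i :: countable => 'u set"
 assumes "\<And>i. i \<in> I ==> F i \<in> Small U"
 shows "(\<Union>i\<in>I. F i) \<in> Small U"
proof (rule subset_small[OF UN_nat_small])
 \<comment> \<open>Numbers that code no member of \<open>I\<close> are assigned a singleton, which
   is small by \<open>sing_small\<close>.\<close>
 let ?G = "\<lambda>n. if \<exists>i\<in>I. to_nat i = n then F (from_nat n) else {undefined}"
 show "?G n \<in> Small U" for n using assms sing_small by (auto split: if_split)
 show "(\<Union>i\<in>I. F i) \<subseteq> (\<Union>n. ?G n)"
 proof safe
  fix x i assume "i \<in> I" "x \<in> F i"
  then have "x \<in> ?G (to_nat i)" by auto
  then show "x \<in> (\<Union>n. ?G n)" by blast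
 qed
qed

lemma Un_small: "A \<in> Small U ==> B \<in> Small U ==> A \<union> B \<in> Small U"
 using UN_countable_small[of "UNIV :: bool set" "\<lambda>b. if b then A else B"] by (simp add: UNIV_bool Un_commute)

text \<open>The tags \<open>p\<close> and \<open>q\<close> keep leaves and branchings apart, since
  every element of \<open>'u\<close> might itself be a coded pair.\<close>

primrec encode :: "'u => 'u => 'u btree => 'u" where
 "encode p q (Lf x) = upair U p x"
| "encode p q (Nd s t) = upair U q (upair U (encode p q s) (encode p q t))"

lemma inj_encode:
 assumes "p \<noteq> q"
 shows "inj (encode p q)"
proof
 show "encode p q s = encode p q t ==> s = t" for s t
 proof (induction s arbitrary: t)
  case (Lf x) with assms show ?case by (cases t) (simp_all add: upair_inject)
 next
  case (Nd a b) with assms show ?case by (cases t) (auto simp: upair_inject)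
 qed
qed

text \<open>The codes are exhausted by countably many small stages; stage \<open>F n\<close>
  contains those of the trees of depth at most \<open>n\<close>.\<close>

lemma encode_small:
 assumes A: "A \<in> Small U"
 shows "encode p q ` {t. t <: A} \<in> Small U"
proof -
 define F where "F = rec_nat (upair U p ` A) (\<lambda>_ B. B \<union> upair U q ` uprod U B B)"
 have F: "F 0 = upair U p ` A" "F (Suc n) = F n \<union> upair U q ` uprod U (F n) (F n)" for n by (simp_all add: F_def)
 have "F n \<in> Small U" for n by (induction n) (auto simp: F intro!: Un_small image_small uprod_small A)
 then have S: "(\<Union>n. F n) \<in> Small U" by (rule UN_nat_small)
 have mono: "F m \<subseteq> F n" if "m \<le> n" for m n by (rule lift_Suc_mono_le[OF _ that]) (simp add: F)
 have "t <: A ==> \<exists>n. encode p q t \<in> F n" for t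
 proof (induction t)
  case (Lf x) then show ?case using F(1) by force
 next
  case (Nd s t)
  then obtain m n where "encode p q s \<in> F m" "encode p q t \<in> F n" by auto
  with mono[of m "max m n"] mono[of n "max m n"] have "encode p q s \<in> F (max m n)" "encode p q t \<in> F (max m n)" by auto
  then have "encode p q (Nd s t) \<in> F (Suc (max m n))" by (auto simp: F(2))
  then show ?case by blast
 qed
 then show ?thesis by (intro subset_small[OF S]) auto
qed

lemma ex_enc: "\<exists>enc :: 'u btree => 'u. inj enc \<and> (\<forall>A\<in>Small U. enc ` {t. t <: A} \<in> Small U)"
proof -
 obtain f :: "nat => 'u" where "inj f" using ex_nat_code by blast
 then have "f 0 \<noteq> f 1" by (simp add: inj_eq)
 with inj_encode encode_small show ?thesis by blast
qed

text \<open>Supplies tags in \<open>'u\<close> for the summands of disjoint unions indexed by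
  terms.\<close>

lemma ex_tag: "\<exists>c :: expr => 'u. inj c"
proof -
 obtain f :: "nat => 'u" where "inj f" using ex_nat_code by blast
 then have "inj (f \<circ> (to_nat :: expr => nat))" by (rule inj_compose) simp
 then show ?thesis by blast
qed

section \<open>Disjoint unions of simplicial sets\<close>

lemma sSet_simps:
 "X \<in> Obj (sSet U) \<longleftrightarrow> simplicial_set X \<and> (\<forall>n. simp X n \<in> Small U)"
 "f \<in> Hom (sSet U) X Y \<longleftrightarrow> sdom f = X \<and> scod f = Y \<and> X \<in> Obj (sSet U) \<and> Y \<in> Obj (sSet U) \<and> simplicial_map f"
 "Comp (sSet U) g f = \<lparr>sdom = sdom f, scod = scod g, sfun = (\<lambda>n. \<lambda>x\<in>simp (sdom f) n. sfun g n (sfun f n x))\<rparr>"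
 "Prod (sSet U) X Y = sset_prod U X Y"
 "Pr1 (sSet U) X Y = \<lparr>sdom = sset_prod U X Y, scod = X, sfun = (\<lambda>n. \<lambda>z\<in>uprod U (simp X n) (simp Y n). fst (unpair U z))\<rparr>"
 "Pr2 (sSet U) X Y = \<lparr>sdom = sset_prod U X Y, scod = Y, sfun = (\<lambda>n. \<lambda>z\<in>uprod U (simp X n) (simp Y n). snd (unpair U z))\<rparr>"
 "Tuple (sSet U) f g = \<lparr>sdom = sdom f, scod = sset_prod U (scod f) (scod g),
   sfun = (\<lambda>n. \<lambda>x\<in>simp (sdom f) n. upair U (sfun f n x) (sfun g n x))\<rparr>"
 by (auto simp: sSet_def Hom_def Let_def compose_def)

context
 fixes c :: "expr => 'u"
 assumes c: "inj c"
begin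

text \<open>A simplex carries the tag of its summand, and \<open>the_inv c\<close> recovers from it
  the simplicial set whose operators act.\<close>

definition sset_coprod :: "expr set => (expr => 'u sset) => 'u sset" where
 "sset_coprod I X = (let S = (\<lambda>n. \<Union>i\<in>I. upair U (c i) ` simp (X i) n) in
  \<lparr>simp = S, act = (\<lambda>m n \<theta>. if \<theta> \<in> Delta m n
    then (\<lambda>z\<in>S n. upair U (fst (unpair U z)) (act (X (the_inv c (fst (unpair U z)))) m n \<theta> (snd (unpair U z))))
    else (\<lambda>_. undefined))\<rparr>)"

lemma sset_coprod_simps:
 "simp (sset_coprod I X) n = (\<Union>i\<in>I. upair U (c i) ` simp (X i) n)"
 "[|\<theta> \<in> Delta m n; i \<in> I; x \<in> simp (X i) n|] ==> act (sset_coprod I X) m n \<theta> (upair U (c i) x) = upair U (c i) (act (X i) m n \<theta> x)"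
 using c by (auto simp: sset_coprod_def Let_def upair_inject the_inv_f_f)

lemma in_sset_coprod [simp]: "upair U (c i) x \<in> simp (sset_coprod I X) n \<longleftrightarrow> i \<in> I \<and> x \<in> simp (X i) n"
 using c by (auto simp: sset_coprod_simps(1) upair_inject inj_eq)

lemma sset_coprod_Obj:
 assumes X: "\<And>i. i \<in> I ==> X i \<in> Obj (sSet U)"
 shows "sset_coprod I X \<in> Obj (sSet U)"
proof -
 note ac = sset_coprod_simps(2)[where I = I and X = X]
 have s: "simplicial_set (X i)" "simp (X i) n \<in> Small U" if "i \<in> I" for i n using X[OF that] by (simp_all add: sSet_simps)
 have "simplicial_set (sset_coprod I X)"
  unfolding simplicial_set_def
 proof (intro conjI allI ballI impI)
  fix m n \<theta> assume t: "\<theta> \<in> Delta m n"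
  show "act (sset_coprod I X) m n \<theta> \<in> simp (sset_coprod I X) n \<rightarrow>\<^sub>E simp (sset_coprod I X) m"
  proof (rule PiE_I)
   fix z assume "z \<in> simp (sset_coprod I X) n"
   then obtain i x where z: "z = upair U (c i) x" "i \<in> I" "x \<in> simp (X i) n" by (auto simp: sset_coprod_simps(1))
   show "act (sset_coprod I X) m n \<theta> z \<in> simp (sset_coprod I X) m"
    using ac[OF t z(2,3)] act_in[OF s(1)[OF z(2)] t z(3)] z by simp
  next
   show "act (sset_coprod I X) m n \<theta> z = undefined" if "z \<notin> simp (sset_coprod I X) n" for z
    using that t by (simp add: sset_coprod_def Let_def)
  qed
 next
  show "act (sset_coprod I X) m n \<theta> = (\<lambda>_. undefined)" if "\<theta> \<notin> Delta m n" for m n \<theta>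
   using that by (simp add: sset_coprod_def Let_def)
 next
  fix n z assume "z \<in> simp (sset_coprod I X) n"
  then obtain i x where z: "z = upair U (c i) x" "i \<in> I" "x \<in> simp (X i) n" by (auto simp: sset_coprod_simps(1))
  have "act (X i) n n (\<lambda>i\<in>{..n}. i) x = x" using s(1)[OF z(2)] z(3) unfolding simplicial_set_def by blast
  then show "act (sset_coprod I X) n n (\<lambda>i\<in>{..n}. i) z = z" using ac[OF Delta_id z(2,3)] z(1) by simp
 next
  fix m n p \<theta> \<phi> z assume t: "\<theta> \<in> Delta m n" "\<phi> \<in> Delta n p" and "z \<in> simp (sset_coprod I X) p"
  then obtain i x where z: "z = upair U (c i) x" "i \<in> I" "x \<in> simp (X i) p" by (auto simp: sset_coprod_simps(1))
  have "act (X i) m p (compose {..m} \<phi> \<theta>) x = act (X i) m n \<theta> (act (X i) n p \<phi> x)"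
   using s(1)[OF z(2)] z(3) t unfolding simplicial_set_def by blast
  then show "act (sset_coprod I X) m p (compose {..m} \<phi> \<theta>) z = act (sset_coprod I X) m n \<theta> (act (sset_coprod I X) n p \<phi> z)"
   using ac[OF Delta_comp[OF t] z(2,3)] ac[OF t(2) z(2,3)]
    ac[OF t(1) z(2) act_in[OF s(1)[OF z(2)] t(2) z(3)]] z(1) by simp
 qed
 then show ?thesis using s(2) by (auto simp: sSet_simps sset_coprod_simps(1) intro!: UN_countable_small image_small)
qed

text \<open>Coproducts and products are formed levelwise, so distributivity is that of sets, and the
  induced map is defined by cases on the tag.\<close>

lemma distributive_category_sSet: "distributive_category (sSet U)"
proof -
 interpret V: cartesian_category "sSet U" by (rule cartesian_category_sSet)
 show ?thesis
 proof
  fix I and X :: "expr => 'u sset" assume X: "\<And>i. i \<in> I ==> X i \<in> Obj (sSet U)"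
  let ?H = "sset_coprod I X" and ?inc = "\<lambda>i. \<lparr>sdom = X i, scod = sset_coprod I X, sfun = (\<lambda>n. \<lambda>x\<in>simp (X i) n. upair U (c i) x)\<rparr>"
  note ac = sset_coprod_simps(2)[where I = I and X = X]
  have H: "?H \<in> Obj (sSet U)" by (rule sset_coprod_Obj[OF X])
  have inc: "?inc i \<in> Hom (sSet U) (X i) ?H" if "i \<in> I" for i
   using X[OF that] H that unfolding sSet_simps(2)
   by (auto simp: sSet_simps(1) ac intro!: simplicial_map_restrictI[where h = "\<lambda>n x. upair U (c i) x"])
  have "V.distributive_coproduct I X ?H ?inc"
   unfolding V.distributive_coproduct_def
  proof (intro conjI ballI allI impI)
   show "?H \<in> Obj (sSet U)" "\<And>i. i \<in> I ==> ?inc i \<in> Hom (sSet U) (X i) ?H" using H inc by simp_all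
   fix W Y f assume W: "W \<in> Obj (sSet U)" and Y: "Y \<in> Obj (sSet U)"
    and "\<forall>i\<in>I. f i \<in> Hom (sSet U) (Prod (sSet U) (X i) W) Y"
   then have f: "sdom (f i) = sset_prod U (X i) W" "scod (f i) = Y" "simplicial_map (f i)" if "i \<in> I" for i
    using that by (simp_all add: sSet_simps(2,4))
   \<comment> \<open>A simplex of the product has the form ((tag of i, x), w); \<open>h\<close>
     reads off i and applies \<open>f i\<close> to (x, w).\<close>
   define h where "h n z = sfun (f (the_inv c (fst (unpair U (fst (unpair U z)))))) n (upair U (snd (unpair U (fst (unpair U z)))) (snd (unpair U z)))" for n z
   have h: "h n (upair U (upair U (c i) x) w) = sfun (f i) n (upair U x w)" for n i x w
    using c by (simp add: h_def the_inv_f_f)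
   define g where "g = \<lparr>sdom = sset_prod U ?H W, scod = Y, sfun = (\<lambda>n. restrict (h n) (uprod U (simp ?H n) (simp W n)))\<rparr>"
   have PE: "\<exists>i x w. z = upair U (upair U (c i) x) w \<and> i \<in> I \<and> x \<in> simp (X i) n \<and> w \<in> simp W n" if "z \<in> uprod U (simp ?H n) (simp W n)" for n z
    using that by (auto simp: sset_coprod_simps(1) elim!: uprodE)
   have P: "sset_prod U ?H W \<in> Obj (sSet U)" using V.Prod_Obj[OF H W] by (simp add: sSet_simps(4))
   have "simplicial_map g"
   proof (rule simplicial_map_restrictI)
    show "sfun g n = restrict (h n) (simp (sdom g) n)" for n by (simp add: g_def sset_prod_simps(1))
    show "simplicial_set (sdom g)" using P by (simp add: g_def sSet_simps(1))
    fix n z assume "z \<in> simp (sdom g) n"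
    then obtain i x w where z: "z = upair U (upair U (c i) x) w" "i \<in> I" "x \<in> simp (X i) n" "w \<in> simp W n"
     using PE[of z n] by (auto simp: g_def sset_prod_simps(1))
    have xw: "upair U x w \<in> simp (sdom (f i)) n" using z f by (simp add: sset_prod_simps(1))
    show "h n z \<in> simp (scod g) n" using simplicial_map_app[OF f(3) xw] z f by (simp add: h g_def)
    fix m \<theta> assume t: "\<theta> \<in> Delta m n"
    have cx: "upair U (c i) x \<in> simp ?H n" using z by simp
    show "h m (act (sdom g) m n \<theta> z) = act (scod g) m n \<theta> (h n z)"
     using simplicial_map_act[OF f(3)[OF z(2)] xw t] f(1,2)[OF z(2)] sset_prod_simps(2)[OF t z(3,4)] sset_prod_simps(2)[OF t cx z(4)]
      ac[of \<theta> m n i x] t z by (simp add: h g_def)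
   qed
   then have g: "g \<in> Hom (sSet U) (Prod (sSet U) ?H W) Y" using P Y by (simp add: sSet_simps(2,4) g_def)
   have key: "sfun (Comp (sSet U) k (Tuple (sSet U) (Comp (sSet U) (?inc i) (Pr1 (sSet U) (X i) W)) (Pr2 (sSet U) (X i) W))) n (upair U x w)
     = sfun k n (upair U (upair U (c i) x) w)"
    if "i \<in> I" "x \<in> simp (X i) n" "w \<in> simp W n" for k i x w n
    using that by (simp add: sSet_simps sset_prod_simps(1))
   show "\<exists>!g. g \<in> Hom (sSet U) (Prod (sSet U) ?H W) Y \<and>
     (\<forall>i\<in>I. Comp (sSet U) g (Tuple (sSet U) (Comp (sSet U) (?inc i) (Pr1 (sSet U) (X i) W)) (Pr2 (sSet U) (X i) W)) = f i)"
   proof (rule ex1I[of _ g], safe)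
    show "g \<in> Hom (sSet U) (Prod (sSet U) ?H W) Y" by (rule g)
    fix i assume i: "i \<in> I"
    have t: "Tuple (sSet U) (Comp (sSet U) (?inc i) (Pr1 (sSet U) (X i) W)) (Pr2 (sSet U) (X i) W) \<in> Hom (sSet U) (Prod (sSet U) (X i) W) (Prod (sSet U) ?H W)"
     by (rule V.Tuple_Hom[OF V.Comp_Hom[OF V.Pr1_Hom[OF X[OF i] W] inc[OF i]] V.Pr2_Hom[OF X[OF i] W]])
    have k: "Comp (sSet U) g (Tuple (sSet U) (Comp (sSet U) (?inc i) (Pr1 (sSet U) (X i) W)) (Pr2 (sSet U) (X i) W)) \<in> Hom (sSet U) (Prod (sSet U) (X i) W) Y"
     by (rule V.Comp_Hom[OF t g])
    show "Comp (sSet U) g (Tuple (sSet U) (Comp (sSet U) (?inc i) (Pr1 (sSet U) (X i) W)) (Pr2 (sSet U) (X i) W)) = f i"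
    proof (rule smap_eqI)
     fix n z assume "z \<in> simp (sdom (Comp (sSet U) g (Tuple (sSet U) (Comp (sSet U) (?inc i) (Pr1 (sSet U) (X i) W)) (Pr2 (sSet U) (X i) W)))) n"
     then obtain x w where z: "z = upair U x w" "x \<in> simp (X i) n" "w \<in> simp W n"
      by (auto simp: sSet_simps sset_prod_simps(1) elim!: uprodE)
     have "upair U (c i) x \<in> simp ?H n" using z i by simp
     with key[OF i z(2,3), of g] show "sfun (Comp (sSet U) g (Tuple (sSet U) (Comp (sSet U) (?inc i) (Pr1 (sSet U) (X i) W)) (Pr2 (sSet U) (X i) W))) n z = sfun (f i) n z"
      using z by (simp add: g_def h)
    qed (use k f[OF i] in \<open>simp_all add: sSet_simps(2,4)\<close>)
   next
    fix k assume k: "k \<in> Hom (sSet U) (Prod (sSet U) ?H W) Y"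
     and e: "\<forall>i\<in>I. Comp (sSet U) k (Tuple (sSet U) (Comp (sSet U) (?inc i) (Pr1 (sSet U) (X i) W)) (Pr2 (sSet U) (X i) W)) = f i"
    show "k = g"
    proof (rule smap_eqI)
     fix n z assume "z \<in> simp (sdom k) n"
     then have zz: "z \<in> uprod U (simp ?H n) (simp W n)" using k by (simp add: sSet_simps(2,4) sset_prod_simps(1))
     from PE[OF this] obtain i x w where z: "z = upair U (upair U (c i) x) w" "i \<in> I" "x \<in> simp (X i) n" "w \<in> simp W n" by blast
     then show "sfun k n z = sfun g n z" using key[OF z(2-4), of k] e[rule_format, OF z(2)] zz by (simp add: g_def h)
    qed (use k g in \<open>simp_all add: sSet_simps(2,4)\<close>)
   qed
  qed
  then show "\<exists>H inc. V.distributive_coproduct I X H inc" by blast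
 qed
qed

end

end

section \<open>Coproducts of spaces\<close>

text \<open>The identity is one of the singular simplices on which openness is tested.\<close>

lemma Delta_generated_simplex_space: "Delta_generated (simplex_space p)"
 unfolding Delta_generated_def
proof (intro allI impI)
 fix W assume W: "Delta_open (simplex_space p) W"
 have "continuous_map (simplex_space p) (simplex_space p) id" by simp
 with W have "openin (simplex_space p) {t \<in> standard_simplex p. id t \<in> W}" unfolding Delta_open_def by blast
 moreover have "{t \<in> standard_simplex p. id t \<in> W} = W" using W by (auto simp: Delta_open_def)
 ultimately show "openin (simplex_space p) W" by simp
qed

text \<open>A \<Delta>-generated space carries the final topology for its singular simplices, so
  maps out of it may be tested on them.\<close>

lemma continuous_map_simplices:
 assumes Z: "Delta_generated Z" and g: "g \<in> topspace Z \<rightarrow> topspace Y"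
  and s: "\<And>p s. continuous_map (simplex_space p) Z s ==> continuous_map (simplex_space p) Y (g \<circ> s)"
 shows "continuous_map Z Y g"
 unfolding continuous_map_def
proof (intro conjI allI impI)
 show "g \<in> topspace Z \<rightarrow> topspace Y" by (rule g)
 fix W assume W: "openin Y W"
 have "Delta_open Z {z \<in> topspace Z. g z \<in> W}"
  unfolding Delta_open_def
 proof (intro conjI allI impI)
  fix p s' assume s': "continuous_map (simplex_space p) Z s'"
  have "openin (simplex_space p) {t \<in> topspace (simplex_space p). (g \<circ> s') t \<in> W}"
   by (rule openin_continuous_map_preimage[OF s[OF s'] W])
  moreover have "{t \<in> topspace (simplex_space p). (g \<circ> s') t \<in> W} = {t \<in> standard_simplex p. s' t \<in> {z \<in> topspace Z. g z \<in> W}}"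
   using s' by (auto simp: continuous_map_def Pi_iff)
  ultimately show "openin (simplex_space p) {t \<in> standard_simplex p. s' t \<in> {z \<in> topspace Z. g z \<in> W}}" by simp
 qed auto
 with Z show "openin Z {z \<in> topspace Z. g z \<in> W}" by (simp add: Delta_generated_def)
qed

section \<open>Disjoint unions of \<Delta>-generated spaces\<close>

context universe
begin

lemma TopDelta_simps:
 "X \<in> Obj (TopDelta U) \<longleftrightarrow> Delta_generated X \<and> topspace X \<in> Small U"
 "f \<in> Hom (TopDelta U) X Y \<longleftrightarrow> tdom f = X \<and> tcod f = Y \<and> X \<in> Obj (TopDelta U) \<and> Y \<in> Obj (TopDelta U) \<and>
   continuous_map X Y (tfun f) \<and> tfun f \<in> extensional (topspace X)"
 "Comp (TopDelta U) g f = \<lparr>tdom = tdom f, tcod = tcod g, tfun = (\<lambda>x\<in>topspace (tdom f). tfun g (tfun f x))\<rparr>"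
 "Prod (TopDelta U) X Y = Delta_prod U X Y"
 "Pr1 (TopDelta U) X Y = \<lparr>tdom = Delta_prod U X Y, tcod = X, tfun = (\<lambda>z\<in>uprod U (topspace X) (topspace Y). fst (unpair U z))\<rparr>"
 "Pr2 (TopDelta U) X Y = \<lparr>tdom = Delta_prod U X Y, tcod = Y, tfun = (\<lambda>z\<in>uprod U (topspace X) (topspace Y). snd (unpair U z))\<rparr>"
 "Tuple (TopDelta U) f g = \<lparr>tdom = tdom f, tcod = Delta_prod U (tcod f) (tcod g),
   tfun = (\<lambda>x\<in>topspace (tdom f). upair U (tfun f x) (tfun g x))\<rparr>"
 by (auto simp: TopDelta_def Hom_def Let_def compose_def)

lemma tmap_eqI:
 assumes "f \<in> Hom (TopDelta U) X Y" "g \<in> Hom (TopDelta U) X Y" "\<And>x. x \<in> topspace X ==> tfun f x = tfun g x"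
 shows "f = g"
proof -
 have "tfun f = tfun g" by (rule extensionalityI[of _ "topspace X"]) (use assms in \<open>auto simp: TopDelta_simps\<close>)
 with assms(1,2) show ?thesis by (simp add: TopDelta_simps(2))
qed

context
 fixes c :: "expr => 'u"
 assumes c: "inj c"
begin

text \<open>The disjoint union topology, that is, the final topology for the tagged
  inclusions.\<close>

definition topology_coprod :: "expr set => (expr => 'u topology) => 'u topology" where
 "topology_coprod I X = topology (\<lambda>W. W \<subseteq> (\<Union>i\<in>I. upair U (c i) ` topspace (X i)) \<and>
   (\<forall>i\<in>I. openin (X i) {x \<in> topspace (X i). upair U (c i) x \<in> W}))"

lemma openin_topology_coprod:
 "openin (topology_coprod I X) W \<longleftrightarrow> W \<subseteq> (\<Union>i\<in>I. upair U (c i) ` topspace (X i)) \<and>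
   (\<forall>i\<in>I. openin (X i) {x \<in> topspace (X i). upair U (c i) x \<in> W})"
proof -
 have 1: "{x \<in> A. h x \<in> S \<inter> T} = {x \<in> A. h x \<in> S} \<inter> {x \<in> A. h x \<in> T}" for A S T and h :: "'u => 'u" by auto
 have 2: "{x \<in> A. h x \<in> \<Union>K} = (\<Union>S\<in>K. {x \<in> A. h x \<in> S})" for A K and h :: "'u => 'u" by auto
 have "istopology (\<lambda>W. W \<subseteq> (\<Union>i\<in>I. upair U (c i) ` topspace (X i)) \<and>
   (\<forall>i\<in>I. openin (X i) {x \<in> topspace (X i). upair U (c i) x \<in> W}))"
  unfolding istopology_def 1 2 by (safe; (intro openin_Int openin_Union)?; blast)
 then show ?thesis by (simp add: topology_coprod_def)
qed

lemma topspace_topology_coprod: "topspace (topology_coprod I X) = (\<Union>i\<in>I. upair U (c i) ` topspace (X i))"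
proof
 show "topspace (topology_coprod I X) \<subseteq> (\<Union>i\<in>I. upair U (c i) ` topspace (X i))"
  using openin_topspace[of "topology_coprod I X"] unfolding openin_topology_coprod by blast
 have "{x \<in> topspace (X i). upair U (c i) x \<in> (\<Union>i\<in>I. upair U (c i) ` topspace (X i))} = topspace (X i)" if "i \<in> I" for i
  using that by blast
 then show "(\<Union>i\<in>I. upair U (c i) ` topspace (X i)) \<subseteq> topspace (topology_coprod I X)"
  by (intro openin_subset) (simp add: openin_topology_coprod)
qed

lemma in_topology_coprod [simp]:
 "upair U (c i) x \<in> topspace (topology_coprod I X) \<longleftrightarrow> i \<in> I \<and> x \<in> topspace (X i)"
 using c by (auto simp: topspace_topology_coprod upair_inject inj_eq)

lemma continuous_coprod_inc: "i \<in> I ==> continuous_map (X i) (topology_coprod I X) (upair U (c i))"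
 unfolding continuous_map_def by (simp add: openin_topology_coprod)

text \<open>Tags make the summands disjoint, so the trace of the set on every other summand is
  empty.\<close>

lemma openin_summand:
 assumes i: "i \<in> I" and Q: "openin (X i) Q"
 shows "openin (topology_coprod I X) (upair U (c i) ` Q)"
proof -
 have "{x \<in> topspace (X j). upair U (c j) x \<in> upair U (c i) ` Q} = (if j = i then Q else {})" for j
  using c openin_subset[OF Q] by (auto simp: upair_inject inj_eq)
 moreover have "upair U (c i) ` Q \<subseteq> (\<Union>i\<in>I. upair U (c i) ` topspace (X i))" using i openin_subset[OF Q] by blast
 ultimately show ?thesis using Q by (simp add: openin_topology_coprod)
qed

text \<open>Each inclusion has a \<Delta>-generated source and so remains continuous into the
  \<Delta>-ification. Hence a \<open>Delta_open\<close> set has open traces on all summands.\<close>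

lemma Delta_generated_coprod:
 assumes X: "\<And>i. i \<in> I ==> Delta_generated (X i)"
 shows "Delta_generated (topology_coprod I X)"
 unfolding Delta_generated_def
proof (intro allI impI)
 fix W assume W: "Delta_open (topology_coprod I X) W"
 show "openin (topology_coprod I X) W"
  unfolding openin_topology_coprod
 proof (intro conjI ballI)
  show "W \<subseteq> (\<Union>i\<in>I. upair U (c i) ` topspace (X i))" using W by (simp add: Delta_open_def topspace_topology_coprod)
  fix i assume i: "i \<in> I"
  have "continuous_map (X i) (Delta_ification (topology_coprod I X)) (upair U (c i))"
   by (rule continuous_from_Delta[OF X[OF i] continuous_coprod_inc[OF i, of X]])
  from openin_continuous_map_preimage[OF this] W
  show "openin (X i) {x \<in> topspace (X i). upair U (c i) x \<in> W}" by (simp add: openin_Delta_ification)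
 qed
qed

text \<open>Simplices are connected, so a simplex of a coproduct lies in one summand.\<close>

lemma simplex_coprod:
 assumes s: "continuous_map (simplex_space p) (topology_coprod I X) s"
 obtains i s' where "i \<in> I" "continuous_map (simplex_space p) (X i) s'" "\<And>t. t \<in> standard_simplex p ==> s t = upair U (c i) (s' t)"
proof -
 let ?S = "simplex_space p" and ?T = "\<lambda>i. upair U (c i) ` topspace (X i)"
 have st: "s t \<in> (\<Union>i\<in>I. ?T i)" if "t \<in> standard_simplex p" for t
  using continuous_map_image_subset_topspace[OF s] that by (simp add: topspace_topology_coprod image_subset_iff)
 obtain t0 where t0: "t0 \<in> standard_simplex p" using nonempty_standard_simplex by blast
 then obtain i where i: "i \<in> I" "s t0 \<in> ?T i" using st by blast
 have pre: "openin ?S {t \<in> standard_simplex p. s t \<in> W}" if "openin (topology_coprod I X) W" for W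
  using openin_continuous_map_preimage[OF s that] by simp
 \<comment> \<open>The summand that contains the image of \<open>t0\<close>, and the union of all
   the others: their preimages would separate the simplex if the second were nonempty.\<close>
 let ?A = "{t \<in> standard_simplex p. s t \<in> ?T i}" and ?B = "{t \<in> standard_simplex p. s t \<in> (\<Union>j\<in>I - {i}. ?T j)}"
 have sep: "openin ?S ?A" "openin ?S ?B" "topspace ?S \<subseteq> ?A \<union> ?B" "?A \<inter> ?B = {}" "?A \<noteq> {}"
 proof -
  show "openin ?S ?A" by (rule pre[OF openin_summand[OF i(1), of X, OF openin_topspace]])
  show "openin ?S ?B" by (rule pre, rule openin_Union) (auto intro: openin_summand)
  show "topspace ?S \<subseteq> ?A \<union> ?B" using st by auto
  show "?A \<inter> ?B = {}" using c by (auto simp: upair_inject inj_eq)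
  show "?A \<noteq> {}" using t0 i by auto
 qed
 have B: "?B = {}"
 proof (rule ccontr)
  assume "?B \<noteq> {}"
  with sep have "\<exists>E1 E2. openin ?S E1 \<and> openin ?S E2 \<and> topspace ?S \<subseteq> E1 \<union> E2 \<and> E1 \<inter> E2 = {} \<and> E1 \<noteq> {} \<and> E2 \<noteq> {}"
   by (intro exI[of _ ?A] exI[of _ ?B] conjI)
  moreover have "connected_space ?S" using connectedin_standard_simplex[of p] by (simp add: connectedin_def)
  ultimately show False unfolding connected_space_def by (rule notE[rotated])
 qed
 have A: "s t = upair U (c i) (snd (unpair U (s t)))" "snd (unpair U (s t)) \<in> topspace (X i)" if t: "t \<in> standard_simplex p" for t
 proof -
  have "s t \<in> ?T i" using st[OF t] B t by auto
  then show "s t = upair U (c i) (snd (unpair U (s t)))" "snd (unpair U (s t)) \<in> topspace (X i)" by auto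
 qed
 show thesis
 proof (rule that[OF i(1) _ A(1)])
  show "continuous_map ?S (X i) (\<lambda>t. snd (unpair U (s t)))"
   unfolding continuous_map_def
  proof (intro conjI allI impI)
   show "(\<lambda>t. snd (unpair U (s t))) \<in> topspace ?S \<rightarrow> topspace (X i)" using A(2) by simp
   fix Q assume Q: "openin (X i) Q"
   have "snd (unpair U (s t)) \<in> Q \<longleftrightarrow> s t \<in> upair U (c i) ` Q" if "t \<in> standard_simplex p" for t
    by (subst (2) A(1)[OF that]) (auto simp: upair_inject)
   then have "{t \<in> topspace ?S. snd (unpair U (s t)) \<in> Q} = {t \<in> standard_simplex p. s t \<in> upair U (c i) ` Q}" by auto
   with pre[OF openin_summand[OF i(1), of X, OF Q]] show "openin ?S {t \<in> topspace ?S. snd (unpair U (s t)) \<in> Q}" by simp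
  qed
 qed
qed

text \<open>Openness in a \<Delta>-ified product is defined through simplices, so continuity of the
  map given by cases is tested on them; the first component of each simplex stays in one
  summand.\<close>

lemma distributive_category_TopDelta: "distributive_category (TopDelta U)"
proof -
 interpret V: cartesian_category "TopDelta U" by (rule cartesian_category_TopDelta)
 show ?thesis
 proof
  fix I and X :: "expr => 'u topology" assume X: "\<And>i. i \<in> I ==> X i \<in> Obj (TopDelta U)"
  let ?H = "topology_coprod I X" and ?inc = "\<lambda>i. \<lparr>tdom = X i, tcod = topology_coprod I X, tfun = (\<lambda>x\<in>topspace (X i). upair U (c i) x)\<rparr>"
  have Xd: "Delta_generated (X i)" "topspace (X i) \<in> Small U" if "i \<in> I" for i using X[OF that] by (simp_all add: TopDelta_simps(1))
  have H: "?H \<in> Obj (TopDelta U)"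
   using Delta_generated_coprod[OF Xd(1)] UN_countable_small[OF image_small[OF Xd(2)]] by (simp add: TopDelta_simps(1) topspace_topology_coprod)
  have inc: "?inc i \<in> Hom (TopDelta U) (X i) ?H" if "i \<in> I" for i
   using X[OF that] H continuous_coprod_inc[OF that, of X] by (simp add: TopDelta_simps(2) cont_restrict)
  have "V.distributive_coproduct I X ?H ?inc"
   unfolding V.distributive_coproduct_def
  proof (intro conjI ballI allI impI)
   show "?H \<in> Obj (TopDelta U)" "\<And>i. i \<in> I ==> ?inc i \<in> Hom (TopDelta U) (X i) ?H" using H inc by simp_all
   fix W Y f assume W: "W \<in> Obj (TopDelta U)" and Y: "Y \<in> Obj (TopDelta U)"
    and f0: "\<forall>i\<in>I. f i \<in> Hom (TopDelta U) (Prod (TopDelta U) (X i) W) Y"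
   then have f: "continuous_map (Delta_prod U (X i) W) Y (tfun (f i))" if "i \<in> I" for i
    using that by (simp add: TopDelta_simps(2,4))
   define h where "h z = tfun (f (the_inv c (fst (unpair U (fst (unpair U z)))))) (upair U (snd (unpair U (fst (unpair U z)))) (snd (unpair U z)))" for z
   have h: "h (upair U (upair U (c i) x) w) = tfun (f i) (upair U x w)" for i x w
    using c by (simp add: h_def the_inv_f_f)
   let ?P = "Delta_prod U ?H W"
   have P: "?P \<in> Obj (TopDelta U)" using V.Prod_Obj[OF H W] by (simp add: TopDelta_simps(4))
   have PE: "\<exists>i x w. z = upair U (upair U (c i) x) w \<and> i \<in> I \<and> x \<in> topspace (X i) \<and> w \<in> topspace W" if "z \<in> topspace ?P" for z
    using that by (auto simp: topspace_Delta_prod topspace_topology_coprod elim!: uprodE)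
   have "continuous_map ?P Y h"
   proof (rule continuous_map_simplices[OF Delta_prod_gen])
    show "h \<in> topspace ?P \<rightarrow> topspace Y"
    proof
     fix z assume "z \<in> topspace ?P"
     from PE[OF this] obtain i x w where z: "z = upair U (upair U (c i) x) w" "i \<in> I" "x \<in> topspace (X i)" "w \<in> topspace W" by blast
     have "upair U x w \<in> topspace (Delta_prod U (X i) W)" using z by (simp add: topspace_Delta_prod)
     then show "h z \<in> topspace Y" using f[OF z(2)] by (auto simp: z(1) h continuous_map_def)
    qed
    fix p s assume s: "continuous_map (simplex_space p) ?P s"
    have s1: "continuous_map (simplex_space p) ?H (\<lambda>t. fst (unpair U (s t)))"
     using continuous_map_compose[OF s cont_fst] by (simp add: o_def)
    have s2: "continuous_map (simplex_space p) W (\<lambda>t. snd (unpair U (s t)))"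
     using continuous_map_compose[OF s cont_snd] by (simp add: o_def)
    \<comment> \<open>The simplex lies over a single summand, so along it \<open>h\<close> coincides
      with the one continuous map \<open>f i\<close>.\<close>
    obtain i s' where i: "i \<in> I" and s': "continuous_map (simplex_space p) (X i) s'"
     and e: "\<And>t. t \<in> standard_simplex p ==> fst (unpair U (s t)) = upair U (c i) (s' t)" using simplex_coprod[OF s1] by metis
    have "continuous_map (simplex_space p) Y (tfun (f i) \<circ> (\<lambda>t. upair U (s' t) (snd (unpair U (s t)))))"
     by (rule continuous_map_compose[OF cont_pair[OF Delta_generated_simplex_space s' s2] f[OF i]])
    then show "continuous_map (simplex_space p) Y (h \<circ> s)"
    proof (rule continuous_map_eq)
     fix t assume t: "t \<in> topspace (simplex_space p)"
     have "s t \<in> uprod U (topspace ?H) (topspace W)" using s t by (auto simp: continuous_map_def topspace_Delta_prod)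
     from unpair_in(1)[OF this] have "s t = upair U (upair U (c i) (s' t)) (snd (unpair U (s t)))" using e t by simp
     then have "h (s t) = h (upair U (upair U (c i) (s' t)) (snd (unpair U (s t))))" by simp
     then show "(tfun (f i) \<circ> (\<lambda>t. upair U (s' t) (snd (unpair U (s t))))) t = (h \<circ> s) t" by (simp add: h)
    qed
   qed
   define g where "g = \<lparr>tdom = ?P, tcod = Y, tfun = restrict h (topspace ?P)\<rparr>"
   have g: "g \<in> Hom (TopDelta U) (Prod (TopDelta U) ?H W) Y"
    using P Y \<open>continuous_map ?P Y h\<close> by (simp add: TopDelta_simps(2,4) g_def cont_restrict)
   let ?m = "\<lambda>i. Tuple (TopDelta U) (Comp (TopDelta U) (?inc i) (Pr1 (TopDelta U) (X i) W)) (Pr2 (TopDelta U) (X i) W)"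
   have key: "tfun (Comp (TopDelta U) k (?m i)) (upair U x w) = tfun k (upair U (upair U (c i) x) w)"
    if "i \<in> I" "x \<in> topspace (X i)" "w \<in> topspace W" for k i x w
    using that by (simp add: TopDelta_simps topspace_Delta_prod)
   show "\<exists>!g. g \<in> Hom (TopDelta U) (Prod (TopDelta U) ?H W) Y \<and> (\<forall>i\<in>I. Comp (TopDelta U) g (?m i) = f i)"
   proof (rule ex1I[of _ g], safe)
    show "g \<in> Hom (TopDelta U) (Prod (TopDelta U) ?H W) Y" by (rule g)
    fix i assume i: "i \<in> I"
    have m: "?m i \<in> Hom (TopDelta U) (Prod (TopDelta U) (X i) W) (Prod (TopDelta U) ?H W)"
     by (rule V.Tuple_Hom[OF V.Comp_Hom[OF V.Pr1_Hom[OF X[OF i] W] inc[OF i]] V.Pr2_Hom[OF X[OF i] W]])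
    show "Comp (TopDelta U) g (?m i) = f i"
    proof (rule tmap_eqI[OF V.Comp_Hom[OF m g] f0[rule_format, OF i]])
     fix z assume "z \<in> topspace (Prod (TopDelta U) (X i) W)"
     then obtain x w where z: "z = upair U x w" "x \<in> topspace (X i)" "w \<in> topspace W"
      by (auto simp: TopDelta_simps(4) topspace_Delta_prod elim!: uprodE)
     show "tfun (Comp (TopDelta U) g (?m i)) z = tfun (f i) z"
      unfolding z(1) key[OF i z(2,3)] using z i by (simp add: g_def h topspace_Delta_prod)
    qed
   next
    fix k assume k: "k \<in> Hom (TopDelta U) (Prod (TopDelta U) ?H W) Y" and e: "\<forall>i\<in>I. Comp (TopDelta U) k (?m i) = f i"
    show "k = g"
    proof (rule tmap_eqI[OF k g])
     fix z assume "z \<in> topspace (Prod (TopDelta U) ?H W)"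
     then have zz: "z \<in> topspace ?P" by (simp add: TopDelta_simps(4))
     from PE[OF this] obtain i x w where z: "z = upair U (upair U (c i) x) w" "i \<in> I" "x \<in> topspace (X i)" "w \<in> topspace W" by blast
     then show "tfun k z = tfun g z" using key[OF z(2-4), of k] e[rule_format, OF z(2)] zz by (simp add: g_def h)
    qed
   qed
  qed
  then show "\<exists>H inc. V.distributive_coproduct I X H inc" by blast
 qed
qed

end

text \<open>Every universe supplies a coding of trees, so that distributivity is the only property
  of \<open>V\<close> left to be verified.\<close>

lemma ex_free_monad:
 assumes "distributive_category V"
 shows "\<exists>S. two_monad (VCat U V) S \<and> algebras_are_symmetric_monoidal U V S"
proof -
 interpret V: distributive_category V by (rule assms)
 obtain enc :: "'u btree => 'u" where enc: "inj enc" "\<forall>A\<in>Small U. enc ` {t. t <: A} \<in> Small U" using ex_enc by blast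
 interpret free_construction V U enc by unfold_locales (use enc in auto)
 show ?thesis using two_monad_free algebras_are_symmetric_monoidal_free by blast
qed

end

theorem mainTheorem3:
 fixes U :: "'u univ"
 assumes "universe U"
 shows "(\<exists>S. two_monad (VCat U (sSet U)) S \<and> algebras_are_symmetric_monoidal U (sSet U) S) \<and>
     (\<exists>S. two_monad (VCat U (TopDelta U)) S \<and>
       algebras_are_symmetric_monoidal U (TopDelta U) S)"
proof -
 interpret universe U by (rule assms)
 \<comment> \<open>The same tags serve the disjoint unions of simplicial sets and of spaces.\<close>
 obtain c :: "expr => 'u" where "inj c" using ex_tag by blast
 then show ?thesis
  using ex_free_monad[OF distributive_category_sSet] ex_free_monad[OF distributive_category_TopDelta] by blast
qed

end
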